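(* Let $s,t\in(0,1)$ with $4s+2t>3$, and set $2_s^*=\frac{6}{3-2s}$. Assume that $V:\mathbb{R}^3\to\mathbb{R}$ satisfies: (V1) $V\in C(\mathbb{R}^3)$ and $\inf_{x\in\mathbb{R}^3}V(x)\ge V_0$ for some constant $V_0>0$; (V2) there exists $h>0$ such that $\lim_{|y|\to\infty}\operatorname{meas}(\{x\in B_h(y): V(x)\le c\})=0$ for every $c>0$. Assume that $f:\mathbb{R}^3\times\mathbb{R}\to\mathbb{R}$, with $F(x,u)=\int_0^u f(x,r)\,dr$, satisfies: (f1) $f$ is a Carathéodory function and $f(x,u)=o(|u|)$ as $u\to0$, uniformly in $x\in\mathbb{R}^3$; (f2) for some $1<p<2_s^*-1$ there is $C>0$ such that $|f(x,u)|\le C(1+|u|^p)$; (f3) $\lim_{|\tau|\to\infty}\frac{F(x,\tau)}{\tau^4}=+\infty$ for a.e. $x\in\mathbb{R}^3$; (f4) for a.e. $x\in\mathbb{R}^3$, $\tau\mapsto\frac{f(x,\tau)}{|\tau|^3}$ is an increasing function of $\tau$ on $\mathbb{R}\setminus\{0\}$. Let $\lambda>0$, let $$\mathcal{N}_\lambda=\{u\in H\setminus\{0\}:\langle I_\lambda'(u),u\rangle=0\},\qquad c_\lambda=\inf_{u\in\mathcal{N}_\lambda}I_\lambda(u),$$ and let $u_\lambda$ be a least energy sign-changing solution, with precisely two nodal domains, of the system $$(-\Delta)^s u+V(x)u+\lambda\phi u=f(x,u),\qquad (-\Delta)^t\phi=u^2\qquad\text{in }\mathbb{R}^3.$$ Then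 $c_\lambda>0$, $c_\lambda$ is achieved on $\mathcal{N}_\lambda$, and $I_\lambda(u_\lambda)>2c_\lambda$. In particular, $c_\lambda$ is achieved either by a positive or by a negative function.
   Context: All functions are real-valued; $B_h(y)$ is the open ball of radius $h$ centered at $y$ and $\operatorname{meas}$ is Lebesgue measure. For $\alpha\in(0,1)$ the operator $(-\Delta)^{\alpha/2}$ is normalized so that $$\int_{\mathbb{R}^3}(-\Delta)^{\alpha/2}u\,(-\Delta)^{\alpha/2}v\,dx=\iint_{\mathbb{R}^3\times\mathbb{R}^3}\frac{(u(x)-u(y))(v(x)-v(y))}{|x-y|^{3+2\alpha}}\,dx\,dy .$$ $\mathcal{D}^{\alpha,2}(\mathbb{R}^3)$ is the completion of $C_0^\infty(\mathbb{R}^3)$ under $\|u\|_{\mathcal D^{\alpha,2}}=\|(-\Delta)^{\alpha/2}u\|_{L^2}$, and $H^\alpha(\mathbb{R}^3)$ is the fractional Sobolev space of $u\in L^2(\mathbb{R}^3)$ with finite Gagliardo seminorm $\|(-\Delta)^{\alpha/2}u\|_{L^2}$. Let $$H=\Big\{u\in H^s(\mathbb{R}^3):\int_{\mathbb{R}^3}V(x)u^2dx<\infty\Big\},\qquad \|u\|^2=\int_{\mathbb{R}^3}\big(|(-\Delta)^{s/2}u|^2+V(x)u^2\big)dx.$$ For $u\in H$, $\phi_u^t\in\mathcal{D}^{t,2}(\mathbb{R}^3)$ is the unique element (given by the Lax–Milgram theorem) with $\int_{\mathbb{R}^3}(-\Delta)^{t/2}\phi_u^t(-\Delta)^{t/2}v\,dx=\int_{\mathbb{R}^3}u^2v\,dx$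 for all $v\in\mathcal{D}^{t,2}(\mathbb{R}^3)$; it equals a positive constant depending only on $t$ times $\int_{\mathbb{R}^3}\frac{u^2(y)}{|x-y|^{3-2t}}dy$. Substituting $\phi=\phi_u^t$, the system becomes $(-\Delta)^su+V(x)u+\lambda\phi_u^tu=f(x,u)$ in $\mathbb{R}^3$, whose solutions are the critical points of the $C^1$ functional $I_\lambda:H\to\mathbb{R}$, $$I_\lambda(u)=\frac12\|u\|^2+\frac\lambda4\int_{\mathbb{R}^3}\phi_u^tu^2dx-\int_{\mathbb{R}^3}F(x,u)\,dx.$$ Write $v^+=\max\{v,0\}$, $v^-=\min\{v,0\}$. A least energy sign-changing solution of the system is a $u\in H$ with $I_\lambda'(u)=0$, $u^\pm\ne0$ and $I_\lambda(u)=\inf\{I_\lambda(v): v\in H,\ v^\pm\neq0,\ I_\lambda'(v)=0\}$. A nodal domain of $u$ is, as usual, a connected component of $\{x\in\mathbb{R}^3:u(x)\ne0\}$. *)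

theory Defs
  imports "HOL-Analysis.Analysis"
begin

text \<open>
  Elements of the function spaces below are represented by Lebesgue measurable functions
  \<open>real^3 \<Rightarrow> real\<close>; no quotient by almost-everywhere equality is formed, so \<open>u \<noteq> 0\<close> is rendered
  as "not almost everywhere zero" and the norms are seminorms on representatives.
\<close>

type_synonym R3 = "real^3"

definition gagliardo_kernel :: "real \<Rightarrow> (R3 \<Rightarrow> real) \<Rightarrow> (R3 \<Rightarrow> real) \<Rightarrow> R3 \<times> R3 \<Rightarrow> real" where
  "gagliardo_kernel \<alpha> u v =
     (\<lambda>(x, y). (u x - u y) * (v x - v y) / norm (x - y) powr (3 + 2 * \<alpha>))"

text \<open>
  With the normalization of the fractional Laplacian adopted here, this bilinear form is
  \<open>\<integral> (-\<Delta>)^(\<alpha>/2) u (-\<Delta>)^(\<alpha>/2) v dx\<close>, and \<open>gagliardo_norm \<alpha> u\<close> is the \<open>L^2\<close> norm of \<open>(-\<Delta>)^(\<alpha>/2) u\<close>.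
\<close>

definition gagliardo_form :: "real \<Rightarrow> (R3 \<Rightarrow> real) \<Rightarrow> (R3 \<Rightarrow> real) \<Rightarrow> real" where
  "gagliardo_form \<alpha> u v = integral\<^sup>L (lebesgue \<Otimes>\<^sub>M lebesgue) (gagliardo_kernel \<alpha> u v)"

definition gagliardo_norm :: "real \<Rightarrow> (R3 \<Rightarrow> real) \<Rightarrow> real" where
  "gagliardo_norm \<alpha> u = sqrt (gagliardo_form \<alpha> u u)"

definition fractional_sobolev :: "real \<Rightarrow> (R3 \<Rightarrow> real) set" where
  "fractional_sobolev \<alpha> =
     {u \<in> borel_measurable lebesgue.
        integrable lebesgue (\<lambda>x. (u x)\<^sup>2) \<and>
        integrable (lebesgue \<Otimes>\<^sub>M lebesgue) (gagliardo_kernel \<alpha> u u)}"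

primrec continuously_differentiable :: "nat \<Rightarrow> (R3 \<Rightarrow> real) \<Rightarrow> bool" where
  "continuously_differentiable 0 g \<longleftrightarrow> continuous_on UNIV g"
| "continuously_differentiable (Suc k) g \<longleftrightarrow>
     (\<forall>x. g differentiable (at x)) \<and>
     (\<forall>i. continuously_differentiable k (\<lambda>x. frechet_derivative g (at x) (axis i 1)))"

definition test_functions :: "(R3 \<Rightarrow> real) set" where
  "test_functions =
     {g. (\<forall>k. continuously_differentiable k g) \<and> compact (closure {x. g x \<noteq> 0})}"

text \<open>
  The completion of the test functions under \<open>gagliardo_norm \<alpha>\<close>, realized as a space of functions:
  since \<open>2 * \<alpha> < 3\<close>, by the Sobolev inequality every Cauchy sequence has a subsequence converging
  almost everywhere, and the limit is zero almost everywhere iff the sequence tends to zero in the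
  norm.
\<close>

definition homogeneous_sobolev :: "real \<Rightarrow> (R3 \<Rightarrow> real) set" where
  "homogeneous_sobolev \<alpha> =
     {u \<in> borel_measurable lebesgue.
        \<exists>g :: nat \<Rightarrow> R3 \<Rightarrow> real.
          (\<forall>n. g n \<in> test_functions) \<and>
          (\<forall>\<epsilon>>0. \<exists>N. \<forall>m\<ge>N. \<forall>n\<ge>N. gagliardo_norm \<alpha> (\<lambda>x. g m x - g n x) < \<epsilon>) \<and>
          (AE x in lebesgue. (\<lambda>n. g n x) \<longlonglongrightarrow> u x)}"

definition space_H :: "real \<Rightarrow> (R3 \<Rightarrow> real) \<Rightarrow> (R3 \<Rightarrow> real) set" where
  "space_H s V = {u \<in> fractional_sobolev s. integrable lebesgue (\<lambda>x. V x * (u x)\<^sup>2)}"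

definition norm_H :: "real \<Rightarrow> (R3 \<Rightarrow> real) \<Rightarrow> (R3 \<Rightarrow> real) \<Rightarrow> real" where
  "norm_H s V u = sqrt ((gagliardo_norm s u)\<^sup>2 + (LINT x|lebesgue. V x * (u x)\<^sup>2))"

text \<open>
  The Lax--Milgram solution; it is unique only up to almost-everywhere equality, and the choice
  operator picks a representative.
\<close>

definition phi :: "real \<Rightarrow> (R3 \<Rightarrow> real) \<Rightarrow> (R3 \<Rightarrow> real)" where
  "phi t u = (SOME \<phi>. \<phi> \<in> homogeneous_sobolev t \<and>
     (\<forall>v \<in> homogeneous_sobolev t.
        gagliardo_form t \<phi> v = (LINT x|lebesgue. (u x)\<^sup>2 * v x)))"

text \<open>The interval integral is oriented, so this is also correct for negative \<open>\<tau>\<close>.\<close>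

definition primitive :: "(R3 \<Rightarrow> real \<Rightarrow> real) \<Rightarrow> R3 \<Rightarrow> real \<Rightarrow> real" where
  "primitive f x \<tau> = (LBINT r=ereal 0..ereal \<tau>. f x r)"

definition energy ::
  "real \<Rightarrow> real \<Rightarrow> (R3 \<Rightarrow> real) \<Rightarrow> (R3 \<Rightarrow> real \<Rightarrow> real) \<Rightarrow> real \<Rightarrow> (R3 \<Rightarrow> real) \<Rightarrow> real" where
  "energy s t V f lam u =
     1/2 * (norm_H s V u)\<^sup>2
     + lam/4 * (LINT x|lebesgue. phi t u x * (u x)\<^sup>2)
     - (LINT x|lebesgue. primitive f x (u x))"

text \<open>
  \<open>L\<close> is the Frechet derivative at \<open>u\<close> of the functional \<open>J\<close> on the normed space \<open>space_H s V\<close>.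
  This is stated by hand because the space depends on parameters and is not a type. The values of
  \<open>L\<close> outside the space are irrelevant.
\<close>

definition has_derivative_H ::
  "real \<Rightarrow> (R3 \<Rightarrow> real) \<Rightarrow> ((R3 \<Rightarrow> real) \<Rightarrow> real) \<Rightarrow> ((R3 \<Rightarrow> real) \<Rightarrow> real) \<Rightarrow> (R3 \<Rightarrow> real) \<Rightarrow> bool"
where
  "has_derivative_H s V J L u \<longleftrightarrow>
     (\<forall>v \<in> space_H s V. \<forall>w \<in> space_H s V. \<forall>a b.
        L (\<lambda>x. a * v x + b * w x) = a * L v + b * L w) \<and>
     (\<exists>K. \<forall>v \<in> space_H s V. \<bar>L v\<bar> \<le> K * norm_H s V v) \<and>
     (\<forall>\<epsilon>>0. \<exists>\<delta>>0. \<forall>v \<in> space_H s V. norm_H s V v < \<delta> \<longrightarrow>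
        \<bar>J (\<lambda>x. u x + v x) - J u - L v\<bar> \<le> \<epsilon> * norm_H s V v)"

definition nehari ::
  "real \<Rightarrow> real \<Rightarrow> (R3 \<Rightarrow> real) \<Rightarrow> (R3 \<Rightarrow> real \<Rightarrow> real) \<Rightarrow> real \<Rightarrow> (R3 \<Rightarrow> real) set" where
  "nehari s t V f lam =
     {u \<in> space_H s V. \<not> (AE x in lebesgue. u x = 0) \<and>
        (\<exists>L. has_derivative_H s V (energy s t V f lam) L u \<and> L u = 0)}"

definition nehari_level ::
  "real \<Rightarrow> real \<Rightarrow> (R3 \<Rightarrow> real) \<Rightarrow> (R3 \<Rightarrow> real \<Rightarrow> real) \<Rightarrow> real \<Rightarrow> real" where
  "nehari_level s t V f lam = (INF u \<in> nehari s t V f lam. energy s t V f lam u)"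

definition sign_changing :: "(R3 \<Rightarrow> real) \<Rightarrow> bool" where
  "sign_changing u \<longleftrightarrow>
     \<not> (AE x in lebesgue. max (u x) 0 = 0) \<and> \<not> (AE x in lebesgue. min (u x) 0 = 0)"

definition sign_changing_solutions ::
  "real \<Rightarrow> real \<Rightarrow> (R3 \<Rightarrow> real) \<Rightarrow> (R3 \<Rightarrow> real \<Rightarrow> real) \<Rightarrow> real \<Rightarrow> (R3 \<Rightarrow> real) set" where
  "sign_changing_solutions s t V f lam =
     {u \<in> space_H s V. sign_changing u \<and>
        has_derivative_H s V (energy s t V f lam) (\<lambda>_. 0) u}"

definition least_energy_sign_changing_solution ::
  "real \<Rightarrow> real \<Rightarrow> (R3 \<Rightarrow> real) \<Rightarrow> (R3 \<Rightarrow> real \<Rightarrow> real) \<Rightarrow> real \<Rightarrow> (R3 \<Rightarrow> real) \<Rightarrow> bool" where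
  "least_energy_sign_changing_solution s t V f lam u \<longleftrightarrow>
     u \<in> sign_changing_solutions s t V f lam \<and>
     energy s t V f lam u = (INF v \<in> sign_changing_solutions s t V f lam. energy s t V f lam v)"

text \<open>Taken for the given pointwise representative \<open>u\<close>, e.g. the continuous one.\<close>

definition nodal_domains :: "(R3 \<Rightarrow> real) \<Rightarrow> R3 set set" where
  "nodal_domains u = components {x. u x \<noteq> 0}"

definition caratheodory :: "(R3 \<Rightarrow> real \<Rightarrow> real) \<Rightarrow> bool" where
  "caratheodory f \<longleftrightarrow>
     (\<forall>\<tau>. (\<lambda>x. f x \<tau>) \<in> borel_measurable lebesgue) \<and>
     (AE x in lebesgue. continuous_on UNIV (f x))"

end

theory Submission
  imports Defs "HOL-Complex_Analysis.Great_Picard"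
begin

text \<open>
  Everything is reduced to Fatou's lemma and pointwise inequalities. If \<open>u x = a\<close> then on half of a ball
  whose volume is a multiple of \<open>a\<close> to the power minus the critical exponent one has
  \<open>|u x - u y| \<ge> a / 2\<close>; integrating this gives the Sobolev inequality, and
  averaging over small cubes or balls in the same spirit gives the compact embedding of \<open>H\<close>. The potential
  \<open>\<phi>\<^sub>u\<close> is obtained by minimization along a nonnegative sequence of test functions, hence is nonnegative.

  By (f4), \<open>\<tau> \<mapsto> (1 - \<tau>\<^sup>4) f(r) r / 4 + F(\<tau> r) - F(r)\<close> is nonnegative for \<open>\<tau> \<ge> 0\<close>. So every ray meets the Nehari set,
  the energy is maximal there, and a minimizing sequence converges, after a rescaling by at most one, to a minimizer.
  For a sign-changing solution, projecting \<open>u\<^sup>+\<close> and \<open>u\<^sup>-\<close> separately loses exactly the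
  positive cross terms of the Gagliardo form and of the Poisson term, whence \<open>I(u) > 2 c\<close>. The same comparison
  shows that a minimizer cannot change sign. Strict positivity needs no Euler--Lagrange equation: where a minimizer
  vanishes, raising it to \<open>\<epsilon> \<psi>\<close> lowers the energy to first order in \<open>\<epsilon>\<close>.
\<close>

section \<open>The Gagliardo form\<close>

text \<open>Monotonicity in (f4) is not strict and f is merely continuous in its second variable.
  Hence a ray may meet the Nehari set more than once, that set has no evident manifold structure,
  and a minimizer on it is not known in advance to be a critical point; this is why every step
  compares energies along rays. A quarter of the Nehari functional is the right amount to subtract
  from the energy: it cancels the quartic Poisson term. What remains,
  \<open>ip u u / 4 + AR u\<close>, consists of nonnegative terms that decrease under factors at
  most one and are lower semicontinuous along a minimizing sequence. The decisive strict
  inequalities rest on nonlocality: the Gagliardo kernel is positive between any two distinct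
  points, so two functions with disjoint supports still interact. The explicit Riesz kernel of the
  potential never enters. The weak equation alone makes the Poisson term a Gagliardo form of two
  potentials, which gives its symmetry, its expansion and its lower semicontinuity. Hoelder-type
  estimates are obtained throughout from additive Young bounds on normalized functions, followed by
  scaling.\<close>

abbreviation LL :: "(R3 \<times> R3) measure" where "LL \<equiv> lebesgue \<Otimes>\<^sub>M lebesgue"

text \<open>Tonelli's theorem on \<open>LL\<close> needs sigma-finite factors; balls of integer
  radius exhaust the space.\<close>

lemma sigma_finite_lebesgue: "sigma_finite_measure (lebesgue :: 'a::euclidean_space measure)"
proof
  show "\<exists>A::'a set set. countable A \<and> A \<subseteq> sets lebesgue \<and> \<Union>A = space lebesgue \<and> (\<forall>a\<in>A. emeasure lebesgue a \<noteq> \<infinity>)"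
  proof (intro exI[of _ "range (\<lambda>n::nat. ball (0::'a) (real n))"] conjI ballI)
    show "\<Union> (range (\<lambda>n::nat. ball (0::'a) (real n))) = space lebesgue"
      by (auto simp: reals_Archimedean2)
    fix a assume "a \<in> range (\<lambda>n::nat. ball (0::'a) (real n))"
    then show "emeasure lebesgue a \<noteq> \<infinity>"
      using emeasure_lborel_ball_finite by (auto simp: less_top)
  qed auto
qed

interpretation lebesgue: sigma_finite_measure "lebesgue :: R3 measure"
  by (rule sigma_finite_lebesgue)

interpretation LL: pair_sigma_finite "lebesgue :: R3 measure" "lebesgue :: R3 measure" ..

lemma emeasure_lebesgue_ball3:
  "r \<ge> 0 \<Longrightarrow> emeasure lebesgue (ball (x::R3) r) = ennreal (4/3*pi*r^3)"
  by (simp add: emeasure_ball unit_ball_vol_3 mult_ac del: unit_ball_vol_numeral)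

lemma measure_lebesgue_ball3:
  "r \<ge> 0 \<Longrightarrow> measure lebesgue (ball (x::R3) r) = 4/3*pi*r^3"
  using emeasure_lebesgue_ball3[of r x] by (simp add: measure_def del: emeasure_lborel_ball_finite emeasure_completion)

lemma measurable_id_lebesgue [measurable]: "(\<lambda>x. x) \<in> borel_measurable (lebesgue :: R3 measure)"
  using id_borel_measurable_lebesgue by (simp add: id_def)

lemma measurable_fst_LL [measurable]: "fst \<in> borel_measurable LL"
  using measurable_compose[OF measurable_fst measurable_id_lebesgue] by simp

lemma measurable_snd_LL [measurable]: "snd \<in> borel_measurable LL"
  using measurable_compose[OF measurable_snd measurable_id_lebesgue] by simp

lemma measurable_gagliardo_kernel [measurable]:
  assumes [measurable]: "u \<in> borel_measurable lebesgue" "v \<in> borel_measurable lebesgue"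
  shows "gagliardo_kernel \<alpha> u v \<in> borel_measurable LL"
  unfolding gagliardo_kernel_def split_beta' by measurable

lemma gagliardo_kernel_eq: "gagliardo_kernel \<alpha> u v z =
   (u (fst z) - u (snd z)) * (v (fst z) - v (snd z)) / norm (fst z - snd z) powr (3 + 2 * \<alpha>)"
  by (simp add: gagliardo_kernel_def split_beta')

lemma gagliardo_kernel_diag: "gagliardo_kernel \<alpha> u u z =
   (u (fst z) - u (snd z))\<^sup>2 / norm (fst z - snd z) powr (3 + 2 * \<alpha>)"
  by (simp add: gagliardo_kernel_eq power2_eq_square)

lemma gagliardo_kernel_nonneg [simp]: "0 \<le> gagliardo_kernel \<alpha> u u z"
  by (simp add: gagliardo_kernel_diag)

lemma gagliardo_form_nonneg [simp]: "0 \<le> gagliardo_form \<alpha> u u"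
  by (simp add: gagliardo_form_def)

lemma gagliardo_norm_nonneg [simp]: "0 \<le> gagliardo_norm \<alpha> u"
  by (simp add: gagliardo_norm_def)

lemma gagliardo_norm_sq: "(gagliardo_norm \<alpha> u)\<^sup>2 = gagliardo_form \<alpha> u u"
  by (simp add: gagliardo_norm_def)

lemma gagliardo_kernel_commute: "gagliardo_kernel \<alpha> u v = gagliardo_kernel \<alpha> v u"
  by (auto simp: gagliardo_kernel_eq mult_ac)

lemma gagliardo_form_commute: "gagliardo_form \<alpha> u v = gagliardo_form \<alpha> v u"
  by (simp add: gagliardo_form_def gagliardo_kernel_commute)

text \<open>Outside this set \<open>gagliardo_form \<alpha> u u\<close> is the junk value \<open>0\<close> of a divergent integral.\<close>

definition gagliardo_space :: "real \<Rightarrow> (R3 \<Rightarrow> real) set" where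
  "gagliardo_space \<alpha> = {u \<in> borel_measurable lebesgue. integrable LL (gagliardo_kernel \<alpha> u u)}"

lemma gagliardo_spaceD:
  assumes "u \<in> gagliardo_space \<alpha>"
  shows "u \<in> borel_measurable lebesgue" "integrable LL (gagliardo_kernel \<alpha> u u)"
  using assms by (auto simp: gagliardo_space_def)

lemma abs_mult_le_sq: "\<bar>a * b\<bar> \<le> a\<^sup>2 + (b::real)\<^sup>2"
proof -
  have "0 \<le> (\<bar>a\<bar> - \<bar>b\<bar>)\<^sup>2" by simp
  then have "2 * (\<bar>a\<bar> * \<bar>b\<bar>) \<le> a\<^sup>2 + b\<^sup>2" by (simp add: power2_diff)
  moreover have "0 \<le> \<bar>a\<bar> * \<bar>b\<bar>" by simp
  ultimately show ?thesis unfolding abs_mult by linarith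
qed

lemma integrable_mult_of_sq:
  fixes a b :: "'a \<Rightarrow> real"
  assumes [measurable]: "a \<in> borel_measurable M" "b \<in> borel_measurable M"
    and "integrable M (\<lambda>x. (a x)\<^sup>2)" "integrable M (\<lambda>x. (b x)\<^sup>2)"
  shows "integrable M (\<lambda>x. a x * b x)"
proof (rule Bochner_Integration.integrable_bound)
  show "integrable M (\<lambda>x. (a x)\<^sup>2 + (b x)\<^sup>2)" using assms by simp
  show "AE x in M. norm (a x * b x) \<le> norm ((a x)\<^sup>2 + (b x)\<^sup>2)"
    unfolding real_norm_def by (intro AE_I2 order_trans[OF abs_mult_le_sq abs_ge_self])
qed measurable

text \<open>Applying |a b| \<le> a^2 + b^2 to the increments bounds the mixed kernel by the two
  diagonal ones, so the bilinear form is meaningful on all of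
  \<open>gagliardo_space\<close>.\<close>

lemma integrable_gagliardo_kernel:
  assumes "u \<in> gagliardo_space \<alpha>" "v \<in> gagliardo_space \<alpha>"
  shows "integrable LL (gagliardo_kernel \<alpha> u v)"
proof -
  note [measurable] = gagliardo_spaceD(1)[OF assms(1)] gagliardo_spaceD(1)[OF assms(2)]
  have "\<bar>gagliardo_kernel \<alpha> u v z\<bar> \<le> gagliardo_kernel \<alpha> u u z + gagliardo_kernel \<alpha> v v z" for z
    unfolding gagliardo_kernel_diag unfolding gagliardo_kernel_eq abs_divide add_divide_distrib[symmetric]
    by (simp add: divide_right_mono abs_mult_le_sq)
  note le = this
  have "integrable LL (\<lambda>z. gagliardo_kernel \<alpha> u u z + gagliardo_kernel \<alpha> v v z)"
    using assms by (intro Bochner_Integration.integrable_add gagliardo_spaceD)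
  then show ?thesis
    by (rule Bochner_Integration.integrable_bound) (use le in \<open>auto intro!: AE_I2 order_trans[OF _ abs_ge_self]\<close>)
qed

lemma gagliardo_kernel_lin:
  "gagliardo_kernel \<alpha> (\<lambda>x. a * u x + b * v x) w z = a * gagliardo_kernel \<alpha> u w z + b * gagliardo_kernel \<alpha> v w z"
  by (simp add: gagliardo_kernel_eq divide_simps algebra_simps)

lemma gagliardo_kernel_lin2:
  "gagliardo_kernel \<alpha> (\<lambda>x. a * u x + b * v x) (\<lambda>x. a * u x + b * v x) z =
     a\<^sup>2 * gagliardo_kernel \<alpha> u u z + 2 * a * b * gagliardo_kernel \<alpha> u v z + b\<^sup>2 * gagliardo_kernel \<alpha> v v z"
  unfolding gagliardo_kernel_eq times_divide_eq_right add_divide_distrib[symmetric]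
  by (rule arg_cong2[of _ _ _ _ divide]) (simp_all add: power2_eq_square algebra_simps)

lemma gagliardo_space_lin:
  assumes "u \<in> gagliardo_space \<alpha>" "v \<in> gagliardo_space \<alpha>"
  shows "(\<lambda>x. a * u x + b * v x) \<in> gagliardo_space \<alpha>"
proof -
  note [measurable] = gagliardo_spaceD(1)[OF assms(1)] gagliardo_spaceD(1)[OF assms(2)]
  have "gagliardo_kernel \<alpha> (\<lambda>x. a * u x + b * v x) (\<lambda>x. a * u x + b * v x) = (\<lambda>z.
     a\<^sup>2 * gagliardo_kernel \<alpha> u u z + 2 * a * b * gagliardo_kernel \<alpha> u v z + b\<^sup>2 * gagliardo_kernel \<alpha> v v z)"
    by (rule ext) (rule gagliardo_kernel_lin2)
  then show ?thesis using assms integrable_gagliardo_kernel[OF assms]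
    unfolding gagliardo_space_def by auto
qed

lemma gagliardo_form_lin:
  assumes "u \<in> gagliardo_space \<alpha>" "v \<in> gagliardo_space \<alpha>" "w \<in> gagliardo_space \<alpha>"
  shows "gagliardo_form \<alpha> (\<lambda>x. a * u x + b * v x) w = a * gagliardo_form \<alpha> u w + b * gagliardo_form \<alpha> v w"
  using assms unfolding gagliardo_form_def
  by (simp add: gagliardo_kernel_lin[abs_def] integrable_gagliardo_kernel)

lemma gagliardo_form_lin2:
  assumes "u \<in> gagliardo_space \<alpha>" "v \<in> gagliardo_space \<alpha>"
  shows "gagliardo_form \<alpha> (\<lambda>x. a * u x + b * v x) (\<lambda>x. a * u x + b * v x) =
    a\<^sup>2 * gagliardo_form \<alpha> u u + 2 * a * b * gagliardo_form \<alpha> u v + b\<^sup>2 * gagliardo_form \<alpha> v v"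
  using assms unfolding gagliardo_form_def
  by (simp add: gagliardo_kernel_lin2[abs_def] integrable_gagliardo_kernel)

text \<open>Cauchy-Schwarz for a positive semidefinite form, reduced to its three coefficients so
  that it serves both the Gagliardo form and the inner product \<open>ip\<close>.\<close>

lemma psd_form_bound:
  fixes A B C :: real
  assumes "\<And>a b. 0 \<le> a\<^sup>2 * A + 2 * a * b * B + b\<^sup>2 * C" "0 \<le> A" "0 \<le> C"
  shows "\<bar>B\<bar> \<le> sqrt A * sqrt C"
proof -
  have "B\<^sup>2 \<le> A * C"
  proof (cases "C = 0")
    case True
    have "B = 0"
    proof (rule ccontr)
      assume "B \<noteq> 0"
      \<comment> \<open>With C = 0 this choice of b gives the quadratic form the value - A -
        2.\<close>
      then show False using assms(1)[of 1 "- (A + 1) / B"] True \<open>0 \<le> A\<close> by simp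
    qed
    then show ?thesis using True by simp
  next
    case False
    \<comment> \<open>The pair (C, - B) minimizes the form up to scaling and returns the
      discriminant times C.\<close>
    have "0 \<le> C * (A * C - B\<^sup>2)" using assms(1)[of C "-B"] by (simp add: power2_eq_square algebra_simps)
    then show ?thesis using False assms(3) by (simp add: zero_le_mult_iff)
  qed
  then have "sqrt (B\<^sup>2) \<le> sqrt (A * C)" by (rule real_sqrt_le_mono)
  then show ?thesis by (simp add: real_sqrt_mult)
qed

lemma gagliardo_form_CS:
  assumes "u \<in> gagliardo_space \<alpha>" "v \<in> gagliardo_space \<alpha>"
  shows "\<bar>gagliardo_form \<alpha> u v\<bar> \<le> gagliardo_norm \<alpha> u * gagliardo_norm \<alpha> v"
  unfolding gagliardo_norm_def
  by (rule psd_form_bound) (simp_all flip: gagliardo_form_lin2[OF assms])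

lemma gagliardo_norm_triangle:
  assumes "u \<in> gagliardo_space \<alpha>" "v \<in> gagliardo_space \<alpha>"
  shows "gagliardo_norm \<alpha> (\<lambda>x. u x + v x) \<le> gagliardo_norm \<alpha> u + gagliardo_norm \<alpha> v"
proof (rule power2_le_imp_le)
  have "(gagliardo_norm \<alpha> (\<lambda>x. u x + v x))\<^sup>2 = (gagliardo_norm \<alpha> u)\<^sup>2 + 2 * gagliardo_form \<alpha> u v + (gagliardo_norm \<alpha> v)\<^sup>2"
    using gagliardo_form_lin2[OF assms, of 1 1] by (simp add: gagliardo_norm_sq)
  also have "\<dots> \<le> (gagliardo_norm \<alpha> u + gagliardo_norm \<alpha> v)\<^sup>2"
    using gagliardo_form_CS[OF assms] by (simp add: power2_sum)
  finally show "(gagliardo_norm \<alpha> (\<lambda>x. u x + v x))\<^sup>2 \<le> (gagliardo_norm \<alpha> u + gagliardo_norm \<alpha> v)\<^sup>2" .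
qed simp

lemma gagliardo_norm_scale:
  "gagliardo_norm \<alpha> (\<lambda>x. c * u x) = \<bar>c\<bar> * gagliardo_norm \<alpha> u"
proof -
  have "gagliardo_kernel \<alpha> (\<lambda>x. c * u x) (\<lambda>x. c * u x) z = c\<^sup>2 * gagliardo_kernel \<alpha> u u z" for z
    by (simp add: gagliardo_kernel_eq power2_eq_square divide_simps) (simp add: algebra_simps)
  then have "gagliardo_kernel \<alpha> (\<lambda>x. c * u x) (\<lambda>x. c * u x) = (\<lambda>z. c\<^sup>2 * gagliardo_kernel \<alpha> u u z)" ..
  then show ?thesis by (simp add: gagliardo_norm_def gagliardo_form_def real_sqrt_mult)
qed

lemma gagliardo_space_scale:
  assumes "u \<in> gagliardo_space \<alpha>" shows "(\<lambda>x. c * u x) \<in> gagliardo_space \<alpha>"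
  using gagliardo_space_lin[OF assms assms, of c 0] by simp

lemma gagliardo_norm_diff_commute:
  "gagliardo_norm \<alpha> (\<lambda>x. u x - v x) = gagliardo_norm \<alpha> (\<lambda>x. v x - u x)"
  using gagliardo_norm_scale[of \<alpha> "-1" "\<lambda>x. u x - v x"] by simp

text \<open>Squared increments are all that the form sees, so a pointwise bound on them gives
  membership and the estimate at once. Truncation, absolute values, sign parts and maxima of two
  functions are all treated this way.\<close>

lemma gagliardo_space_dominated:
  assumes [measurable]: "w \<in> borel_measurable lebesgue" and "u \<in> gagliardo_space \<alpha>" "v \<in> gagliardo_space \<alpha>"
    and *: "\<And>x y. (w x - w y)\<^sup>2 \<le> (u x - u y)\<^sup>2 + (v x - v y)\<^sup>2"
  shows "w \<in> gagliardo_space \<alpha>" "gagliardo_form \<alpha> w w \<le> gagliardo_form \<alpha> u u + gagliardo_form \<alpha> v v"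
proof -
  have le: "gagliardo_kernel \<alpha> w w z \<le> gagliardo_kernel \<alpha> u u z + gagliardo_kernel \<alpha> v v z" for z
    unfolding gagliardo_kernel_diag add_divide_distrib[symmetric] by (intro divide_right_mono *) simp
  have i: "integrable LL (gagliardo_kernel \<alpha> w w)"
    by (rule Bochner_Integration.integrable_bound[of LL "\<lambda>z. gagliardo_kernel \<alpha> u u z + gagliardo_kernel \<alpha> v v z"])
       (use assms le in \<open>auto dest: gagliardo_spaceD intro!: AE_I2 order_trans[OF _ abs_ge_self]\<close>)
  then show "w \<in> gagliardo_space \<alpha>" by (auto simp: gagliardo_space_def)
  have "gagliardo_form \<alpha> w w \<le> integral\<^sup>L LL (\<lambda>z. gagliardo_kernel \<alpha> u u z + gagliardo_kernel \<alpha> v v z)"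
    unfolding gagliardo_form_def by (intro integral_mono i) (use assms le in \<open>auto dest: gagliardo_spaceD\<close>)
  then show "gagliardo_form \<alpha> w w \<le> gagliardo_form \<alpha> u u + gagliardo_form \<alpha> v v"
    using assms by (simp add: gagliardo_form_def gagliardo_spaceD)
qed

lemma zero_in_gagliardo_space [simp]: "(\<lambda>x. 0) \<in> gagliardo_space \<alpha>"
  by (simp add: gagliardo_space_def gagliardo_kernel_def split_beta')

lemma gagliardo_form_zero [simp]: "gagliardo_form \<alpha> (\<lambda>x. 0) u = 0"
  by (simp add: gagliardo_form_def gagliardo_kernel_def split_beta')

lemma gagliardo_space_contraction:
  assumes "w \<in> borel_measurable lebesgue" "u \<in> gagliardo_space \<alpha>"
    and *: "\<And>x y. \<bar>w x - w y\<bar> \<le> \<bar>u x - u y\<bar>"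
  shows "w \<in> gagliardo_space \<alpha>" "gagliardo_form \<alpha> w w \<le> gagliardo_form \<alpha> u u"
    "gagliardo_norm \<alpha> w \<le> gagliardo_norm \<alpha> u"
proof -
  have "(w x - w y)\<^sup>2 \<le> (u x - u y)\<^sup>2 + (0 - 0)\<^sup>2" for x y
    using *[of x y] by (simp add: abs_le_square_iff)
  from gagliardo_space_dominated[OF assms(1,2) zero_in_gagliardo_space this]
  show "w \<in> gagliardo_space \<alpha>" "gagliardo_form \<alpha> w w \<le> gagliardo_form \<alpha> u u" by simp_all
  then show "gagliardo_norm \<alpha> w \<le> gagliardo_norm \<alpha> u" by (simp add: gagliardo_norm_def)
qed

section \<open>Null sets of the product measure and Fatou's lemma\<close>

lemma AE_fst_LL:
  assumes "AE x in lebesgue. Q x" shows "AE z in LL. Q (fst z)"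
proof -
  from assms obtain N where N: "{x. \<not> Q x} \<subseteq> N" "emeasure lebesgue N = 0" "N \<in> sets lebesgue"
    by (auto elim!: AE_E)
  show ?thesis
  proof (rule AE_I)
    show "{z \<in> space LL. \<not> Q (fst z)} \<subseteq> N \<times> UNIV" using N by auto
    show "emeasure LL (N \<times> UNIV) = 0"
      using N lebesgue.emeasure_pair_measure_Times[of N lebesgue UNIV] by simp
    show "N \<times> UNIV \<in> sets LL" using N by auto
  qed
qed

lemma AE_snd_LL:
  assumes "AE x in lebesgue. Q x" shows "AE z in LL. Q (snd z)"
proof -
  from assms obtain N where N: "{x. \<not> Q x} \<subseteq> N" "emeasure lebesgue N = 0" "N \<in> sets lebesgue"
    by (auto elim!: AE_E)
  show ?thesis
  proof (rule AE_I)
    show "{z \<in> space LL. \<not> Q (snd z)} \<subseteq> UNIV \<times> N" using N by auto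
    show "emeasure LL (UNIV \<times> N) = 0"
      using N lebesgue.emeasure_pair_measure_Times[of UNIV lebesgue N] by simp
    show "UNIV \<times> N \<in> sets LL" using N by auto
  qed
qed

lemma gagliardo_form_nn:
  assumes "u \<in> borel_measurable lebesgue"
  shows "u \<in> gagliardo_space \<alpha> \<longleftrightarrow> (\<integral>\<^sup>+z. ennreal (gagliardo_kernel \<alpha> u u z) \<partial>LL) < \<infinity>"
    and "u \<in> gagliardo_space \<alpha> \<Longrightarrow> (\<integral>\<^sup>+z. ennreal (gagliardo_kernel \<alpha> u u z) \<partial>LL) = ennreal (gagliardo_form \<alpha> u u)"
  using assms unfolding gagliardo_space_def gagliardo_form_def
  by (auto simp: integrable_iff_bounded nn_integral_eq_integral)

lemma gagliardo_form_iterated: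
  assumes "u \<in> gagliardo_space \<alpha>"
  shows "(\<integral>\<^sup>+x. \<integral>\<^sup>+y. ennreal (gagliardo_kernel \<alpha> u u (x, y)) \<partial>lebesgue \<partial>lebesgue) = ennreal (gagliardo_form \<alpha> u u)"
proof -
  note [measurable] = gagliardo_spaceD(1)[OF assms]
  have "(\<lambda>z. ennreal (gagliardo_kernel \<alpha> u u z)) \<in> borel_measurable LL" by measurable
  from lebesgue.nn_integral_fst[OF this] show ?thesis
    using gagliardo_form_nn(2)[OF gagliardo_spaceD(1)[OF assms] assms] by simp
qed

text \<open>Fatou in terms of the real-valued integral. Integrability of the limit is part of the
  conclusion, since otherwise its integral could be the default value 0 and the bound would be
  void.\<close>

lemma integral_Fatou_bound:
  fixes g :: "nat \<Rightarrow> 'a \<Rightarrow> real" and h :: "'a \<Rightarrow> real"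
  assumes [measurable]: "\<And>n. g n \<in> borel_measurable M" "h \<in> borel_measurable M"
    and i: "\<And>n. integrable M (g n)" and nn: "\<And>n x. 0 \<le> g n x" and hn: "\<And>x. 0 \<le> h x"
    and lim: "AE x in M. (\<lambda>n. g n x) \<longlonglongrightarrow> h x"
    and bd: "\<forall>\<^sub>F n in sequentially. integral\<^sup>L M (g n) \<le> B"
  shows "integrable M h" "integral\<^sup>L M h \<le> B"
proof -
  obtain n0 where "integral\<^sup>L M (g n0) \<le> B" using bd by (auto simp: eventually_sequentially)
  moreover have "0 \<le> integral\<^sup>L M (g n0)" using nn by simp
  ultimately have B: "0 \<le> B" by linarith
  have "(\<integral>\<^sup>+x. ennreal (h x) \<partial>M) = (\<integral>\<^sup>+x. liminf (\<lambda>n. ennreal (g n x)) \<partial>M)"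
  proof (rule nn_integral_cong_AE)
    show "AE x in M. ennreal (h x) = liminf (\<lambda>n. ennreal (g n x))"
      using lim
    proof eventually_elim
      case (elim x)
      then have "(\<lambda>n. ennreal (g n x)) \<longlonglongrightarrow> ennreal (h x)" by (rule tendsto_ennrealI)
      then show ?case by (simp add: lim_imp_Liminf)
    qed
  qed
  also have "\<dots> \<le> liminf (\<lambda>n. \<integral>\<^sup>+x. ennreal (g n x) \<partial>M)"
    by (rule nn_integral_liminf) measurable
  also have "\<dots> = liminf (\<lambda>n. ennreal (integral\<^sup>L M (g n)))"
    using i nn by (simp add: nn_integral_eq_integral)
  also have "\<dots> \<le> ennreal B"
    by (rule Liminf_le) (use bd in \<open>auto elim!: eventually_mono intro: ennreal_leI\<close>)
  finally have *: "(\<integral>\<^sup>+x. ennreal (h x) \<partial>M) \<le> ennreal B" .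
  then show I: "integrable M h" using hn
    by (intro integrableI_bounded) (auto simp: less_top[symmetric] top_unique)
  show "integral\<^sup>L M h \<le> B" using * nn_integral_eq_integral[OF I] hn B by simp
qed

text \<open>Off the diagonal the denominator is fixed and the numerators converge; on the diagonal
  all kernels are 0 because division by zero is 0.\<close>

lemma gagliardo_Fatou:
  assumes "\<And>n. g n \<in> gagliardo_space \<alpha>" "v \<in> borel_measurable lebesgue"
    and lim: "AE x in lebesgue. (\<lambda>n. g n x) \<longlonglongrightarrow> v x"
    and bd: "\<forall>\<^sub>F n in sequentially. gagliardo_form \<alpha> (g n) (g n) \<le> B"
  shows "v \<in> gagliardo_space \<alpha>" "gagliardo_form \<alpha> v v \<le> B"
proof -
  note [measurable] = gagliardo_spaceD(1)[OF assms(1)] assms(2)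
  have *: "AE z in LL. (\<lambda>n. gagliardo_kernel \<alpha> (g n) (g n) z) \<longlonglongrightarrow> gagliardo_kernel \<alpha> v v z"
    using AE_fst_LL[OF lim] AE_snd_LL[OF lim]
  proof eventually_elim
    case (elim z) then show ?case unfolding gagliardo_kernel_diag
      by (cases "fst z = snd z") (auto intro!: tendsto_intros)
  qed
  note F = integral_Fatou_bound[of "\<lambda>n. gagliardo_kernel \<alpha> (g n) (g n)" LL "gagliardo_kernel \<alpha> v v" B]
  show "v \<in> gagliardo_space \<alpha>" unfolding gagliardo_space_def
    using F(1) * assms bd by (auto simp: gagliardo_spaceD gagliardo_form_def)
  show "gagliardo_form \<alpha> v v \<le> B"
    using F(2) * assms bd by (auto simp: gagliardo_spaceD gagliardo_form_def)
qed

section \<open>The fractional Sobolev inequality\<close>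

definition sobolev_exponent :: "real \<Rightarrow> real" where
  "sobolev_exponent \<alpha> = 6 / (3 - 2 * \<alpha>)"

lemma sobolev_exponent_gt_2: "0 < \<alpha> \<Longrightarrow> \<alpha> < 1 \<Longrightarrow> 2 < sobolev_exponent \<alpha>"
  by (simp add: sobolev_exponent_def field_simps)

lemma sobolev_exponent_pos: "\<alpha> < 1 \<Longrightarrow> 0 < sobolev_exponent \<alpha>"
  by (simp add: sobolev_exponent_def)

text \<open>On at least half of the ball around \<open>x\<close> whose volume is twice the Chebyshev bound for
  \<open>{|u| > |u x| / 2}\<close> one has \<open>|u x - u y| \<ge> |u x| / 2\<close>.\<close>

lemma gagliardo_kernel_pointwise:
  fixes u :: "R3 \<Rightarrow> real"
  assumes \<alpha>: "0 < \<alpha>" and q: "0 < q"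
    and [measurable]: "u \<in> borel_measurable lebesgue"
    and int: "integrable lebesgue (\<lambda>x. \<bar>u x\<bar> powr q)"
    and M: "(LINT x|lebesgue. \<bar>u x\<bar> powr q) = M" "0 < M" and a: "\<bar>u x\<bar> = a" "0 < a"
  defines "\<rho> \<equiv> (2 / a) powr q * M"
  shows "ennreal (a\<^sup>2 / 4 / (2 * \<rho> / (4/3*pi)) powr (1 + 2 * \<alpha> / 3) * \<rho>)
    \<le> (\<integral>\<^sup>+y. ennreal (gagliardo_kernel \<alpha> u u (x, y)) \<partial>lebesgue)"
proof -
  have \<rho>: "\<rho> > 0" using M a by (simp add: \<rho>_def)
  \<comment> \<open>The radius of the ball of volume 2 \<rho>. Since \<rho> bounds the measure of
    \<open>bad\<close>, at least half of the ball is left in \<open>S\<close>.\<close>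
  define r where "r = (2 * \<rho> / (4/3*pi)) powr (1/3)"
  have r: "r > 0" using \<rho> by (simp add: r_def)
  have "r ^ 3 = r powr 3" using r by (simp add: powr_numeral)
  also have "\<dots> = 2 * \<rho> / (4/3*pi)" using \<rho> by (simp add: r_def powr_powr)
  finally have r3: "4/3*pi * r^3 = 2 * \<rho>" by (simp add: field_simps)
  define bad where "bad = {y \<in> ball x r. \<bar>u y\<bar> > a / 2}"
  define S where "S = {y \<in> ball x r. \<bar>u y\<bar> \<le> a / 2}"
  have ball: "ball x r \<in> fmeasurable lebesgue"
    by (rule fmeasurableI) (use r in \<open>auto simp: emeasure_lebesgue_ball3 simp del: emeasure_completion\<close>)
  have [measurable]: "bad \<in> sets lebesgue" "S \<in> sets lebesgue"
  proof -
    have "bad = ball x r \<inter> {y \<in> space lebesgue. a / 2 < \<bar>u y\<bar>}"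
      "S = ball x r \<inter> {y \<in> space lebesgue. \<bar>u y\<bar> \<le> a / 2}" by (auto simp: bad_def S_def)
    moreover have "ball x r \<in> sets lebesgue" "{y \<in> space lebesgue. a / 2 < \<bar>u y\<bar>} \<in> sets lebesgue"
      "{y \<in> space lebesgue. \<bar>u y\<bar> \<le> a / 2} \<in> sets lebesgue"
      by (simp, measurable)
    ultimately show "bad \<in> sets lebesgue" "S \<in> sets lebesgue" by (simp_all only: sets.Int)
  qed
  have fm: "bad \<in> fmeasurable lebesgue" "S \<in> fmeasurable lebesgue"
    by (rule fmeasurableI2[OF ball _ \<open>bad \<in> sets lebesgue\<close>], auto simp: bad_def)
       (rule fmeasurableI2[OF ball _ \<open>S \<in> sets lebesgue\<close>], auto simp: S_def)
  have mb: "measure lebesgue bad \<le> \<rho>"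
  proof -
    have "(a / 2) powr q * measure lebesgue bad = (LINT y|lebesgue. (a / 2) powr q * indicat_real bad y)"
      using fm by (simp add: fmeasurable_def)
    also have "\<dots> \<le> (LINT y|lebesgue. \<bar>u y\<bar> powr q)"
    proof (rule integral_mono[OF _ int])
      show "integrable lebesgue (\<lambda>y. (a / 2) powr q * indicat_real bad y)"
        using fm by (simp add: fmeasurable_def)
      show "(a / 2) powr q * indicat_real bad y \<le> \<bar>u y\<bar> powr q" for y
        using q a by (auto simp: indicator_def bad_def intro!: powr_mono2)
    qed
    finally have "(a / 2) powr q * measure lebesgue bad \<le> M" using M by simp
    then have "(2 / a) powr q * ((a / 2) powr q * measure lebesgue bad) \<le> \<rho>"
      unfolding \<rho>_def by (rule mult_left_mono) simp
    moreover have "(2 / a) powr q * (a / 2) powr q = 1"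
      using a by (simp flip: powr_mult)
    ultimately show ?thesis by (simp flip: mult.assoc)
  qed
  have "ball x r = bad \<union> S" "bad \<inter> S = {}" by (auto simp: bad_def S_def)
  then have "measure lebesgue (ball x r) = measure lebesgue bad + measure lebesgue S"
    using fm by (simp add: fmeasurable_def less_top measure_Union del: emeasure_completion measure_completion)
  then have mS: "\<rho> \<le> measure lebesgue S"
    using mb r3 measure_lebesgue_ball3[of r x] r by (simp del: measure_completion)
  \<comment> \<open>A lower bound for the kernel on \<open>S\<close>: the increment is at least a /
    2 and the distance at most r.\<close>
  define k where "k = a\<^sup>2 / 4 / r powr (3 + 2 * \<alpha>)"
  have k: "0 \<le> k" by (simp add: k_def)
  have "ennreal (k * \<rho>) \<le> ennreal k * emeasure lebesgue S"
    using mS k fm by (simp add: emeasure_eq_measure2 ennreal_mult'[symmetric] mult_left_mono ennreal_leI del: emeasure_completion measure_completion)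
  also have "\<dots> = (\<integral>\<^sup>+y. ennreal k * indicator S y \<partial>lebesgue)"
    by (rule nn_integral_cmult_indicator[symmetric]) simp
  also have "\<dots> \<le> (\<integral>\<^sup>+y. ennreal (gagliardo_kernel \<alpha> u u (x, y)) \<partial>lebesgue)"
  proof (rule nn_integral_mono)
    fix y
    show "ennreal k * indicator S y \<le> ennreal (gagliardo_kernel \<alpha> u u (x, y))"
    proof (cases "y \<in> S")
      case True
      then have y: "norm (x - y) < r" "\<bar>u y\<bar> \<le> a / 2" by (auto simp: S_def dist_norm)
      then have "x \<noteq> y" using a by auto
      have "a / 2 \<le> \<bar>u x - u y\<bar>" using y(2) a(1) by linarith
      then have "(a / 2)\<^sup>2 \<le> (u x - u y)\<^sup>2" using a(2) by (intro iffD1[OF abs_le_square_iff]) simp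
      moreover have "norm (x - y) powr (3 + 2 * \<alpha>) \<le> r powr (3 + 2 * \<alpha>)"
        using y \<alpha> by (intro powr_mono2) auto
      ultimately have "k \<le> (u x - u y)\<^sup>2 / norm (x - y) powr (3 + 2 * \<alpha>)"
        unfolding k_def using \<open>x \<noteq> y\<close> by (intro frac_le) (auto simp: power_divide)
      then show ?thesis using True by (simp add: gagliardo_kernel_diag ennreal_leI)
    qed simp
  qed
  also have "k = a\<^sup>2 / 4 / (2 * \<rho> / (4/3*pi)) powr (1 + 2 * \<alpha> / 3)"
    by (simp add: k_def r_def powr_powr add_divide_distrib)
  finally show ?thesis .
qed

text \<open>This is where criticality of the exponent enters: only for q (3 - 2 \<alpha>) = 6 does
  the pointwise lower bound scale like a to the power q. In logarithmic variables the claim is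
  linear.\<close>

lemma sobolev_powr_identity:
  fixes a M c \<alpha> :: real
  assumes "0 < a" "0 < M" "0 < c" "0 < \<alpha>" "\<alpha> < 1" "q = sobolev_exponent \<alpha>"
  shows "a\<^sup>2 / 4 / (2 * ((2 / a) powr q * M) / c) powr (1 + 2 * \<alpha> / 3) * ((2 / a) powr q * M)
    = (c powr (1 + 2 * \<alpha> / 3) / 4 / 2 powr (1 + 2 * \<alpha> / 3) / 2 powr (2 * \<alpha> * q / 3)) * M powr (- (2 * \<alpha> / 3)) * a powr q"
proof -
  have e: "q * (3 - 2 * \<alpha>) = 6" using assms(5) unfolding assms(6) sobolev_exponent_def by (simp only: times_divide_eq_left) (simp add: divide_eq_eq)
  define A B C D where "A = ln a" and "B = ln M" and "C = ln c" and "D = ln (2::real)"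
  have v: "a = exp A" "M = exp B" "c = exp C" "2 = exp D"
    using assms by (simp_all add: A_def B_def C_def D_def)
  have 2: "(2::real) / a = exp (D - A)" by (simp add: v(1) exp_diff D_def)
  have L: "a\<^sup>2 / (2 * ((2 / a) powr q * M) / c) powr (1 + 2 * \<alpha> / 3) * ((2 / a) powr q * M) =
     exp (2 * A - (1 + 2 * \<alpha> / 3) * (D + q * (D - A) + B - C) + q * (D - A) + B)"
  proof -
    have \<rho>: "(2 / a) powr q * M = exp (q * (D - A) + B)"
      unfolding 2 by (simp add: v(2) powr_def exp_add)
    have "2 * ((2 / a) powr q * M) / c = exp (D + q * (D - A) + B - C)"
      unfolding \<rho> by (simp add: exp_add exp_diff v(3) D_def)
    moreover have "a\<^sup>2 = exp (2 * A)" by (simp add: v(1) exp_double)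
    ultimately show ?thesis unfolding \<rho> by (simp add: powr_def del: exp_ln flip: exp_add exp_diff)
  qed
  have R: "(c powr (1 + 2 * \<alpha> / 3) / 2 powr (1 + 2 * \<alpha> / 3) / 2 powr (2 * \<alpha> * q / 3)) * M powr (- (2 * \<alpha> / 3)) * a powr q
     = exp ((1 + 2 * \<alpha> / 3) * C - (1 + 2 * \<alpha> / 3) * D - 2 * \<alpha> * q / 3 * D - (2 * \<alpha> / 3) * B + q * A)"
    by (simp add: v(1-3) powr_def D_def flip: exp_add exp_diff)
  \<comment> \<open>The two exponents differ by A (6 - q (3 - 2 \<alpha>)) / 3, which vanishes for
    the critical q.\<close>
  have "2 * A - (1 + 2 * \<alpha> / 3) * (D + q * (D - A) + B - C) + q * (D - A) + B =
    (1 + 2 * \<alpha> / 3) * C - (1 + 2 * \<alpha> / 3) * D - 2 * \<alpha> * q / 3 * D - (2 * \<alpha> / 3) * B + q * A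
    + A * (6 - q * (3 - 2 * \<alpha>)) / 3"
    by (simp add: field_simps)
  then have "a\<^sup>2 / (2 * ((2 / a) powr q * M) / c) powr (1 + 2 * \<alpha> / 3) * ((2 / a) powr q * M) =
    (c powr (1 + 2 * \<alpha> / 3) / 2 powr (1 + 2 * \<alpha> / 3) / 2 powr (2 * \<alpha> * q / 3)) * M powr (- (2 * \<alpha> / 3)) * a powr q"
    using L R e by simp
  then show ?thesis by (simp add: field_simps)
qed

text \<open>Integrating the pointwise bound gives \<kappa> M^(1 - 2 \<alpha> / 3) \<le> form, and 1
  - 2 \<alpha> / 3 = 2 / q. The bound contains M itself, so M must be finite beforehand.\<close>

proposition fractional_sobolev_ineq:
  assumes \<alpha>: "0 < \<alpha>" "\<alpha> < 1"
  defines "q \<equiv> sobolev_exponent \<alpha>"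
  obtains C where "C > 0" "\<And>u. u \<in> gagliardo_space \<alpha> \<Longrightarrow> integrable lebesgue (\<lambda>x. \<bar>u x\<bar> powr q) \<Longrightarrow>
    (LINT x|lebesgue. \<bar>u x\<bar> powr q) \<le> C * gagliardo_norm \<alpha> u powr q"
proof -
  define c where "c = 4/3 * pi"
  define \<kappa> where "\<kappa> = c powr (1 + 2 * \<alpha> / 3) / 4 / 2 powr (1 + 2 * \<alpha> / 3) / 2 powr (2 * \<alpha> * q / 3)"
  have c: "c > 0" by (simp add: c_def)
  then have \<kappa>: "\<kappa> > 0" by (simp add: \<kappa>_def)
  have q: "q > 0" using sobolev_exponent_pos \<alpha> by (simp add: q_def)
  show thesis
  proof (rule that[of "(1 / \<kappa>) powr (q / 2)"])
    show "(1 / \<kappa>) powr (q / 2) > 0" using \<kappa> by simp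
    fix u assume u: "u \<in> gagliardo_space \<alpha>" and int: "integrable lebesgue (\<lambda>x. \<bar>u x\<bar> powr q)"
    note [measurable] = gagliardo_spaceD(1)[OF u]
    define M where "M = (LINT x|lebesgue. \<bar>u x\<bar> powr q)"
    have "M \<ge> 0" by (simp add: M_def)
    show "(LINT x|lebesgue. \<bar>u x\<bar> powr q) \<le> (1 / \<kappa>) powr (q / 2) * gagliardo_norm \<alpha> u powr q"
    \<comment> \<open>The pointwise bound contains a negative power of M.\<close>
    proof (cases "M = 0")
      case True then show ?thesis by (simp add: M_def)
    next
      case False
      with \<open>M \<ge> 0\<close> have M: "M > 0" by simp
      define m where "m = \<kappa> * M powr (- (2 * \<alpha> / 3))"
      have m: "m \<ge> 0" using \<kappa> by (simp add: m_def)
      have pw: "ennreal (m * \<bar>u x\<bar> powr q) \<le> (\<integral>\<^sup>+y. ennreal (gagliardo_kernel \<alpha> u u (x, y)) \<partial>lebesgue)" for x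
      proof (cases "u x = 0")
        case False
        then have "0 < \<bar>u x\<bar>" by simp
        from gagliardo_kernel_pointwise[OF \<alpha>(1) q gagliardo_spaceD(1)[OF u] int M_def[symmetric] M refl this]
        show ?thesis
          using sobolev_powr_identity[OF \<open>0 < \<bar>u x\<bar>\<close> M c \<alpha> q_def[unfolded atomize_eq]] by (simp add: c_def m_def \<kappa>_def)
      qed simp
      have "ennreal (m * M) = (\<integral>\<^sup>+x. ennreal (m * \<bar>u x\<bar> powr q) \<partial>lebesgue)"
        using int m by (simp add: M_def nn_integral_eq_integral)
      also have "\<dots> \<le> (\<integral>\<^sup>+x. \<integral>\<^sup>+y. ennreal (gagliardo_kernel \<alpha> u u (x, y)) \<partial>lebesgue \<partial>lebesgue)"
        by (rule nn_integral_mono) (rule pw)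
      also have "\<dots> = ennreal (gagliardo_form \<alpha> u u)" by (rule gagliardo_form_iterated[OF u])
      finally have "m * M \<le> gagliardo_form \<alpha> u u" by simp
      moreover have "m * M = \<kappa> * M powr (2 / q)"
      proof -
        have "2 / q = 1 - 2 * \<alpha> / 3" using \<alpha> by (simp add: q_def sobolev_exponent_def field_simps)
        then have "M powr (2 / q) = M powr (- (2 * \<alpha> / 3) + 1)" by simp
        also have "\<dots> = M powr (- (2 * \<alpha> / 3)) * M powr 1" by (rule powr_add)
        finally have "M powr (2 / q) = M powr (- (2 * \<alpha> / 3)) * M powr 1" .
        then show ?thesis using M by (simp add: m_def)
      qed
      ultimately have "M powr (2 / q) \<le> 1 / \<kappa> * gagliardo_form \<alpha> u u" using \<kappa> by (simp add: field_simps)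
      then have "(M powr (2 / q)) powr (q / 2) \<le> (1 / \<kappa> * gagliardo_form \<alpha> u u) powr (q / 2)"
        using q by (intro powr_mono2) auto
      also have "\<dots> = (1 / \<kappa>) powr (q / 2) * gagliardo_norm \<alpha> u powr q"
      proof -
        have "(1 / \<kappa> * gagliardo_form \<alpha> u u) powr (q / 2) = (1 / \<kappa>) powr (q / 2) * gagliardo_form \<alpha> u u powr (q / 2)"
          by (rule powr_mult)
        then show ?thesis by (simp add: powr_powr gagliardo_norm_def flip: powr_half_sqrt)
      qed
      finally show ?thesis using M q by (simp add: powr_powr M_def)
    qed
  qed
qed

lemma truncation_abs_diff: "\<bar>max (- n) (min n a) - max (- n) (min n b)\<bar> \<le> \<bar>a - (b::real)\<bar>"
  by (auto simp: max_def min_def)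

text \<open>Truncation supplies the a priori integrability that \<open>fractional_sobolev_ineq\<close> assumes.\<close>

proposition fractional_sobolev_embedding:
  assumes \<alpha>: "0 < \<alpha>" "\<alpha> < 1"
  defines "q \<equiv> sobolev_exponent \<alpha>"
  obtains C where "C > 0" "\<And>u. u \<in> fractional_sobolev \<alpha> \<Longrightarrow> integrable lebesgue (\<lambda>x. \<bar>u x\<bar> powr q)"
    "\<And>u. u \<in> fractional_sobolev \<alpha> \<Longrightarrow> (LINT x|lebesgue. \<bar>u x\<bar> powr q) \<le> C * gagliardo_norm \<alpha> u powr q"
proof -
  obtain C where C: "C > 0" "\<And>u. u \<in> gagliardo_space \<alpha> \<Longrightarrow> integrable lebesgue (\<lambda>x. \<bar>u x\<bar> powr q) \<Longrightarrow>
    (LINT x|lebesgue. \<bar>u x\<bar> powr q) \<le> C * gagliardo_norm \<alpha> u powr q"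
    using fractional_sobolev_ineq[OF \<alpha>] unfolding q_def by blast
  have q2: "q > 2" using sobolev_exponent_gt_2 \<alpha> by (simp add: q_def)
  have *: "integrable lebesgue (\<lambda>x. \<bar>u x\<bar> powr q) \<and> (LINT x|lebesgue. \<bar>u x\<bar> powr q) \<le> C * gagliardo_norm \<alpha> u powr q"
    if u: "u \<in> fractional_sobolev \<alpha>" for u
  proof -
    have g: "u \<in> gagliardo_space \<alpha>" and i2: "integrable lebesgue (\<lambda>x. (u x)\<^sup>2)"
      using u by (auto simp: fractional_sobolev_def gagliardo_space_def)
    note [measurable] = gagliardo_spaceD(1)[OF g]
    define T where "T n x = max (- real n) (min (real n) (u x))" for n x
    have [measurable]: "T n \<in> borel_measurable lebesgue" for n unfolding T_def[abs_def] by measurable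
    have Tg: "T n \<in> gagliardo_space \<alpha>" "gagliardo_norm \<alpha> (T n) \<le> gagliardo_norm \<alpha> u" for n
      by (rule gagliardo_space_contraction[OF _ g]; simp add: T_def truncation_abs_diff)+
    have Tb: "\<bar>T n x\<bar> \<le> real n" "\<bar>T n x\<bar> \<le> \<bar>u x\<bar>" for n x by (auto simp: T_def)
    have Ti: "integrable lebesgue (\<lambda>x. \<bar>T n x\<bar> powr q)" for n
    proof (rule Bochner_Integration.integrable_bound)
      show "integrable lebesgue (\<lambda>x. real n powr (q - 2) * (u x)\<^sup>2)" using i2 by simp
      have "\<bar>T n x\<bar> powr q \<le> real n powr (q - 2) * (u x)\<^sup>2" for x
      proof -
        have "\<bar>T n x\<bar> powr q = \<bar>T n x\<bar> powr (q - 2) * \<bar>T n x\<bar> powr 2"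
          by (subst powr_add[symmetric]) simp
        also have "\<dots> \<le> real n powr (q - 2) * \<bar>u x\<bar> powr 2"
          using q2 Tb by (intro mult_mono powr_mono2) auto
        finally show ?thesis by simp
      qed
      then show "AE x in lebesgue. norm (\<bar>T n x\<bar> powr q) \<le> norm (real n powr (q - 2) * (u x)\<^sup>2)"
        by (auto simp: abs_mult intro!: AE_I2)
    qed measurable
    have "(LINT x|lebesgue. \<bar>T n x\<bar> powr q) \<le> C * gagliardo_norm \<alpha> u powr q" for n
      using C(2)[OF Tg(1) Ti, of n] Tg(2)[of n] C(1) q2
      by (auto elim!: order_trans intro!: mult_left_mono powr_mono2)
    moreover have "(\<lambda>n. \<bar>T n x\<bar> powr q) \<longlonglongrightarrow> \<bar>u x\<bar> powr q" for x
    \<comment> \<open>At each point the truncation is eventually the identity.\<close>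
    proof (rule tendsto_eventually)
      obtain N where N: "\<bar>u x\<bar> \<le> real N" using real_arch_simple by blast
      show "\<forall>\<^sub>F n in sequentially. \<bar>T n x\<bar> powr q = \<bar>u x\<bar> powr q"
        using eventually_ge_at_top[of N]
      proof eventually_elim
        case (elim n) then have "\<bar>u x\<bar> \<le> real n" using N by simp
        then have "T n x = u x" by (auto simp: T_def)
        then show ?case by simp
      qed
    qed
    ultimately show ?thesis
      using integral_Fatou_bound[of "\<lambda>n x. \<bar>T n x\<bar> powr q" lebesgue "\<lambda>x. \<bar>u x\<bar> powr q" "C * gagliardo_norm \<alpha> u powr q"] Ti
      by auto
  qed
  show thesis using that[of C] C(1) * by blast
qed

section \<open>Test functions\<close>

text \<open>Dyadic shells. Inside the unit ball their contributions decay like 2^((2 \<alpha> - 2)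
  k), outside like 2^(- 2 \<alpha> k); both series converge exactly because 0 < \<alpha> <
  1.\<close>

lemma nn_integral_truncated_kernel_bound:
  assumes \<alpha>: "0 < \<alpha>" "\<alpha> < 1"
  obtains C where "\<And>x::R3. (\<integral>\<^sup>+y. ennreal (min 1 ((norm (x - y))\<^sup>2) / norm (x - y) powr (3 + 2 * \<alpha>)) \<partial>lebesgue) \<le> ennreal C"
proof -
  \<comment> \<open>\<open>a k\<close> bounds the integrand where (1/2)^(k+1) \<le> r < (1/2)^k, and
    \<open>b k\<close> where 2^k \<le> r < 2^(k+1). For an upper bound each shell may be enlarged to
    the ball containing it.\<close>
  define a where "a k = ((1/2) ^ k)\<^sup>2 * (2 ^ Suc k) powr (3 + 2 * \<alpha>)" for k :: nat
  define b where "b k = (2 ^ k) powr (- (3 + 2 * \<alpha>))" for k :: nat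
  define c where "c = 4/3 * pi"
  have c: "c > 0" by (simp add: c_def)
  have ann: "0 \<le> a k" "0 \<le> b k" for k by (simp_all add: a_def b_def)
  have pw: "ennreal (min 1 ((norm (x - y))\<^sup>2) / norm (x - y) powr (3 + 2 * \<alpha>))
     \<le> (\<Sum>k. ennreal (a k) * indicator (ball x ((1/2)^k)) y) + (\<Sum>k. ennreal (b k) * indicator (ball x (2 ^ Suc k)) y)"
     (is "ennreal ?F \<le> ?A + ?B") for x y :: R3
  proof (cases "x = y")
    case False
    define r where "r = norm (x - y)"
    have r: "r > 0" using False by (simp add: r_def)
    show ?thesis
    proof (cases "r < 1")
      case True
      define k where "k = (LEAST k. (1/2)^(Suc k) \<le> r)"
      have "\<exists>k. (1/2)^(Suc k) \<le> r"
      proof -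
        obtain n where "(1/2)^n < r" using real_arch_pow_inv[OF r, of "1/2"] by auto
        moreover have "(1/2)^Suc n \<le> (1/2::real)^n" by simp
        ultimately show ?thesis by (intro exI[of _ n]) linarith
      qed
      then have k1: "(1/2)^(Suc k) \<le> r" unfolding k_def by (rule LeastI_ex)
      have k2: "r < (1/2)^k"
      proof (cases k)
        case 0 then show ?thesis using True by simp
      next
        case (Suc j)
        then have "\<not> (1/2)^(Suc j) \<le> r" unfolding k_def by (intro not_less_Least) simp
        then show ?thesis using Suc by simp
      qed
      have "?F \<le> ((1/2)^k)\<^sup>2 / ((1/2)^(Suc k)) powr (3 + 2 * \<alpha>)"
        unfolding r_def[symmetric]
      proof (rule frac_le)
        show "min 1 (r\<^sup>2) \<le> ((1/2)^k)\<^sup>2" using r k2 by (intro min.coboundedI2 power_mono) auto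
        show "((1/2)^(Suc k)) powr (3 + 2 * \<alpha>) \<le> r powr (3 + 2 * \<alpha>)" using k1 \<alpha> by (intro powr_mono2) auto
      qed auto
      also have "\<dots> = a k" unfolding a_def by (simp add: power_one_over powr_divide field_simps)
      finally have "ennreal ?F \<le> ennreal (a k) * indicator (ball x ((1/2)^k)) y"
        using k2 by (simp add: r_def dist_norm ennreal_leI)
      also have "\<dots> \<le> ?A" by (rule sum_le_suminf[of _ "{k}", simplified]) auto
      also have "?A \<le> ?A + ?B" by simp
      finally show ?thesis .
    next
      case False
      define k where "k = (LEAST k. r < 2^(Suc k))"
      have "\<exists>k. r < 2^(Suc k)"
      proof -
        obtain n where "r < 2^n" using real_arch_pow[of 2 r] by auto
        moreover have "(2::real)^n \<le> 2^Suc n" by simp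
        ultimately show ?thesis by (intro exI[of _ n]) linarith
      qed
      then have k1: "r < 2^(Suc k)" unfolding k_def by (rule LeastI_ex)
      have k2: "2^k \<le> r"
      proof (cases k)
        case 0 then show ?thesis using False by simp
      next
        case (Suc j)
        then have "\<not> r < 2^(Suc j)" unfolding k_def by (intro not_less_Least) simp
        then show ?thesis using Suc by simp
      qed
      have "?F \<le> 1 / (2^k) powr (3 + 2 * \<alpha>)"
        unfolding r_def[symmetric]
      proof (rule frac_le)
        show "(2^k) powr (3 + 2 * \<alpha>) \<le> r powr (3 + 2 * \<alpha>)" using k2 \<alpha> by (intro powr_mono2) auto
      qed auto
      also have "\<dots> = b k" unfolding b_def by (simp only: powr_minus_divide)
      finally have "ennreal ?F \<le> ennreal (b k) * indicator (ball x (2^Suc k)) y"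
        using k1 by (simp add: r_def dist_norm ennreal_leI)
      also have "\<dots> \<le> ?B" by (rule sum_le_suminf[of _ "{k}", simplified]) auto
      also have "?B \<le> ?A + ?B" by simp
      finally show ?thesis .
    qed
  qed simp
  have sa: "summable (\<lambda>k. a k * (c * ((1/2)^k)^3))"
  proof -
    have eq: "a k * (c * ((1/2)^k)^3) = c * 2 powr (3 + 2 * \<alpha>) * (2 powr (2 * \<alpha> - 2)) ^ k" for k
    proof -
      have "a k * ((1/2)^k)^3 = 2 powr (- 2 * real k + (3 + 2 * \<alpha>) * (real k + 1) - 3 * real k)"
      proof -
        have "((1/2) ^ k)\<^sup>2 = (2::real) powr (- 2 * real k)" "((1/2) ^ k)^3 = (2::real) powr (- 3 * real k)"
          by (simp_all add: powr_minus powr_realpow power_one_over inverse_eq_divide mult.commute[of _ "real k"] flip: power_mult powr_powr)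
        moreover have "((2::real) ^ Suc k) powr (3 + 2 * \<alpha>) = 2 powr ((3 + 2 * \<alpha>) * (real k + 1))"
          by (subst powr_realpow[symmetric]) (simp_all add: powr_powr mult.commute add.commute)
        ultimately show ?thesis unfolding a_def by (simp add: powr_diff powr_add powr_minus field_simps)
      qed
      also have "\<dots> = 2 powr (3 + 2 * \<alpha>) * 2 powr ((2 * \<alpha> - 2) * k)"
        by (simp add: algebra_simps flip: powr_add)
      also have "2 powr ((2 * \<alpha> - 2) * k) = (2 powr (2 * \<alpha> - 2)) ^ k"
        by (simp add: powr_powr flip: powr_realpow)
      finally show ?thesis by (simp add: mult_ac)
    qed
    have "2 powr (2 * \<alpha> - 2) < (1::real)" using \<alpha> by (simp add: powr_less_one)
    then show ?thesis unfolding eq by (intro summable_mult summable_geometric) simp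
  qed
  have sb: "summable (\<lambda>k. b k * (c * (2^Suc k)^3))"
  proof -
    have eq: "b k * (c * (2^Suc k)^3) = 8 * c * (2 powr (- 2 * \<alpha>)) ^ k" for k
    proof -
      have "b k * (2^k)^3 = 2 powr (- (3 + 2 * \<alpha>) * real k + 3 * real k)"
        unfolding b_def powr_add by (simp add: powr_powr mult_ac flip: powr_realpow power_mult)
      also have "\<dots> = 2 powr (- 2 * \<alpha> * k)" by (simp add: algebra_simps)
      also have "\<dots> = (2 powr (- 2 * \<alpha>)) ^ k" by (simp add: powr_powr flip: powr_realpow)
      finally show ?thesis by (simp add: power_mult_distrib mult_ac)
    qed
    have "2 powr (- 2 * \<alpha>) < (1::real)" using \<alpha> by (simp add: powr_less_one)
    then show ?thesis unfolding eq by (intro summable_mult summable_geometric) simp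
  qed
  have "(\<integral>\<^sup>+y. ennreal (min 1 ((norm (x - y))\<^sup>2) / norm (x - y) powr (3 + 2 * \<alpha>)) \<partial>lebesgue)
    \<le> ennreal ((\<Sum>k. a k * (c * ((1/2)^k)^3)) + (\<Sum>k. b k * (c * (2^Suc k)^3)))" for x :: R3
  proof -
    have "(\<integral>\<^sup>+y. ennreal (min 1 ((norm (x - y))\<^sup>2) / norm (x - y) powr (3 + 2 * \<alpha>)) \<partial>lebesgue)
      \<le> (\<integral>\<^sup>+y. (\<Sum>k. ennreal (a k) * indicator (ball x ((1/2)^k)) y) + (\<Sum>k. ennreal (b k) * indicator (ball x (2 ^ Suc k)) y) \<partial>lebesgue)"
      by (rule nn_integral_mono) (rule pw)
    also have "\<dots> = (\<Sum>k. ennreal (a k) * emeasure lebesgue (ball x ((1/2)^k))) + (\<Sum>k. ennreal (b k) * emeasure lebesgue (ball x (2^Suc k)))"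
    proof -
      have [measurable]: "ball x r \<in> sets lebesgue" for r by simp
      have m: "(\<lambda>y. ennreal d * indicator (ball x r) y) \<in> borel_measurable lebesgue" for d r by measurable
      show ?thesis
        by (subst nn_integral_add)
          (simp_all only: nn_integral_suminf m borel_measurable_suminf_order nn_integral_cmult_indicator \<open>\<And>r. ball x r \<in> sets lebesgue\<close>)
    qed
    also have "\<dots> = (\<Sum>k. ennreal (a k * (c * ((1/2)^k)^3))) + (\<Sum>k. ennreal (b k * (c * (2^Suc k)^3)))"
    proof -
      have "ennreal (a k) * emeasure lebesgue (ball x ((1/2)^k)) = ennreal (a k * (c * ((1/2)^k)^3))"
        "ennreal (b k) * emeasure lebesgue (ball x (2^Suc k)) = ennreal (b k * (c * (2^Suc k)^3))" for k
        unfolding c_def by (subst emeasure_lebesgue_ball3, simp, rule ennreal_mult'[symmetric], rule ann)+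
      then show ?thesis by simp
    qed
    also have "\<dots> = ennreal ((\<Sum>k. a k * (c * ((1/2)^k)^3)) + (\<Sum>k. b k * (c * (2^Suc k)^3)))"
    proof -
      have nn: "0 \<le> a k * (c * ((1/2)^k)^3)" "0 \<le> b k * (c * (2^Suc k)^3)" for k using ann c by simp_all
      show ?thesis
        unfolding suminf_ennreal2[OF nn(1) sa] suminf_ennreal2[OF nn(2) sb]
        by (rule ennreal_plus[symmetric]) (intro suminf_nonneg sa sb nn)+
    qed
    finally show ?thesis .
  qed
  then show thesis by (rule that)
qed

text \<open>The squared increment is at most K min(1, |x - y|^2) and vanishes unless one of the
  points lies in the ball of radius R. By symmetry of the kernel it suffices to integrate with x in
  that ball, which has finite measure.\<close>

lemma lipschitz_gagliardo_space:
  fixes u :: "R3 \<Rightarrow> real"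
  assumes \<alpha>: "0 < \<alpha>" "\<alpha> < 1" and lip: "\<And>x y. \<bar>u x - u y\<bar> \<le> L * norm (x - y)"
    and bd: "\<And>x. \<bar>u x\<bar> \<le> B" and supp: "\<And>x. R \<le> norm x \<Longrightarrow> u x = 0"
  shows "u \<in> gagliardo_space \<alpha>"
proof -
  have L: "L \<ge> 0"
    using order_trans[OF abs_ge_zero lip[of 0 "axis 1 1"]] by (simp add: norm_axis_1)
  have B: "B \<ge> 0" using order_trans[OF abs_ge_zero bd] by blast
  have "continuous_on UNIV u"
    by (rule lipschitz_on_continuous_on[of L], rule lipschitz_onI) (use lip L in \<open>auto simp: dist_norm\<close>)
  then have um [measurable]: "u \<in> borel_measurable lebesgue"
    by (simp add: borel_measurable_continuous_onI measurable_completion)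
  define K where "K = L\<^sup>2 + (2 * B)\<^sup>2"
  have K: "K \<ge> 0" by (simp add: K_def)
  define k where "k x y = ennreal (K * (min 1 ((norm (x - y))\<^sup>2) / norm (x - y) powr (3 + 2 * \<alpha>)))" for x y :: R3
  obtain C where C: "\<And>x::R3. (\<integral>\<^sup>+y. ennreal (min 1 ((norm (x - y))\<^sup>2) / norm (x - y) powr (3 + 2 * \<alpha>)) \<partial>lebesgue) \<le> ennreal C"
    using nn_integral_truncated_kernel_bound[OF \<alpha>] by blast
  have ksym: "k x y = k y x" for x y by (simp add: k_def norm_minus_commute)
  have [measurable]: "k x \<in> borel_measurable lebesgue" for x unfolding k_def[abs_def] by measurable
  have [measurable]: "(\<lambda>z. k (fst z) (snd z)) \<in> borel_measurable LL" unfolding k_def by measurable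
  have kC: "(\<integral>\<^sup>+y. k x y \<partial>lebesgue) \<le> ennreal K * ennreal C" for x
    unfolding k_def using K by (simp add: ennreal_mult' nn_integral_cmult C mult_left_mono del: times_divide_eq_right)
  define S where "S = ball (0::R3) R"
  have [measurable]: "S \<in> sets lebesgue" by (simp add: S_def)
  have Sfin: "emeasure lebesgue S < \<infinity>" using emeasure_lborel_ball_finite[of 0 R] by (simp add: S_def)
  have i1: "(\<integral>\<^sup>+x. \<integral>\<^sup>+y. k x y * indicator S x \<partial>lebesgue \<partial>lebesgue) < \<infinity>"
  proof -
    have "(\<integral>\<^sup>+x. \<integral>\<^sup>+y. k x y * indicator S x \<partial>lebesgue \<partial>lebesgue) = (\<integral>\<^sup>+x. (\<integral>\<^sup>+y. k x y \<partial>lebesgue) * indicator S x \<partial>lebesgue)"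
      by (intro nn_integral_cong nn_integral_multc) measurable
    also have "\<dots> \<le> (\<integral>\<^sup>+x. ennreal K * ennreal C * indicator S x \<partial>lebesgue)"
      by (intro nn_integral_mono mult_right_mono kC) simp
    also have "\<dots> = ennreal K * ennreal C * emeasure lebesgue S" by (rule nn_integral_cmult_indicator) simp
    also have "\<dots> < \<infinity>" using Sfin by (simp add: ennreal_mult_less_top del: emeasure_completion)
    finally show ?thesis .
  qed
  have le: "ennreal (gagliardo_kernel \<alpha> u u z) \<le> k (fst z) (snd z) * indicator S (fst z) + k (fst z) (snd z) * indicator S (snd z)" for z
  proof (cases "fst z \<in> S \<or> snd z \<in> S")
    case False
    then have "u (fst z) = 0" "u (snd z) = 0" using supp by (auto simp: S_def)
    then show ?thesis by (simp add: gagliardo_kernel_diag)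
  next
    case True
    define x y where "x = fst z" and "y = snd z"
    have "(u x - u y)\<^sup>2 \<le> L\<^sup>2 * (norm (x - y))\<^sup>2"
      using power_mono[OF lip[of x y], of 2] by (simp add: power_mult_distrib)
    moreover have "\<bar>u x - u y\<bar> \<le> 2 * B" using bd[of x] bd[of y] by linarith
    then have "(u x - u y)\<^sup>2 \<le> (2 * B)\<^sup>2" using B by (intro iffD1[OF abs_le_square_iff]) simp
    ultimately have "(u x - u y)\<^sup>2 \<le> K * min 1 ((norm (x - y))\<^sup>2)"
      unfolding K_def min_def by (auto simp: distrib_right intro: order_trans)
    then have "gagliardo_kernel \<alpha> u u z \<le> K * min 1 ((norm (x - y))\<^sup>2) / norm (x - y) powr (3 + 2 * \<alpha>)"
      by (simp add: gagliardo_kernel_diag x_def y_def divide_right_mono)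
    then have "ennreal (gagliardo_kernel \<alpha> u u z) \<le> k x y" by (simp add: k_def ennreal_leI)
    then show ?thesis using True
      by (auto simp: x_def y_def indicator_def intro: order_trans add_increasing)
  qed
  have "(\<integral>\<^sup>+z. ennreal (gagliardo_kernel \<alpha> u u z) \<partial>LL) \<le> (\<integral>\<^sup>+z. k (fst z) (snd z) * indicator S (fst z) + k (fst z) (snd z) * indicator S (snd z) \<partial>LL)"
    by (rule nn_integral_mono) (rule le)
  also have "\<dots> = (\<integral>\<^sup>+z. k (fst z) (snd z) * indicator S (fst z) \<partial>LL) + (\<integral>\<^sup>+z. k (fst z) (snd z) * indicator S (snd z) \<partial>LL)"
    by (rule nn_integral_add) measurable
  also have "(\<integral>\<^sup>+z. k (fst z) (snd z) * indicator S (fst z) \<partial>LL) = (\<integral>\<^sup>+x. \<integral>\<^sup>+y. k x y * indicator S x \<partial>lebesgue \<partial>lebesgue)"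
    by (subst lebesgue.nn_integral_fst[symmetric]) simp_all
  also have "(\<integral>\<^sup>+z. k (fst z) (snd z) * indicator S (snd z) \<partial>LL) = (\<integral>\<^sup>+y. \<integral>\<^sup>+x. k x y * indicator S y \<partial>lebesgue \<partial>lebesgue)"
    by (subst LL.nn_integral_snd[symmetric]) simp_all
  also have "\<dots> = (\<integral>\<^sup>+x. \<integral>\<^sup>+y. k x y * indicator S x \<partial>lebesgue \<partial>lebesgue)" by (simp add: ksym)
  also have "\<dots> + \<dots> < \<infinity>" using i1 by simp
  finally have "(\<integral>\<^sup>+z. ennreal (gagliardo_kernel \<alpha> u u z) \<partial>LL) < \<infinity>" .
  then show ?thesis using gagliardo_form_nn(1)[OF um] by simp
qed

section \<open>Closure properties of smooth functions\<close>

lemma continuously_differentiable_Suc_D: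
  "continuously_differentiable (Suc k) g \<Longrightarrow> continuously_differentiable k g"
proof (induction k arbitrary: g)
  case 0
  then show ?case
    by (auto simp: continuous_on_eq_continuous_at intro: differentiable_imp_continuous_within)
qed auto

lemma frechet_derivative_eqI:
  "(f has_derivative f') (at x) \<Longrightarrow> frechet_derivative f (at x) = f'"
  using frechet_derivative_at by metis

lemma continuously_differentiable_lin:
  assumes "continuously_differentiable k g" "continuously_differentiable k h"
  shows "continuously_differentiable k (\<lambda>x. a * g x + b * h x)"
  using assms
proof (induction k arbitrary: g h)
  case 0 then show ?case by (auto intro!: continuous_intros)
next
  case (Suc k)
  have d: "((\<lambda>x. a * g x + b * h x) has_derivative
      (\<lambda>v. a * frechet_derivative g (at x) v + b * frechet_derivative h (at x) v)) (at x)" for x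
    using Suc.prems by (auto intro!: derivative_eq_intros simp: frechet_derivative_works[symmetric])
  show ?case using d Suc.IH Suc.prems by (auto simp: frechet_derivative_eqI[OF d] differentiable_def)
qed

lemma continuously_differentiable_mult:
  assumes "continuously_differentiable k g" "continuously_differentiable k h"
  shows "continuously_differentiable k (\<lambda>x. g x * h x)"
  using assms
proof (induction k arbitrary: g h)
  case 0 then show ?case by (auto intro!: continuous_intros)
next
  case (Suc k)
  \<comment> \<open>The factors 1 give the derivative the shape a g + b h required by the closure
    rule for linear combinations.\<close>
  have d: "((\<lambda>x. g x * h x) has_derivative
      (\<lambda>v. 1 * (g x * frechet_derivative h (at x) v) + 1 * (frechet_derivative g (at x) v * h x))) (at x)" for x
    using Suc.prems by (auto intro!: derivative_eq_intros simp: frechet_derivative_works[symmetric])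
  have kk: "continuously_differentiable k g" "continuously_differentiable k h"
    using Suc.prems continuously_differentiable_Suc_D by blast+
  show ?case using d Suc.IH Suc.prems kk
    unfolding continuously_differentiable.simps frechet_derivative_eqI[OF d]
    by (intro conjI allI continuously_differentiable_lin) (auto simp: differentiable_def)
qed

lemma continuously_differentiable_const: "continuously_differentiable k (\<lambda>x. c)"
proof (induction k arbitrary: c)
  case (Suc k)
  have "((\<lambda>x. c) has_derivative (\<lambda>v. 0)) (at x)" for x :: R3 by simp
  then show ?case using Suc by (simp add: frechet_derivative_eqI)
qed simp

text \<open>The induction closes because the derivative 1 - tanh^2 is again a polynomial in
  tanh.\<close>

lemma continuously_differentiable_tanh:
  assumes "continuously_differentiable k g"
  shows "continuously_differentiable k (\<lambda>x. tanh (g x / c))"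
  using assms
proof (induction k arbitrary: g)
  case 0 then show ?case by (auto intro!: continuous_intros simp: divide_inverse)
next
  case (Suc k)
  have d: "((\<lambda>x. tanh (g x / c)) has_derivative
      (\<lambda>v. (1 * 1 + (-1) * (tanh (g x / c) * tanh (g x / c))) * ((1 / c) * frechet_derivative g (at x) v + 0 * 1))) (at x)" for x
  proof -
    have "((\<lambda>x. g x / c) has_derivative (\<lambda>v. frechet_derivative g (at x) v / c)) (at x)"
      using Suc.prems by (auto intro!: derivative_eq_intros simp: frechet_derivative_works[symmetric] divide_inverse)
    then have "((\<lambda>x. tanh (g x / c)) has_derivative (\<lambda>v. (frechet_derivative g (at x) v / c) * (1 - tanh (g x / c) ^ 2))) (at x)"
      by (rule DERIV_compose_FDERIV[rotated]) (auto intro!: derivative_eq_intros)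
    moreover have "(\<lambda>v. (frechet_derivative g (at x) v / c) * (1 - tanh (g x / c) ^ 2)) =
      (\<lambda>v. (1 * 1 + (-1) * (tanh (g x / c) * tanh (g x / c))) * ((1 / c) * frechet_derivative g (at x) v + 0 * 1))"
      by (simp add: power2_eq_square mult.commute)
    ultimately show ?thesis by simp
  qed
  have k: "continuously_differentiable k g"
    using Suc.prems continuously_differentiable_Suc_D by blast
  show ?case using d Suc.IH[OF k] Suc.prems
    unfolding continuously_differentiable.simps frechet_derivative_eqI[OF d]
    by (intro conjI allI continuously_differentiable_lin continuously_differentiable_mult continuously_differentiable_const)
       (auto simp: differentiable_def)
qed

text \<open>A smooth, even, 1-Lipschitz approximation of the absolute value; its higher derivatives are
  polynomials in \<open>tanh\<close>.\<close>

definition smooth_abs :: "real \<Rightarrow> real \<Rightarrow> real" where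
  "smooth_abs c \<tau> = c * ln (cosh (\<tau> / c))"

lemma smooth_abs_0 [simp]: "smooth_abs c 0 = 0" by (simp add: smooth_abs_def)

lemma DERIV_smooth_abs: "c \<noteq> 0 \<Longrightarrow> (smooth_abs c has_real_derivative tanh (\<tau> / c)) (at \<tau>)"
  unfolding smooth_abs_def[abs_def]
  by (auto intro!: derivative_eq_intros simp: tanh_def cosh_real_pos)

lemma smooth_abs_lipschitz:
  assumes "c > 0" shows "\<bar>smooth_abs c a - smooth_abs c b\<bar> \<le> \<bar>a - b\<bar>"
proof -
  have "norm (smooth_abs c a - smooth_abs c b) \<le> 1 * norm (a - b)"
  proof (rule field_differentiable_bound[OF convex_UNIV])
    fix z show "(smooth_abs c has_real_derivative tanh (z / c)) (at z within UNIV)"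
      using DERIV_smooth_abs assms by simp
    show "norm (tanh (z / c)) \<le> 1"
      using tanh_real_lt_1[of "z / c"] tanh_real_gt_neg1[of "z / c"] by simp
  qed auto
  then show ?thesis by simp
qed

lemma smooth_abs_nonneg: "c > 0 \<Longrightarrow> 0 \<le> smooth_abs c \<tau>"
  by (simp add: smooth_abs_def cosh_real_ge_1)

lemma smooth_abs_le: "c > 0 \<Longrightarrow> smooth_abs c \<tau> \<le> \<bar>\<tau>\<bar>"
  using smooth_abs_lipschitz[of c \<tau> 0] smooth_abs_nonneg[of c \<tau>] by simp

text \<open>From cosh \<tau> \<ge> exp |\<tau>| / 2; the loss c ln 2 disappears as c tends to
  0.\<close>

lemma smooth_abs_ge: assumes "c > 0" shows "\<bar>\<tau>\<bar> - c * ln 2 \<le> smooth_abs c \<tau>"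
proof -
  have "exp \<bar>\<tau> / c\<bar> / 2 \<le> cosh \<bar>\<tau> / c\<bar>" by (simp add: cosh_def)
  also have "cosh \<bar>\<tau> / c\<bar> = cosh (\<tau> / c)" by (rule cosh_real_abs)
  finally have "ln (exp \<bar>\<tau> / c\<bar> / 2) \<le> ln (cosh (\<tau> / c))" by (intro ln_mono) (auto simp: cosh_real_pos)
  then have "\<bar>\<tau>\<bar> / c - ln 2 \<le> ln (cosh (\<tau> / c))" using assms by (simp add: ln_div)
  then have "c * (\<bar>\<tau>\<bar> / c - ln 2) \<le> c * ln (cosh (\<tau> / c))" using assms by (intro mult_left_mono) auto
  then show ?thesis using assms by (simp add: smooth_abs_def algebra_simps)
qed

lemma smooth_abs_tendsto: "(\<lambda>n. smooth_abs (1 / real (Suc n)) \<tau>) \<longlonglongrightarrow> \<bar>\<tau>\<bar>"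
proof (rule tendsto_sandwich)
  show "\<forall>\<^sub>F n in sequentially. \<bar>\<tau>\<bar> - 1 / real (Suc n) * ln 2 \<le> smooth_abs (1 / real (Suc n)) \<tau>"
    by (intro always_eventually allI smooth_abs_ge) simp
  show "\<forall>\<^sub>F n in sequentially. smooth_abs (1 / real (Suc n)) \<tau> \<le> \<bar>\<tau>\<bar>"
    by (intro always_eventually allI smooth_abs_le) simp
  have "(\<lambda>n. \<bar>\<tau>\<bar> - 1 / real (Suc n) * ln 2) \<longlonglongrightarrow> \<bar>\<tau>\<bar> - 0 * ln 2"
    by (intro tendsto_intros LIMSEQ_Suc lim_1_over_n)
  then show "(\<lambda>n. \<bar>\<tau>\<bar> - 1 / real (Suc n) * ln 2) \<longlonglongrightarrow> \<bar>\<tau>\<bar>" by simp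
qed simp

lemma continuously_differentiable_smooth_abs:
  assumes "continuously_differentiable k g" "c \<noteq> 0"
  shows "continuously_differentiable k (\<lambda>x. smooth_abs c (g x))"
proof (cases k)
  case 0
  have "continuous_on UNIV (smooth_abs c)"
    using DERIV_smooth_abs[OF assms(2)] by (intro DERIV_continuous_on) auto
  then show ?thesis using assms 0 continuous_on_compose2[of UNIV "smooth_abs c" UNIV g] by auto
next
  case (Suc j)
  have d: "((\<lambda>x. smooth_abs c (g x)) has_derivative
      (\<lambda>v. tanh (g x / c) * frechet_derivative g (at x) v)) (at x)" for x
  proof -
    have "(g has_derivative frechet_derivative g (at x)) (at x)"
      using assms Suc by (auto simp: frechet_derivative_works[symmetric])
    from DERIV_compose_FDERIV[OF DERIV_smooth_abs[OF assms(2)] this] show ?thesis by (simp add: mult.commute)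
  qed
  have "continuously_differentiable j g"
    using assms Suc continuously_differentiable_Suc_D by blast
  then show ?thesis using d assms Suc
    by (auto simp: frechet_derivative_eqI[OF d] differentiable_def
        intro!: continuously_differentiable_mult continuously_differentiable_tanh)
qed

section \<open>Test functions: supports, absolute values and bounds\<close>

lemma test_functions_support:
  assumes "h \<in> test_functions" "g \<in> test_functions"
    "\<And>x. g x = 0 \<Longrightarrow> h x = 0 \<Longrightarrow> k x = (0::real)"
  shows "compact (closure {x. k x \<noteq> 0})"
proof -
  have "compact (closure {x. g x \<noteq> 0} \<union> closure {x. h x \<noteq> 0})"
    using assms(1,2) by (auto simp: test_functions_def)
  moreover have "closure {x. k x \<noteq> 0} \<subseteq> closure {x. g x \<noteq> 0} \<union> closure {x. h x \<noteq> 0}"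
    unfolding closure_Un[symmetric] using assms(3) by (intro closure_mono) auto
  ultimately show ?thesis using compact_Int_closed[OF _ closed_closure] by (metis inf.absorb_iff2)
qed

lemma test_functions_lin:
  assumes "g \<in> test_functions" "h \<in> test_functions"
  shows "(\<lambda>x. a * g x + b * h x) \<in> test_functions"
  using test_functions_support[OF assms(2,1), of "\<lambda>x. a * g x + b * h x"] assms
  by (auto simp: test_functions_def intro: continuously_differentiable_lin)

lemma zero_test_function: "(\<lambda>x. 0) \<in> test_functions"
  by (simp add: test_functions_def continuously_differentiable_const)

lemma test_functions_smooth_abs:
  assumes "g \<in> test_functions" "c > 0"
  shows "(\<lambda>x. smooth_abs c (g x)) \<in> test_functions"
  using test_functions_support[OF assms(1,1), of "\<lambda>x. smooth_abs c (g x)"] assms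
  by (auto simp: test_functions_def intro: continuously_differentiable_smooth_abs)

text \<open>Off the compact support the derivative vanishes, and on it the partial derivatives are
  bounded by continuity; their sum is a Lipschitz constant.\<close>

lemma test_functions_bounds:
  assumes "g \<in> test_functions"
  obtains L B R where "\<And>x y. \<bar>g x - g y\<bar> \<le> L * norm (x - y)" "\<And>x. \<bar>g x\<bar> \<le> B" "\<And>x. R \<le> norm x \<Longrightarrow> g x = 0"
proof -
  define K where "K = closure {x. g x \<noteq> 0}"
  have K: "compact K" and zero: "\<And>x. x \<notin> K \<Longrightarrow> g x = 0"
    using assms closure_subset[of "{x. g x \<noteq> 0}"] by (auto simp: test_functions_def K_def)
  have cd: "continuously_differentiable 1 g" using assms by (auto simp: test_functions_def)
  then have dg: "g differentiable (at x)" for x by simp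
  define D where "D x = frechet_derivative g (at x)" for x
  have D: "(g has_derivative D x) (at x)" for x
    using dg by (simp add: D_def frechet_derivative_works[symmetric])
  have cont: "continuous_on UNIV (\<lambda>x. D x (axis i 1))" for i
    using cd by (simp add: D_def)
  have outside: "D x = (\<lambda>v. 0)" if "x \<notin> K" for x
    unfolding D_def
  proof (rule frechet_derivative_eqI)
    have "open (- K)" using K by (simp add: compact_imp_closed open_Compl)
    then show "(g has_derivative (\<lambda>v. 0)) (at x)"
      by (rule has_derivative_transform_within_open[OF has_derivative_const[of 0]]) (use that zero in auto)
  qed
  have bdd: "\<exists>B\<ge>0. \<forall>x. \<bar>h x\<bar> \<le> B" if "continuous_on UNIV h" "\<And>x. x \<notin> K \<Longrightarrow> h x = 0" for h :: "R3 \<Rightarrow> real"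
  proof -
    have "compact (h ` K)" using K that continuous_on_subset by (blast intro: compact_continuous_image)
    then obtain B where "\<forall>y\<in>h ` K. norm y \<le> B" using compact_imp_bounded bounded_iff by metis
    then have "\<bar>h x\<bar> \<le> max B 0" for x using that(2)[of x] by (cases "x \<in> K") auto
    then show ?thesis by (intro exI[of _ "max B 0"]) simp
  qed
  have "\<exists>B\<ge>0. \<forall>x. \<bar>D x (axis i 1)\<bar> \<le> B" for i
    by (rule bdd[OF cont]) (simp add: outside)
  then obtain b where b: "\<And>i x. \<bar>D x (axis i 1)\<bar> \<le> b i" "\<And>i. 0 \<le> b i" by metis
  have Dle: "\<bar>D x v\<bar> \<le> (\<Sum>i\<in>UNIV. b i) * norm v" for x v
  proof -
    have lin: "linear (D x)" using D[of x] has_derivative_linear by blast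
    have "v = (\<Sum>i\<in>UNIV. (v $ i) *\<^sub>R axis i 1)" using basis_expansion[of v] by (simp add: scalar_mult_eq_scaleR)
    then have "D x v = D x (\<Sum>i\<in>UNIV. (v $ i) *\<^sub>R axis i 1)" by (rule arg_cong)
    also have "\<dots> = (\<Sum>i\<in>UNIV. (v $ i) * D x (axis i 1))"
      by (simp add: linear_sum[OF lin] linear_scale[OF lin])
    also have "\<bar>\<dots>\<bar> \<le> (\<Sum>i\<in>UNIV. norm v * b i)"
      by (rule order_trans[OF sum_abs]) (auto simp: abs_mult intro!: sum_mono mult_mono b component_le_norm_cart)
    finally show ?thesis by (simp add: sum_distrib_left mult.commute)
  qed
  have "\<bar>g x - g y\<bar> \<le> (\<Sum>i\<in>UNIV. b i) * norm (x - y)" for x y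
  proof -
    have "norm (g x - g y) \<le> (\<Sum>i\<in>UNIV. b i) * norm (x - y)"
    proof (rule differentiable_bound[OF convex_UNIV])
      show "(g has_derivative D z) (at z within UNIV)" for z using D by simp
      show "onorm (D z) \<le> (\<Sum>i\<in>UNIV. b i)" for z by (rule onorm_bound) (use Dle b in \<open>auto intro: sum_nonneg\<close>)
    qed auto
    then show ?thesis by simp
  qed
  moreover have "continuous_on UNIV g" using cd continuously_differentiable_Suc_D[of 0 g] by simp
  then obtain B where "\<And>x. \<bar>g x\<bar> \<le> B" using bdd[of g] zero by auto
  moreover obtain R where "\<And>x. x \<in> K \<Longrightarrow> norm x \<le> R"
    using K compact_imp_bounded bounded_iff by metis
  \<comment> \<open>The shift by 1 is needed because points of norm exactly R may belong to the
    support.\<close>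
  then have "g x = 0" if "R + 1 \<le> norm x" for x using zero that by force
  ultimately show thesis by (rule that)
qed

lemma integrable_bounded_support:
  fixes g :: "R3 \<Rightarrow> real"
  assumes "g \<in> borel_measurable lebesgue" "\<And>x. \<bar>g x\<bar> \<le> B" "\<And>x. R \<le> norm x \<Longrightarrow> g x = 0"
  shows "integrable lebesgue g"
proof (rule Bochner_Integration.integrable_bound)
  show "integrable lebesgue (\<lambda>x. B * indicat_real (ball (0::R3) R) x)"
    using emeasure_lborel_ball_finite[of 0 R] by (intro integrable_mult_right integrable_real_indicator) auto
  show "AE x in lebesgue. norm (g x) \<le> norm (B * indicat_real (ball 0 R) x)"
  proof (rule AE_I2)
    fix x show "norm (g x) \<le> norm (B * indicat_real (ball 0 R) x)"
      using assms(2)[of x] assms(3)[of x] by (cases "norm x < R") auto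
  qed
qed (use assms in simp)

section \<open>The homogeneous space\<close>

lemma subsequence_choice:
  assumes "\<And>k::nat. \<forall>\<^sub>F n in sequentially. P k n"
  obtains r :: "nat \<Rightarrow> nat" where "strict_mono r" "\<And>k. P k (r k)"
proof -
  have "\<exists>r. \<forall>k. P k (r k) \<and> r k < r (Suc k)"
  proof (rule dependent_nat_choice)
    show "\<exists>n. P 0 n" using assms[of 0] by (auto simp: eventually_sequentially)
    fix x k
    show "\<exists>y. P (Suc k) y \<and> x < y"
      using eventually_conj[OF assms[of "Suc k"] eventually_gt_at_top[of x]]
      by (auto simp: eventually_sequentially)
  qed
  then show thesis using that by (auto simp: strict_mono_Suc_iff)
qed

lemma convergent_geometric_increments:
  fixes a :: "nat \<Rightarrow> real"
  assumes "\<forall>\<^sub>F k in sequentially. \<bar>a (Suc k) - a k\<bar> \<le> (1/2)^k"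
  shows "convergent a"
proof -
  have "summable (\<lambda>k. a (Suc k) - a k)"
    by (rule summable_comparison_test_ev[where g="\<lambda>k. (1/2)^k"]) (use assms in auto)
  then have "convergent (\<lambda>n. \<Sum>k<n. a (Suc k) - a k)" by (simp add: summable_iff_convergent)
  then have "convergent (\<lambda>n. a n - a 0)" by (simp add: sum_lessThan_telescope)
  from convergent_add[OF this convergent_const[of "a 0"]] show ?thesis by simp
qed

text \<open>Chebyshev and Borel-Cantelli: along a fast subsequence the k-th increment exceeds 2^(-k)
  only on a set of measure at most 2^(-k). No triangle inequality for the integrals is involved, so
  any q > 0 is allowed.\<close>

lemma Lq_Cauchy_AE_subseq:
  fixes u :: "nat \<Rightarrow> 'a \<Rightarrow> real"
  assumes [measurable]: "\<And>n. u n \<in> borel_measurable M" and q: "0 < q"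
    and int: "\<And>m n. integrable M (\<lambda>x. \<bar>u m x - u n x\<bar> powr q)"
    and Cauchy: "\<And>e. e > 0 \<Longrightarrow> \<exists>N. \<forall>m\<ge>N. \<forall>n\<ge>N. (LINT x|M. \<bar>u m x - u n x\<bar> powr q) < e"
  obtains r v where "strict_mono r" "v \<in> borel_measurable M" "AE x in M. (\<lambda>k. u (r k) x) \<longlonglongrightarrow> v x"
proof -
  have "\<forall>\<^sub>F n in sequentially. \<forall>m\<ge>n. (LINT x|M. \<bar>u m x - u n x\<bar> powr q) < ((1/2)^k) powr q * (1/2)^k" for k :: nat
  proof -
    obtain N where "\<forall>m\<ge>N. \<forall>n\<ge>N. (LINT x|M. \<bar>u m x - u n x\<bar> powr q) < ((1/2)^k) powr q * (1/2)^k"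
      using Cauchy[of "((1/2)^k) powr q * (1/2)^k"] by auto
    then show ?thesis unfolding eventually_sequentially by (meson le_trans)
  qed
  from subsequence_choice[of "\<lambda>k n. \<forall>m\<ge>n. (LINT x|M. \<bar>u m x - u n x\<bar> powr q) < ((1/2)^k) powr q * (1/2)^k", OF this]
  obtain r where r: "strict_mono r"
    "\<And>k. \<forall>m\<ge>r k. (LINT x|M. \<bar>u m x - u (r k) x\<bar> powr q) < ((1/2)^k) powr q * (1/2)^k"
    by blast
  \<comment> \<open>The threshold ((1/2)^k) powr q * (1/2)^k in the choice of r leaves exactly
    (1/2)^k after Chebyshev's inequality.\<close>
  define A where "A k = {x \<in> space M. (1/2)^k \<le> \<bar>u (r (Suc k)) x - u (r k) x\<bar>}" for k
  have [measurable]: "A k \<in> sets M" for k unfolding A_def by measurable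
  have A: "emeasure M (A k) \<le> ennreal ((1/2)^k)" for k
  proof -
    have "ennreal (((1/2)^k) powr q) * emeasure M (A k) = (\<integral>\<^sup>+x. ennreal (((1/2)^k) powr q) * indicator (A k) x \<partial>M)"
      by (rule nn_integral_cmult_indicator[symmetric]) simp
    also have "\<dots> \<le> (\<integral>\<^sup>+x. ennreal (\<bar>u (r (Suc k)) x - u (r k) x\<bar> powr q) \<partial>M)"
      using q by (intro nn_integral_mono) (auto simp: indicator_def A_def intro!: ennreal_leI powr_mono2)
    also have "\<dots> = ennreal (LINT x|M. \<bar>u (r (Suc k)) x - u (r k) x\<bar> powr q)"
      by (rule nn_integral_eq_integral[OF int]) simp
    also have "\<dots> \<le> ennreal (((1/2)^k) powr q * (1/2)^k)"
      using r(2)[of k] r(1) by (intro ennreal_leI) (auto simp: strict_mono_less_eq less_imp_le)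
    also have "\<dots> = ennreal (((1/2)^k) powr q) * ennreal ((1/2)^k)" by (rule ennreal_mult'') simp
    finally show ?thesis by (subst (asm) ennreal_mult_le_mult_iff) auto
  qed
  have fin: "emeasure M (A k) < \<infinity>" for k
    using A[of k] by (simp add: order_le_less_trans)
  have A': "measure M (A k) \<le> (1/2)^k" for k
    using A[of k] fin[of k] by (simp add: emeasure_eq_ennreal_measure)
  have "summable (\<lambda>k. (1/2::real)^k)" by (rule summable_geometric) simp
  then have "summable (\<lambda>k. measure M (A k))"
    by (rule summable_comparison_test'[where N=0]) (use A' in simp)
  then have AE1: "AE x in M. \<forall>\<^sub>F k in sequentially. x \<in> space M - A k"
    using fin by (intro borel_cantelli_AE1) simp_all
  \<comment> \<open>Where the sequence diverges \<open>lim\<close> is some unspecified value, but v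
    remains measurable.\<close>
  define v where "v x = lim (\<lambda>k. u (r k) x)" for x
  have "v \<in> borel_measurable M" unfolding v_def[abs_def] by measurable
  moreover have "AE x in M. (\<lambda>k. u (r k) x) \<longlonglongrightarrow> v x"
    using AE1
  proof eventually_elim
    case (elim x)
    then have "\<forall>\<^sub>F k in sequentially. \<bar>u (r (Suc k)) x - u (r k) x\<bar> \<le> (1/2)^k"
      by eventually_elim (auto simp: A_def)
    then have "convergent (\<lambda>k. u (r k) x)" by (rule convergent_geometric_increments)
    then show ?case unfolding v_def by (simp add: convergent_LIMSEQ_iff)
  qed
  ultimately show thesis using r(1) that by blast
qed

section \<open>The critical space and its completeness\<close>

lemma powr_abs_add_le:
  assumes "0 \<le> q" shows "\<bar>x + y\<bar> powr q \<le> 2 powr q * (\<bar>x\<bar> powr q + \<bar>y :: real\<bar> powr q)"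
proof -
  have "\<bar>x + y\<bar> powr q \<le> (2 * max \<bar>x\<bar> \<bar>y\<bar>) powr q" using assms by (intro powr_mono2) auto
  also have "\<dots> = 2 powr q * (max \<bar>x\<bar> \<bar>y\<bar>) powr q" by (rule powr_mult)
  also have "\<dots> \<le> 2 powr q * (\<bar>x\<bar> powr q + \<bar>y\<bar> powr q)" by (intro mult_left_mono) (auto simp: max_def)
  finally show ?thesis .
qed

lemma integrable_powr_add:
  fixes u v :: "'a \<Rightarrow> real"
  assumes [measurable]: "u \<in> borel_measurable M" "v \<in> borel_measurable M" and "0 \<le> q"
    and "integrable M (\<lambda>x. \<bar>u x\<bar> powr q)" "integrable M (\<lambda>x. \<bar>v x\<bar> powr q)"
  shows "integrable M (\<lambda>x. \<bar>u x + v x\<bar> powr q)"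
proof (rule Bochner_Integration.integrable_bound)
  show "integrable M (\<lambda>x. 2 powr q * (\<bar>u x\<bar> powr q + \<bar>v x\<bar> powr q))" using assms by simp
  show "AE x in M. norm (\<bar>u x + v x\<bar> powr q) \<le> norm (2 powr q * (\<bar>u x\<bar> powr q + \<bar>v x\<bar> powr q))"
    using powr_abs_add_le[OF assms(3)] by (auto simp: abs_mult intro!: AE_I2)
qed measurable

text \<open>A finite Gagliardo seminorm does not exclude constants; the integrable critical power
  does. On this set the seminorm is definite up to null sets and complete, and it contains both the
  test functions and their completion.\<close>

definition critical_space :: "real \<Rightarrow> (R3 \<Rightarrow> real) set" where
  "critical_space \<alpha> = {u \<in> gagliardo_space \<alpha>. integrable lebesgue (\<lambda>x. \<bar>u x\<bar> powr sobolev_exponent \<alpha>)}"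

lemma critical_spaceD:
  assumes "u \<in> critical_space \<alpha>"
  shows "u \<in> gagliardo_space \<alpha>" "u \<in> borel_measurable lebesgue"
    "integrable lebesgue (\<lambda>x. \<bar>u x\<bar> powr sobolev_exponent \<alpha>)"
  using assms by (auto simp: critical_space_def gagliardo_space_def)

lemma critical_space_lin:
  assumes "0 < \<alpha>" "\<alpha> < 1" "u \<in> critical_space \<alpha>" "v \<in> critical_space \<alpha>"
  shows "(\<lambda>x. a * u x + b * v x) \<in> critical_space \<alpha>"
proof -
  have "(\<lambda>x. \<bar>c * w x\<bar> powr sobolev_exponent \<alpha>) = (\<lambda>x. \<bar>c\<bar> powr sobolev_exponent \<alpha> * \<bar>w x\<bar> powr sobolev_exponent \<alpha>)" for c and w :: "R3 \<Rightarrow> real"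
    by (simp add: abs_mult powr_mult)
  moreover note [measurable] = critical_spaceD(2)[OF assms(3)] critical_spaceD(2)[OF assms(4)]
  ultimately show ?thesis using assms sobolev_exponent_pos[of \<alpha>] unfolding critical_space_def
    by (auto intro!: gagliardo_space_lin integrable_powr_add)
qed

lemma critical_space_diff:
  assumes "0 < \<alpha>" "\<alpha> < 1" "u \<in> critical_space \<alpha>" "v \<in> critical_space \<alpha>"
  shows "(\<lambda>x. u x - v x) \<in> critical_space \<alpha>"
  using critical_space_lin[OF assms, of 1 "-1"] by simp

lemma critical_space_abs:
  assumes "u \<in> critical_space \<alpha>" shows "(\<lambda>x. \<bar>u x\<bar>) \<in> critical_space \<alpha>"
  using assms critical_spaceD(2)[OF assms] unfolding critical_space_def
  by (auto intro!: gagliardo_space_contraction(1)[where u=u])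

lemma test_functions_subset_critical_space:
  assumes \<alpha>: "0 < \<alpha>" "\<alpha> < 1" shows "test_functions \<subseteq> critical_space \<alpha>"
proof
  fix g assume "g \<in> test_functions"
  then obtain L B R where g: "\<And>x y. \<bar>g x - g y\<bar> \<le> L * norm (x - y)" "\<And>x. \<bar>g x\<bar> \<le> B" "\<And>x. R \<le> norm x \<Longrightarrow> g x = 0"
    using test_functions_bounds by metis
  have G: "g \<in> gagliardo_space \<alpha>" by (rule lipschitz_gagliardo_space[OF \<alpha> g])
  note [measurable] = gagliardo_spaceD(1)[OF G]
  have "integrable lebesgue (\<lambda>x. \<bar>g x\<bar> powr sobolev_exponent \<alpha>)"
    by (rule integrable_bounded_support[of _ "B powr sobolev_exponent \<alpha>" R])
       (use g sobolev_exponent_pos \<alpha> in \<open>auto intro!: powr_mono2 simp: less_imp_le\<close>)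
  then show "g \<in> critical_space \<alpha>" using G by (simp add: critical_space_def)
qed

lemma gagliardo_norm_zero_AE:
  assumes \<alpha>: "0 < \<alpha>" "\<alpha> < 1" and u: "u \<in> critical_space \<alpha>" and z: "gagliardo_norm \<alpha> u = 0"
  shows "AE x in lebesgue. u x = 0"
proof -
  define q where "q = sobolev_exponent \<alpha>"
  obtain K where K: "K > 0" "\<And>u. u \<in> gagliardo_space \<alpha> \<Longrightarrow> integrable lebesgue (\<lambda>x. \<bar>u x\<bar> powr q) \<Longrightarrow>
    (LINT x|lebesgue. \<bar>u x\<bar> powr q) \<le> K * gagliardo_norm \<alpha> u powr q"
    using fractional_sobolev_ineq[OF \<alpha>] unfolding q_def by blast
  have i: "integrable lebesgue (\<lambda>x. \<bar>u x\<bar> powr q)" and G: "u \<in> gagliardo_space \<alpha>"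
    using u by (auto simp: critical_space_def q_def)
  have "(LINT x|lebesgue. \<bar>u x\<bar> powr q) = 0"
    using K(2)[OF G i] z by (intro antisym) auto
  then have "AE x in lebesgue. \<bar>u x\<bar> powr q = 0"
    using integral_nonneg_eq_0_iff_AE[OF i] by simp
  then show ?thesis by simp
qed

definition gagliardo_Cauchy :: "real \<Rightarrow> (nat \<Rightarrow> R3 \<Rightarrow> real) \<Rightarrow> bool" where
  "gagliardo_Cauchy \<alpha> g \<longleftrightarrow> (\<forall>\<epsilon>>0. \<exists>N. \<forall>m\<ge>N. \<forall>n\<ge>N. gagliardo_norm \<alpha> (\<lambda>x. g m x - g n x) < \<epsilon>)"

text \<open>With n fixed, Fatou along r turns the Cauchy bound on g (r k) - g n into the same bound
  on v - g n, for the form as well as for the critical power. Adding back one g N then puts v into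
  the space.\<close>

lemma critical_space_limit:
  assumes \<alpha>: "0 < \<alpha>" "\<alpha> < 1" and g: "\<And>n. g n \<in> critical_space \<alpha>" and C: "gagliardo_Cauchy \<alpha> g"
    and r: "strict_mono r" and v: "v \<in> borel_measurable lebesgue"
    and lim: "AE x in lebesgue. (\<lambda>k. g (r k) x) \<longlonglongrightarrow> v x"
  shows "v \<in> critical_space \<alpha>" "(\<lambda>n. gagliardo_norm \<alpha> (\<lambda>x. g n x - v x)) \<longlonglongrightarrow> 0"
proof -
  define q where "q = sobolev_exponent \<alpha>"
  have q: "q > 0" using sobolev_exponent_pos \<alpha> by (simp add: q_def)
  obtain K where K: "K > 0" "\<And>u. u \<in> gagliardo_space \<alpha> \<Longrightarrow> integrable lebesgue (\<lambda>x. \<bar>u x\<bar> powr q) \<Longrightarrow>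
    (LINT x|lebesgue. \<bar>u x\<bar> powr q) \<le> K * gagliardo_norm \<alpha> u powr q"
    using fractional_sobolev_ineq[OF \<alpha>] unfolding q_def by blast
  have *: "\<exists>N. \<forall>n\<ge>N. (\<lambda>x. v x - g n x) \<in> critical_space \<alpha> \<and> gagliardo_norm \<alpha> (\<lambda>x. v x - g n x) \<le> e" if e: "e > 0" for e
  proof -
    obtain N where N: "\<And>m n. m \<ge> N \<Longrightarrow> n \<ge> N \<Longrightarrow> gagliardo_norm \<alpha> (\<lambda>x. g m x - g n x) < e"
      using C e unfolding gagliardo_Cauchy_def by meson
    show ?thesis
    proof (intro exI allI impI)
      fix n assume n: "N \<le> n"
      define w where "w k x = g (r k) x - g n x" for k x
      have w: "w k \<in> critical_space \<alpha>" for k unfolding w_def[abs_def] using critical_space_diff[OF \<alpha> g g] .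
      then have wg: "w k \<in> gagliardo_space \<alpha>" and wi: "integrable lebesgue (\<lambda>x. \<bar>w k x\<bar> powr q)" for k
        by (auto simp: critical_space_def q_def)
      have gm: "g k \<in> borel_measurable lebesgue" for k using g[of k] by (rule critical_spaceD)
      have we: "\<forall>\<^sub>F k in sequentially. gagliardo_norm \<alpha> (w k) \<le> e"
        using eventually_ge_at_top[of N]
      proof eventually_elim
        case (elim k)
        then have "r k \<ge> N" using seq_suble[OF r, of k] by simp
        then show ?case unfolding w_def[abs_def] using N n less_imp_le by blast
      qed
      have wl: "AE x in lebesgue. (\<lambda>k. w k x) \<longlonglongrightarrow> v x - g n x"
        using lim unfolding w_def by eventually_elim (intro tendsto_intros)
      note [measurable] = gagliardo_spaceD(1)[OF wg] gm v
      have we2: "\<forall>\<^sub>F k in sequentially. gagliardo_form \<alpha> (w k) (w k) \<le> e\<^sup>2"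
        using we by eventually_elim (simp add: power_mono flip: gagliardo_norm_sq)
      have G: "(\<lambda>x. v x - g n x) \<in> gagliardo_space \<alpha>" "gagliardo_form \<alpha> (\<lambda>x. v x - g n x) (\<lambda>x. v x - g n x) \<le> e\<^sup>2"
        by (rule gagliardo_Fatou[OF wg _ wl we2]; measurable)+
      have "integrable lebesgue (\<lambda>x. \<bar>v x - g n x\<bar> powr q)"
      proof (rule integral_Fatou_bound(1)[of "\<lambda>k x. \<bar>w k x\<bar> powr q"])
        show "AE x in lebesgue. (\<lambda>k. \<bar>w k x\<bar> powr q) \<longlonglongrightarrow> \<bar>v x - g n x\<bar> powr q"
          using wl by eventually_elim (use q in \<open>auto intro!: tendsto_powr' tendsto_rabs\<close>)
        show "\<forall>\<^sub>F k in sequentially. (LINT x|lebesgue. \<bar>w k x\<bar> powr q) \<le> K * e powr q"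
          using we
        proof eventually_elim
          case (elim k)
          then have "gagliardo_norm \<alpha> (w k) powr q \<le> e powr q" using q by (intro powr_mono2) auto
          then have "K * gagliardo_norm \<alpha> (w k) powr q \<le> K * e powr q" using K(1) by simp
          then show ?case using K(2)[OF wg wi, of k] by linarith
        qed
      qed (use wi in auto)
      then have "(\<lambda>x. v x - g n x) \<in> critical_space \<alpha>" using G by (simp add: critical_space_def q_def)
      moreover have "gagliardo_norm \<alpha> (\<lambda>x. v x - g n x) \<le> e"
        using G(2) e unfolding gagliardo_norm_def by (intro real_le_lsqrt) auto
      ultimately show "(\<lambda>x. v x - g n x) \<in> critical_space \<alpha> \<and> gagliardo_norm \<alpha> (\<lambda>x. v x - g n x) \<le> e" ..
    qed
  qed
  obtain N where "(\<lambda>x. v x - g N x) \<in> critical_space \<alpha>" using *[of 1] by auto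
  from critical_space_lin[OF \<alpha> this g[of N], of 1 1] show "v \<in> critical_space \<alpha>" by simp
  show "(\<lambda>n. gagliardo_norm \<alpha> (\<lambda>x. g n x - v x)) \<longlonglongrightarrow> 0"
  proof (rule LIMSEQ_I)
    fix e :: real assume "e > 0"
    then obtain N where "\<forall>n\<ge>N. gagliardo_norm \<alpha> (\<lambda>x. v x - g n x) \<le> e / 2" using *[of "e/2"] by auto
    then have "\<forall>n\<ge>N. norm (gagliardo_norm \<alpha> (\<lambda>x. g n x - v x) - 0) < e"
      using \<open>e > 0\<close> by (auto simp: gagliardo_norm_diff_commute[of \<alpha> _ v] intro: le_less_trans)
    then show "\<exists>N. \<forall>n\<ge>N. norm (gagliardo_norm \<alpha> (\<lambda>x. g n x - v x) - 0) < e" ..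
  qed
qed

lemma critical_space_complete:
  assumes \<alpha>: "0 < \<alpha>" "\<alpha> < 1" and g: "\<And>n. g n \<in> critical_space \<alpha>" and C: "gagliardo_Cauchy \<alpha> g"
  obtains r v where "strict_mono r" "v \<in> critical_space \<alpha>" "AE x in lebesgue. (\<lambda>k. g (r k) x) \<longlonglongrightarrow> v x"
    "(\<lambda>n. gagliardo_norm \<alpha> (\<lambda>x. g n x - v x)) \<longlonglongrightarrow> 0"
proof -
  define q where "q = sobolev_exponent \<alpha>"
  have q: "q > 0" using sobolev_exponent_pos \<alpha> by (simp add: q_def)
  obtain K where K: "K > 0" "\<And>u. u \<in> gagliardo_space \<alpha> \<Longrightarrow> integrable lebesgue (\<lambda>x. \<bar>u x\<bar> powr q) \<Longrightarrow>
    (LINT x|lebesgue. \<bar>u x\<bar> powr q) \<le> K * gagliardo_norm \<alpha> u powr q"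
    using fractional_sobolev_ineq[OF \<alpha>] unfolding q_def by blast
  have d: "(\<lambda>x. g m x - g n x) \<in> critical_space \<alpha>" for m n using critical_space_diff[OF \<alpha> g g] .
  have gm: "g n \<in> borel_measurable lebesgue" for n using g[of n] by (rule critical_spaceD)
  have int: "integrable lebesgue (\<lambda>x. \<bar>g m x - g n x\<bar> powr q)" for m n
    using d by (simp add: critical_space_def q_def)
  have "\<exists>N. \<forall>m\<ge>N. \<forall>n\<ge>N. (LINT x|lebesgue. \<bar>g m x - g n x\<bar> powr q) < e" if "e > 0" for e
  proof -
    define \<delta> where "\<delta> = (e / K) powr (1 / q)"
    have "\<delta> > 0" using that K by (simp add: \<delta>_def)
    then obtain N where N: "\<And>m n. m \<ge> N \<Longrightarrow> n \<ge> N \<Longrightarrow> gagliardo_norm \<alpha> (\<lambda>x. g m x - g n x) < \<delta>"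
      using C unfolding gagliardo_Cauchy_def by meson
    have "(LINT x|lebesgue. \<bar>g m x - g n x\<bar> powr q) < e" if "m \<ge> N" "n \<ge> N" for m n
    proof -
      have "(LINT x|lebesgue. \<bar>g m x - g n x\<bar> powr q) \<le> K * gagliardo_norm \<alpha> (\<lambda>x. g m x - g n x) powr q"
        using d int by (intro K(2)) (auto simp: critical_space_def)
      also have "\<dots> < K * \<delta> powr q" using N[OF that] K(1) q by (intro mult_strict_left_mono powr_less_mono2) auto
      also have "\<dots> = e" using \<open>e > 0\<close> K(1) q by (simp add: \<delta>_def powr_powr)
      finally show ?thesis .
    qed
    then show ?thesis by blast
  qed
  from Lq_Cauchy_AE_subseq[OF gm q int this] obtain r v where
    *: "strict_mono r" "v \<in> borel_measurable lebesgue" "AE x in lebesgue. (\<lambda>k. g (r k) x) \<longlonglongrightarrow> v x" .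
  show thesis by (rule that[OF *(1) _ *(3)]) (rule critical_space_limit[OF \<alpha> g C *])+
qed

lemma homogeneous_sobolevE:
  assumes \<alpha>: "0 < \<alpha>" "\<alpha> < 1" and v: "v \<in> homogeneous_sobolev \<alpha>"
  obtains g where "v \<in> critical_space \<alpha>" "\<And>n. g n \<in> test_functions" "(\<lambda>n. gagliardo_norm \<alpha> (\<lambda>x. g n x - v x)) \<longlonglongrightarrow> 0"
proof -
  from v obtain g where g: "\<And>n. g n \<in> test_functions" "gagliardo_Cauchy \<alpha> g"
    "AE x in lebesgue. (\<lambda>n. g n x) \<longlonglongrightarrow> v x" "v \<in> borel_measurable lebesgue"
    by (auto simp: homogeneous_sobolev_def gagliardo_Cauchy_def)
  have gc: "g n \<in> critical_space \<alpha>" for n using g(1) test_functions_subset_critical_space[OF \<alpha>] by blast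
  from critical_space_limit[OF \<alpha> gc g(2) strict_mono_id g(4)] g(1,3) show thesis by (intro that) auto
qed

text \<open>The definition asks for almost everywhere convergence, while only norm convergence is
  given. A subsequence converges almost everywhere to some w, and v - w has zero seminorm, hence is
  a null function.\<close>

lemma homogeneous_sobolevI:
  assumes \<alpha>: "0 < \<alpha>" "\<alpha> < 1" and v: "v \<in> critical_space \<alpha>" and g: "\<And>n. g n \<in> test_functions"
    and lim: "(\<lambda>n. gagliardo_norm \<alpha> (\<lambda>x. g n x - v x)) \<longlonglongrightarrow> 0"
  shows "v \<in> homogeneous_sobolev \<alpha>"
proof -
  have gc: "g n \<in> critical_space \<alpha>" for n using g test_functions_subset_critical_space[OF \<alpha>] by blast
  have dG: "(\<lambda>x. g n x - v x) \<in> gagliardo_space \<alpha>" for n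
    using critical_space_diff[OF \<alpha> gc v] by (simp add: critical_space_def)
  have dG': "(\<lambda>x. v x - g n x) \<in> gagliardo_space \<alpha>" for n
    using critical_space_diff[OF \<alpha> v gc] by (simp add: critical_space_def)
  have C: "gagliardo_Cauchy \<alpha> g"
    unfolding gagliardo_Cauchy_def
  proof (intro allI impI)
    fix e :: real assume "e > 0"
    then obtain N where N: "\<And>n. n \<ge> N \<Longrightarrow> gagliardo_norm \<alpha> (\<lambda>x. g n x - v x) < e / 2"
      using LIMSEQ_D[OF lim, of "e/2"] by auto
    have "gagliardo_norm \<alpha> (\<lambda>x. g m x - g n x) < e" if "m \<ge> N" "n \<ge> N" for m n
      using gagliardo_norm_triangle[OF dG dG', of m n] N[OF that(1)] N[OF that(2)]
      by (simp add: gagliardo_norm_diff_commute[of \<alpha> v])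
    then show "\<exists>N. \<forall>m\<ge>N. \<forall>n\<ge>N. gagliardo_norm \<alpha> (\<lambda>x. g m x - g n x) < e" by blast
  qed
  obtain r w where w: "strict_mono r" "w \<in> critical_space \<alpha>" "AE x in lebesgue. (\<lambda>k. g (r k) x) \<longlonglongrightarrow> w x"
    "(\<lambda>n. gagliardo_norm \<alpha> (\<lambda>x. g n x - w x)) \<longlonglongrightarrow> 0"
    using critical_space_complete[OF \<alpha> gc C] by blast
  have wG: "(\<lambda>x. g n x - w x) \<in> gagliardo_space \<alpha>" for n
    using critical_space_diff[OF \<alpha> gc w(2)] by (simp add: critical_space_def)
  have vw: "AE x in lebesgue. v x - w x = 0"
  proof (rule gagliardo_norm_zero_AE[OF \<alpha>])
    show "(\<lambda>x. v x - w x) \<in> critical_space \<alpha>" by (rule critical_space_diff[OF \<alpha> v w(2)])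
    have "gagliardo_norm \<alpha> (\<lambda>x. v x - w x) \<le> gagliardo_norm \<alpha> (\<lambda>x. g n x - v x) + gagliardo_norm \<alpha> (\<lambda>x. g n x - w x)" for n
      using gagliardo_norm_triangle[OF dG' wG, of n n] by (simp add: gagliardo_norm_diff_commute[of \<alpha> v])
    then have "gagliardo_norm \<alpha> (\<lambda>x. v x - w x) \<le> 0 + 0"
      by (intro LIMSEQ_le_const[OF tendsto_add[OF lim w(4)]]) auto
    then show "gagliardo_norm \<alpha> (\<lambda>x. v x - w x) = 0" by (simp add: antisym)
  qed
  have "AE x in lebesgue. (\<lambda>k. g (r k) x) \<longlonglongrightarrow> v x"
    using w(3) vw by eventually_elim simp
  moreover have "\<exists>N. \<forall>m\<ge>N. \<forall>n\<ge>N. gagliardo_norm \<alpha> (\<lambda>x. g (r m) x - g (r n) x) < e" if "e > 0" for e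
  proof -
    obtain N where N: "\<And>m n. m \<ge> N \<Longrightarrow> n \<ge> N \<Longrightarrow> gagliardo_norm \<alpha> (\<lambda>x. g m x - g n x) < e"
      using C \<open>e > 0\<close> unfolding gagliardo_Cauchy_def by meson
    have "gagliardo_norm \<alpha> (\<lambda>x. g (r m) x - g (r n) x) < e" if "m \<ge> N" "n \<ge> N" for m n
      using that seq_suble[OF w(1), of m] seq_suble[OF w(1), of n] by (intro N) auto
    then show ?thesis by blast
  qed
  ultimately show ?thesis using g v unfolding homogeneous_sobolev_def
    by (auto simp: critical_spaceD intro!: exI[of _ "\<lambda>n. g (r n)"])
qed

lemma gagliardo_space_diff:
  assumes "u \<in> gagliardo_space \<alpha>" "v \<in> gagliardo_space \<alpha>"
  shows "(\<lambda>x. u x - v x) \<in> gagliardo_space \<alpha>"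
  using gagliardo_space_lin[OF assms, of 1 "-1"] by simp

lemma gagliardo_form_diff:
  assumes "u \<in> gagliardo_space \<alpha>" "v \<in> gagliardo_space \<alpha>" "w \<in> gagliardo_space \<alpha>"
  shows "gagliardo_form \<alpha> (\<lambda>x. u x - v x) w = gagliardo_form \<alpha> u w - gagliardo_form \<alpha> v w"
  using gagliardo_form_lin[OF assms, of 1 "-1"] by simp

lemma linear_quadratic_nonneg_zero:
  fixes a b :: real
  assumes "\<And>\<tau>. 0 \<le> \<tau> * a + \<tau>\<^sup>2 * b" "0 \<le> b"
  shows "a = 0"
proof (rule ccontr)
  assume a: "a \<noteq> 0"
  \<comment> \<open>The shift by 1 covers b = 0; the value at this \<tau> is - (a / (b +
    1))^2.\<close>
  define \<tau> where "\<tau> = - a / (b + 1)"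
  have "c \<noteq> 0 \<Longrightarrow> - a / c * a + (- a / c)\<^sup>2 * (c - 1) = - (a\<^sup>2 / c\<^sup>2)" for c
    by (simp add: power2_eq_square field_simps)
  from this[of "b + 1"] have "\<tau> * a + \<tau>\<^sup>2 * b = - (a\<^sup>2 / (b + 1)\<^sup>2)"
    using \<open>0 \<le> b\<close> by (simp add: \<tau>_def)
  moreover have "a\<^sup>2 / (b + 1)\<^sup>2 > 0" using a \<open>0 \<le> b\<close> by simp
  ultimately show False using assms(1)[of \<tau>] by simp
qed

text \<open>Riesz representation of a nonnegative density. Replacing \<open>g\<close> by \<open>smooth_abs c \<circ> g\<close> does not
  increase the energy for small \<open>c\<close>, so the minimizing sequence, and hence the representative, can be
  taken nonnegative.\<close>

proposition homogeneous_sobolev_riesz: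
  assumes \<alpha>: "0 < \<alpha>" "\<alpha> < 1" and \<rho>: "\<rho> \<in> borel_measurable lebesgue" "\<And>x. 0 \<le> \<rho> x"
    and int: "\<And>v. v \<in> critical_space \<alpha> \<Longrightarrow> integrable lebesgue (\<lambda>x. \<rho> x * v x)"
    and bd: "\<And>v. v \<in> critical_space \<alpha> \<Longrightarrow> \<bar>LINT x|lebesgue. \<rho> x * v x\<bar> \<le> K * gagliardo_norm \<alpha> v"
  obtains \<phi> where "\<phi> \<in> homogeneous_sobolev \<alpha>" "AE x in lebesgue. 0 \<le> \<phi> x"
    "\<And>v. v \<in> homogeneous_sobolev \<alpha> \<Longrightarrow> gagliardo_form \<alpha> \<phi> v = (LINT x|lebesgue. \<rho> x * v x)"
proof -
  let ?T = test_functions and ?B = "gagliardo_form \<alpha>" and ?N = "gagliardo_norm \<alpha>"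
  define l where "l v = (LINT x|lebesgue. \<rho> x * v x)" for v
  define J where "J v = ?B v v / 2 - l v" for v
  have TC: "g \<in> ?T \<Longrightarrow> g \<in> critical_space \<alpha>" for g using test_functions_subset_critical_space[OF \<alpha>] by blast
  have TG: "g \<in> ?T \<Longrightarrow> g \<in> gagliardo_space \<alpha>" for g using TC critical_spaceD by blast
  have llin: "l (\<lambda>x. a * u x + b * v x) = a * l u + b * l v" if "u \<in> critical_space \<alpha>" "v \<in> critical_space \<alpha>" for a b u v
  proof -
    have "(\<lambda>x. \<rho> x * (a * u x + b * v x)) = (\<lambda>x. a * (\<rho> x * u x) + b * (\<rho> x * v x))" by (auto simp: algebra_simps)
    then show ?thesis using int[OF that(1)] int[OF that(2)] by (simp add: l_def)
  qed
  \<comment> \<open>Completing the square in the seminorm of g bounds \<open>J\<close> from below on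
    the test functions.\<close>
  have Jlow: "- (K\<^sup>2 / 2) \<le> J g" if "g \<in> ?T" for g
  proof -
    have "0 \<le> (?N g - K)\<^sup>2 / 2" by simp
    also have "\<dots> = ?B g g / 2 - K * ?N g + K\<^sup>2 / 2"
      by (simp add: power2_diff gagliardo_norm_sq[symmetric] field_simps)
    also have "\<dots> \<le> J g + K\<^sup>2 / 2" using bd[OF TC[OF that]] by (simp add: J_def l_def abs_le_iff)
    finally show ?thesis by simp
  qed
  define m where "m = (INF g\<in>?T. J g)"
  have bdd: "bdd_below (J ` ?T)" using Jlow by (intro bdd_belowI2)
  have Tne: "?T \<noteq> {}" using zero_test_function by blast
  have mle: "m \<le> J g" if "g \<in> ?T" for g unfolding m_def using bdd that by (rule cINF_lower)
  have ex: "\<exists>h. h \<in> ?T \<and> (\<forall>x. 0 \<le> h x) \<and> J h < m + 1 / real (Suc n)" for n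
  proof -
    obtain g where g: "g \<in> ?T" "J g < m + 1 / real (Suc n)"
      using cInf_lessD[of "J ` ?T" "m + 1 / real (Suc n)"] Tne by (auto simp: m_def)
    note [measurable] = critical_spaceD(2)[OF TC[OF g(1)]] \<rho>(1)
    define h where "h k x = smooth_abs (1 / real (Suc k)) (g x)" for k x
    have hT: "h k \<in> ?T" for k unfolding h_def[abs_def] by (rule test_functions_smooth_abs[OF g(1)]) simp
    note [measurable] = critical_spaceD(2)[OF TC[OF hT]]
    have "(\<lambda>k. l (h k)) \<longlonglongrightarrow> l (\<lambda>x. \<bar>g x\<bar>)"
      unfolding l_def
    proof (rule integral_dominated_convergence)
      show "integrable lebesgue (\<lambda>x. \<rho> x * \<bar>g x\<bar>)" by (intro int critical_space_abs TC g)
      show "AE x in lebesgue. (\<lambda>k. \<rho> x * h k x) \<longlonglongrightarrow> \<rho> x * \<bar>g x\<bar>"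
        unfolding h_def by (intro AE_I2 tendsto_intros smooth_abs_tendsto)
      show "AE x in lebesgue. norm (\<rho> x * h k x) \<le> \<rho> x * \<bar>g x\<bar>" for k
        unfolding h_def using \<rho>(2) smooth_abs_nonneg[of "1 / real (Suc k)"] smooth_abs_le[of "1 / real (Suc k)"]
        by (intro AE_I2) (simp add: abs_mult mult_left_mono)
    qed measurable
    then have "(\<lambda>k. ?B g g / 2 - l (h k)) \<longlonglongrightarrow> ?B g g / 2 - l (\<lambda>x. \<bar>g x\<bar>)" by (intro tendsto_intros)
    moreover have "l g \<le> l (\<lambda>x. \<bar>g x\<bar>)" unfolding l_def
      by (intro integral_mono int TC critical_space_abs g mult_left_mono \<rho>) simp
    then have "?B g g / 2 - l (\<lambda>x. \<bar>g x\<bar>) < m + 1 / real (Suc n)" using g(2) by (simp add: J_def)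
    ultimately have "\<forall>\<^sub>F k in sequentially. ?B g g / 2 - l (h k) < m + 1 / real (Suc n)"
      by (rule order_tendstoD)
    then obtain k where k: "?B g g / 2 - l (h k) < m + 1 / real (Suc n)" by (auto simp: eventually_sequentially)
    have "?B (h k) (h k) \<le> ?B g g"
      by (rule gagliardo_space_contraction(2)) (use TG[OF g(1)] in \<open>auto simp: h_def smooth_abs_lipschitz\<close>)
    then have "J (h k) < m + 1 / real (Suc n)" using k by (simp add: J_def)
    moreover have "0 \<le> h k x" for x by (simp add: h_def smooth_abs_nonneg)
    ultimately show ?thesis using hT by blast
  qed
  then obtain h where h: "\<And>n. h n \<in> ?T" "\<And>n x. 0 \<le> h n x" "\<And>n. J (h n) < m + 1 / real (Suc n)" by metis
  have hC: "h n \<in> critical_space \<alpha>" for n using TC h by blast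
  have hG: "h n \<in> gagliardo_space \<alpha>" for n using TG h by blast
  \<comment> \<open>The midpoint of two competitors is a competitor, so by the parallelogram
    identity near-minimizers are close to each other and a minimizing sequence is Cauchy.\<close>
  have par: "?B (\<lambda>x. g x - k x) (\<lambda>x. g x - k x) \<le> 4 * (J g + J k - 2 * m)" if "g \<in> ?T" "k \<in> ?T" for g k
  proof -
    have "J (\<lambda>x. (1/2) * g x + (1/2) * k x) = (1/8) * ?B g g + (1/4) * ?B g k + (1/8) * ?B k k - l g / 2 - l k / 2"
      unfolding J_def gagliardo_form_lin2[OF TG TG, OF that] llin[OF TC TC, OF that] by (simp add: power2_eq_square field_simps)
    moreover have "?B (\<lambda>x. g x - k x) (\<lambda>x. g x - k x) = ?B g g - 2 * ?B g k + ?B k k"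
      using gagliardo_form_lin2[OF TG TG, OF that, of 1 "-1"] by simp
    moreover have "m \<le> J (\<lambda>x. (1/2) * g x + (1/2) * k x)" by (intro mle test_functions_lin that)
    ultimately show ?thesis by (simp add: J_def field_simps)
  qed
  have C: "gagliardo_Cauchy \<alpha> h" unfolding gagliardo_Cauchy_def
  proof (intro allI impI)
    fix e :: real assume e: "e > 0"
    obtain N where N: "1 / real (Suc N) < e\<^sup>2 / 8" using nat_approx_posE[of "e\<^sup>2 / 8"] e by auto
    have "?N (\<lambda>x. h i x - h j x) < e" if "i \<ge> N" "j \<ge> N" for i j
    proof -
      have *: "J (h n) < m + e\<^sup>2 / 8" if "n \<ge> N" for n
      proof -
        have "1 / real (Suc n) \<le> 1 / real (Suc N)" using that by (intro divide_left_mono) auto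
        then show ?thesis using h(3)[of n] N by linarith
      qed
      have "(?N (\<lambda>x. h i x - h j x))\<^sup>2 < e\<^sup>2"
        using par[OF h(1) h(1), of i j] *[OF that(1)] *[OF that(2)] by (simp add: gagliardo_norm_sq)
      then show ?thesis using e by (simp add: power_less_imp_less_base)
    qed
    then show "\<exists>N. \<forall>i\<ge>N. \<forall>j\<ge>N. ?N (\<lambda>x. h i x - h j x) < e" by blast
  qed
  obtain r \<phi> where \<phi>: "strict_mono r" "\<phi> \<in> critical_space \<alpha>" "AE x in lebesgue. (\<lambda>k. h (r k) x) \<longlonglongrightarrow> \<phi> x"
    "(\<lambda>n. ?N (\<lambda>x. h n x - \<phi> x)) \<longlonglongrightarrow> 0"
    using critical_space_complete[OF \<alpha> hC C] by blast
  have \<phi>G: "\<phi> \<in> gagliardo_space \<alpha>" using \<phi>(2) critical_spaceD by blast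
  have \<phi>H: "\<phi> \<in> homogeneous_sobolev \<alpha>" by (rule homogeneous_sobolevI[OF \<alpha> \<phi>(2) h(1) \<phi>(4)])
  have \<phi>0: "AE x in lebesgue. 0 \<le> \<phi> x"
    using \<phi>(3) by eventually_elim (rule LIMSEQ_le_const, auto simp: h)
  have Blim: "(\<lambda>n. ?B (g n) w) \<longlonglongrightarrow> ?B u w"
    if "\<And>n. g n \<in> gagliardo_space \<alpha>" "u \<in> gagliardo_space \<alpha>" "w \<in> gagliardo_space \<alpha>" "(\<lambda>n. ?N (\<lambda>x. g n x - u x)) \<longlonglongrightarrow> 0"
    for g u w
  proof -
    have dG: "(\<lambda>x. g n x - u x) \<in> gagliardo_space \<alpha>" for n by (rule gagliardo_space_diff[OF that(1,2)])
    have "\<bar>?B (g n) w - ?B u w\<bar> \<le> ?N (\<lambda>x. g n x - u x) * ?N w" for n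
      using gagliardo_form_CS[OF dG that(3), of n] gagliardo_form_diff[OF that(1)[of n] that(2,3)] by simp
    then have "(\<lambda>n. ?B (g n) w - ?B u w) \<longlonglongrightarrow> 0"
      by (intro Lim_null_comparison[OF always_eventually tendsto_mult_left_zero[OF that(4)]]) auto
    then show ?thesis by (simp add: LIM_zero_iff)
  qed
  have eqT: "?B \<phi> w = l w" if w: "w \<in> ?T" for w
  proof -
    have "(\<lambda>n. J (h n)) \<longlonglongrightarrow> m"
    proof (rule tendsto_sandwich)
      show "\<forall>\<^sub>F n in sequentially. m \<le> J (h n)" by (intro always_eventually allI mle h)
      show "\<forall>\<^sub>F n in sequentially. J (h n) \<le> m + 1 / real (Suc n)"
        by (intro always_eventually allI less_imp_le h)
      have "(\<lambda>n. m + 1 / real (Suc n)) \<longlonglongrightarrow> m + 0" by (intro tendsto_intros LIMSEQ_Suc lim_1_over_n)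
      then show "(\<lambda>n. m + 1 / real (Suc n)) \<longlonglongrightarrow> m" by simp
    qed simp
    \<comment> \<open>The infimum is not above the value at h n + \<tau> w. Letting n tend to
      infinity gives a quadratic in \<tau> with no constant term, so its linear coefficient, the
      first variation, vanishes.\<close>
    have "0 \<le> \<tau> * (?B \<phi> w - l w) + \<tau>\<^sup>2 * (?B w w / 2)" for \<tau>
    proof -
      have eq: "J (\<lambda>x. 1 * h n x + \<tau> * w x) = J (h n) + \<tau> * (?B (h n) w - l w) + \<tau>\<^sup>2 * (?B w w / 2)" for n
        unfolding J_def gagliardo_form_lin2[OF hG TG[OF w]] llin[OF hC TC[OF w]] by (simp add: field_simps)
      have "(\<lambda>n. J (h n) + \<tau> * (?B (h n) w - l w) + \<tau>\<^sup>2 * (?B w w / 2)) \<longlonglongrightarrow> m + \<tau> * (?B \<phi> w - l w) + \<tau>\<^sup>2 * (?B w w / 2)"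
        by (intro tendsto_intros \<open>(\<lambda>n. J (h n)) \<longlonglongrightarrow> m\<close> Blim hG \<phi>G TG w \<phi>)
      then have "m \<le> m + \<tau> * (?B \<phi> w - l w) + \<tau>\<^sup>2 * (?B w w / 2)"
      proof (rule LIMSEQ_le_const, intro exI allI impI)
        fix n
        have "m \<le> J (\<lambda>x. 1 * h n x + \<tau> * w x)" by (intro mle test_functions_lin h w)
        then show "m \<le> J (h n) + \<tau> * (?B (h n) w - l w) + \<tau>\<^sup>2 * (?B w w / 2)" unfolding eq .
      qed
      then show ?thesis by simp
    qed
    then have "?B \<phi> w - l w = 0" by (rule linear_quadratic_nonneg_zero) simp
    then show ?thesis by simp
  qed
  have "?B \<phi> v = l v" if v: "v \<in> homogeneous_sobolev \<alpha>" for v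
  proof -
    obtain g where g: "v \<in> critical_space \<alpha>" "\<And>n. g n \<in> ?T" "(\<lambda>n. ?N (\<lambda>x. g n x - v x)) \<longlonglongrightarrow> 0"
      by (rule homogeneous_sobolevE[OF \<alpha> v], rule that)
    have vG: "v \<in> gagliardo_space \<alpha>" by (rule critical_spaceD(1)[OF g(1)])
    have "(\<lambda>n. ?B (g n) \<phi>) \<longlonglongrightarrow> ?B v \<phi>" by (intro Blim TG g vG \<phi>G)
    moreover have "(\<lambda>n. l (g n)) \<longlonglongrightarrow> l v"
    proof -
      have "\<bar>l (g n) - l v\<bar> \<le> ?N (\<lambda>x. g n x - v x) * K" for n
        using bd[OF critical_space_diff[OF \<alpha> TC[OF g(2)[of n]] g(1)]] llin[OF TC[OF g(2)[of n]] g(1), of 1 "-1"]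
        by (simp add: l_def mult.commute)
      then have "(\<lambda>n. l (g n) - l v) \<longlonglongrightarrow> 0"
        by (intro Lim_null_comparison[OF always_eventually tendsto_mult_left_zero[OF g(3)]]) auto
      then show ?thesis by (simp add: LIM_zero_iff)
    qed
    moreover have "?B (g n) \<phi> = l (g n)" for n using eqT[OF g(2)] by (simp add: gagliardo_form_commute)
    ultimately have "?B v \<phi> = l v" by (simp add: LIMSEQ_unique)
    then show ?thesis by (simp add: gagliardo_form_commute)
  qed
  then show thesis using that \<phi>H \<phi>0 unfolding l_def by blast
qed

lemma homogeneous_sobolev_lin:
  assumes \<alpha>: "0 < \<alpha>" "\<alpha> < 1" and u: "u \<in> homogeneous_sobolev \<alpha>" and v: "v \<in> homogeneous_sobolev \<alpha>"
  shows "(\<lambda>x. a * u x + b * v x) \<in> homogeneous_sobolev \<alpha>"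
proof -
  obtain g where g: "u \<in> critical_space \<alpha>" "\<And>n. g n \<in> test_functions" "(\<lambda>n. gagliardo_norm \<alpha> (\<lambda>x. g n x - u x)) \<longlonglongrightarrow> 0"
    by (rule homogeneous_sobolevE[OF \<alpha> u], rule that)
  obtain h where h: "v \<in> critical_space \<alpha>" "\<And>n. h n \<in> test_functions" "(\<lambda>n. gagliardo_norm \<alpha> (\<lambda>x. h n x - v x)) \<longlonglongrightarrow> 0"
    by (rule homogeneous_sobolevE[OF \<alpha> v], rule that)
  have C: "g n \<in> critical_space \<alpha>" "h n \<in> critical_space \<alpha>" for n
    using g(2) h(2) test_functions_subset_critical_space[OF \<alpha>] by auto
  have dG: "(\<lambda>x. g n x - u x) \<in> gagliardo_space \<alpha>" "(\<lambda>x. h n x - v x) \<in> gagliardo_space \<alpha>" for n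
    by (intro gagliardo_space_diff critical_spaceD(1) C g h)+
  show ?thesis
  proof (rule homogeneous_sobolevI[OF \<alpha>])
    show "(\<lambda>x. a * u x + b * v x) \<in> critical_space \<alpha>" by (intro critical_space_lin \<alpha> g h)
    show "(\<lambda>x. a * g n x + b * h n x) \<in> test_functions" for n by (intro test_functions_lin g h)
    have eq: "(a * g n x + b * h n x) - (a * u x + b * v x) = a * (g n x - u x) + b * (h n x - v x)" for n x
      by (simp add: algebra_simps)
    have le: "gagliardo_norm \<alpha> (\<lambda>x. (a * g n x + b * h n x) - (a * u x + b * v x)) \<le>
      \<bar>a\<bar> * gagliardo_norm \<alpha> (\<lambda>x. g n x - u x) + \<bar>b\<bar> * gagliardo_norm \<alpha> (\<lambda>x. h n x - v x)" for n
      unfolding eq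
      using gagliardo_norm_triangle[OF gagliardo_space_scale[OF dG(1)] gagliardo_space_scale[OF dG(2)], of a n b n]
      by (simp add: gagliardo_norm_scale)
    have "(\<lambda>n. \<bar>a\<bar> * gagliardo_norm \<alpha> (\<lambda>x. g n x - u x) + \<bar>b\<bar> * gagliardo_norm \<alpha> (\<lambda>x. h n x - v x)) \<longlonglongrightarrow> \<bar>a\<bar> * 0 + \<bar>b\<bar> * 0"
      by (intro tendsto_intros g h)
    then have z: "(\<lambda>n. \<bar>a\<bar> * gagliardo_norm \<alpha> (\<lambda>x. g n x - u x) + \<bar>b\<bar> * gagliardo_norm \<alpha> (\<lambda>x. h n x - v x)) \<longlonglongrightarrow> 0" by simp
    show "(\<lambda>n. gagliardo_norm \<alpha> (\<lambda>x. (a * g n x + b * h n x) - (a * u x + b * v x))) \<longlonglongrightarrow> 0"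
    proof (rule Lim_null_comparison[OF always_eventually z], rule allI)
      fix n show "norm (gagliardo_norm \<alpha> (\<lambda>x. (a * g n x + b * h n x) - (a * u x + b * v x))) \<le>
        \<bar>a\<bar> * gagliardo_norm \<alpha> (\<lambda>x. g n x - u x) + \<bar>b\<bar> * gagliardo_norm \<alpha> (\<lambda>x. h n x - v x)"
        unfolding real_norm_def abs_of_nonneg[OF gagliardo_norm_nonneg] by (rule le)
    qed
  qed
qed

section \<open>The energy space and the Poisson potential\<close>

text \<open>An additive substitute for the three-factor Hoelder inequality: every factor is at most
  the corresponding power of the largest of the three terms, and the exponents add up to 1.\<close>

lemma powr_Young3:
  fixes x y z :: real
  assumes "0 \<le> x" "0 \<le> y" "0 \<le> z" "0 < r" "0 < q" "2 / r + 1 / q = 1"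
  shows "x * y * z \<le> x powr r + y powr r + z powr q"
proof -
  define m where "m = max (max (x powr r) (y powr r)) (z powr q)"
  have m: "0 \<le> m" by (simp add: m_def le_max_iff_disj)
  have "x = (x powr r) powr (1 / r)" "y = (y powr r) powr (1 / r)" "z = (z powr q) powr (1 / q)"
    using assms by (simp_all add: powr_powr)
  moreover have "(x powr r) powr (1 / r) \<le> m powr (1 / r)" "(y powr r) powr (1 / r) \<le> m powr (1 / r)"
    "(z powr q) powr (1 / q) \<le> m powr (1 / q)"
    using assms by (auto simp: m_def intro!: powr_mono2)
  ultimately have "x * y * z \<le> m powr (1 / r) * m powr (1 / r) * m powr (1 / q)"
    using assms by (intro mult_mono) auto
  also have "\<dots> = m powr (1 / r + 1 / r + 1 / q)" by (simp only: powr_add)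
  also have "1 / r + 1 / r + 1 / q = 1" using assms(6) by simp
  also have "m powr 1 = m" using m by simp
  also have "m \<le> x powr r + y powr r + z powr q" by (auto simp: m_def)
  finally show ?thesis .
qed

lemma powr_le_sum_powr:
  fixes x :: real
  assumes "0 \<le> x" "a \<le> r" "r \<le> b"
  shows "x powr r \<le> x powr a + x powr b"
proof (cases "x \<le> 1")
  case True
  then have "x powr r \<le> x powr a" using assms by (intro powr_mono') auto
  then show ?thesis by (simp add: add_increasing2)
next
  case False
  then have "x powr r \<le> x powr b" using assms by (intro powr_mono) auto
  then show ?thesis by (simp add: add_increasing)
qed

locale schroedinger_space =
  fixes s :: real and V :: "R3 \<Rightarrow> real"
  assumes s: "0 < s" "s < 1" and V_cont: "continuous_on UNIV V"
    and V_pos: "\<exists>V0>0. \<forall>x. V0 \<le> V x"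
begin

abbreviation "H \<equiv> space_H s V"
abbreviation "nrm \<equiv> norm_H s V"

definition ip :: "(R3 \<Rightarrow> real) \<Rightarrow> (R3 \<Rightarrow> real) \<Rightarrow> real" where
  "ip u v = gagliardo_form s u v + (LINT x|lebesgue. V x * (u x * v x))"

lemma V_measurable [measurable]: "V \<in> borel_measurable lebesgue"
  using V_cont by (simp add: borel_measurable_continuous_onI measurable_completion)

lemma V_nonneg: "0 \<le> V x"
  using V_pos by (meson less_imp_le order_trans)

lemma space_HD:
  assumes "u \<in> H"
  shows "u \<in> borel_measurable lebesgue" "u \<in> gagliardo_space s" "u \<in> fractional_sobolev s"
    "integrable lebesgue (\<lambda>x. (u x)\<^sup>2)" "integrable lebesgue (\<lambda>x. V x * (u x)\<^sup>2)"
  using assms by (auto simp: space_H_def fractional_sobolev_def gagliardo_space_def)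

text \<open>Because V is bounded below by a positive constant, square integrability follows from
  finiteness of the potential energy.\<close>

lemma space_HI:
  assumes "u \<in> gagliardo_space s" "integrable lebesgue (\<lambda>x. V x * (u x)\<^sup>2)"
  shows "u \<in> H"
proof -
  obtain V0 where V0: "V0 > 0" "\<And>x. V0 \<le> V x" using V_pos by blast
  note [measurable] = gagliardo_spaceD(1)[OF assms(1)]
  have "integrable lebesgue (\<lambda>x. (u x)\<^sup>2)"
  proof (rule Bochner_Integration.integrable_bound)
    show "integrable lebesgue (\<lambda>x. (1 / V0) * (V x * (u x)\<^sup>2))" using assms(2) by simp
    have "(u x)\<^sup>2 \<le> (1 / V0) * (V x * (u x)\<^sup>2)" for x
      using mult_right_mono[OF V0(2)[of x], of "(u x)\<^sup>2"] V0(1) by (simp add: field_simps)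
    then show "AE x in lebesgue. norm ((u x)\<^sup>2) \<le> norm ((1 / V0) * (V x * (u x)\<^sup>2))"
      by (intro AE_I2) (simp add: V_nonneg V0(1) less_imp_le)
  qed measurable
  then show ?thesis using assms by (auto simp: space_H_def fractional_sobolev_def gagliardo_space_def)
qed

lemma space_H_dominated:
  assumes [measurable]: "w \<in> borel_measurable lebesgue" and u: "u \<in> H" and v: "v \<in> H"
    and d: "\<And>x y. (w x - w y)\<^sup>2 \<le> (u x - u y)\<^sup>2 + (v x - v y)\<^sup>2" and b: "\<And>x. (w x)\<^sup>2 \<le> (u x)\<^sup>2 + (v x)\<^sup>2"
  shows "w \<in> H"
proof (rule space_HI)
  show "w \<in> gagliardo_space s"
    by (rule gagliardo_space_dominated(1)[OF assms(1) space_HD(2)[OF u] space_HD(2)[OF v] d])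
  show "integrable lebesgue (\<lambda>x. V x * (w x)\<^sup>2)"
  proof (rule Bochner_Integration.integrable_bound)
    show "integrable lebesgue (\<lambda>x. V x * (u x)\<^sup>2 + V x * (v x)\<^sup>2)" using space_HD(5) u v by simp
    show "AE x in lebesgue. norm (V x * (w x)\<^sup>2) \<le> norm (V x * (u x)\<^sup>2 + V x * (v x)\<^sup>2)"
      using mult_left_mono[OF b V_nonneg] by (intro AE_I2) (simp add: V_nonneg distrib_left)
  qed measurable
qed

lemma zero_in_H: "(\<lambda>x. 0) \<in> H" by (rule space_HI) simp_all

lemma space_H_contraction:
  assumes "w \<in> borel_measurable lebesgue" and u: "u \<in> H"
    and d: "\<And>x y. \<bar>w x - w y\<bar> \<le> \<bar>u x - u y\<bar>" and b: "\<And>x. \<bar>w x\<bar> \<le> \<bar>u x\<bar>"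
  shows "w \<in> H"
proof (rule space_H_dominated[OF assms(1) u zero_in_H])
  show "(w x - w y)\<^sup>2 \<le> (u x - u y)\<^sup>2 + (0 - 0)\<^sup>2" for x y using d[of x y] by (simp add: abs_le_square_iff)
  show "(w x)\<^sup>2 \<le> (u x)\<^sup>2 + 0\<^sup>2" for x using b[of x] by (simp add: abs_le_square_iff)
qed

lemma integrable_V_mult:
  assumes u: "u \<in> H" and v: "v \<in> H"
  shows "integrable lebesgue (\<lambda>x. V x * (u x * v x))"
proof -
  note [measurable] = space_HD(1)[OF u] space_HD(1)[OF v]
  have "(sqrt (V x) * w x)\<^sup>2 = V x * (w x)\<^sup>2" for w :: "R3 \<Rightarrow> real" and x
    by (simp add: power_mult_distrib V_nonneg)
  then have "integrable lebesgue (\<lambda>x. (sqrt (V x) * u x) * (sqrt (V x) * v x))"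
    using space_HD(5)[OF u] space_HD(5)[OF v] by (intro integrable_mult_of_sq; (measurable)?; simp)
  moreover have "(sqrt (V x) * u x) * (sqrt (V x) * v x) = V x * (u x * v x)" for x
  proof -
    have "(sqrt (V x) * u x) * (sqrt (V x) * v x) = (sqrt (V x) * sqrt (V x)) * (u x * v x)" by (simp only: mult_ac)
    then show ?thesis using V_nonneg[of x] by simp
  qed
  ultimately show ?thesis by simp
qed

lemma ip_commute: "ip u v = ip v u"
  by (simp add: ip_def gagliardo_form_commute mult_ac)

lemma nrm_nonneg [simp]: "0 \<le> nrm u"
  by (simp add: norm_H_def V_nonneg)

lemma nrm_sq: "(nrm u)\<^sup>2 = ip u u"
  by (simp add: norm_H_def ip_def V_nonneg gagliardo_norm_sq flip: power2_eq_square)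

lemma space_H_lin:
  assumes u: "u \<in> H" and v: "v \<in> H"
  shows "(\<lambda>x. a * u x + b * v x) \<in> H"
proof (rule space_HI)
  show "(\<lambda>x. a * u x + b * v x) \<in> gagliardo_space s" using gagliardo_space_lin space_HD(2) u v by blast
  have "(\<lambda>x. V x * (a * u x + b * v x)\<^sup>2) = (\<lambda>x. a\<^sup>2 * (V x * (u x)\<^sup>2) + 2 * a * b * (V x * (u x * v x)) + b\<^sup>2 * (V x * (v x)\<^sup>2))"
    by (auto simp: power2_eq_square algebra_simps)
  then show "integrable lebesgue (\<lambda>x. V x * (a * u x + b * v x)\<^sup>2)"
    using space_HD(5)[OF u] space_HD(5)[OF v] integrable_V_mult[OF u v] by simp
qed

lemma space_H_scale: "u \<in> H \<Longrightarrow> (\<lambda>x. c * u x) \<in> H"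
  using space_H_lin[of u u c 0] by simp

lemma space_H_add: "u \<in> H \<Longrightarrow> v \<in> H \<Longrightarrow> (\<lambda>x. u x + v x) \<in> H"
  using space_H_lin[of u v 1 1] by simp

lemma space_H_diff: "u \<in> H \<Longrightarrow> v \<in> H \<Longrightarrow> (\<lambda>x. u x - v x) \<in> H"
  using space_H_lin[of u v 1 "-1"] by simp

lemma ip_lin:
  assumes "u \<in> H" "v \<in> H" "w \<in> H"
  shows "ip (\<lambda>x. a * u x + b * v x) w = a * ip u w + b * ip v w"
proof -
  have "(\<lambda>x. V x * ((a * u x + b * v x) * w x)) = (\<lambda>x. a * (V x * (u x * w x)) + b * (V x * (v x * w x)))"
    by (auto simp: algebra_simps)
  then show ?thesis
    using assms integrable_V_mult[OF assms(1,3)] integrable_V_mult[OF assms(2,3)]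
    by (simp add: ip_def gagliardo_form_lin space_HD algebra_simps)
qed

lemma ip_lin2:
  assumes "u \<in> H" "v \<in> H"
  shows "ip (\<lambda>x. a * u x + b * v x) (\<lambda>x. a * u x + b * v x) = a\<^sup>2 * ip u u + 2 * a * b * ip u v + b\<^sup>2 * ip v v"
  unfolding ip_lin[OF assms space_H_lin[OF assms]]
  unfolding ip_commute[of u "\<lambda>x. a * u x + b * v x"] ip_commute[of v "\<lambda>x. a * u x + b * v x"]
    ip_lin[OF assms assms(1)] ip_lin[OF assms assms(2)] ip_commute[of v u]
  by (simp add: power2_eq_square algebra_simps)

lemma ip_nonneg [simp]: "0 \<le> ip u u" by (simp flip: nrm_sq)

lemma nrm_eq: "nrm u = sqrt (ip u u)" by (simp flip: nrm_sq)

lemma ip_CS: "u \<in> H \<Longrightarrow> v \<in> H \<Longrightarrow> \<bar>ip u v\<bar> \<le> nrm u * nrm v"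
  unfolding nrm_eq by (rule psd_form_bound) (simp_all flip: ip_lin2)

lemma nrm_add_sq: "u \<in> H \<Longrightarrow> v \<in> H \<Longrightarrow> (nrm (\<lambda>x. u x + v x))\<^sup>2 = (nrm u)\<^sup>2 + 2 * ip u v + (nrm v)\<^sup>2"
  using ip_lin2[of u v 1 1] by (simp add: nrm_sq)

lemma nrm_triangle: "u \<in> H \<Longrightarrow> v \<in> H \<Longrightarrow> nrm (\<lambda>x. u x + v x) \<le> nrm u + nrm v"
  by (rule power2_le_imp_le) (use nrm_add_sq[of u v] ip_CS[of u v] in \<open>auto simp: power2_sum\<close>)

lemma ip_scale2: "ip (\<lambda>x. c * u x) (\<lambda>x. c * u x) = c\<^sup>2 * ip u u"
proof -
  have "(gagliardo_norm s (\<lambda>x. c * u x))\<^sup>2 = c\<^sup>2 * (gagliardo_norm s u)\<^sup>2"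
    by (simp add: gagliardo_norm_scale power_mult_distrib)
  moreover have "(LINT x|lebesgue. V x * (c * u x * (c * u x))) = c\<^sup>2 * (LINT x|lebesgue. V x * (u x * u x))"
    by (simp add: power2_eq_square mult_ac flip: integral_mult_right_zero)
  ultimately show ?thesis by (simp add: ip_def gagliardo_norm_sq distrib_left)
qed

lemma nrm_scale: "nrm (\<lambda>x. c * u x) = \<bar>c\<bar> * nrm u"
  by (simp add: nrm_eq ip_scale2 real_sqrt_mult)

lemma gagliardo_le_nrm: "gagliardo_norm s u \<le> nrm u"
  unfolding norm_H_def by (rule real_le_rsqrt) (simp add: V_nonneg)

lemma H_L2_bound:
  obtains C where "C > 0" "\<And>u. u \<in> H \<Longrightarrow> (LINT x|lebesgue. (u x)\<^sup>2) \<le> C * (nrm u)\<^sup>2"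
proof -
  obtain V0 where V0: "V0 > 0" "\<And>x. V0 \<le> V x" using V_pos by blast
  show thesis
  proof (rule that[of "1 / V0"])
    fix u assume u: "u \<in> H"
    have "(LINT x|lebesgue. (u x)\<^sup>2) \<le> (LINT x|lebesgue. (1 / V0) * (V x * (u x)\<^sup>2))"
    proof (rule integral_mono)
      show "(u x)\<^sup>2 \<le> (1 / V0) * (V x * (u x)\<^sup>2)" for x
        using mult_right_mono[OF V0(2)[of x], of "(u x)\<^sup>2"] V0(1) by (simp add: field_simps)
    qed (use space_HD[OF u] in auto)
    also have "\<dots> = (1 / V0) * (LINT x|lebesgue. V x * (u x)\<^sup>2)" by (rule integral_mult_right_zero)
    also have "\<dots> \<le> 1 / V0 * (nrm u)\<^sup>2"
      unfolding nrm_sq ip_def using V0(1) by (intro mult_left_mono) (simp_all add: power2_eq_square)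
    finally show "(LINT x|lebesgue. (u x)\<^sup>2) \<le> 1 / V0 * (nrm u)\<^sup>2" .
  qed (use V0 in simp)
qed

lemma nrm_zero_AE:
  assumes u: "u \<in> H" shows "nrm u = 0 \<longleftrightarrow> (AE x in lebesgue. u x = 0)"
proof
  obtain C where C: "C > 0" "\<And>u. u \<in> H \<Longrightarrow> (LINT x|lebesgue. (u x)\<^sup>2) \<le> C * (nrm u)\<^sup>2" by (rule H_L2_bound, rule that)
  assume "nrm u = 0"
  then have "(LINT x|lebesgue. (u x)\<^sup>2) = 0" using C(2)[OF u] by (intro antisym) auto
  then show "AE x in lebesgue. u x = 0"
    using integral_nonneg_eq_0_iff_AE[OF space_HD(4)[OF u]] by simp
next
  assume z: "AE x in lebesgue. u x = 0"
  note [measurable] = space_HD(1)[OF u]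
  have "gagliardo_form s u u = 0"
    unfolding gagliardo_form_def
  proof (rule integral_eq_zero_AE)
    show "AE z in LL. gagliardo_kernel s u u z = 0"
      using AE_fst_LL[OF z] AE_snd_LL[OF z] by eventually_elim (simp add: gagliardo_kernel_diag)
  qed
  moreover have "(LINT x|lebesgue. V x * (u x * u x)) = 0"
    by (rule integral_eq_zero_AE) (use z in eventually_elim, simp)
  ultimately show "nrm u = 0" by (simp add: nrm_eq ip_def)
qed

text \<open>On the unit ball the r-th power is dominated by the square plus the critical power, both
  already controlled; homogeneity extends the bound to the whole space.\<close>

lemma H_embedding:
  assumes r: "2 \<le> r" "r \<le> sobolev_exponent s"
  obtains C where "C > 0" "\<And>u. u \<in> H \<Longrightarrow> integrable lebesgue (\<lambda>x. \<bar>u x\<bar> powr r)"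
    "\<And>u. u \<in> H \<Longrightarrow> (LINT x|lebesgue. \<bar>u x\<bar> powr r) \<le> C * nrm u powr r"
proof -
  define q where "q = sobolev_exponent s"
  obtain C1 where C1: "C1 > 0" "\<And>u. u \<in> H \<Longrightarrow> (LINT x|lebesgue. (u x)\<^sup>2) \<le> C1 * (nrm u)\<^sup>2" by (rule H_L2_bound, rule that)
  obtain C2 where C2: "C2 > 0" "\<And>u. u \<in> fractional_sobolev s \<Longrightarrow> integrable lebesgue (\<lambda>x. \<bar>u x\<bar> powr q)"
    "\<And>u. u \<in> fractional_sobolev s \<Longrightarrow> (LINT x|lebesgue. \<bar>u x\<bar> powr q) \<le> C2 * gagliardo_norm s u powr q"
    using fractional_sobolev_embedding[OF s] unfolding q_def by blast
  have le: "\<bar>u x\<bar> powr r \<le> (u x)\<^sup>2 + \<bar>u x\<bar> powr q" for u :: "R3 \<Rightarrow> real" and x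
    using powr_le_sum_powr[of "\<bar>u x\<bar>" 2 r q] r by (simp add: q_def)
  have int: "integrable lebesgue (\<lambda>x. \<bar>u x\<bar> powr r)" if u: "u \<in> H" for u
  proof (rule Bochner_Integration.integrable_bound)
    show "integrable lebesgue (\<lambda>x. (u x)\<^sup>2 + \<bar>u x\<bar> powr q)" using space_HD[OF u] C2 by simp
    note [measurable] = space_HD(1)[OF u]
    show "(\<lambda>x. \<bar>u x\<bar> powr r) \<in> borel_measurable lebesgue" by measurable
    show "AE x in lebesgue. norm (\<bar>u x\<bar> powr r) \<le> norm ((u x)\<^sup>2 + \<bar>u x\<bar> powr q)"
      using le by (intro AE_I2) simp
  qed
  have unit: "(LINT x|lebesgue. \<bar>u x\<bar> powr r) \<le> C1 + C2" if u: "u \<in> H" "nrm u \<le> 1" for u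
  proof -
    have "(LINT x|lebesgue. \<bar>u x\<bar> powr r) \<le> (LINT x|lebesgue. (u x)\<^sup>2 + \<bar>u x\<bar> powr q)"
      by (rule integral_mono) (use int[OF u(1)] le space_HD[OF u(1)] C2 in auto)
    also have "\<dots> = (LINT x|lebesgue. (u x)\<^sup>2) + (LINT x|lebesgue. \<bar>u x\<bar> powr q)"
      using space_HD[OF u(1)] C2 by simp
    also have "\<dots> \<le> C1 * (nrm u)\<^sup>2 + C2 * gagliardo_norm s u powr q"
      by (intro add_mono C1 C2 space_HD u)
    also have "\<dots> \<le> C1 * 1 + C2 * 1"
    proof (intro add_mono mult_left_mono)
      show "(nrm u)\<^sup>2 \<le> 1" using u(2) by (simp add: power_le_one)
      have "gagliardo_norm s u powr q \<le> 1 powr q"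
        using u(2) gagliardo_le_nrm[of u] r by (intro powr_mono2) (auto simp: q_def)
      then show "gagliardo_norm s u powr q \<le> 1" by simp
    qed (use C1 C2 in auto)
    finally show ?thesis by simp
  qed
  show thesis
  proof (rule that[of "C1 + C2"])
    fix u assume u: "u \<in> H"
    show "(LINT x|lebesgue. \<bar>u x\<bar> powr r) \<le> (C1 + C2) * nrm u powr r"
    proof (cases "nrm u = 0")
      case True
      then have "AE x in lebesgue. \<bar>u x\<bar> powr r = 0" using nrm_zero_AE[OF u] by auto
      then have "(LINT x|lebesgue. \<bar>u x\<bar> powr r) = 0" by (rule integral_eq_zero_AE)
      then show ?thesis using True C1 C2 by simp
    next
      case False
      then have N: "nrm u > 0" using nrm_nonneg[of u] by linarith
      define v where "v x = (1 / nrm u) * u x" for x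
      have v: "v \<in> H" "nrm v \<le> 1" unfolding v_def[abs_def] by (rule space_H_scale[OF u]) (simp only: nrm_scale, use N in simp)
      have "(LINT x|lebesgue. \<bar>u x\<bar> powr r) = (LINT x|lebesgue. nrm u powr r * \<bar>v x\<bar> powr r)"
        using N by (simp add: v_def abs_mult powr_mult powr_divide)
      also have "\<dots> = nrm u powr r * (LINT x|lebesgue. \<bar>v x\<bar> powr r)" by simp
      also have "\<dots> \<le> nrm u powr r * (C1 + C2)" by (intro mult_left_mono unit v) simp
      finally show ?thesis by (simp add: mult.commute)
    qed
  qed (use C1 C2 int in auto)
qed

end

locale schroedinger_poisson_space = schroedinger_space s V for s V +
  fixes t :: real
  assumes t: "0 < t" "t < 1" and st: "4 * s + 2 * t > 3"
begin

text \<open>The exponent 12 / (3 + 2 t) is forced by the duality relation with two factors from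
  \<open>H\<close> and one from the potential space. It does not exceed the critical exponent of s
  precisely when 4 s + 2 t \<ge> 3.\<close>

lemma trilinear_exponent: "2 \<le> 12 / (3 + 2 * t)" "12 / (3 + 2 * t) \<le> sobolev_exponent s"
    "2 / (12 / (3 + 2 * t)) + 1 / sobolev_exponent t = 1"
  using s t st by (simp_all add: sobolev_exponent_def field_simps)

text \<open>This estimate supplies the continuity of v \<mapsto> \<integral> u^2 v that the Riesz
  representation needs, and all later bounds on the Poisson term.\<close>

lemma trilinear_bound:
  obtains K where "K > 0"
    "\<And>a b v. a \<in> H \<Longrightarrow> b \<in> H \<Longrightarrow> v \<in> critical_space t \<Longrightarrow> integrable lebesgue (\<lambda>x. a x * b x * v x)"
    "\<And>a b v. a \<in> H \<Longrightarrow> b \<in> H \<Longrightarrow> v \<in> critical_space t \<Longrightarrow>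
       (LINT x|lebesgue. \<bar>a x * b x * v x\<bar>) \<le> K * nrm a * nrm b * gagliardo_norm t v"
proof -
  define r where "r = 12 / (3 + 2 * t)"
  define q where "q = sobolev_exponent t"
  have r: "2 \<le> r" "r \<le> sobolev_exponent s" "2 / r + 1 / q = 1" using trilinear_exponent by (auto simp: r_def q_def)
  have q: "q > 0" using sobolev_exponent_pos t by (simp add: q_def)
  obtain C where C: "C > 0" "\<And>u. u \<in> H \<Longrightarrow> integrable lebesgue (\<lambda>x. \<bar>u x\<bar> powr r)"
    "\<And>u. u \<in> H \<Longrightarrow> (LINT x|lebesgue. \<bar>u x\<bar> powr r) \<le> C * nrm u powr r" using H_embedding[OF r(1,2)] by blast
  obtain C' where C': "C' > 0" "\<And>u. u \<in> gagliardo_space t \<Longrightarrow> integrable lebesgue (\<lambda>x. \<bar>u x\<bar> powr q) \<Longrightarrow>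
    (LINT x|lebesgue. \<bar>u x\<bar> powr q) \<le> C' * gagliardo_norm t u powr q"
    using fractional_sobolev_ineq[OF t] unfolding q_def by blast
  have le: "\<bar>a x * b x * v x\<bar> \<le> \<bar>a x\<bar> powr r + \<bar>b x\<bar> powr r + \<bar>v x\<bar> powr q" for a b v :: "R3 \<Rightarrow> real" and x
    using powr_Young3[of "\<bar>a x\<bar>" "\<bar>b x\<bar>" "\<bar>v x\<bar>" r q] r q by (simp add: abs_mult)
  have i3: "integrable lebesgue (\<lambda>x. \<bar>a x\<bar> powr r + \<bar>b x\<bar> powr r + \<bar>v x\<bar> powr q)"
    if "a \<in> H" "b \<in> H" "v \<in> critical_space t" for a b v
    using C(2) critical_spaceD(3) that by (simp add: q_def)
  have int: "integrable lebesgue (\<lambda>x. a x * b x * v x)"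
    if "a \<in> H" "b \<in> H" "v \<in> critical_space t" for a b v
  proof (rule Bochner_Integration.integrable_bound[OF i3[OF that]])
    note [measurable] = space_HD(1)[OF that(1)] space_HD(1)[OF that(2)] critical_spaceD(2)[OF that(3)]
    show "(\<lambda>x. a x * b x * v x) \<in> borel_measurable lebesgue" by measurable
    show "AE x in lebesgue. norm (a x * b x * v x) \<le> norm (\<bar>a x\<bar> powr r + \<bar>b x\<bar> powr r + \<bar>v x\<bar> powr q)"
      unfolding real_norm_def by (intro AE_I2 order_trans[OF le abs_ge_self])
  qed
  define K where "K = 2 * C + C'"
  have unit: "(LINT x|lebesgue. \<bar>a x * b x * v x\<bar>) \<le> K"
    if abv: "a \<in> H" "b \<in> H" "v \<in> critical_space t" and n: "nrm a = 1" "nrm b = 1" "gagliardo_norm t v = 1" for a b v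
  proof -
    have "(LINT x|lebesgue. \<bar>a x * b x * v x\<bar>) \<le> (LINT x|lebesgue. \<bar>a x\<bar> powr r + \<bar>b x\<bar> powr r + \<bar>v x\<bar> powr q)"
      by (rule integral_mono) (use int[OF abv] i3[OF abv] le in auto)
    also have "\<dots> = (LINT x|lebesgue. \<bar>a x\<bar> powr r) + (LINT x|lebesgue. \<bar>b x\<bar> powr r) + (LINT x|lebesgue. \<bar>v x\<bar> powr q)"
      using C(2) critical_spaceD(3) abv by (simp add: q_def)
    also have "\<dots> \<le> C * nrm a powr r + C * nrm b powr r + C' * gagliardo_norm t v powr q"
      using critical_spaceD[OF abv(3)] by (intro add_mono C abv C') (auto simp: q_def)
    finally show ?thesis by (simp add: n K_def)
  qed
  have "(LINT x|lebesgue. \<bar>a x * b x * v x\<bar>) \<le> K * nrm a * nrm b * gagliardo_norm t v"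
    if abv: "a \<in> H" "b \<in> H" "v \<in> critical_space t" for a b v
  proof (cases "nrm a = 0 \<or> nrm b = 0 \<or> gagliardo_norm t v = 0")
    case True
    then have "(AE x in lebesgue. a x = 0) \<or> (AE x in lebesgue. b x = 0) \<or> (AE x in lebesgue. v x = 0)"
      using nrm_zero_AE[OF abv(1)] nrm_zero_AE[OF abv(2)] gagliardo_norm_zero_AE[OF t abv(3)] by auto
    then have "AE x in lebesgue. \<bar>a x * b x * v x\<bar> = 0" by (auto elim!: eventually_mono)
    then have "(LINT x|lebesgue. \<bar>a x * b x * v x\<bar>) = 0" by (rule integral_eq_zero_AE)
    then show ?thesis using True by auto
  next
    case False
    define A B N where "A = nrm a" and "B = nrm b" and "N = gagliardo_norm t v"
    have pos: "A > 0" "B > 0" "N > 0"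
      using False nrm_nonneg[of a] nrm_nonneg[of b] gagliardo_norm_nonneg[of t v]
      by (simp_all add: A_def B_def N_def less_le del: nrm_nonneg gagliardo_norm_nonneg)
    define a' b' v' where "a' x = (1 / A) * a x" and "b' x = (1 / B) * b x" and "v' x = (1 / N) * v x" for x
    have "(LINT x|lebesgue. \<bar>a' x * b' x * v' x\<bar>) \<le> K"
    proof (rule unit)
      show "a' \<in> H" "b' \<in> H" unfolding a'_def[abs_def] b'_def[abs_def] by (intro space_H_scale abv)+
      show "v' \<in> critical_space t" using critical_space_lin[OF t abv(3,3), of "1/N" 0] by (simp add: v'_def[abs_def])
      show "nrm a' = 1" "nrm b' = 1" "gagliardo_norm t v' = 1"
        unfolding a'_def[abs_def] b'_def[abs_def] v'_def[abs_def] nrm_scale gagliardo_norm_scale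
        using pos by (simp_all add: A_def B_def N_def)
    qed
    moreover have "\<bar>a x * b x * v x\<bar> = (A * B * N) * \<bar>a' x * b' x * v' x\<bar>" for x
      using pos by (simp add: a'_def b'_def v'_def abs_mult)
    ultimately show ?thesis using pos by (simp add: A_def[symmetric] B_def[symmetric] N_def[symmetric] mult_ac)
  qed
  then show thesis using int C C' by (intro that[of K]) (auto simp: K_def)
qed

text \<open>One constant is fixed once and for all, so that later bounds can name it.\<close>

definition trilinear_const :: real where
  "trilinear_const = (SOME K. K > 0 \<and> (\<forall>a\<in>H. \<forall>b\<in>H. \<forall>v\<in>critical_space t.
     integrable lebesgue (\<lambda>x. a x * b x * v x) \<and>
     (LINT x|lebesgue. \<bar>a x * b x * v x\<bar>) \<le> K * nrm a * nrm b * gagliardo_norm t v))"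

abbreviation "KT \<equiv> trilinear_const"

lemma trilinear:
  shows KT_pos: "KT > 0"
    and trilinear_integrable: "a \<in> H \<Longrightarrow> b \<in> H \<Longrightarrow> v \<in> critical_space t \<Longrightarrow> integrable lebesgue (\<lambda>x. a x * b x * v x)"
    and trilinear_le_abs: "a \<in> H \<Longrightarrow> b \<in> H \<Longrightarrow> v \<in> critical_space t \<Longrightarrow>
       (LINT x|lebesgue. \<bar>a x * b x * v x\<bar>) \<le> KT * nrm a * nrm b * gagliardo_norm t v"
proof -
  have "\<exists>K. K > 0 \<and> (\<forall>a\<in>H. \<forall>b\<in>H. \<forall>v\<in>critical_space t.
     integrable lebesgue (\<lambda>x. a x * b x * v x) \<and>
     (LINT x|lebesgue. \<bar>a x * b x * v x\<bar>) \<le> K * nrm a * nrm b * gagliardo_norm t v)"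
  proof -
    obtain K where "K > 0"
      "\<And>a b v. a \<in> H \<Longrightarrow> b \<in> H \<Longrightarrow> v \<in> critical_space t \<Longrightarrow> integrable lebesgue (\<lambda>x. a x * b x * v x)"
      "\<And>a b v. a \<in> H \<Longrightarrow> b \<in> H \<Longrightarrow> v \<in> critical_space t \<Longrightarrow>
         (LINT x|lebesgue. \<bar>a x * b x * v x\<bar>) \<le> K * nrm a * nrm b * gagliardo_norm t v"
      by (rule trilinear_bound, rule that)
    then show ?thesis by (intro exI[of _ K] conjI ballI)
  qed
  from someI_ex[OF this, folded trilinear_const_def]
  have K: "KT > 0" "\<forall>a\<in>H. \<forall>b\<in>H. \<forall>v\<in>critical_space t.
     integrable lebesgue (\<lambda>x. a x * b x * v x) \<and>
     (LINT x|lebesgue. \<bar>a x * b x * v x\<bar>) \<le> KT * nrm a * nrm b * gagliardo_norm t v" by (rule conjunct1, rule conjunct2)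
  show "KT > 0" by (rule K)
  assume abv: "a \<in> H" "b \<in> H" "v \<in> critical_space t"
  note K' = bspec[OF bspec[OF bspec[OF K(2) abv(1)] abv(2)] abv(3)]
  show "integrable lebesgue (\<lambda>x. a x * b x * v x)" using K' by (rule conjunct1)
  show "(LINT x|lebesgue. \<bar>a x * b x * v x\<bar>) \<le> KT * nrm a * nrm b * gagliardo_norm t v" using K' by (rule conjunct2)
qed

lemma trilinear_le:
  assumes "a \<in> H" "b \<in> H" "v \<in> critical_space t"
  shows "\<bar>LINT x|lebesgue. a x * b x * v x\<bar> \<le> KT * nrm a * nrm b * gagliardo_norm t v"
  using integral_abs_bound[of lebesgue "\<lambda>x. a x * b x * v x"] trilinear_le_abs[OF assms] by linarith

text \<open>\<open>phi\<close> is an unspecified solution, whereas nonnegativity is known for the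
  one obtained by minimization. Any two solutions differ by an element whose form with itself is 0,
  so the sign is inherited almost everywhere.\<close>

lemma phi_properties:
  assumes u: "u \<in> H"
  shows phi_homogeneous: "phi t u \<in> homogeneous_sobolev t"
    and phi_form: "\<And>v. v \<in> homogeneous_sobolev t \<Longrightarrow> gagliardo_form t (phi t u) v = (LINT x|lebesgue. (u x)\<^sup>2 * v x)"
    and phi_nonneg: "AE x in lebesgue. 0 \<le> phi t u x"
proof -
  note [measurable] = space_HD(1)[OF u]
  obtain \<phi> where \<phi>: "\<phi> \<in> homogeneous_sobolev t" "AE x in lebesgue. 0 \<le> \<phi> x"
    "\<And>v. v \<in> homogeneous_sobolev t \<Longrightarrow> gagliardo_form t \<phi> v = (LINT x|lebesgue. (u x)\<^sup>2 * v x)"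
  proof (rule homogeneous_sobolev_riesz[OF t, of "\<lambda>x. (u x)\<^sup>2" "KT * nrm u * nrm u"])
    fix v assume "v \<in> critical_space t"
    then show "integrable lebesgue (\<lambda>x. (u x)\<^sup>2 * v x)"
      "\<bar>LINT x|lebesgue. (u x)\<^sup>2 * v x\<bar> \<le> KT * nrm u * nrm u * gagliardo_norm t v"
      using trilinear_integrable[OF u u] trilinear_le[OF u u] by (simp_all add: power2_eq_square)
  qed auto
  let ?P = "\<lambda>\<phi>. \<phi> \<in> homogeneous_sobolev t \<and> (\<forall>v \<in> homogeneous_sobolev t.
        gagliardo_form t \<phi> v = (LINT x|lebesgue. (u x)\<^sup>2 * v x))"
  have "?P (phi t u)" unfolding phi_def by (rule someI[of ?P \<phi>]) (use \<phi> in blast)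
  then show hom: "phi t u \<in> homogeneous_sobolev t" and form: "\<And>v. v \<in> homogeneous_sobolev t \<Longrightarrow> gagliardo_form t (phi t u) v = (LINT x|lebesgue. (u x)\<^sup>2 * v x)"
    by blast+
  define d where "d x = phi t u x - \<phi> x" for x
  have c: "phi t u \<in> critical_space t" "\<phi> \<in> critical_space t"
    using homogeneous_sobolevE[OF t] hom \<phi>(1) by metis+
  have dh: "d \<in> homogeneous_sobolev t" using homogeneous_sobolev_lin[OF t hom \<phi>(1), of 1 "-1"] by (simp add: d_def[abs_def])
  have dc: "d \<in> critical_space t" unfolding d_def[abs_def] by (rule critical_space_diff[OF t c])
  have "gagliardo_form t d d = 0"
    using gagliardo_form_diff[OF critical_spaceD(1)[OF c(1)] critical_spaceD(1)[OF c(2)] critical_spaceD(1)[OF dc]]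
      form[OF dh] \<phi>(3)[OF dh] by (simp add: d_def[abs_def])
  then have "gagliardo_norm t d = 0" by (simp add: gagliardo_norm_def)
  then have "AE x in lebesgue. d x = 0" by (rule gagliardo_norm_zero_AE[OF t dc])
  then show "AE x in lebesgue. 0 \<le> phi t u x" using \<phi>(2) by eventually_elim (simp add: d_def)
qed

lemma phi_critical: "u \<in> H \<Longrightarrow> phi t u \<in> critical_space t"
  using homogeneous_sobolevE[OF t phi_homogeneous] by metis

lemma phi_gagliardo: "u \<in> H \<Longrightarrow> phi t u \<in> gagliardo_space t"
  using phi_critical critical_spaceD(1) by blast

definition inter :: "(R3 \<Rightarrow> real) \<Rightarrow> (R3 \<Rightarrow> real) \<Rightarrow> real" where
  "inter u w = (LINT x|lebesgue. phi t u x * (w x)\<^sup>2)"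

text \<open>The weak equation of \<open>phi t w\<close> tested with \<open>phi t u\<close>. Symmetry
  of the interaction is then symmetry of the form.\<close>

lemma inter_form: "u \<in> H \<Longrightarrow> w \<in> H \<Longrightarrow> inter u w = gagliardo_form t (phi t u) (phi t w)"
  using phi_form[of w "phi t u"] phi_homogeneous[of u]
  by (simp add: inter_def mult.commute gagliardo_form_commute)

lemma inter_commute: "u \<in> H \<Longrightarrow> w \<in> H \<Longrightarrow> inter u w = inter w u"
  by (simp add: inter_form gagliardo_form_commute)

lemma phi_integrable:
  assumes "u \<in> H" "a \<in> H" "b \<in> H"
  shows "integrable lebesgue (\<lambda>x. phi t u x * (a x * b x))"
  using trilinear_integrable[OF assms(2,3) phi_critical[OF assms(1)]] by (simp add: mult_ac)

lemma phi_integrable_sq: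
  assumes "u \<in> H" "a \<in> H"
  shows "integrable lebesgue (\<lambda>x. phi t u x * (a x)\<^sup>2)"
  using phi_integrable[OF assms(1,2,2)] by (simp add: power2_eq_square)

lemma inter_nonneg: assumes "u \<in> H" shows "0 \<le> inter u w"
  unfolding inter_def
  by (rule integral_nonneg_AE) (use phi_nonneg[OF assms] in eventually_elim, simp)

text \<open>Test the weak equation with the potential itself and cancel one factor of its
  seminorm.\<close>

lemma phi_norm_le: assumes u: "u \<in> H" shows "gagliardo_norm t (phi t u) \<le> KT * (nrm u)\<^sup>2"
proof (cases "gagliardo_norm t (phi t u) = 0")
  case True then show ?thesis using KT_pos by simp
next
  case False
  then have pos: "gagliardo_norm t (phi t u) > 0" by (simp add: less_le)
  have "(gagliardo_norm t (phi t u))\<^sup>2 = (LINT x|lebesgue. u x * u x * phi t u x)"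
    using phi_form[OF u phi_homogeneous[OF u]] unfolding gagliardo_norm_sq by (simp add: power2_eq_square)
  also have "\<dots> \<le> KT * nrm u * nrm u * gagliardo_norm t (phi t u)"
    using trilinear_le[OF u u phi_critical[OF u]] by linarith
  finally show ?thesis using pos by (simp add: power2_eq_square mult_ac)
qed

lemma phi_trilinear_le:
  assumes "u \<in> H" "a \<in> H" "b \<in> H"
  shows "\<bar>LINT x|lebesgue. phi t u x * (a x * b x)\<bar> \<le> KT\<^sup>2 * (nrm u)\<^sup>2 * nrm a * nrm b"
proof -
  have "\<bar>LINT x|lebesgue. phi t u x * (a x * b x)\<bar> \<le> KT * nrm a * nrm b * gagliardo_norm t (phi t u)"
    using trilinear_le[OF assms(2,3) phi_critical[OF assms(1)]] by (simp add: mult_ac)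
  also have "\<dots> \<le> KT * nrm a * nrm b * (KT * (nrm u)\<^sup>2)"
    using KT_pos by (intro mult_left_mono phi_norm_le assms) auto
  finally show ?thesis by (simp add: power2_eq_square mult_ac)
qed

lemma inter_scale_right: "inter u (\<lambda>x. c * w x) = c\<^sup>2 * inter u w"
proof -
  have "phi t u x * (c * w x)\<^sup>2 = c\<^sup>2 * (phi t u x * (w x)\<^sup>2)" for x
    by (simp add: power_mult_distrib)
  then show ?thesis by (simp only: inter_def integral_mult_right_zero)
qed

lemma inter_scale_left: "u \<in> H \<Longrightarrow> w \<in> H \<Longrightarrow> inter (\<lambda>x. c * u x) w = c\<^sup>2 * inter u w"
  using inter_commute[of "\<lambda>x. c * u x" w] inter_commute[of u w] space_H_scale[of u c]
  by (simp add: inter_scale_right)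

lemma inter_scale:
  assumes "u \<in> H" shows "inter (\<lambda>x. c * u x) (\<lambda>x. c * u x) = c ^ 4 * inter u u"
proof -
  have "c ^ 4 = c\<^sup>2 * c\<^sup>2" by (simp flip: power_add)
  then show ?thesis by (simp add: inter_scale_right inter_scale_left assms)
qed

text \<open>Expand the square of \<open>phi t w - phi t u\<close>. The first term is a nonnegative
  square and, near u, of second order: the former yields lower semicontinuity, the latter
  differentiability of the Poisson term.\<close>

lemma inter_expand:
  assumes u: "u \<in> H" and w: "w \<in> H"
  shows "inter w w - inter u u = gagliardo_form t (\<lambda>x. phi t w x - phi t u x) (\<lambda>x. phi t w x - phi t u x)
    + 2 * (inter u w - inter u u)"
proof -
  note G = phi_gagliardo[OF u] phi_gagliardo[OF w]
  show ?thesis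
    using gagliardo_form_lin2[OF G(2,1), of 1 "-1"] by (simp add: inter_form u w gagliardo_form_commute[of t "phi t w" "phi t u"])
qed

text \<open>The difference of the two densities factors as (u + v)^2 - u^2 = v (2 u + v), to which
  the trilinear bound applies.\<close>

lemma phi_diff_norm:
  assumes u: "u \<in> H" and v: "v \<in> H"
  shows "gagliardo_norm t (\<lambda>x. phi t (\<lambda>x. u x + v x) x - phi t u x) \<le> KT * nrm v * (2 * nrm u + nrm v)"
proof -
  let ?w = "\<lambda>x. u x + v x" and ?k = "\<lambda>x. 2 * u x + 1 * v x"
  have w: "?w \<in> H" by (rule space_H_add[OF u v])
  have k: "?k \<in> H" by (rule space_H_lin[OF u v])
  define d where "d x = phi t ?w x - phi t u x" for x
  have dh: "d \<in> homogeneous_sobolev t"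
    using homogeneous_sobolev_lin[OF t phi_homogeneous[OF w] phi_homogeneous[OF u], of 1 "-1"] by (simp add: d_def[abs_def])
  have dc: "d \<in> critical_space t" unfolding d_def[abs_def] by (intro critical_space_diff t phi_critical u w)
  have "gagliardo_form t d d = (LINT x|lebesgue. (?w x)\<^sup>2 * d x) - (LINT x|lebesgue. (u x)\<^sup>2 * d x)"
    using gagliardo_form_diff[OF phi_gagliardo[OF w] phi_gagliardo[OF u] critical_spaceD(1)[OF dc]]
      phi_form[OF w dh] phi_form[OF u dh] by (simp add: d_def[abs_def])
  also have "\<dots> = (LINT x|lebesgue. (?w x)\<^sup>2 * d x - (u x)\<^sup>2 * d x)"
    using trilinear_integrable[OF w w dc] trilinear_integrable[OF u u dc] by (simp add: power2_eq_square)
  also have "\<dots> = (LINT x|lebesgue. v x * ?k x * d x)"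
    by (rule Bochner_Integration.integral_cong) (auto simp: power2_eq_square algebra_simps)
  also have "\<dots> \<le> KT * nrm v * nrm ?k * gagliardo_norm t d"
    using trilinear_le[OF v k dc] by linarith
  finally have *: "(gagliardo_norm t d)\<^sup>2 \<le> KT * nrm v * nrm ?k * gagliardo_norm t d" by (simp add: gagliardo_norm_sq)
  have "gagliardo_norm t d \<le> KT * nrm v * nrm ?k"
  proof (cases "gagliardo_norm t d = 0")
    case True then show ?thesis using KT_pos by simp
  next
    case False
    then have "gagliardo_norm t d > 0" by (simp add: less_le)
    then show ?thesis using * by (simp add: power2_eq_square)
  qed
  also have "\<dots> \<le> KT * nrm v * (2 * nrm u + nrm v)"
    using KT_pos nrm_triangle[OF space_H_scale[OF u] v, of 2] by (intro mult_left_mono) (auto simp: nrm_scale)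
  finally show ?thesis by (simp add: d_def[abs_def])
qed

end

section \<open>Compactness\<close>

text \<open>Lower semicontinuity phrased for all large indices, so that it can be combined for
  several terms at one common index.\<close>

lemma integral_Fatou_eventually_gt:
  fixes g :: "nat \<Rightarrow> 'a \<Rightarrow> real" and h :: "'a \<Rightarrow> real"
  assumes [measurable]: "\<And>n. g n \<in> borel_measurable M" "h \<in> borel_measurable M"
    and i: "\<And>n. integrable M (g n)" and ih: "integrable M h"
    and nn: "\<And>n x. 0 \<le> g n x" and hn: "\<And>x. 0 \<le> h x"
    and lim: "AE x in M. (\<lambda>n. g n x) \<longlonglongrightarrow> h x" and c: "c < integral\<^sup>L M h"
  shows "\<forall>\<^sub>F n in sequentially. c < integral\<^sup>L M (g n)"
proof (rule ccontr)
  assume neg: "\<not> ?thesis"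
  then have fr: "\<exists>\<^sub>F n in sequentially. integral\<^sup>L M (g n) \<le> c"
    by (simp add: frequently_def not_less not_le)
  have "ennreal (integral\<^sup>L M h) = (\<integral>\<^sup>+x. ennreal (h x) \<partial>M)"
    using nn_integral_eq_integral[OF ih] hn by simp
  also have "\<dots> = (\<integral>\<^sup>+x. liminf (\<lambda>n. ennreal (g n x)) \<partial>M)"
  proof (rule nn_integral_cong_AE)
    show "AE x in M. ennreal (h x) = liminf (\<lambda>n. ennreal (g n x))"
      using lim
    proof eventually_elim
      case (elim x)
      then have "(\<lambda>n. ennreal (g n x)) \<longlonglongrightarrow> ennreal (h x)" by (rule tendsto_ennrealI)
      then show ?case by (simp add: lim_imp_Liminf)
    qed
  qed
  also have "\<dots> \<le> liminf (\<lambda>n. \<integral>\<^sup>+x. ennreal (g n x) \<partial>M)"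
    by (rule nn_integral_liminf) measurable
  also have "\<dots> = liminf (\<lambda>n. ennreal (integral\<^sup>L M (g n)))"
    using i nn by (simp add: nn_integral_eq_integral)
  finally have le: "ennreal (integral\<^sup>L M h) \<le> liminf (\<lambda>n. ennreal (integral\<^sup>L M (g n)))" .
  \<comment> \<open>An index violating the claim shows c \<ge> 0, which is needed because
    \<open>ennreal\<close> sends negative numbers to 0.\<close>
  obtain n0 where n0: "integral\<^sup>L M (g n0) \<le> c" using fr frequently_ex by blast
  have "0 \<le> integral\<^sup>L M (g n0)" using nn by simp
  then have c0: "0 \<le> c" using n0 by linarith
  then have "ennreal c < liminf (\<lambda>n. ennreal (integral\<^sup>L M (g n)))"
    using c le by (intro less_le_trans[OF _ le]) (simp add: ennreal_less_iff)
  then have "\<forall>\<^sub>F n in sequentially. ennreal c < ennreal (integral\<^sup>L M (g n))" by (rule less_LiminfD)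
  then have "\<forall>\<^sub>F n in sequentially. c < integral\<^sup>L M (g n)"
    by eventually_elim (use c0 in \<open>simp add: ennreal_less_iff\<close>)
  then show False using neg by simp
qed

text \<open>Integer parts make the cubes half-open, so they partition the space exactly, with no
  shared faces.\<close>

definition cube :: "real \<Rightarrow> int \<times> int \<times> int \<Rightarrow> R3 set" where
  "cube \<delta> z = {x. \<lfloor>x $ 1 / \<delta>\<rfloor> = fst z \<and> \<lfloor>x $ 2 / \<delta>\<rfloor> = fst (snd z) \<and> \<lfloor>x $ 3 / \<delta>\<rfloor> = snd (snd z)}"

lemma cube_disjoint: "x \<in> cube \<delta> z \<Longrightarrow> x \<in> cube \<delta> z' \<Longrightarrow> z = z'"
  by (auto simp: cube_def prod_eq_iff)

lemma cube_diam:
  assumes "\<delta> > 0" "x \<in> cube \<delta> z" "y \<in> cube \<delta> z" shows "norm (x - y) \<le> 3 * \<delta>"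
proof -
  have *: "\<bar>a - b\<bar> \<le> \<delta>" if "\<lfloor>a / \<delta>\<rfloor> = \<lfloor>b / \<delta>\<rfloor>" for a b
  proof -
    have "\<bar>a / \<delta> - b / \<delta>\<bar> \<le> 1" using that by linarith
    then have "\<bar>a - b\<bar> / \<delta> \<le> 1" using assms(1) by (simp add: abs_divide flip: diff_divide_distrib)
    then show ?thesis using assms(1) by simp
  qed
  have "norm (x - y) \<le> (\<Sum>i\<in>UNIV. \<bar>(x - y) $ i\<bar>)" by (rule norm_le_l1_cart)
  also have "\<dots> = \<bar>x $ 1 - y $ 1\<bar> + \<bar>x $ 2 - y $ 2\<bar> + \<bar>x $ 3 - y $ 3\<bar>" unfolding sum_3 by simp
  also have "\<dots> \<le> \<delta> + \<delta> + \<delta>" using assms(2,3) by (intro add_mono *) (auto simp: cube_def)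
  finally show ?thesis by simp
qed

lemma sets_cube [measurable]: "cube \<delta> z \<in> sets lebesgue"
proof -
  have "(\<lambda>x. \<lfloor>x $ i / \<delta>\<rfloor>) \<in> measurable borel (count_space UNIV)" for i :: 3 by measurable
  then have "{x \<in> space borel. \<lfloor>x $ 1 / \<delta>\<rfloor> = fst z \<and> \<lfloor>x $ 2 / \<delta>\<rfloor> = fst (snd z) \<and> \<lfloor>x $ 3 / \<delta>\<rfloor> = snd (snd z)} \<in> sets borel"
    by measurable
  then show ?thesis by (simp add: cube_def)
qed

text \<open>The half-open cube lies between an open and a closed box of the same volume.\<close>

lemma measure_cube:
  assumes \<delta>: "\<delta> > 0" shows "emeasure lebesgue (cube \<delta> z) = ennreal (\<delta> ^ 3)"
proof -
  obtain a b c where z: "z = (a, b, c)" by (cases z)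
  define l u :: R3 where "l = vector [a * \<delta>, b * \<delta>, c * \<delta>]" and "u = vector [(a + 1) * \<delta>, (b + 1) * \<delta>, (c + 1) * \<delta>]"
  have fl: "\<lfloor>y / \<delta>\<rfloor> = k \<longleftrightarrow> k * \<delta> \<le> y \<and> y < (k + 1) * \<delta>" for y k
    using \<delta> by (auto simp: floor_eq_iff field_simps)
  have 1: "box l u \<subseteq> cube \<delta> z" "cube \<delta> z \<subseteq> cbox l u"
    by (auto simp: mem_box_cart forall_3 cube_def z fl l_def u_def intro: less_imp_le)
  have d: "u $ i - l $ i = \<delta>" for i
    using exhaust_3[of i] by (auto simp: l_def u_def distrib_right)
  have "l $ i \<le> u $ i" for i using d[of i] \<delta> by simp
  then have "cbox l u \<noteq> {}" by (simp add: interval_ne_empty_cart)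
  then have "measure lborel (cbox l u) = prod (\<lambda>i. u $ i - l $ i) UNIV" by (rule content_cbox_cart)
  also have "\<dots> = \<delta> ^ 3" by (simp add: d)
  finally have ec: "emeasure lborel (cbox l u) = ennreal (\<delta> ^ 3)"
    using emeasure_eq_ennreal_measure[of lborel "cbox l u"] emeasure_lborel_cbox_finite[of l u] by simp
  moreover have "emeasure lborel (box l u) = emeasure lborel (cbox l u)"
    unfolding emeasure_lborel_box_eq emeasure_lborel_cbox_eq ..
  ultimately have "emeasure lebesgue (box l u) = ennreal (\<delta> ^ 3)" "emeasure lebesgue (cbox l u) = ennreal (\<delta> ^ 3)"
    by simp_all
  moreover have "emeasure lebesgue (box l u) \<le> emeasure lebesgue (cube \<delta> z)" "emeasure lebesgue (cube \<delta> z) \<le> emeasure lebesgue (cbox l u)"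
    by (rule emeasure_mono[OF 1(1) sets_cube], rule emeasure_mono[OF 1(2)], simp)
  ultimately show ?thesis by (intro antisym) (simp_all only:)
qed

lemma cube_cover:
  assumes \<delta>: "\<delta> > 0"
  obtains Z where "finite Z" "ball 0 R \<subseteq> (\<Union>z\<in>Z. cube \<delta> z)"
proof -
  define N where "N = \<lceil>R / \<delta>\<rceil> + 1"
  show thesis
  proof (rule that[of "{-N..N} \<times> {-N..N} \<times> {-N..N}"])
    show "ball 0 R \<subseteq> (\<Union>z\<in>{-N..N} \<times> {-N..N} \<times> {-N..N}. cube \<delta> z)"
    proof
      fix x :: R3 assume "x \<in> ball 0 R"
      then have "\<bar>x $ i\<bar> < R" for i using component_le_norm_cart[of x i] by simp
      then have "\<bar>x $ i / \<delta>\<bar> < R / \<delta>" for i using \<delta> by (simp add: divide_strict_right_mono)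
      then have "\<lfloor>x $ i / \<delta>\<rfloor> \<in> {-N..N}" for i
      proof -
        have "\<bar>x $ i / \<delta>\<bar> < R / \<delta>" by fact
        then show ?thesis unfolding N_def atLeastAtMost_iff by linarith
      qed
      then show "x \<in> (\<Union>z\<in>{-N..N} \<times> {-N..N} \<times> {-N..N}. cube \<delta> z)"
        by (intro UN_I[of "(\<lfloor>x $ 1 / \<delta>\<rfloor>, \<lfloor>x $ 2 / \<delta>\<rfloor>, \<lfloor>x $ 3 / \<delta>\<rfloor>)"]) (auto simp: cube_def)
    qed
  qed simp
qed

text \<open>On a cube \<open>Q\<close> one expands
  \<open>\<integral>\<integral>\<^bsub>Q \<times> Q\<^esub> (w x - w y)\<^sup>2 = 2 |Q| \<integral>\<^bsub>Q\<^esub> w\<^sup>2 - 2 (\<integral>\<^bsub>Q\<^esub> w)\<^sup>2\<close>.\<close>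

lemma cubes_poincare:
  assumes \<delta>: "\<delta> > 0" and s: "0 < s" and w: "w \<in> gagliardo_space s" and w2: "integrable lebesgue (\<lambda>x. (w x)\<^sup>2)" and Z: "finite Z"
  shows "(\<Sum>z\<in>Z. LINT x|lebesgue. indicator (cube \<delta> z) x * (w x)\<^sup>2) \<le>
    (3 * \<delta>) powr (3 + 2 * s) / (2 * \<delta> ^ 3) * gagliardo_form s w w
    + (\<Sum>z\<in>Z. (LINT x|lebesgue. indicator (cube \<delta> z) x * w x)\<^sup>2) / \<delta> ^ 3"
proof -
  note [measurable] = gagliardo_spaceD(1)[OF w]
  define q where "q z x = indicat_real (cube \<delta> z) x" for z x
  have q01: "0 \<le> q z x" "q z x \<le> 1" for z x by (auto simp: q_def indicator_def)
  have [measurable]: "q z \<in> borel_measurable lebesgue" for z unfolding q_def[abs_def] by measurable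
  have iq: "integrable lebesgue (q z)" for z
    unfolding q_def[abs_def] by (rule integrable_real_indicator) (simp_all add: measure_cube[OF \<delta>] del: emeasure_completion)
  have mq: "(LINT x|lebesgue. q z x) = \<delta> ^ 3" for z
    using \<delta> by (simp add: q_def measure_def measure_cube del: emeasure_completion measure_completion)
  have iqw2: "integrable lebesgue (\<lambda>x. q z x * (w x)\<^sup>2)" for z
    by (rule Bochner_Integration.integrable_bound[OF w2]) (measurable, simp add: q_def indicator_def)
  have iqw: "integrable lebesgue (\<lambda>x. q z x * w x)" for z
  proof (rule Bochner_Integration.integrable_bound)
    show "integrable lebesgue (\<lambda>x. q z x + q z x * (w x)\<^sup>2)" using iq iqw2 by simp
    have "\<bar>w x\<bar> \<le> 1 + (w x)\<^sup>2" for x using abs_mult_le_sq[of 1 "w x"] by simp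
    then show "AE x in lebesgue. norm (q z x * w x) \<le> norm (q z x + q z x * (w x)\<^sup>2)"
      by (intro AE_I2) (simp add: q_def indicator_def)
  qed measurable
  define I J where "I z = (LINT x|lebesgue. q z x * w x)" and "J z = (LINT x|lebesgue. q z x * (w x)\<^sup>2)" for z
  \<comment> \<open>The largest denominator that the kernel can have for two points of one cube,
    whose distance is at most 3 \<delta>.\<close>
  define P where "P = (3 * \<delta>) powr (3 + 2 * s)"
  have inner: "(\<lambda>y. q z y * (w x - w y)\<^sup>2) = (\<lambda>y. (w x)\<^sup>2 * q z y - 2 * w x * (q z y * w y) + q z y * (w y)\<^sup>2)" for z x
    by (auto simp: power2_diff algebra_simps)
  have ii: "integrable lebesgue (\<lambda>y. q z y * (w x - w y)\<^sup>2)" for z x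
    unfolding inner using iq iqw iqw2 by simp
  have iv: "(LINT y|lebesgue. q z y * (w x - w y)\<^sup>2) = (w x)\<^sup>2 * \<delta> ^ 3 - 2 * w x * I z + J z" for z x
    unfolding inner using iq iqw iqw2 by (simp add: mq I_def J_def)
  have outer: "(\<lambda>x. q z x * ((w x)\<^sup>2 * \<delta> ^ 3 - 2 * w x * I z + J z)) = (\<lambda>x. \<delta> ^ 3 * (q z x * (w x)\<^sup>2) - 2 * I z * (q z x * w x) + J z * q z x)" for z
    by (auto simp: algebra_simps)
  have io: "integrable lebesgue (\<lambda>x. q z x * ((w x)\<^sup>2 * \<delta> ^ 3 - 2 * w x * I z + J z))" for z
    unfolding outer using iq iqw iqw2 by simp
  have ov: "(LINT x|lebesgue. q z x * ((w x)\<^sup>2 * \<delta> ^ 3 - 2 * w x * I z + J z)) = 2 * \<delta> ^ 3 * J z - 2 * (I z)\<^sup>2" for z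
    unfolding outer using iq iqw iqw2 by (simp add: mq flip: I_def J_def) (simp add: power2_eq_square)
  have nn: "0 \<le> (w x)\<^sup>2 * \<delta> ^ 3 - 2 * w x * I z + J z" for x z
    unfolding iv[symmetric] by (simp add: q01)
  have pz: "0 \<le> 2 * \<delta> ^ 3 * J z - 2 * (I z)\<^sup>2" for z
    unfolding ov[symmetric] by (simp add: nn q01)
  have e: "ennreal (2 * \<delta> ^ 3 * J z - 2 * (I z)\<^sup>2) = (\<integral>\<^sup>+x. \<integral>\<^sup>+y. ennreal (q z x * (q z y * (w x - w y)\<^sup>2)) \<partial>lebesgue \<partial>lebesgue)" for z
  proof -
    have "(\<integral>\<^sup>+y. ennreal (q z x * (q z y * (w x - w y)\<^sup>2)) \<partial>lebesgue) = ennreal (q z x * ((w x)\<^sup>2 * \<delta> ^ 3 - 2 * w x * I z + J z))" for x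
      using ii[of z x] by (subst nn_integral_eq_integral) (auto simp: q01 iv)
    then show ?thesis using io[of z] nn q01 by (simp add: nn_integral_eq_integral flip: ov)
  qed
  have "ennreal (\<Sum>z\<in>Z. 2 * \<delta> ^ 3 * J z - 2 * (I z)\<^sup>2) = (\<Sum>z\<in>Z. ennreal (2 * \<delta> ^ 3 * J z - 2 * (I z)\<^sup>2))"
    using pz by (simp add: sum_ennreal)
  also have "\<dots> = (\<integral>\<^sup>+x. \<integral>\<^sup>+y. (\<Sum>z\<in>Z. ennreal (q z x * (q z y * (w x - w y)\<^sup>2))) \<partial>lebesgue \<partial>lebesgue)"
    unfolding e
  proof (subst nn_integral_sum[symmetric])
    fix z assume "z \<in> Z"
    have "(\<lambda>x. \<integral>\<^sup>+y. ennreal (q z x * (q z y * (w x - w y)\<^sup>2)) \<partial>lebesgue) = (\<lambda>x. ennreal (q z x * ((w x)\<^sup>2 * \<delta> ^ 3 - 2 * w x * I z + J z)))"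
      using ii by (intro ext, subst nn_integral_eq_integral) (auto simp: q01 iv)
    then show "(\<lambda>x. \<integral>\<^sup>+y. ennreal (q z x * (q z y * (w x - w y)\<^sup>2)) \<partial>lebesgue) \<in> borel_measurable lebesgue" by simp
  qed (simp add: nn_integral_sum)
  also have "\<dots> \<le> (\<integral>\<^sup>+x. \<integral>\<^sup>+y. ennreal P * ennreal (gagliardo_kernel s w w (x, y)) \<partial>lebesgue \<partial>lebesgue)"
  proof (intro nn_integral_mono)
    fix x y
    have "(\<Sum>z\<in>Z. q z x * (q z y * (w x - w y)\<^sup>2)) \<le> P * gagliardo_kernel s w w (x, y)"
    proof (cases "\<exists>z\<in>Z. x \<in> cube \<delta> z \<and> y \<in> cube \<delta> z")
      case False
      then have "(\<Sum>z\<in>Z. q z x * (q z y * (w x - w y)\<^sup>2)) = 0" by (intro sum.neutral) (auto simp: q_def)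
      then show ?thesis by (simp add: P_def)
    next
      case True
      then obtain z0 where z0: "z0 \<in> Z" "x \<in> cube \<delta> z0" "y \<in> cube \<delta> z0" by blast
      \<comment> \<open>At most one cube contains both points, so summation over Z costs no factor
        and the full form appears once on the right.\<close>
      have "q z x * (q z y * (w x - w y)\<^sup>2) = (if z = z0 then (w x - w y)\<^sup>2 else 0)" for z
        using z0 cube_disjoint[of x \<delta> z z0] by (cases "z = z0"; cases "x \<in> cube \<delta> z") (auto simp: q_def)
      then have "(\<Sum>z\<in>Z. q z x * (q z y * (w x - w y)\<^sup>2)) = (w x - w y)\<^sup>2" using Z z0 by simp
      also have "\<dots> \<le> P * gagliardo_kernel s w w (x, y)"
      proof (cases "x = y")
        case False
        have "norm (x - y) powr (3 + 2 * s) \<le> P"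
          unfolding P_def using cube_diam[OF \<delta> z0(2,3)] s by (intro powr_mono2) auto
        then have "(w x - w y)\<^sup>2 * norm (x - y) powr (3 + 2 * s) \<le> (w x - w y)\<^sup>2 * P" by (rule mult_left_mono) simp
        then show ?thesis using False by (simp add: gagliardo_kernel_diag field_simps)
      qed (simp add: P_def)
      finally show ?thesis .
    qed
    then show "(\<Sum>z\<in>Z. ennreal (q z x * (q z y * (w x - w y)\<^sup>2))) \<le> ennreal P * ennreal (gagliardo_kernel s w w (x, y))"
      by (simp add: sum_ennreal q01 P_def ennreal_leI flip: ennreal_mult')
  qed
  also have "\<dots> = ennreal P * (\<integral>\<^sup>+x. \<integral>\<^sup>+y. ennreal (gagliardo_kernel s w w (x, y)) \<partial>lebesgue \<partial>lebesgue)"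
  proof -
    have m: "(\<lambda>z. ennreal (gagliardo_kernel s w w z)) \<in> borel_measurable LL" by measurable
    have "(\<lambda>y. ennreal (gagliardo_kernel s w w (x, y))) \<in> borel_measurable lebesgue" for x
      using measurable_Pair2[OF m] by simp
    then show ?thesis using lebesgue.borel_measurable_nn_integral_fst[OF m] by (simp add: nn_integral_cmult)
  qed
  also have "\<dots> = ennreal (P * gagliardo_form s w w)"
    unfolding gagliardo_form_iterated[OF w] by (simp add: P_def ennreal_mult')
  finally have "(\<Sum>z\<in>Z. 2 * \<delta> ^ 3 * J z - 2 * (I z)\<^sup>2) \<le> P * gagliardo_form s w w"
    by (simp add: P_def)
  then have "2 * \<delta> ^ 3 * (\<Sum>z\<in>Z. J z) \<le> P * gagliardo_form s w w + 2 * (\<Sum>z\<in>Z. (I z)\<^sup>2)"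
    by (simp add: sum_subtractf sum_distrib_left)
  then have "(\<Sum>z\<in>Z. J z) \<le> P / (2 * \<delta> ^ 3) * gagliardo_form s w w + (\<Sum>z\<in>Z. (I z)\<^sup>2) / \<delta> ^ 3"
    using \<delta> by (simp add: field_simps)
  then show ?thesis by (simp add: I_def J_def P_def q_def)
qed

text \<open>Splitting at a threshold \<delta> replaces Hoelder interpolation: a large \<delta> makes
  the weight of the higher power small, while the lower power tends to 0 in the application.\<close>

lemma powr_interpolation:
  fixes x :: real
  assumes "0 \<le> x" "0 < \<delta>" "a \<le> q" "q \<le> b"
  shows "x powr q \<le> \<delta> powr (q - a) * x powr a + \<delta> powr (q - b) * x powr b"
proof (cases "x \<le> \<delta>")
  case True
  have "x powr q = x powr (q - a) * x powr a" using assms(1) by (simp flip: powr_add)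
  also have "\<dots> \<le> \<delta> powr (q - a) * x powr a" using True assms by (intro mult_right_mono powr_mono2) auto
  finally show ?thesis by (simp add: add_increasing2)
next
  case False
  have "x powr q = x powr (q - b) * x powr b" using assms(1) by (simp flip: powr_add)
  also have "\<dots> \<le> \<delta> powr (q - b) * x powr b" using False assms by (intro mult_right_mono powr_mono2') auto
  finally show ?thesis by (simp add: add_increasing)
qed

section \<open>Lower semicontinuity of the norm, and averages over cubes\<close>

context schroedinger_space
begin

lemma H_Fatou:
  assumes g: "\<And>n. g n \<in> H" and v: "v \<in> borel_measurable lebesgue"
    and lim: "AE x in lebesgue. (\<lambda>n. g n x) \<longlonglongrightarrow> v x"
    and bd: "\<forall>\<^sub>F n in sequentially. ip (g n) (g n) \<le> B"
  shows "v \<in> H" "ip v v \<le> B"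
proof -
  note [measurable] = space_HD(1)[OF g] v
  have ipeq: "ip u u = gagliardo_form s u u + (LINT x|lebesgue. V x * (u x)\<^sup>2)" for u
    by (simp add: ip_def power2_eq_square)
  have V0: "0 \<le> (LINT x|lebesgue. V x * (u x)\<^sup>2)" for u by (simp add: V_nonneg)
  have b1: "\<forall>\<^sub>F n in sequentially. gagliardo_form s (g n) (g n) \<le> B"
    using bd
  proof eventually_elim
    case (elim n) then show ?case using V0[of "g n"] unfolding ipeq by linarith
  qed
  have b2: "\<forall>\<^sub>F n in sequentially. (LINT x|lebesgue. V x * (g n x)\<^sup>2) \<le> B"
    using bd
  proof eventually_elim
    case (elim n) then show ?case using gagliardo_form_nonneg[of s "g n"] unfolding ipeq by linarith
  qed
  have lV: "AE x in lebesgue. (\<lambda>n. V x * (g n x)\<^sup>2) \<longlonglongrightarrow> V x * (v x)\<^sup>2"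
    using lim by eventually_elim (intro tendsto_intros)
  have iV: "integrable lebesgue (\<lambda>x. V x * (v x)\<^sup>2)"
    by (rule integral_Fatou_bound(1)[of "\<lambda>n x. V x * (g n x)\<^sup>2"]) (use lV b2 space_HD[OF g] in \<open>auto simp: V_nonneg\<close>)
  have vG: "v \<in> gagliardo_space s" by (rule gagliardo_Fatou(1)[OF space_HD(2)[OF g] v lim b1])
  show vH: "v \<in> H" by (rule space_HI[OF vG iV])
  show "ip v v \<le> B"
  proof (rule ccontr)
    assume "\<not> ip v v \<le> B"
    define a b where "a = gagliardo_form s v v" and "b = (LINT x|lebesgue. V x * (v x)\<^sup>2)"
    \<comment> \<open>Half of the excess for each summand: the two eventual lower bounds a - e and b
      - e then add up to exactly B.\<close>
    define e where "e = (a + b - B) / 2"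
    have e: "e > 0" using \<open>\<not> ip v v \<le> B\<close> by (simp add: e_def a_def b_def ipeq)
    have "AE z in LL. (\<lambda>n. gagliardo_kernel s (g n) (g n) z) \<longlonglongrightarrow> gagliardo_kernel s v v z"
      using AE_fst_LL[OF lim] AE_snd_LL[OF lim]
    proof eventually_elim
      case (elim z) then show ?case unfolding gagliardo_kernel_diag
        by (cases "fst z = snd z") (auto intro!: tendsto_intros)
    qed
    then have "\<forall>\<^sub>F n in sequentially. a - e < integral\<^sup>L LL (gagliardo_kernel s (g n) (g n))"
      by (intro integral_Fatou_eventually_gt) (use e gagliardo_spaceD(2)[OF space_HD(2)[OF g]] gagliardo_spaceD(2)[OF vG] in \<open>auto simp: a_def gagliardo_form_def\<close>)
    moreover have "\<forall>\<^sub>F n in sequentially. b - e < (LINT x|lebesgue. V x * (g n x)\<^sup>2)"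
      by (intro integral_Fatou_eventually_gt[OF _ _ _ iV _ _ lV]) (use e space_HD[OF g] in \<open>auto simp: b_def V_nonneg\<close>)
    ultimately have "\<forall>\<^sub>F n in sequentially. False"
      using bd
    proof eventually_elim
      case (elim n)
      then have "a - e + (b - e) < ip (g n) (g n)" unfolding ipeq gagliardo_form_def by linarith
      then show ?case using elim(3) by (simp add: e_def field_simps)
    qed
    then show False by simp
  qed
qed

text \<open>Bounded averages over countably many cubes are what the diagonal extraction of a
  subsequence requires.\<close>

lemma H_averages_bounded:
  assumes u: "u \<in> H" and \<delta>: "\<delta> > 0" and b: "(LINT x|lebesgue. (u x)\<^sup>2) \<le> B"
  shows "\<bar>LINT x|lebesgue. indicator (cube \<delta> z) x * u x\<bar> \<le> \<delta> ^ 3 + B"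
proof -
  note [measurable] = space_HD(1)[OF u]
  have iq: "integrable lebesgue (indicat_real (cube \<delta> z))"
    by (rule integrable_real_indicator) (simp_all add: measure_cube[OF \<delta>] del: emeasure_completion)
  have mq: "(LINT x|lebesgue. indicat_real (cube \<delta> z) x) = \<delta> ^ 3"
    using \<delta> by (simp add: measure_def measure_cube del: emeasure_completion measure_completion)
  have le: "norm (indicat_real (cube \<delta> z) x * u x) \<le> indicat_real (cube \<delta> z) x + (u x)\<^sup>2" for x
    using abs_mult_le_sq[of 1 "u x"] by (simp add: indicator_def)
  have i2: "integrable lebesgue (\<lambda>x. indicat_real (cube \<delta> z) x + (u x)\<^sup>2)"
    using iq space_HD(4)[OF u] by simp
  have i1: "integrable lebesgue (\<lambda>x. indicat_real (cube \<delta> z) x * u x)"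
    by (rule Bochner_Integration.integrable_bound[OF i2])
       (measurable, use le in \<open>auto intro!: AE_I2 order_trans[OF _ abs_ge_self]\<close>)
  have "\<bar>LINT x|lebesgue. indicator (cube \<delta> z) x * u x\<bar> \<le> (LINT x|lebesgue. \<bar>indicat_real (cube \<delta> z) x * u x\<bar>)"
    by (rule integral_abs_bound)
  also have "\<dots> \<le> (LINT x|lebesgue. indicat_real (cube \<delta> z) x + (u x)\<^sup>2)"
    by (rule integral_mono) (use i1 i2 le in auto)
  also have "\<dots> = \<delta> ^ 3 + (LINT x|lebesgue. (u x)\<^sup>2)" using iq space_HD(4)[OF u] mq by simp
  finally show ?thesis using b by simp
qed

end

section \<open>Control of tails by the potential, and the compact embedding\<close>

locale coercive_schroedinger_space = schroedinger_space +
  assumes V2: "\<exists>h>0. \<forall>c>0. ((\<lambda>y. measure lebesgue {x \<in> ball y h. V x \<le> c}) \<longlongrightarrow> 0) at_infinity"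
begin

text \<open>Where \<open>V \<le> c\<close> and \<open>x\<close> is far out, half of a small ball around \<open>x\<close> lies in \<open>{V > c}\<close>; comparing
  \<open>u x\<close> with \<open>u y\<close> there bounds \<open>u\<^sup>2\<close> by its mass on \<open>{V > c}\<close> and the Gagliardo seminorm.\<close>

lemma H_tail:
  assumes e: "e > 0"
  obtains R where "\<And>u. u \<in> H \<Longrightarrow> nrm u \<le> M \<Longrightarrow> (LINT x|lebesgue. indicator {x. R \<le> norm x} x * (u x)\<^sup>2) \<le> e"
proof -
  obtain h where h: "h > 0" "\<And>c. c > 0 \<Longrightarrow> ((\<lambda>y. measure lebesgue {x \<in> ball y h. V x \<le> c}) \<longlongrightarrow> 0) at_infinity"
    using V2 by blast
  \<comment> \<open>Chosen so that the mass on {V > c}, counted five times in the end, is at most 5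
    M^2 / c \<le> e / 2; the 1 keeps c positive when M = 0.\<close>
  define c where "c = (10 * M\<^sup>2 + 1) / e"
  have c: "c > 0" using e by (simp add: c_def add_nonneg_pos)
  define P where "P = 3 * M\<^sup>2 / pi"
  \<comment> \<open>r \<le> h lets (V2), stated for radius h, control the part of the ball of radius
    r where V \<le> c. The other bound makes the Gagliardo contribution P r^(2s) at most e /
    2.\<close>
  define r where "r = min h ((e / (2 * P + 1)) powr (1 / (2 * s)))"
  have P: "P \<ge> 0" by (simp add: P_def)
  have r: "r > 0" "r \<le> h" using h e P by (simp_all add: r_def)
  have rs: "P * r powr (2 * s) \<le> e / 2"
  proof -
    have "r powr (2 * s) \<le> ((e / (2 * P + 1)) powr (1 / (2 * s))) powr (2 * s)"
      using r s by (intro powr_mono2) (auto simp: r_def)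
    also have "\<dots> = e / (2 * P + 1)" using s e P by (simp add: powr_powr)
    finally have "P * r powr (2 * s) \<le> P * (e / (2 * P + 1))" using P by (rule mult_left_mono)
    also have "\<dots> \<le> e / 2" using e P by (simp add: field_simps)
    finally show ?thesis .
  qed
  define b where "b = 4/3 * pi * r ^ 3"
  have b: "b > 0" using r by (simp add: b_def)
  have "\<forall>\<^sub>F y in at_infinity. measure lebesgue {x \<in> ball y h. V x \<le> c} < b / 2"
    using order_tendstoD(2)[OF h(2)[OF c], of "b/2"] b by simp
  then obtain R where R: "\<And>y. R \<le> norm y \<Longrightarrow> measure lebesgue {x \<in> ball y h. V x \<le> c} < b / 2"
    by (auto simp: eventually_at_infinity)
  define A where "A = {x. R \<le> norm x \<and> V x \<le> c}"
  define G where "G = {x. c < V x}"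
  have "{x \<in> space lebesgue. R \<le> norm x \<and> V x \<le> c} \<in> sets lebesgue" "{x \<in> space lebesgue. c < V x} \<in> sets lebesgue"
    by measurable
  then have [measurable]: "A \<in> sets lebesgue" "G \<in> sets lebesgue" by (simp_all add: A_def G_def)
  have [measurable]: "ball x \<rho> \<in> sets lebesgue" for x :: R3 and \<rho> by simp
  have [measurable]: "{x. R \<le> norm x} \<in> sets (lebesgue :: R3 measure)"
  proof -
    have "{x \<in> space (lebesgue :: R3 measure). R \<le> norm x} \<in> sets lebesgue" by measurable
    then show ?thesis by simp
  qed
  have half: "ennreal (b / 2) \<le> emeasure lebesgue (ball x r \<inter> G)" if "x \<in> A" for x
  proof -
    have fb: "ball x \<rho> \<in> fmeasurable lebesgue" if "\<rho> \<ge> 0" for \<rho>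
      by (rule fmeasurableI) (use that in \<open>auto simp: emeasure_lebesgue_ball3 simp del: emeasure_completion\<close>)
    have Vc: "{y \<in> ball x h. V y \<le> c} = ball x h - G" by (auto simp: G_def)
    have sG: "G \<in> sets lebesgue" "ball x r \<in> sets lebesgue" "ball x h \<in> sets lebesgue"
      by (fact \<open>G \<in> sets lebesgue\<close>, simp, simp)
    have f1: "ball x r \<inter> G \<in> fmeasurable lebesgue" "ball x r - G \<in> fmeasurable lebesgue" "ball x h - G \<in> fmeasurable lebesgue"
    proof -
      have r0: "0 \<le> r" and h0: "0 \<le> h" using r h by simp_all
      show "ball x r \<inter> G \<in> fmeasurable lebesgue" by (rule fmeasurableI2[OF fb[OF r0] Int_lower1 sets.Int[OF sG(2,1)]])
      show "ball x r - G \<in> fmeasurable lebesgue" by (rule fmeasurableI2[OF fb[OF r0] Diff_subset sets.Diff[OF sG(2,1)]])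
      show "ball x h - G \<in> fmeasurable lebesgue" by (rule fmeasurableI2[OF fb[OF h0] Diff_subset sets.Diff[OF sG(3,1)]])
    qed
    have "measure lebesgue (ball x r - G) \<le> measure lebesgue (ball x h - G)"
      by (rule measure_mono_fmeasurable[OF Diff_mono[OF subset_ball[OF r(2)] subset_refl] sets.Diff[OF sG(2,1)] f1(3)])
    also have "\<dots> < b / 2" using R[of x] that unfolding Vc by (simp add: A_def)
    finally have 1: "measure lebesgue (ball x r - G) < b / 2" .
    have "measure lebesgue ((ball x r \<inter> G) \<union> (ball x r - G)) = measure lebesgue (ball x r \<inter> G) + measure lebesgue (ball x r - G)"
      by (rule measure_Union) (use fmeasurableD2[OF f1(1)] fmeasurableD2[OF f1(2)] fmeasurableD[OF f1(1)] fmeasurableD[OF f1(2)] in \<open>auto simp del: emeasure_completion\<close>)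
    moreover have "(ball x r \<inter> G) \<union> (ball x r - G) = ball x r" by auto
    ultimately have "b / 2 \<le> measure lebesgue (ball x r \<inter> G)"
      using 1 measure_lebesgue_ball3[of r x] r unfolding b_def by (simp del: measure_completion)
    then show ?thesis using f1(1) by (simp add: emeasure_eq_measure2 ennreal_leI del: emeasure_completion measure_completion)
  qed
  have "(LINT x|lebesgue. indicator {x. R \<le> norm x} x * (u x)\<^sup>2) \<le> e" if u: "u \<in> H" "nrm u \<le> M" for u
  proof -
    note [measurable] = space_HD(1)[OF u(1)]
    define w where "w x = ennreal ((u x)\<^sup>2)" for x
    have [measurable]: "w \<in> borel_measurable lebesgue" unfolding w_def[abs_def] by measurable
    have G1: "(\<integral>\<^sup>+x. w x * indicator G x \<partial>lebesgue) \<le> ennreal (M\<^sup>2 / c)"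
    proof -
      have "w x * indicator G x \<le> ennreal ((1 / c) * (V x * (u x)\<^sup>2))" for x
      proof (cases "x \<in> G")
        case True
        then have "c * (u x)\<^sup>2 \<le> V x * (u x)\<^sup>2" by (intro mult_right_mono) (auto simp: G_def)
        then show ?thesis using True c by (simp add: w_def field_simps ennreal_leI)
      qed simp
      then have "(\<integral>\<^sup>+x. w x * indicator G x \<partial>lebesgue) \<le> (\<integral>\<^sup>+x. ennreal ((1 / c) * (V x * (u x)\<^sup>2)) \<partial>lebesgue)"
        by (rule nn_integral_mono)
      also have "\<dots> = ennreal (LINT x|lebesgue. (1 / c) * (V x * (u x)\<^sup>2))"
        using space_HD(5)[OF u(1)] c by (intro nn_integral_eq_integral) (auto simp: V_nonneg)
      also have "\<dots> = ennreal ((1 / c) * (LINT x|lebesgue. V x * (u x)\<^sup>2))" by (simp only: integral_mult_right_zero)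
      also have "(1 / c) * (LINT x|lebesgue. V x * (u x)\<^sup>2) \<le> (1 / c) * M\<^sup>2"
      proof (rule mult_left_mono)
        have "(LINT x|lebesgue. V x * (u x)\<^sup>2) \<le> (nrm u)\<^sup>2" unfolding nrm_sq ip_def by (simp add: power2_eq_square)
        also have "\<dots> \<le> M\<^sup>2" using u(2) by (intro power_mono) auto
        finally show "(LINT x|lebesgue. V x * (u x)\<^sup>2) \<le> M\<^sup>2" .
      qed (use c in simp)
      finally show ?thesis by (simp add: ennreal_leI)
    qed
    define Q where "Q = r powr (3 + 2 * s)"
    define k where "k x y = ennreal (gagliardo_kernel s u u (x, y))" for x y
    have km: "(\<lambda>z. k (fst z) (snd z)) \<in> borel_measurable LL" unfolding k_def prod.collapse by measurable
    then have [measurable]: "k x \<in> borel_measurable lebesgue" for x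
      using measurable_Pair2[of "\<lambda>z. k (fst z) (snd z)" lebesgue lebesgue borel x] by simp
    define B where "B x y = indicator (ball x r) y * (w y * indicator G y)" for x y :: R3
    have Bm: "(\<lambda>z. B (fst z) (snd z)) \<in> borel_measurable LL"
    proof -
      have "(\<lambda>z. B (fst z) (snd z)) = (\<lambda>z. (if dist (fst z) (snd z) < r then 1 else 0) * (w (snd z) * indicator G (snd z)))"
        by (auto simp: B_def)
      also have "\<dots> \<in> borel_measurable LL" by measurable
      finally show ?thesis .
    qed
    then have [measurable]: "B x \<in> borel_measurable lebesgue" for x
      using measurable_Pair2[of "\<lambda>z. B (fst z) (snd z)" lebesgue lebesgue borel x] by simp
    have pw: "ennreal (b / 2) * (w x * indicator A x) \<le> 2 * (\<integral>\<^sup>+y. B x y \<partial>lebesgue) + ennreal (2 * Q) * (\<integral>\<^sup>+y. k x y \<partial>lebesgue)" for x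
    proof (cases "x \<in> A")
      case True
      have "ennreal (b / 2) * (w x * indicator A x) \<le> w x * emeasure lebesgue (ball x r \<inter> G)"
        using True mult_right_mono[OF half[OF True], of "w x"] by (simp add: mult.commute del: emeasure_completion)
      also have "\<dots> = (\<integral>\<^sup>+y. w x * indicator (ball x r \<inter> G) y \<partial>lebesgue)"
        by (rule nn_integral_cmult_indicator[symmetric]) measurable
      also have "\<dots> \<le> (\<integral>\<^sup>+y. 2 * B x y + ennreal (2 * Q) * k x y \<partial>lebesgue)"
      proof (rule nn_integral_mono)
        fix y
        show "w x * indicator (ball x r \<inter> G) y \<le> 2 * B x y + ennreal (2 * Q) * k x y"
        proof (cases "y \<in> ball x r \<inter> G")
          case True
          have "(u x - u y)\<^sup>2 \<le> Q * gagliardo_kernel s u u (x, y)"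
          proof (cases "x = y")
            case False
            have "norm (x - y) powr (3 + 2 * s) \<le> Q"
              unfolding Q_def using True s by (intro powr_mono2) (auto simp: dist_norm)
            then have "(u x - u y)\<^sup>2 * norm (x - y) powr (3 + 2 * s) \<le> (u x - u y)\<^sup>2 * Q" by (rule mult_left_mono) simp
            then show ?thesis using False by (simp add: gagliardo_kernel_diag field_simps)
          qed (simp add: Q_def)
          moreover have "(u x)\<^sup>2 \<le> 2 * (u y)\<^sup>2 + 2 * (u x - u y)\<^sup>2"
          proof -
            have "0 \<le> (u x - 2 * u y)\<^sup>2" by simp
            then show ?thesis by (simp add: power2_eq_square algebra_simps)
          qed
          ultimately have "(u x)\<^sup>2 \<le> 2 * (u y)\<^sup>2 + (2 * Q) * gagliardo_kernel s u u (x, y)" by simp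
          then have "w x \<le> ennreal (2 * (u y)\<^sup>2 + (2 * Q) * gagliardo_kernel s u u (x, y))"
            unfolding w_def by (rule ennreal_leI)
          also have "\<dots> = 2 * w y + ennreal (2 * Q) * k x y"
            by (simp add: w_def k_def Q_def ennreal_plus ennreal_mult)
          finally show ?thesis using True by (simp add: B_def)
        qed simp
      qed
      also have "\<dots> = 2 * (\<integral>\<^sup>+y. B x y \<partial>lebesgue) + ennreal (2 * Q) * (\<integral>\<^sup>+y. k x y \<partial>lebesgue)"
        by (simp add: nn_integral_add nn_integral_cmult)
      finally show ?thesis .
    qed simp
    \<comment> \<open>By Tonelli each y in \<open>G\<close> is counted by the points x within
      distance r of it, a set of measure b.\<close>
    have iB: "(\<integral>\<^sup>+x. \<integral>\<^sup>+y. B x y \<partial>lebesgue \<partial>lebesgue) = ennreal b * (\<integral>\<^sup>+y. w y * indicator G y \<partial>lebesgue)"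
    proof -
      have inner: "(\<integral>\<^sup>+x. B x y \<partial>lebesgue) = ennreal b * (w y * indicator G y)" for y
      proof -
        have "B x y = (w y * indicator G y) * indicator (ball y r) x" for x
          by (auto simp: B_def indicator_def dist_commute)
        then have "(\<integral>\<^sup>+x. B x y \<partial>lebesgue) = (w y * indicator G y) * emeasure lebesgue (ball y r)"
          by (simp add: nn_integral_cmult_indicator del: emeasure_completion)
        then show ?thesis using r by (simp add: emeasure_lebesgue_ball3 b_def mult.commute del: emeasure_completion)
      qed
      have "(\<integral>\<^sup>+x. \<integral>\<^sup>+y. B x y \<partial>lebesgue \<partial>lebesgue) = (\<integral>\<^sup>+y. \<integral>\<^sup>+x. B x y \<partial>lebesgue \<partial>lebesgue)"
        using LL.Fubini[OF Bm] by simp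
      then show ?thesis unfolding inner by (simp add: nn_integral_cmult)
    qed
    have M2: "gagliardo_form s u u \<le> M\<^sup>2"
    proof -
      have "gagliardo_form s u u \<le> (nrm u)\<^sup>2" unfolding gagliardo_norm_sq[symmetric] using gagliardo_le_nrm[of u] by (intro power_mono) auto
      also have "\<dots> \<le> M\<^sup>2" using u(2) by (intro power_mono) auto
      finally show ?thesis .
    qed
    have mB: "(\<lambda>x. \<integral>\<^sup>+y. B x y \<partial>lebesgue) \<in> borel_measurable lebesgue"
      using lebesgue.borel_measurable_nn_integral_fst[OF Bm] by simp
    have mk: "(\<lambda>x. \<integral>\<^sup>+y. k x y \<partial>lebesgue) \<in> borel_measurable lebesgue"
      using lebesgue.borel_measurable_nn_integral_fst[OF km] by simp
    have "ennreal (b / 2) * (\<integral>\<^sup>+x. w x * indicator A x \<partial>lebesgue) = (\<integral>\<^sup>+x. ennreal (b / 2) * (w x * indicator A x) \<partial>lebesgue)"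
      by (rule nn_integral_cmult[symmetric]) measurable
    also have "\<dots> \<le> (\<integral>\<^sup>+x. 2 * (\<integral>\<^sup>+y. B x y \<partial>lebesgue) + ennreal (2 * Q) * (\<integral>\<^sup>+y. k x y \<partial>lebesgue) \<partial>lebesgue)"
      by (rule nn_integral_mono) (rule pw)
    also have "\<dots> = 2 * (ennreal b * (\<integral>\<^sup>+y. w y * indicator G y \<partial>lebesgue)) + ennreal (2 * Q) * ennreal (gagliardo_form s u u)"
      using mB mk by (simp add: nn_integral_add nn_integral_cmult iB gagliardo_form_iterated[OF space_HD(2)[OF u(1)]] k_def)
    also have "\<dots> \<le> 2 * (ennreal b * ennreal (M\<^sup>2 / c)) + ennreal (2 * Q) * ennreal (M\<^sup>2)"
      using G1 M2 by (intro add_mono mult_left_mono ennreal_leI) auto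
    also have "\<dots> = ennreal (b / 2 * (4 * (M\<^sup>2 / c) + 4 * Q * M\<^sup>2 / b))"
      using b c by (simp add: Q_def field_simps flip: ennreal_mult ennreal_plus ennreal_numeral)
    also have "\<dots> = ennreal (b / 2) * ennreal (4 * (M\<^sup>2 / c) + 4 * Q * M\<^sup>2 / b)"
      using b by (intro ennreal_mult') simp
    finally have A1: "(\<integral>\<^sup>+x. w x * indicator A x \<partial>lebesgue) \<le> ennreal (4 * (M\<^sup>2 / c) + 4 * Q * M\<^sup>2 / b)"
      using b by (subst (asm) ennreal_mult_le_mult_iff) auto
    \<comment> \<open>The volume b is of order r^3 while Q = r^(3 + 2 s), so the quotient gains
      r^(2s); this determined \<open>P\<close>.\<close>
    have Qb: "4 * Q * M\<^sup>2 / b = P * r powr (2 * s)"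
      using r by (simp add: Q_def b_def P_def powr_add powr_numeral field_simps)
    have "ennreal (LINT x|lebesgue. indicator {x. R \<le> norm x} x * (u x)\<^sup>2) = (\<integral>\<^sup>+x. ennreal (indicator {x. R \<le> norm x} x * (u x)\<^sup>2) \<partial>lebesgue)"
    proof (rule nn_integral_eq_integral[symmetric])
      show "integrable lebesgue (\<lambda>x. indicator {x. R \<le> norm x} x * (u x)\<^sup>2)"
        by (rule Bochner_Integration.integrable_bound[OF space_HD(4)[OF u(1)]]) (measurable, simp add: indicator_def)
    qed simp
    also have "\<dots> \<le> (\<integral>\<^sup>+x. w x * indicator A x + w x * indicator G x \<partial>lebesgue)"
      by (rule nn_integral_mono) (auto simp: indicator_def w_def A_def G_def)
    also have "\<dots> = (\<integral>\<^sup>+x. w x * indicator A x \<partial>lebesgue) + (\<integral>\<^sup>+x. w x * indicator G x \<partial>lebesgue)"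
      by (rule nn_integral_add) measurable
    also have "\<dots> \<le> ennreal (4 * (M\<^sup>2 / c) + 4 * Q * M\<^sup>2 / b) + ennreal (M\<^sup>2 / c)"
      by (intro add_mono A1 G1)
    also have "\<dots> = ennreal (5 * M\<^sup>2 / c + P * r powr (2 * s))"
      unfolding Qb using c P by (subst ennreal_plus[symmetric]) (auto simp: field_simps)
    finally have "(LINT x|lebesgue. indicator {x. R \<le> norm x} x * (u x)\<^sup>2) \<le> 5 * M\<^sup>2 / c + P * r powr (2 * s)"
      by (subst (asm) ennreal_le_iff) (use c P in simp_all)
    also have "5 * M\<^sup>2 / c \<le> e / 2" 
    proof -
      have "0 < 10 * M\<^sup>2 + 1" by (simp add: add_nonneg_pos)
      then show ?thesis using e by (simp add: c_def field_simps)
    qed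
    finally show ?thesis using rs by simp
  qed
  then show thesis by (rule that)
qed

end

context coercive_schroedinger_space
begin

lemma H_diff_bounded:
  assumes "u \<in> H" "v \<in> H" "nrm u \<le> M" "nrm v \<le> M"
  shows "(\<lambda>x. u x - v x) \<in> H" "nrm (\<lambda>x. u x - v x) \<le> 2 * M"
proof -
  show "(\<lambda>x. u x - v x) \<in> H" by (rule space_H_diff[OF assms(1,2)])
  show "nrm (\<lambda>x. u x - v x) \<le> 2 * M"
    using nrm_triangle[OF assms(1) space_H_scale[OF assms(2)], of "-1"] nrm_scale[of "-1" v] assms by simp
qed

text \<open>The square norm of a difference splits into a tail, the oscillation within cubes and
  finitely many cube averages. The radius, the side of the cubes and the index are chosen in this
  order, each making its share at most e / 4.\<close>

lemma H_L2_Cauchy: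
  assumes u: "\<And>n. u n \<in> H" and M: "\<And>n. nrm (u n) \<le> M"
    and av: "\<And>k z. convergent (\<lambda>n. LINT x|lebesgue. indicat_real (cube (1 / real (Suc k)) z) x * u n x)"
    and e: "e > 0"
  shows "\<exists>N. \<forall>m\<ge>N. \<forall>n\<ge>N. (LINT x|lebesgue. (u m x - u n x)\<^sup>2) < e"
proof -
  obtain R where R: "\<And>w. w \<in> H \<Longrightarrow> nrm w \<le> 2 * M \<Longrightarrow> (LINT x|lebesgue. indicator {x. R \<le> norm x} x * (w x)\<^sup>2) \<le> e / 4"
  proof (rule H_tail[of "e/4" "2 * M"])
    show "0 < e / 4" using e by simp
  qed (rule that)
  define B where "B = (2 * M)\<^sup>2"
  have B: "B \<ge> 0" by (simp add: B_def)
  have M0: "M \<ge> 0" using M[of 0] nrm_nonneg[of "u 0"] by linarith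
  define P where "P \<delta> = (3 * \<delta>) powr (3 + 2 * s) / (2 * \<delta> ^ 3) * B" for \<delta>
  obtain k where k: "P (1 / real (Suc k)) \<le> e / 4"
  proof -
    have Pe: "P \<delta> = 3 powr (3 + 2 * s) / 2 * B * \<delta> powr (2 * s)" if "\<delta> > 0" for \<delta>
    proof -
      have "\<delta> powr (3 + 2 * s) = \<delta> ^ 3 * \<delta> powr (2 * s)" using that by (simp add: powr_add powr_numeral)
      then show ?thesis using that by (simp add: P_def powr_mult)
    qed
    have "((\<lambda>k. 3 powr (3 + 2 * s) / 2 * B * (1 / real (Suc k)) powr (2 * s)) \<longlonglongrightarrow> 3 powr (3 + 2 * s) / 2 * B * 0 powr (2 * s))"
      using s by (intro tendsto_intros tendsto_powr' LIMSEQ_Suc lim_1_over_n) auto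
    then have "(\<lambda>k. P (1 / real (Suc k))) \<longlonglongrightarrow> 0" using s by (simp add: Pe)
    then have "\<forall>\<^sub>F k in sequentially. P (1 / real (Suc k)) < e / 4" using e by (intro order_tendstoD) auto
    then show thesis using that by (auto simp: eventually_sequentially intro: less_imp_le)
  qed
  define \<delta> where "\<delta> = 1 / real (Suc k)"
  have \<delta>: "\<delta> > 0" by (simp add: \<delta>_def)
  obtain Z where Z: "finite Z" "ball 0 R \<subseteq> (\<Union>z\<in>Z. cube \<delta> z)" using cube_cover[OF \<delta>] by blast
  define a where "a z n = (LINT x|lebesgue. indicat_real (cube \<delta> z) x * u n x)" for z n
  \<comment> \<open>Summed over \<open>Z\<close> and divided by \<delta>^3, squared differences of
    averages at most \<eta> amount to at most e / 4; the 1 covers an empty \<open>Z\<close>.\<close>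
  define \<eta> where "\<eta> = e * \<delta> ^ 3 / (4 * (real (card Z) + 1))"
  have \<eta>: "\<eta> > 0" using e \<delta> by (simp add: \<eta>_def)
  have "\<forall>z. \<exists>N. \<forall>m\<ge>N. \<forall>n\<ge>N. norm (a z m - a z n) < sqrt \<eta>"
  proof
    fix z
    have "Cauchy (a z)" using av[of k z] unfolding a_def[abs_def] \<delta>_def by (simp add: Cauchy_convergent_iff)
    then show "\<exists>N. \<forall>m\<ge>N. \<forall>n\<ge>N. norm (a z m - a z n) < sqrt \<eta>" using \<eta> by (intro CauchyD) auto
  qed
  then obtain N where N: "\<And>z m n. N z \<le> m \<Longrightarrow> N z \<le> n \<Longrightarrow> norm (a z m - a z n) < sqrt \<eta>" by metis
  define N0 where "N0 = Max (insert 0 (N ` Z))"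
  have N0: "N z \<le> N0" if "z \<in> Z" for z using that Z(1) by (simp add: N0_def)
  have "(LINT x|lebesgue. (u m x - u n x)\<^sup>2) < e" if mn: "m \<ge> N0" "n \<ge> N0" for m n
  proof -
    define w where "w x = u m x - u n x" for x
    have w: "w \<in> H" "nrm w \<le> 2 * M" unfolding w_def[abs_def] using H_diff_bounded u M by blast+
    note [measurable] = space_HD(1)[OF w(1)]
    have iQ: "integrable lebesgue (\<lambda>x. indicat_real (cube \<delta> z) x * (w x)\<^sup>2)" for z
      by (rule Bochner_Integration.integrable_bound[OF space_HD(4)[OF w(1)]]) (measurable, simp add: indicator_def)
    have tm: "{x. R \<le> norm x} \<in> sets (lebesgue :: R3 measure)"
    proof -
      have "{x \<in> space (lebesgue :: R3 measure). R \<le> norm x} \<in> sets lebesgue" by measurable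
      then show ?thesis by simp
    qed
    have iR: "integrable lebesgue (\<lambda>x. indicat_real {x. R \<le> norm x} x * (w x)\<^sup>2)"
      by (rule Bochner_Integration.integrable_bound[OF space_HD(4)[OF w(1)]]) (use tm in measurable, simp add: indicator_def)
    have uQ: "integrable lebesgue (\<lambda>x. indicat_real (cube \<delta> z) x * u n x)" for z n
    proof -
      note [measurable] = space_HD(1)[OF u]
      have iq: "integrable lebesgue (indicat_real (cube \<delta> z))"
        by (rule integrable_real_indicator) (simp_all add: measure_cube[OF \<delta>] del: emeasure_completion)
      then have i: "integrable lebesgue (\<lambda>x. indicat_real (cube \<delta> z) x + (u n x)\<^sup>2)" using space_HD(4)[OF u] by simp
      have "norm (indicat_real (cube \<delta> z) x * u n x) \<le> norm (indicat_real (cube \<delta> z) x + (u n x)\<^sup>2)" for x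
        using abs_mult_le_sq[of 1 "u n x"] by (simp add: indicator_def)
      note le = this
      show ?thesis by (rule Bochner_Integration.integrable_bound[OF i]) (measurable, use le in simp)
    qed
    have aw: "(LINT x|lebesgue. indicat_real (cube \<delta> z) x * w x) = a z m - a z n" for z
      unfolding a_def w_def right_diff_distrib by (rule Bochner_Integration.integral_diff[OF uQ uQ])
    have fw: "gagliardo_form s w w \<le> B"
    proof -
      have "gagliardo_form s w w \<le> (nrm w)\<^sup>2" unfolding gagliardo_norm_sq[symmetric] using gagliardo_le_nrm[of w] by (intro power_mono) auto
      also have "\<dots> \<le> B" unfolding B_def using w(2) by (intro power_mono) auto
      finally show ?thesis .
    qed
    have "(LINT x|lebesgue. (w x)\<^sup>2) \<le> (LINT x|lebesgue. indicat_real {x. R \<le> norm x} x * (w x)\<^sup>2 + (\<Sum>z\<in>Z. indicat_real (cube \<delta> z) x * (w x)\<^sup>2))"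
    proof (rule integral_mono)
      fix x
      have nn: "0 \<le> (\<Sum>z\<in>Z. indicat_real (cube \<delta> z) x * (w x)\<^sup>2)" by (intro sum_nonneg) simp
      show "(w x)\<^sup>2 \<le> indicat_real {x. R \<le> norm x} x * (w x)\<^sup>2 + (\<Sum>z\<in>Z. indicat_real (cube \<delta> z) x * (w x)\<^sup>2)"
      proof (cases "R \<le> norm x")
        case True then show ?thesis using nn by simp
      next
        case False
        then have "x \<in> ball 0 R" by simp
        then obtain z0 where z0: "z0 \<in> Z" "x \<in> cube \<delta> z0" using Z(2) by blast
        have "indicat_real (cube \<delta> z0) x * (w x)\<^sup>2 \<le> (\<Sum>z\<in>Z. indicat_real (cube \<delta> z) x * (w x)\<^sup>2)"
          using z0 Z(1) by (intro member_le_sum) auto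
        then show ?thesis using z0 False by simp
      qed
    qed (use iQ iR space_HD(4)[OF w(1)] in auto)
    also have "\<dots> = (LINT x|lebesgue. indicat_real {x. R \<le> norm x} x * (w x)\<^sup>2) + (\<Sum>z\<in>Z. LINT x|lebesgue. indicat_real (cube \<delta> z) x * (w x)\<^sup>2)"
      using iQ iR by simp
    also have "\<dots> \<le> e / 4 + ((3 * \<delta>) powr (3 + 2 * s) / (2 * \<delta> ^ 3) * gagliardo_form s w w
        + (\<Sum>z\<in>Z. (LINT x|lebesgue. indicator (cube \<delta> z) x * w x)\<^sup>2) / \<delta> ^ 3)"
      by (intro add_mono R w cubes_poincare \<delta> s space_HD Z)
    also have "(3 * \<delta>) powr (3 + 2 * s) / (2 * \<delta> ^ 3) * gagliardo_form s w w \<le> P \<delta>"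
      unfolding P_def using fw \<delta> by (intro mult_left_mono) auto
    also have "P \<delta> \<le> e / 4" using k by (simp add: \<delta>_def)
    also have "(\<Sum>z\<in>Z. (LINT x|lebesgue. indicator (cube \<delta> z) x * w x)\<^sup>2) / \<delta> ^ 3 \<le> (\<Sum>z\<in>Z. \<eta>) / \<delta> ^ 3"
    proof (intro divide_right_mono sum_mono)
      fix z assume z: "z \<in> Z"
      have "\<bar>a z m - a z n\<bar> \<le> sqrt \<eta>" using N[of z m n] N0[OF z] mn by simp
      then have "\<bar>a z m - a z n\<bar>\<^sup>2 \<le> (sqrt \<eta>)\<^sup>2" by (intro power_mono) auto
      then show "(LINT x|lebesgue. indicator (cube \<delta> z) x * w x)\<^sup>2 \<le> \<eta>" unfolding aw using \<eta> by simp
    qed (use \<delta> in simp)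
    also have "(\<Sum>z\<in>Z. \<eta>) / \<delta> ^ 3 \<le> e / 4"
      using \<delta> e by (simp add: \<eta>_def divide_simps)
    finally show ?thesis using e by (simp add: w_def)
  qed
  then show ?thesis by blast
qed

text \<open>All averages at the scales 1 / (k + 1) form a countable bounded family, so a diagonal
  subsequence makes them converge, which gives convergence of squares. Boundedness of the critical
  power then upgrades this to every smaller exponent.\<close>

proposition H_compact_embedding:
  fixes u :: "nat \<Rightarrow> R3 \<Rightarrow> real"
  assumes u: "\<And>n. u n \<in> H" and M: "\<And>n. nrm (u n) \<le> M"
  obtains r v where "strict_mono r" "v \<in> H" "AE x in lebesgue. (\<lambda>k. u (r k) x) \<longlonglongrightarrow> v x"
    "\<And>q. 2 \<le> q \<Longrightarrow> q < sobolev_exponent s \<Longrightarrow> (\<lambda>k. LINT x|lebesgue. \<bar>u (r k) x - v x\<bar> powr q) \<longlonglongrightarrow> 0"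
proof -
  obtain C where C: "C > 0" "\<And>u. u \<in> H \<Longrightarrow> (LINT x|lebesgue. (u x)\<^sup>2) \<le> C * (nrm u)\<^sup>2" by (rule H_L2_bound, rule that)
  have M0: "M \<ge> 0" using M[of 0] nrm_nonneg[of "u 0"] by linarith
  have b2: "(LINT x|lebesgue. (u n x)\<^sup>2) \<le> C * M\<^sup>2" for n
  proof -
    have "C * (nrm (u n))\<^sup>2 \<le> C * M\<^sup>2" using C(1) M[of n] by (intro mult_left_mono power_mono) auto
    then show ?thesis using C(2)[OF u[of n]] by linarith
  qed
  define f where "f n kz = (LINT x|lebesgue. indicat_real (cube (1 / real (Suc (fst kz))) (snd kz)) x * u n x)"
    for n and kz :: "nat \<times> int \<times> int \<times> int"
  have "norm (f n kz) \<le> 1 + C * M\<^sup>2" for n kz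
  proof -
    have "(1 / real (Suc (fst kz))) ^ 3 \<le> 1" by (intro power_le_one) auto
    moreover have "\<bar>f n kz\<bar> \<le> (1 / real (Suc (fst kz))) ^ 3 + C * M\<^sup>2"
      unfolding f_def by (rule H_averages_bounded[OF u _ b2]) simp
    ultimately show ?thesis unfolding real_norm_def by linarith
  qed
  then obtain r0 where r0: "strict_mono (r0 :: nat \<Rightarrow> nat)" "\<And>kz. \<exists>l. (\<lambda>n. f (r0 n) kz) \<longlonglongrightarrow> l"
  proof (rule function_convergent_subsequence[OF countableI_type[of UNIV], of f "1 + C * M\<^sup>2"])
    fix k :: "nat \<Rightarrow> nat"
    assume "strict_mono k" "\<And>x. x \<in> UNIV \<Longrightarrow> \<exists>l. (\<lambda>n. f (k n) x) \<longlonglongrightarrow> l"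
    then show thesis by (intro that) auto
  qed
  define g where "g n = u (r0 n)" for n
  have g: "g n \<in> H" "nrm (g n) \<le> M" for n using u M by (auto simp: g_def)
  have "convergent (\<lambda>n. LINT x|lebesgue. indicat_real (cube (1 / real (Suc k)) z) x * g n x)" for k z
    using r0(2)[of "(k, z)"] unfolding convergent_def by (simp add: f_def g_def)
  from H_L2_Cauchy[OF g this] have Cau: "e > (0::real) \<Longrightarrow> \<exists>N. \<forall>m\<ge>N. \<forall>n\<ge>N. (LINT x|lebesgue. (g m x - g n x)\<^sup>2) < e" for e .
  have gd: "(\<lambda>x. g m x - g n x) \<in> H" for m n using space_H_diff g by blast
  have p2: "\<bar>y\<bar> powr 2 = y\<^sup>2" for y :: real by simp
  obtain r1 v where r1: "strict_mono r1" "v \<in> borel_measurable lebesgue" "AE x in lebesgue. (\<lambda>k. g (r1 k) x) \<longlonglongrightarrow> v x"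
  proof (rule Lq_Cauchy_AE_subseq[of g lebesgue 2])
    show "g n \<in> borel_measurable lebesgue" for n using space_HD(1) g by blast
    show "integrable lebesgue (\<lambda>x. \<bar>g m x - g n x\<bar> powr 2)" for m n using space_HD(4)[OF gd] by (simp add: p2)
    show "\<exists>N. \<forall>m\<ge>N. \<forall>n\<ge>N. (LINT x|lebesgue. \<bar>g m x - g n x\<bar> powr 2) < e" if "e > 0" for e
      using Cau[OF that] by (simp add: p2)
  qed auto
  define h where "h k = g (r1 k)" for k
  have h: "h n \<in> H" "nrm (h n) \<le> M" for n using g by (auto simp: h_def)
  have "ip (h n) (h n) \<le> M\<^sup>2" for n using h(2)[of n] by (simp flip: nrm_sq add: power_mono)
  then have vH: "v \<in> H" and "ip v v \<le> M\<^sup>2"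
    using H_Fatou[OF h(1) r1(2) r1(3)[folded h_def], of "M\<^sup>2"] by auto
  then have "(nrm v)\<^sup>2 \<le> M\<^sup>2" by (simp add: nrm_sq)
  then have vM: "nrm v \<le> M" using M0 by (rule power2_le_imp_le)
  note [measurable] = space_HD(1)[OF h(1)] r1(2)
  have d: "(\<lambda>x. h k x - v x) \<in> H" "nrm (\<lambda>x. h k x - v x) \<le> 2 * M" for k
    using H_diff_bounded[OF h(1) vH h(2) vM] by blast+
  have L2: "(\<lambda>k. LINT x|lebesgue. (h k x - v x)\<^sup>2) \<longlonglongrightarrow> 0"
  proof (rule LIMSEQ_I)
    fix e :: real assume "e > 0"
    then obtain N where N: "\<And>m n. m \<ge> N \<Longrightarrow> n \<ge> N \<Longrightarrow> (LINT x|lebesgue. (g m x - g n x)\<^sup>2) < e / 2"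
      using Cau[of "e/2"] by auto
    have "norm ((LINT x|lebesgue. (h k x - v x)\<^sup>2) - 0) < e" if k: "k \<ge> N" for k
    proof -
      have "(LINT x|lebesgue. (h k x - v x)\<^sup>2) \<le> e / 2"
      proof (rule integral_Fatou_bound(2)[of "\<lambda>j x. (h k x - h j x)\<^sup>2"])
        show "AE x in lebesgue. (\<lambda>j. (h k x - h j x)\<^sup>2) \<longlonglongrightarrow> (h k x - v x)\<^sup>2"
          using r1(3) unfolding h_def[symmetric] by eventually_elim (intro tendsto_intros)
        show "\<forall>\<^sub>F j in sequentially. (LINT x|lebesgue. (h k x - h j x)\<^sup>2) \<le> e / 2"
          using eventually_ge_at_top[of N]
        proof eventually_elim
          case (elim j)
          then show ?case unfolding h_def using N[of "r1 k" "r1 j"] seq_suble[OF r1(1), of k] seq_suble[OF r1(1), of j] k by simp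
        qed
      qed (use space_HD(4)[OF space_H_diff[OF h(1) h(1)]] in auto)
      then show ?thesis using \<open>e > 0\<close> by simp
    qed
    then show "\<exists>N. \<forall>k\<ge>N. norm ((LINT x|lebesgue. (h k x - v x)\<^sup>2) - 0) < e" by blast
  qed
  define p where "p = sobolev_exponent s"
  have p2': "2 < p" using sobolev_exponent_gt_2 s by (simp add: p_def)
  obtain C' where C': "C' > 0" "\<And>u. u \<in> H \<Longrightarrow> integrable lebesgue (\<lambda>x. \<bar>u x\<bar> powr p)"
    "\<And>u. u \<in> H \<Longrightarrow> (LINT x|lebesgue. \<bar>u x\<bar> powr p) \<le> C' * nrm u powr p"
  proof (rule H_embedding[of p])
    show "2 \<le> p" "p \<le> sobolev_exponent s" using p2' by (simp_all add: p_def)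
  qed (rule that)
  define D where "D = C' * (2 * M) powr p"
  have D: "(LINT x|lebesgue. \<bar>h k x - v x\<bar> powr p) \<le> D" for k
  proof -
    have "C' * nrm (\<lambda>x. h k x - v x) powr p \<le> D"
      unfolding D_def using C'(1) d(2)[of k] p2' by (intro mult_left_mono powr_mono2) auto
    then show ?thesis using C'(3)[OF d(1)[of k]] by linarith
  qed
  have D0: "D \<ge> 0" using C' by (simp add: D_def)
  have "(\<lambda>k. LINT x|lebesgue. \<bar>h k x - v x\<bar> powr q) \<longlonglongrightarrow> 0" if q: "2 \<le> q" "q < p" for q
  proof -
    have C'': "integrable lebesgue (\<lambda>x. \<bar>w x\<bar> powr q)" if w: "w \<in> H" for w
    proof (rule H_embedding[of q])
      show "2 \<le> q" "q \<le> sobolev_exponent s" using q by (simp_all add: p_def)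
    qed (use w in blast)
    have bound: "(LINT x|lebesgue. \<bar>h k x - v x\<bar> powr q) \<le> \<delta> powr (q - 2) * (LINT x|lebesgue. (h k x - v x)\<^sup>2) + \<delta> powr (q - p) * D"
      if \<delta>: "\<delta> > 0" for \<delta> k
    proof -
      have "(LINT x|lebesgue. \<bar>h k x - v x\<bar> powr q) \<le> (LINT x|lebesgue. \<delta> powr (q - 2) * (h k x - v x)\<^sup>2 + \<delta> powr (q - p) * \<bar>h k x - v x\<bar> powr p)"
        using C''[OF d(1)] C'(2)[OF d(1)] space_HD(4)[OF d(1)] powr_interpolation[of "\<bar>h k x - v x\<bar>" \<delta> 2 q p for x] \<delta> q
        by (intro integral_mono) (auto simp: p2)
      also have "\<dots> = \<delta> powr (q - 2) * (LINT x|lebesgue. (h k x - v x)\<^sup>2) + \<delta> powr (q - p) * (LINT x|lebesgue. \<bar>h k x - v x\<bar> powr p)"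
        using C'(2)[OF d(1)] space_HD(4)[OF d(1)] by simp
      also have "\<dots> \<le> \<delta> powr (q - 2) * (LINT x|lebesgue. (h k x - v x)\<^sup>2) + \<delta> powr (q - p) * D"
        by (intro add_left_mono mult_left_mono D) simp
      finally show ?thesis .
    qed
    show ?thesis
    proof (rule LIMSEQ_I)
      fix e :: real assume e: "e > 0"
      \<comment> \<open>Solves \<delta>^(q - p) = e / (2 (D + 1)), so that the critical part
        contributes at most e / 2 uniformly in k.\<close>
      define \<delta> where "\<delta> = (e / (2 * (D + 1))) powr (1 / (q - p))"
      have \<delta>: "\<delta> > 0" using e D0 by (simp add: \<delta>_def)
      have "\<delta> powr (q - p) * D \<le> e / 2"
      proof -
        have "\<delta> powr (q - p) = e / (2 * (D + 1))" using q e D0 by (simp add: \<delta>_def powr_powr)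
        moreover have "e / (2 * (D + 1)) * D \<le> e / 2" using e D0 by (simp add: field_simps)
        ultimately show ?thesis by simp
      qed
      moreover have "(\<lambda>k. \<delta> powr (q - 2) * (LINT x|lebesgue. (h k x - v x)\<^sup>2)) \<longlonglongrightarrow> \<delta> powr (q - 2) * 0"
        by (intro tendsto_intros L2)
      then have "\<forall>\<^sub>F k in sequentially. \<delta> powr (q - 2) * (LINT x|lebesgue. (h k x - v x)\<^sup>2) < e / 2"
        using e by (intro order_tendstoD(2)) auto
      ultimately have "\<forall>\<^sub>F k in sequentially. norm ((LINT x|lebesgue. \<bar>h k x - v x\<bar> powr q) - 0) < e"
      proof (elim eventually_mono)
        fix k assume "\<delta> powr (q - 2) * (LINT x|lebesgue. (h k x - v x)\<^sup>2) < e / 2"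
        with bound[OF \<delta>, of k] \<open>\<delta> powr (q - p) * D \<le> e / 2\<close> have "(LINT x|lebesgue. \<bar>h k x - v x\<bar> powr q) < e" by linarith
        then show "norm ((LINT x|lebesgue. \<bar>h k x - v x\<bar> powr q) - 0) < e" by simp
      qed
      then show "\<exists>N. \<forall>k\<ge>N. norm ((LINT x|lebesgue. \<bar>h k x - v x\<bar> powr q) - 0) < e"
        by (simp add: eventually_sequentially)
    qed
  qed
  then show thesis
    using that[of "r0 \<circ> r1" v] strict_mono_o[OF r0(1) r1(1)] vH r1(3) unfolding h_def g_def p_def by simp
qed

end

section \<open>The superposition operator\<close>

text \<open>Rounding u down to multiples of 1 / (n + 1) leaves countably many values, for each of
  which measurability in x is assumed; continuity in the second variable carries it to the
  limit.\<close>

lemma caratheodory_measurable: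
  fixes g :: "'a \<Rightarrow> real \<Rightarrow> real"
  assumes [measurable]: "\<And>\<tau>. (\<lambda>x. g x \<tau>) \<in> borel_measurable M" "u \<in> borel_measurable M"
    and cont: "\<And>x. continuous_on UNIV (g x)"
  shows "(\<lambda>x. g x (u x)) \<in> borel_measurable M"
proof (rule borel_measurable_LIMSEQ_real)
  fix x
  have "(\<lambda>n. of_int \<lfloor>real (Suc n) * u x\<rfloor> / real (Suc n)) \<longlonglongrightarrow> u x"
  proof (rule tendsto_sandwich)
    show "\<forall>\<^sub>F n in sequentially. u x - 1 / real (Suc n) \<le> of_int \<lfloor>real (Suc n) * u x\<rfloor> / real (Suc n)"
    proof (intro always_eventually allI)
      fix n
      have "real (Suc n) * u x - 1 \<le> of_int \<lfloor>real (Suc n) * u x\<rfloor>" by linarith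
      then have "(real (Suc n) * u x - 1) / real (Suc n) \<le> of_int \<lfloor>real (Suc n) * u x\<rfloor> / real (Suc n)"
        by (rule divide_right_mono) simp
      then show "u x - 1 / real (Suc n) \<le> of_int \<lfloor>real (Suc n) * u x\<rfloor> / real (Suc n)"
        by (simp add: diff_divide_distrib)
    qed
    show "\<forall>\<^sub>F n in sequentially. of_int \<lfloor>real (Suc n) * u x\<rfloor> / real (Suc n) \<le> u x"
    proof (intro always_eventually allI)
      fix n
      have "of_int \<lfloor>real (Suc n) * u x\<rfloor> / real (Suc n) \<le> (real (Suc n) * u x) / real (Suc n)"
        by (rule divide_right_mono) simp_all
      then show "of_int \<lfloor>real (Suc n) * u x\<rfloor> / real (Suc n) \<le> u x" by simp
    qed
    have "(\<lambda>n. u x - 1 / real (Suc n)) \<longlonglongrightarrow> u x - 0" by (intro tendsto_intros LIMSEQ_Suc lim_1_over_n)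
    then show "(\<lambda>n. u x - 1 / real (Suc n)) \<longlonglongrightarrow> u x" by simp
  qed simp
  then show "(\<lambda>n. g x (of_int \<lfloor>real (Suc n) * u x\<rfloor> / real (Suc n))) \<longlonglongrightarrow> g x (u x)"
    using cont[of x] by (auto simp: continuous_on_eq_continuous_at intro: isCont_tendsto_compose)
next
  fix n
  have "(\<lambda>x. \<lfloor>real (Suc n) * u x\<rfloor>) \<in> measurable M (count_space UNIV)" by measurable
  then show "(\<lambda>x. g x (of_int \<lfloor>real (Suc n) * u x\<rfloor> / real (Suc n))) \<in> borel_measurable M"
    by (rule measurable_compose_countable[rotated, of _ _ "\<lambda>k x. g x (of_int k / real (Suc n))"]) simp
qed

lemma DERIV_primitive:
  assumes "continuous_on UNIV (f x)"
  shows "(primitive f x has_real_derivative f x \<tau>) (at \<tau>)"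
proof -
  define b where "b = \<bar>\<tau>\<bar> + 1"
  have "((\<lambda>u. LBINT y=ereal 0..ereal u. f x y) has_vector_derivative f x \<tau>) (at \<tau> within {-b..b})"
    by (rule interval_integral_FTC2) (auto simp: b_def intro: continuous_on_subset[OF assms])
  then have "((\<lambda>u. LBINT y=ereal 0..ereal u. f x y) has_vector_derivative f x \<tau>) (at \<tau>)"
    by (subst (asm) at_within_interior) (auto simp: b_def)
  then show ?thesis by (simp add: has_real_derivative_iff_has_vector_derivative primitive_def[abs_def])
qed

lemma primitive_0 [simp]: "primitive f x 0 = 0"
  by (simp add: primitive_def)

text \<open>Joint measurability of f, obtained from the previous principle with the second
  coordinate as the inserted function, makes the parameter integral measurable.\<close>

lemma measurable_primitive:
  fixes f :: "R3 \<Rightarrow> real \<Rightarrow> real"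
  assumes [measurable]: "\<And>\<tau>. (\<lambda>x. f x \<tau>) \<in> borel_measurable lebesgue" and cont: "\<And>x. continuous_on UNIV (f x)"
  shows "(\<lambda>x. primitive f x \<tau>) \<in> borel_measurable lebesgue"
proof -
  have m: "(\<lambda>z. f (fst z) (snd z)) \<in> borel_measurable (lebesgue \<Otimes>\<^sub>M lborel)"
  proof (rule caratheodory_measurable[of "\<lambda>z. f (fst z)" _ snd])
    show "(\<lambda>z. f (fst z) \<tau>) \<in> borel_measurable (lebesgue \<Otimes>\<^sub>M (lborel :: real measure))" for \<tau>
      by measurable
    show "snd \<in> borel_measurable (lebesgue \<Otimes>\<^sub>M (lborel :: real measure))"
      using measurable_snd[of lebesgue "lborel :: real measure"] by simp
  qed (rule cont)
  have "(\<lambda>x. LINT r:einterval (ereal a) (ereal b)|lborel. f x r) \<in> borel_measurable lebesgue" for a b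
    unfolding set_lebesgue_integral_def
  proof (rule sigma_finite_measure.borel_measurable_lebesgue_integral[OF sigma_finite_lborel])
    have [measurable]: "einterval (ereal a) (ereal b) \<in> sets lborel" by simp
    have "(\<lambda>z. indicat_real (einterval (ereal a) (ereal b)) (snd z) *\<^sub>R f (fst z) (snd z)) \<in> borel_measurable (lebesgue \<Otimes>\<^sub>M lborel)"
      using m by measurable
    then show "(\<lambda>(x, r). indicat_real (einterval (ereal a) (ereal b)) r *\<^sub>R f x r) \<in> borel_measurable (lebesgue \<Otimes>\<^sub>M lborel)"
      by (simp add: split_beta')
  qed
  then show ?thesis unfolding primitive_def interval_lebesgue_integral_def
    by (cases "ereal 0 \<le> ereal \<tau>") (simp_all add: borel_measurable_uminus)
qed

text \<open>If the integrals are summable, the sum of the functions is an integrable majorant of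
  each of them. This makes dominated convergence applicable to nonlinear expressions along fast
  subsequences.\<close>

lemma summable_dominated:
  fixes h :: "nat \<Rightarrow> 'a \<Rightarrow> real"
  assumes i: "\<And>n. integrable M (h n)" and nn: "\<And>n x. 0 \<le> h n x" and s: "summable (\<lambda>n. integral\<^sup>L M (h n))"
  obtains S where "integrable M S" "\<And>x. 0 \<le> S x" "AE x in M. (\<forall>n. h n x \<le> S x) \<and> (\<lambda>n. h n x) \<longlonglongrightarrow> 0"
proof -
  note [measurable] = borel_measurable_integrable[OF i]
  \<comment> \<open>\<open>enn2real\<close> replaces an infinite sum by 0, which happens only on a
    null set.\<close>
  define S where "S x = enn2real (\<Sum>n. ennreal (h n x))" for x
  have [measurable]: "S \<in> borel_measurable M" unfolding S_def[abs_def] by measurable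
  have "(\<integral>\<^sup>+x. (\<Sum>n. ennreal (h n x)) \<partial>M) = (\<Sum>n. \<integral>\<^sup>+x. ennreal (h n x) \<partial>M)"
    by (rule nn_integral_suminf) measurable
  also have "\<dots> = (\<Sum>n. ennreal (integral\<^sup>L M (h n)))" using i nn by (simp add: nn_integral_eq_integral)
  also have "\<dots> = ennreal (\<Sum>n. integral\<^sup>L M (h n))" using s nn by (intro suminf_ennreal2) auto
  finally have I: "(\<integral>\<^sup>+x. (\<Sum>n. ennreal (h n x)) \<partial>M) < \<infinity>" by simp
  have fin: "AE x in M. (\<Sum>n. ennreal (h n x)) \<noteq> \<infinity>"
    by (rule nn_integral_PInf_AE) (use I in auto)
  have "(\<integral>\<^sup>+x. ennreal (S x) \<partial>M) = (\<integral>\<^sup>+x. (\<Sum>n. ennreal (h n x)) \<partial>M)"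
    by (rule nn_integral_cong_AE) (use fin in eventually_elim, simp add: S_def less_top)
  then have "integrable M S" using I by (intro integrableI_bounded) (auto simp: S_def)
  moreover have "AE x in M. (\<forall>n. h n x \<le> S x) \<and> (\<lambda>n. h n x) \<longlonglongrightarrow> 0"
    using fin
  proof eventually_elim
    case (elim x)
    then have sm: "summable (\<lambda>n. h n x)" using summable_suminf_not_top[of "\<lambda>n. h n x"] nn by simp
    then have Sx: "S x = (\<Sum>n. h n x)" unfolding S_def using nn by (simp add: suminf_ennreal2 suminf_nonneg)
    have "h n x \<le> S x" for n
      unfolding Sx using sum_le_suminf[OF sm, of "{n}"] nn by simp
    then show ?case using summable_LIMSEQ_zero[OF sm] by blast
  qed
  ultimately show thesis using that[of S] by (simp add: S_def)
qed

text \<open>Weighted Young inequalities behind the differentiability of the superposition functional: the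
  remainder quotient \<open>a\<close> need only be small in \<open>L\<^sup>2\<close> plus the dual of \<open>L\<^sup>p\<^sup>+\<^sup>1\<close>.\<close>

definition young_rest :: "real \<Rightarrow> real \<Rightarrow> real \<Rightarrow> real" where
  "young_rest p \<eta> a = min (a\<^sup>2 / \<eta>) (a * (a / \<eta>) powr (1 / p))"

lemma young_rest_nonneg: "0 \<le> a \<Longrightarrow> 0 < \<eta> \<Longrightarrow> 0 \<le> young_rest p \<eta> a"
  by (simp add: young_rest_def)

text \<open>Each branch of the minimum has its own Young inequality, from the alternatives a \<le>
  \<eta> z and a \<le> \<eta> z^p; both hold, so the smaller rest may be used.\<close>

lemma young_rest_ineq:
  assumes "0 \<le> a" "0 \<le> z" "0 < \<eta>" "0 < p"
  shows "a * z \<le> \<eta> * (z\<^sup>2 + z powr (p + 1)) + young_rest p \<eta> a"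
proof -
  have 1: "a * z \<le> \<eta> * z\<^sup>2 + a\<^sup>2 / \<eta>"
  proof (cases "a \<le> \<eta> * z")
    case True
    then have "a * z \<le> \<eta> * z * z" using assms by (intro mult_right_mono) auto
    then show ?thesis using assms by (simp add: power2_eq_square mult.assoc add_increasing2)
  next
    case False
    then have "z \<le> a / \<eta>" using assms by (simp add: field_simps)
    then have "a * z \<le> a * (a / \<eta>)" using assms by (intro mult_left_mono) auto
    then show ?thesis using assms by (simp add: power2_eq_square add_increasing)
  qed
  have 2: "a * z \<le> \<eta> * z powr (p + 1) + a * (a / \<eta>) powr (1 / p)"
  proof (cases "a \<le> \<eta> * z powr p")
    case True
    then have "a * z \<le> \<eta> * z powr p * z" using assms by (intro mult_right_mono) auto
    also have "\<dots> = \<eta> * z powr (p + 1)" using assms by (simp add: powr_add)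
    finally show ?thesis using assms by (simp add: add_increasing2)
  next
    case False
    then have "z powr p \<le> a / \<eta>" using assms by (simp add: field_simps)
    then have "(z powr p) powr (1 / p) \<le> (a / \<eta>) powr (1 / p)" using assms by (intro powr_mono2) auto
    then have "z \<le> (a / \<eta>) powr (1 / p)" using assms by (simp add: powr_powr)
    then have "a * z \<le> a * (a / \<eta>) powr (1 / p)" using assms by (intro mult_left_mono) auto
    then show ?thesis using assms by (simp add: add_increasing)
  qed
  have "0 \<le> \<eta> * z\<^sup>2" "0 \<le> \<eta> * z powr (p + 1)" using assms by auto
  then show ?thesis using 1 2 unfolding young_rest_def distrib_left by linarith
qed

text \<open>The quadratic branch is used for b \<le> 1, where a \<le> 2 C b, and the other for b >
  1, where a \<le> 2 C b^p. Thus the rest is integrable as soon as b^2 and b^(p + 1) are.\<close>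

lemma young_rest_bound:
  assumes p: "1 < p" and "0 < \<eta>" "0 \<le> a" "0 \<le> b" "0 \<le> C" "a \<le> C * (b + b powr p)"
  shows "young_rest p \<eta> a \<le> ((2 * C)\<^sup>2 / \<eta> + 2 * C * (2 * C / \<eta>) powr (1 / p)) * (b\<^sup>2 + b powr (p + 1))"
proof -
  define K1 K2 where "K1 = (2 * C)\<^sup>2 / \<eta>" and "K2 = 2 * C * (2 * C / \<eta>) powr (1 / p)"
  have K: "0 \<le> K1" "0 \<le> K2" using assms by (auto simp: K1_def K2_def)
  have "young_rest p \<eta> a \<le> K1 * b\<^sup>2 + K2 * b powr (p + 1)"
  proof (cases "b \<le> 1")
    case True
    then have "b powr p \<le> b powr 1" using assms by (intro powr_mono') auto
    then have "C * (b + b powr p) \<le> C * (b + b)" using assms by (intro mult_left_mono add_left_mono) auto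
    then have "a \<le> 2 * C * b" using assms by simp
    then have "a\<^sup>2 \<le> (2 * C * b)\<^sup>2" using assms by (intro power_mono) auto
    then have "a\<^sup>2 / \<eta> \<le> K1 * b\<^sup>2" using assms by (simp add: K1_def power_mult_distrib divide_right_mono)
    moreover have "0 \<le> K2 * b powr (p + 1)" using K by simp
    ultimately show ?thesis unfolding young_rest_def by linarith
  next
    case False
    then have "b powr 1 \<le> b powr p" using assms by (intro powr_mono) auto
    then have "C * (b + b powr p) \<le> C * (b powr p + b powr p)" using assms False by (intro mult_left_mono add_right_mono) auto
    then have a: "a \<le> 2 * C * b powr p" using assms by simp
    have "(a / \<eta>) powr (1 / p) \<le> (2 * C / \<eta> * b powr p) powr (1 / p)"
      using a assms by (intro powr_mono2) (auto simp: field_simps)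
    also have "\<dots> = (2 * C / \<eta>) powr (1 / p) * (b powr p) powr (1 / p)" by (rule powr_mult)
    also have "(b powr p) powr (1 / p) = b" using assms by (simp add: powr_powr)
    finally have "a * (a / \<eta>) powr (1 / p) \<le> (2 * C * b powr p) * ((2 * C / \<eta>) powr (1 / p) * b)"
      using a assms by (intro mult_mono) auto
    also have "\<dots> = K2 * b powr (p + 1)" using assms by (simp add: K2_def powr_add)
    finally have "a * (a / \<eta>) powr (1 / p) \<le> K2 * b powr (p + 1)" .
    moreover have "0 \<le> K1 * b\<^sup>2" using K by simp
    ultimately show ?thesis unfolding young_rest_def by linarith
  qed
  also have "\<dots> \<le> (K1 + K2) * (b\<^sup>2 + b powr (p + 1))"
    using K by (simp add: distrib_left distrib_right)
  finally show ?thesis by (simp add: K1_def K2_def)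
qed

lemma young_rest_tendsto:
  assumes "0 < \<eta>" "\<And>n. 0 \<le> a n" "a \<longlonglongrightarrow> 0"
  shows "(\<lambda>n. young_rest p \<eta> (a n)) \<longlonglongrightarrow> 0"
proof (rule tendsto_sandwich)
  show "\<forall>\<^sub>F n in sequentially. 0 \<le> young_rest p \<eta> (a n)" using assms young_rest_nonneg by simp
  show "\<forall>\<^sub>F n in sequentially. young_rest p \<eta> (a n) \<le> (a n)\<^sup>2 / \<eta>" by (simp add: young_rest_def)
  have "(\<lambda>n. (a n)\<^sup>2 / \<eta>) \<longlonglongrightarrow> 0\<^sup>2 / \<eta>" using assms by (intro tendsto_intros) auto
  then show "(\<lambda>n. (a n)\<^sup>2 / \<eta>) \<longlonglongrightarrow> 0" by simp
qed simp

text \<open>Hypotheses on \<open>f\<close> in a form valid for every \<open>x\<close>; \<open>superquartic\<close> is the only one that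
  cannot be arranged by modifying \<open>f\<close> on a null set.\<close>

locale quartic_nonlinearity =
  fixes f :: "R3 \<Rightarrow> real \<Rightarrow> real" and p :: real
  assumes f_measurable: "\<And>\<tau>. (\<lambda>x. f x \<tau>) \<in> borel_measurable lebesgue"
    and f_cont: "\<And>x. continuous_on UNIV (f x)"
    and f_zero [simp]: "\<And>x. f x 0 = 0"
    and p: "1 < p"
    and growth: "\<And>\<epsilon>. \<epsilon> > 0 \<Longrightarrow> \<exists>C>0. \<forall>x \<tau>. \<bar>f x \<tau>\<bar> \<le> \<epsilon> * \<bar>\<tau>\<bar> + C * \<bar>\<tau>\<bar> powr p"
    and superquartic: "AE x in lebesgue. filterlim (\<lambda>\<tau>. primitive f x \<tau> / \<tau> ^ 4) at_top at_infinity"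
    and f_mono: "\<And>x. mono_on (UNIV - {0}) (\<lambda>\<tau>. f x \<tau> / \<bar>\<tau>\<bar> ^ 3)"
begin

abbreviation "F \<equiv> primitive f"

lemma DERIV_F: "(F x has_real_derivative f x \<tau>) (at \<tau>)"
  by (rule DERIV_primitive[OF f_cont])

lemma F_cont: "continuous_on UNIV (F x)"
  using DERIV_F by (intro DERIV_continuous_on) auto

lemma f_comp_measurable [measurable]:
  "u \<in> borel_measurable lebesgue \<Longrightarrow> (\<lambda>x. f x (u x)) \<in> borel_measurable lebesgue"
  by (rule caratheodory_measurable[OF f_measurable _ f_cont])

lemma F_comp_measurable [measurable]:
  "u \<in> borel_measurable lebesgue \<Longrightarrow> (\<lambda>x. F x (u x)) \<in> borel_measurable lebesgue"
  by (rule caratheodory_measurable[OF measurable_primitive[OF f_measurable f_cont] _ F_cont])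

text \<open>The bound on the intermediate point is symmetric, so the growth condition applies
  whatever the signs of a and h.\<close>

lemma F_mvt:
  obtains \<xi> where "\<bar>\<xi>\<bar> \<le> \<bar>a\<bar> + \<bar>h\<bar>" "F x (a + h) - F x a = h * f x \<xi>"
proof (cases "h = 0")
  case True then show ?thesis using that[of a] by simp
next
  case False
  show ?thesis
  proof (cases "h > 0")
    case True
    then obtain z where "a < z" "z < a + h" "F x (a + h) - F x a = (a + h - a) * f x z"
      using MVT2[of a "a + h" "F x" "f x"] DERIV_F by auto
    then show ?thesis using that[of z] by auto
  next
    case h: False
    then obtain z where "a + h < z" "z < a" "F x a - F x (a + h) = (a - (a + h)) * f x z"
      using MVT2[of "a + h" a "F x" "f x"] DERIV_F False by auto
    then show ?thesis using that[of z] by (auto simp: algebra_simps)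
  qed
qed

lemma F_growth:
  assumes "\<epsilon> > 0"
  obtains C where "C > 0" "\<And>x \<tau>. \<bar>f x \<tau>\<bar> \<le> \<epsilon> * \<bar>\<tau>\<bar> + C * \<bar>\<tau>\<bar> powr p"
    "\<And>x \<tau>. \<bar>f x \<tau> * \<tau>\<bar> \<le> \<epsilon> * \<tau>\<^sup>2 + C * \<bar>\<tau>\<bar> powr (p + 1)"
    "\<And>x \<tau>. \<bar>F x \<tau>\<bar> \<le> \<epsilon> * \<tau>\<^sup>2 + C * \<bar>\<tau>\<bar> powr (p + 1)"
proof -
  obtain C where C: "C > 0" "\<And>x \<tau>. \<bar>f x \<tau>\<bar> \<le> \<epsilon> * \<bar>\<tau>\<bar> + C * \<bar>\<tau>\<bar> powr p" using growth[OF assms] by blast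
  have eq: "(\<epsilon> * \<bar>\<tau>\<bar> + C * \<bar>\<tau>\<bar> powr p) * \<bar>\<tau>\<bar> = \<epsilon> * \<tau>\<^sup>2 + C * \<bar>\<tau>\<bar> powr (p + 1)" for \<tau> :: real
    by (simp add: powr_add power2_eq_square algebra_simps flip: abs_mult)
  have "\<bar>f x \<tau> * \<tau>\<bar> \<le> \<epsilon> * \<tau>\<^sup>2 + C * \<bar>\<tau>\<bar> powr (p + 1)" for x \<tau>
    unfolding abs_mult eq[symmetric] by (intro mult_right_mono C) simp
  moreover have "\<bar>F x \<tau>\<bar> \<le> \<epsilon> * \<tau>\<^sup>2 + C * \<bar>\<tau>\<bar> powr (p + 1)" for x \<tau>
  proof -
    obtain \<xi> where \<xi>: "\<bar>\<xi>\<bar> \<le> \<bar>\<tau>\<bar>" "F x \<tau> = \<tau> * f x \<xi>" using F_mvt[of 0 \<tau> x] by auto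
    have "\<bar>f x \<xi>\<bar> \<le> \<epsilon> * \<bar>\<xi>\<bar> + C * \<bar>\<xi>\<bar> powr p" by (rule C)
    also have "\<dots> \<le> \<epsilon> * \<bar>\<tau>\<bar> + C * \<bar>\<tau>\<bar> powr p"
      using \<xi> C(1) assms p by (intro add_mono mult_left_mono powr_mono2) auto
    finally have "\<bar>f x \<xi>\<bar> * \<bar>\<tau>\<bar> \<le> (\<epsilon> * \<bar>\<tau>\<bar> + C * \<bar>\<tau>\<bar> powr p) * \<bar>\<tau>\<bar>" by (rule mult_right_mono) simp
    then show ?thesis unfolding eq by (simp add: \<xi> abs_mult mult.commute)
  qed
  ultimately show thesis using that C by blast
qed

text \<open>Multiplication by r treats both signs together: for r < 0 the points \<tau> r and r are
  in reverse order, and the negative factor reverses the inequality back.\<close>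

lemma f_ray_le:
  assumes "0 \<le> \<tau>" "\<tau> \<le> 1" shows "f x (\<tau> * r) * r \<le> \<tau> ^ 3 * (f x r * r)"
proof (cases "\<tau> = 0 \<or> r = 0")
  case False
  then have \<tau>: "\<tau> > 0" and r: "r \<noteq> 0" using assms by auto
  define m where "m \<sigma> = f x \<sigma> / \<bar>\<sigma>\<bar> ^ 3" for \<sigma>
  have m: "f x \<sigma> = m \<sigma> * \<bar>\<sigma>\<bar> ^ 3" if "\<sigma> \<noteq> 0" for \<sigma> using that by (simp add: m_def)
  have "m (\<tau> * r) * r \<le> m r * r"
  proof (cases "r > 0")
    case True
    then have "m (\<tau> * r) \<le> m r"
      using mono_onD[OF f_mono[of x], of "\<tau> * r" r] assms \<tau> by (simp add: m_def mult_left_le_one_le)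
    then show ?thesis using True by (intro mult_right_mono) auto
  next
    case rn: False
    then have "m r \<le> m (\<tau> * r)"
      using mono_onD[OF f_mono[of x], of r "\<tau> * r"] assms \<tau> r mult_right_mono_neg[of \<tau> 1 r] by (simp add: m_def)
    then show ?thesis using rn by (intro mult_right_mono_neg) auto
  qed
  then have "\<bar>\<tau> * r\<bar> ^ 3 * (m (\<tau> * r) * r) \<le> \<bar>\<tau> * r\<bar> ^ 3 * (m r * r)" by (rule mult_left_mono) simp
  then show ?thesis using m[of "\<tau> * r"] m[OF r] \<tau> r by (simp add: abs_mult power_mult_distrib mult_ac)
qed auto

text \<open>The preceding inequality at the point \<tau> r with factor 1 / \<tau>.\<close>

lemma f_ray_ge:
  assumes "1 \<le> \<tau>" shows "\<tau> ^ 3 * (f x r * r) \<le> f x (\<tau> * r) * r"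
proof -
  have \<tau>: "\<tau> > 0" using assms by simp
  have "f x (1 / \<tau> * (\<tau> * r)) * (\<tau> * r) \<le> (1 / \<tau>) ^ 3 * (f x (\<tau> * r) * (\<tau> * r))"
    using assms by (intro f_ray_le) auto
  then have "f x r * (\<tau> * r) * \<tau> ^ 3 \<le> f x (\<tau> * r) * (\<tau> * r)" using \<tau> by (simp add: power_divide field_simps)
  then have "\<tau> * (\<tau> ^ 3 * (f x r * r)) \<le> \<tau> * (f x (\<tau> * r) * r)" by (simp add: mult_ac)
  then show ?thesis using \<tau> by simp
qed

text \<open>\<open>G\<close> has derivative f(\<sigma> r) r - \<sigma>^3 f(r) r, which by the two
  ray inequalities is nonpositive before \<sigma> = 1 and nonnegative after it; so 1 is a
  minimum.\<close>

lemma F_ray: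
  assumes "0 \<le> \<tau>" shows "0 \<le> (1 - \<tau> ^ 4) / 4 * (f x r * r) + F x (\<tau> * r) - F x r"
proof -
  define G where "G \<sigma> = F x (\<sigma> * r) - \<sigma> ^ 4 / 4 * (f x r * r)" for \<sigma>
  have G: "(G has_real_derivative (f x (\<sigma> * r) * r - \<sigma> ^ 3 * (f x r * r))) (at \<sigma>)" for \<sigma>
    unfolding G_def[abs_def]
    by (auto intro!: derivative_eq_intros DERIV_chain2[OF DERIV_F])
  have "G 1 \<le> G \<tau>"
  proof (cases "\<tau> \<le> 1")
    case True
    show ?thesis
    proof (rule DERIV_nonpos_imp_nonincreasing[OF True])
      fix \<sigma> assume "\<tau> \<le> \<sigma>" "\<sigma> \<le> 1"
      then have "f x (\<sigma> * r) * r - \<sigma> ^ 3 * (f x r * r) \<le> 0" using f_ray_le[of \<sigma> x r] assms by simp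
      then show "\<exists>y. (G has_real_derivative y) (at \<sigma>) \<and> y \<le> 0" using G by blast
    qed
  next
    case False
    then have "1 \<le> \<tau>" by simp
    then show ?thesis
    proof (rule DERIV_nonneg_imp_nondecreasing)
      fix \<sigma> assume "1 \<le> \<sigma>" "\<sigma> \<le> \<tau>"
      then have "0 \<le> f x (\<sigma> * r) * r - \<sigma> ^ 3 * (f x r * r)" using f_ray_ge[of \<sigma> x r] by simp
      then show "\<exists>y. (G has_real_derivative y) (at \<sigma>) \<and> 0 \<le> y" using G by blast
    qed
  qed
  then show ?thesis by (simp add: G_def field_simps)
qed

lemma AR_nonneg: "0 \<le> f x r * r / 4 - F x r"
  using F_ray[of 0 x r] by simp

lemma F_ray_ge:
  assumes "1 \<le> \<tau>" shows "\<tau> ^ 4 * F x r \<le> F x (\<tau> * r)"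
proof -
  have "0 \<le> (\<tau> ^ 4 - 1) * (f x r * r / 4 - F x r)"
    using assms AR_nonneg one_le_power[of \<tau> 4] by (intro mult_nonneg_nonneg) auto
  then show ?thesis using F_ray[of \<tau> x r] assms by (simp add: field_simps)
qed

text \<open>Shrinking along a ray decreases this quantity, which is why a projection with factor at
  most one does not raise the energy bound.\<close>

lemma AR_ray_le:
  assumes "0 \<le> \<tau>" "\<tau> \<le> 1"
  shows "f x (\<tau> * r) * (\<tau> * r) / 4 - F x (\<tau> * r) \<le> f x r * r / 4 - F x r"
proof -
  have "\<tau> * (f x (\<tau> * r) * r) \<le> \<tau> * (\<tau> ^ 3 * (f x r * r))"
    using assms by (intro mult_left_mono f_ray_le) auto
  then have "f x (\<tau> * r) * (\<tau> * r) \<le> \<tau> ^ 4 * (f x r * r)"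
    by (simp add: power_Suc[symmetric] mult_ac numeral_eq_Suc)
  then show ?thesis using F_ray[of \<tau> x r] assms by (simp add: field_simps)
qed

end

section \<open>The energy functional and its derivative\<close>

locale sp_problem = schroedinger_poisson_space s V t + coercive_schroedinger_space s V + quartic_nonlinearity f p
  for s V t f p +
  fixes lam :: real
  assumes lam: "lam > 0" and p_subcritical: "p < sobolev_exponent s - 1"
begin

abbreviation "E \<equiv> energy s t V f lam"

text \<open>In the notation of the paper \<open>DE u v\<close> is the pairing of \<open>I'(u)\<close> with \<open>v\<close>, \<open>Ne u = DE u u\<close>, and
  \<open>inter u w\<close> is the integral of \<open>\<phi>\<^sub>u w\<^sup>2\<close>, which is symmetric because it equals the Gagliardo form of the two
  potentials. Below, \<open>AR u\<close> is what \<open>f\<close> contributes to \<open>E u - Ne u / 4\<close>.\<close>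

definition fi :: "(R3 \<Rightarrow> real) \<Rightarrow> (R3 \<Rightarrow> real) \<Rightarrow> real" where
  "fi u v = (LINT x|lebesgue. f x (u x) * v x)"

definition Fi :: "(R3 \<Rightarrow> real) \<Rightarrow> real" where
  "Fi u = (LINT x|lebesgue. F x (u x))"

definition DE :: "(R3 \<Rightarrow> real) \<Rightarrow> (R3 \<Rightarrow> real) \<Rightarrow> real" where
  "DE u v = ip u v + lam * (LINT x|lebesgue. phi t u x * (u x * v x)) - fi u v"

definition Ne :: "(R3 \<Rightarrow> real) \<Rightarrow> real" where
  "Ne u = ip u u + lam * inter u u - fi u u"

lemma energy_eq: "E u = 1/2 * ip u u + lam/4 * inter u u - Fi u"
  by (simp add: energy_def nrm_sq inter_def Fi_def)

lemma DE_self: "DE u u = Ne u"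
  by (simp add: DE_def Ne_def inter_def power2_eq_square)

lemma H_Lq_bound:
  obtains C where "C > 0" "\<And>u. u \<in> H \<Longrightarrow> integrable lebesgue (\<lambda>x. (u x)\<^sup>2 + \<bar>u x\<bar> powr (p + 1))"
    "\<And>u. u \<in> H \<Longrightarrow> (LINT x|lebesgue. (u x)\<^sup>2 + \<bar>u x\<bar> powr (p + 1)) \<le> C * ((nrm u)\<^sup>2 + nrm u powr (p + 1))"
proof -
  obtain C1 where C1: "C1 > 0" "\<And>u. u \<in> H \<Longrightarrow> (LINT x|lebesgue. (u x)\<^sup>2) \<le> C1 * (nrm u)\<^sup>2" by (rule H_L2_bound, rule that)
  obtain C2 where C2: "C2 > 0" "\<And>u. u \<in> H \<Longrightarrow> integrable lebesgue (\<lambda>x. \<bar>u x\<bar> powr (p + 1))"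
    "\<And>u. u \<in> H \<Longrightarrow> (LINT x|lebesgue. \<bar>u x\<bar> powr (p + 1)) \<le> C2 * nrm u powr (p + 1)"
  proof (rule H_embedding[of "p + 1"])
    show "2 \<le> p + 1" "p + 1 \<le> sobolev_exponent s" using p p_subcritical by simp_all
  qed (rule that)
  show thesis
  proof (rule that[of "C1 + C2"])
    fix u assume u: "u \<in> H"
    show i: "integrable lebesgue (\<lambda>x. (u x)\<^sup>2 + \<bar>u x\<bar> powr (p + 1))" using C2(2)[OF u] space_HD(4)[OF u] by simp
    have "(LINT x|lebesgue. (u x)\<^sup>2 + \<bar>u x\<bar> powr (p + 1)) \<le> C1 * (nrm u)\<^sup>2 + C2 * nrm u powr (p + 1)"
      using C1(2)[OF u] C2(2,3)[OF u] space_HD(4)[OF u] by simp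
    also have "\<dots> \<le> (C1 + C2) * ((nrm u)\<^sup>2 + nrm u powr (p + 1))"
      using C1(1) C2(1) by (simp add: distrib_left distrib_right add_increasing add_increasing2)
    finally show "(LINT x|lebesgue. (u x)\<^sup>2 + \<bar>u x\<bar> powr (p + 1)) \<le> (C1 + C2) * ((nrm u)\<^sup>2 + nrm u powr (p + 1))" .
  qed (use C1 C2 in simp)
qed

text \<open>One gauge instead of two norms: it dominates \<open>f x a * b\<close> and
  \<open>F x a\<close> up to constants, satisfies a quasi-triangle inequality, and its integral
  tends to 0 exactly when those of the square and of the (p + 1)-st power do.\<close>

definition pgauge :: "real \<Rightarrow> real" where
  "pgauge \<tau> = \<tau>\<^sup>2 + \<bar>\<tau>\<bar> powr (p + 1)"

lemma pgauge_integrable: "u \<in> H \<Longrightarrow> integrable lebesgue (\<lambda>x. pgauge (u x))"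
  unfolding pgauge_def by (rule H_Lq_bound)

lemma pgauge_nonneg [simp]: "0 \<le> pgauge \<tau>" by (simp add: pgauge_def)

lemma pgauge_abs [simp]: "pgauge \<bar>\<tau>\<bar> = pgauge \<tau>" by (simp add: pgauge_def)

lemma measurable_pgauge [measurable]: "pgauge \<in> borel_measurable borel"
  unfolding pgauge_def[abs_def] by measurable

lemma pgauge_add: "pgauge (a + b) \<le> 2 powr (p + 1) * (pgauge a + pgauge b)"
proof -
  have p1: "2 powr (p + 1) \<ge> (2::real)" using powr_mono[of 1 "p + 1" "2::real"] p by simp
  have "0 \<le> (a - b)\<^sup>2" by simp
  then have "(a + b)\<^sup>2 \<le> 2 * (a\<^sup>2 + b\<^sup>2)" by (simp add: power2_diff power2_sum)
  also have "\<dots> \<le> 2 powr (p + 1) * (a\<^sup>2 + b\<^sup>2)" using p1 by (intro mult_right_mono) auto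
  finally show ?thesis using powr_abs_add_le[of "p + 1" a b] p by (simp add: pgauge_def distrib_left)
qed

lemma f_pgauge:
  obtains C where "C > 0" "\<And>x a b. \<bar>f x a * b\<bar> \<le> C * (pgauge a + pgauge b)" "\<And>x a. \<bar>F x a\<bar> \<le> C * pgauge a"
    "\<And>x a. \<bar>f x a\<bar> \<le> C * (\<bar>a\<bar> + \<bar>a\<bar> powr p)"
proof -
  obtain C where C: "C > 0" "\<And>x \<tau>. \<bar>f x \<tau>\<bar> \<le> 1 * \<bar>\<tau>\<bar> + C * \<bar>\<tau>\<bar> powr p"
    "\<And>x \<tau>. \<bar>F x \<tau>\<bar> \<le> 1 * \<tau>\<^sup>2 + C * \<bar>\<tau>\<bar> powr (p + 1)" by (rule F_growth[of 1, OF zero_less_one], rule that)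
  have le: "\<bar>f x a\<bar> \<le> (1 + C) * (\<bar>a\<bar> + \<bar>a\<bar> powr p)" for x a
  proof -
    have "0 \<le> C * \<bar>a\<bar>" "0 \<le> \<bar>a\<bar> powr p" using C(1) by simp_all
    then show ?thesis using C(2)[of x a] unfolding distrib_left distrib_right by linarith
  qed
  have "\<bar>f x a * b\<bar> \<le> (1 + C) * (pgauge a + pgauge b)" for x a b
  proof -
    define m where "m = max \<bar>a\<bar> \<bar>b\<bar>"
    have m: "\<bar>a\<bar> \<le> m" "\<bar>b\<bar> \<le> m" "0 \<le> m" by (simp_all add: m_def le_max_iff_disj)
    have "\<bar>f x a * b\<bar> \<le> (1 + C) * (\<bar>a\<bar> + \<bar>a\<bar> powr p) * \<bar>b\<bar>"
      unfolding abs_mult by (intro mult_right_mono le) simp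
    also have "\<dots> \<le> (1 + C) * (m + m powr p) * m"
      using C(1) p m by (intro mult_mono mult_left_mono add_mono powr_mono2) auto
    also have "(m + m powr p) * m = pgauge m"
      using m(3) by (simp add: pgauge_def powr_add power2_eq_square distrib_right)
    then have "(1 + C) * (m + m powr p) * m = (1 + C) * pgauge m" by (simp only: mult.assoc)
    also have "(1 + C) * pgauge m \<le> (1 + C) * (pgauge a + pgauge b)"
      using C(1) by (intro mult_left_mono) (auto simp: m_def max_def)
    finally show ?thesis .
  qed
  moreover have "\<bar>F x a\<bar> \<le> (1 + C) * pgauge a" for x a
  proof -
    have "0 \<le> C * a\<^sup>2" "0 \<le> \<bar>a\<bar> powr (p + 1)" using C(1) by simp_all
    then show ?thesis using C(3)[of x a] unfolding pgauge_def distrib_left distrib_right by linarith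
  qed
  ultimately show thesis using le C(1) by (intro that[of "1 + C"]) auto
qed

lemma f_integrable: assumes u: "u \<in> H" and v: "v \<in> H" shows "integrable lebesgue (\<lambda>x. f x (u x) * v x)"
proof -
  note [measurable] = space_HD(1)[OF u] space_HD(1)[OF v]
  obtain C where C: "C > 0" "\<And>x a b. \<bar>f x a * b\<bar> \<le> C * (pgauge a + pgauge b)" by (rule f_pgauge, rule that)
  show ?thesis
  proof (rule Bochner_Integration.integrable_bound)
    show "integrable lebesgue (\<lambda>x. C * (pgauge (u x) + pgauge (v x)))"
      using pgauge_integrable[OF u] pgauge_integrable[OF v] by (intro integrable_mult_right Bochner_Integration.integrable_add)
    show "AE x in lebesgue. norm (f x (u x) * v x) \<le> norm (C * (pgauge (u x) + pgauge (v x)))"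
      unfolding real_norm_def by (intro AE_I2 order_trans[OF C(2) abs_ge_self])
  qed measurable
qed

lemma F_integrable: assumes u: "u \<in> H" shows "integrable lebesgue (\<lambda>x. F x (u x))"
proof -
  note [measurable] = space_HD(1)[OF u]
  obtain C where C: "C > 0" "\<And>x a. \<bar>F x a\<bar> \<le> C * pgauge a" by (rule f_pgauge, rule that)
  show ?thesis
  proof (rule Bochner_Integration.integrable_bound)
    show "integrable lebesgue (\<lambda>x. C * pgauge (u x))"
      using pgauge_integrable[OF u] by (rule integrable_mult_right)
    show "AE x in lebesgue. norm (F x (u x)) \<le> norm (C * pgauge (u x))"
      unfolding real_norm_def by (intro AE_I2 order_trans[OF C(2) abs_ge_self])
  qed measurable
qed

lemma pgauge_dominated:
  assumes v: "\<And>n. v n \<in> H" and s: "summable (\<lambda>n. LINT x|lebesgue. pgauge (v n x))"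
  obtains S where "integrable lebesgue S" "\<And>x. 0 \<le> S x"
    "AE x in lebesgue. (\<forall>n. pgauge (v n x) \<le> S x) \<and> (\<lambda>n. v n x) \<longlonglongrightarrow> 0"
proof -
  obtain S where S: "integrable lebesgue S" "\<And>x. 0 \<le> S x"
    "AE x in lebesgue. (\<forall>n. pgauge (v n x) \<le> S x) \<and> (\<lambda>n. pgauge (v n x)) \<longlonglongrightarrow> 0"
    by (rule summable_dominated[OF pgauge_integrable[OF v] pgauge_nonneg s], rule that)
  have "AE x in lebesgue. (\<forall>n. pgauge (v n x) \<le> S x) \<and> (\<lambda>n. v n x) \<longlonglongrightarrow> 0"
    using S(3)
  proof eventually_elim
    case (elim x)
    then have "(\<lambda>n. sqrt (pgauge (v n x))) \<longlonglongrightarrow> sqrt 0" by (intro tendsto_intros) auto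
    then have "(\<lambda>n. sqrt (pgauge (v n x))) \<longlonglongrightarrow> 0" by simp
    then have "(\<lambda>n. v n x) \<longlonglongrightarrow> 0"
      by (rule Lim_null_comparison[rotated]) (intro always_eventually allI, simp add: real_le_rsqrt pgauge_def)
    then show ?case using elim by blast
  qed
  then show thesis using that[OF S(1,2)] by blast
qed

lemma pgauge_unit:
  obtains C where "C > 0" "\<And>u. u \<in> H \<Longrightarrow> nrm u \<le> 1 \<Longrightarrow> (LINT x|lebesgue. pgauge (u x)) \<le> C * nrm u"
proof -
  obtain C where C: "C > 0" "\<And>u. u \<in> H \<Longrightarrow> (LINT x|lebesgue. pgauge (u x)) \<le> C * ((nrm u)\<^sup>2 + nrm u powr (p + 1))"
    by (rule H_Lq_bound[folded pgauge_def], rule that)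
  have "(LINT x|lebesgue. pgauge (u x)) \<le> (2 * C) * nrm u" if u: "u \<in> H" "nrm u \<le> 1" for u
  proof -
    have "(nrm u)\<^sup>2 \<le> nrm u" using u(2) by (simp add: power2_eq_square mult_left_le)
    moreover have "nrm u powr (p + 1) \<le> nrm u powr 1" using u(2) p by (intro powr_mono') auto
    ultimately have "C * ((nrm u)\<^sup>2 + nrm u powr (p + 1)) \<le> C * (2 * nrm u)" using C(1) by (intro mult_left_mono) auto
    then show ?thesis using C(2)[OF u(1)] by simp
  qed
  then show thesis using C(1) by (intro that[of "2 * C"]) auto
qed

text \<open>A sequence of violations can be taken with geometrically small norms, so its gauges have
  a common integrable majorant. The remainder quotients then tend to 0 almost everywhere, and
  Young's inequality separates them from the normalized increment.\<close>

lemma Fi_frechet: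
  assumes u: "u \<in> H" and e: "e > 0"
  shows "\<exists>\<delta>>0. \<forall>v\<in>H. nrm v < \<delta> \<longrightarrow> \<bar>Fi (\<lambda>x. u x + v x) - Fi u - fi u v\<bar> \<le> e * nrm v"
proof (rule ccontr)
  assume neg: "\<not> ?thesis"
  obtain C0 where C0: "C0 > 0" "\<And>u. u \<in> H \<Longrightarrow> nrm u \<le> 1 \<Longrightarrow> (LINT x|lebesgue. pgauge (u x)) \<le> C0 * nrm u"
    by (rule pgauge_unit, rule that)
  obtain C where C: "C > 0" "\<And>x a. \<bar>f x a\<bar> \<le> C * (\<bar>a\<bar> + \<bar>a\<bar> powr p)" by (rule f_pgauge, rule that)
  have "\<exists>v\<in>H. nrm v < (1/2)^n \<and> e * nrm v < \<bar>Fi (\<lambda>x. u x + v x) - Fi u - fi u v\<bar>" for n :: nat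
    using neg by (metis not_le zero_less_divide_1_iff zero_less_numeral zero_less_power)
  then obtain v where v: "\<And>n. v n \<in> H" "\<And>n. nrm (v n) < (1/2)^n"
    "\<And>n. e * nrm (v n) < \<bar>Fi (\<lambda>x. u x + v n x) - Fi u - fi u (v n)\<bar>" by metis
  have uv: "(\<lambda>x. u x + v n x) \<in> H" for n by (rule space_H_add[OF u v(1)])
  note [measurable] = space_HD(1)[OF u] space_HD(1)[OF v(1)] space_HD(1)[OF uv]
  have pos: "nrm (v n) > 0" for n
  proof (rule ccontr)
    assume "\<not> nrm (v n) > 0"
    then have z: "nrm (v n) = 0" using nrm_nonneg[of "v n"] by linarith
    then have ae: "AE x in lebesgue. v n x = 0" using nrm_zero_AE[OF v(1)] by blast
    have "Fi (\<lambda>x. u x + v n x) = Fi u" unfolding Fi_def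
      by (rule integral_cong_AE) (measurable, use ae in eventually_elim, simp)
    moreover have "fi u (v n) = 0" unfolding fi_def
      by (rule integral_eq_zero_AE) (use ae in eventually_elim, simp)
    ultimately show False using v(3)[of n] z by simp
  qed
  have n1: "nrm (v n) \<le> 1" for n using v(2)[of n] power_le_one[of "1/2::real" n] by simp
  have "(LINT x|lebesgue. pgauge (v n x)) \<le> C0 * (1/2)^n" for n
    by (rule order_trans[OF C0(2)[OF v(1) n1] mult_left_mono[OF less_imp_le[OF v(2)]]]) (use C0(1) in simp)
  note le = this
  have "summable (\<lambda>n. C0 * (1/2::real)^n)" by (intro summable_mult summable_geometric) simp
  then have sm: "summable (\<lambda>n. LINT x|lebesgue. pgauge (v n x))"
    by (rule summable_comparison_test'[where N = 0]) (use le in simp)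
  obtain S where S: "integrable lebesgue S" "\<And>x. 0 \<le> S x"
    "AE x in lebesgue. (\<forall>n. pgauge (v n x) \<le> S x) \<and> (\<lambda>n. v n x) \<longlonglongrightarrow> 0"
    by (rule pgauge_dominated[of v, OF v(1) sm], rule that)
  \<comment> \<open>Where v n x = 0 the quotient is 0 by convention, in agreement with the vanishing
    remainder.\<close>
  define a where "a n x = \<bar>F x (u x + v n x) - F x (u x) - f x (u x) * v n x\<bar> / \<bar>v n x\<bar>" for n x
  have a0: "0 \<le> a n x" for n x by (simp add: a_def)
  have [measurable]: "a n \<in> borel_measurable lebesgue" for n unfolding a_def[abs_def] by measurable
  have ab: "a n x \<le> (2 * C) * ((\<bar>u x\<bar> + \<bar>v n x\<bar>) + (\<bar>u x\<bar> + \<bar>v n x\<bar>) powr p)" for n x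
  proof (cases "v n x = 0")
    case True then show ?thesis using C(1) by (simp add: a_def)
  next
    case False
    obtain \<xi> where \<xi>: "\<bar>\<xi>\<bar> \<le> \<bar>u x\<bar> + \<bar>v n x\<bar>" "F x (u x + v n x) - F x (u x) = v n x * f x \<xi>"
      using F_mvt by blast
    have "a n x = \<bar>v n x * (f x \<xi> - f x (u x))\<bar> / \<bar>v n x\<bar>" unfolding a_def \<xi>(2) by (simp add: algebra_simps)
    also have "\<dots> = \<bar>f x \<xi> - f x (u x)\<bar>" using False by (simp add: abs_mult)
    also have "\<dots> \<le> \<bar>f x \<xi>\<bar> + \<bar>f x (u x)\<bar>" by simp
    also have "\<dots> \<le> C * (\<bar>\<xi>\<bar> + \<bar>\<xi>\<bar> powr p) + C * (\<bar>u x\<bar> + \<bar>u x\<bar> powr p)" by (intro add_mono C)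
    also have "\<dots> \<le> C * ((\<bar>u x\<bar> + \<bar>v n x\<bar>) + (\<bar>u x\<bar> + \<bar>v n x\<bar>) powr p) + C * ((\<bar>u x\<bar> + \<bar>v n x\<bar>) + (\<bar>u x\<bar> + \<bar>v n x\<bar>) powr p)"
      using \<xi>(1) C(1) p by (intro add_mono mult_left_mono powr_mono2) auto
    finally show ?thesis by simp
  qed
  \<comment> \<open>The normalized increment has gauge integral at most C0, so its share is e / 4;
    together with the rest below e / 2 this stays under e.\<close>
  define \<eta> where "\<eta> = e / (4 * C0)"
  have \<eta>: "\<eta> > 0" using e C0 by (simp add: \<eta>_def)
  define K where "K = (2 * (2 * C))\<^sup>2 / \<eta> + 2 * (2 * C) * (2 * (2 * C) / \<eta>) powr (1 / p)"
  have K: "0 \<le> K" using \<eta> C by (simp add: K_def)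
  define W where "W x = K * (2 powr (p + 1) * (pgauge (u x) + S x))" for x
  have Wi: "integrable lebesgue W" unfolding W_def[abs_def]
    using pgauge_integrable[OF u] S(1) by (intro integrable_mult_right Bochner_Integration.integrable_add)
  define y where "y n x = young_rest p \<eta> (a n x)" for n x
  have [measurable]: "y n \<in> borel_measurable lebesgue" for n unfolding y_def[abs_def] young_rest_def by measurable
  have y0: "0 \<le> y n x" for n x unfolding y_def by (rule young_rest_nonneg[OF a0 \<eta>])
  have yW: "AE x in lebesgue. \<forall>n. y n x \<le> W x"
    using S(3)
  proof eventually_elim
    case (elim x)
    show ?case
    proof
      fix n
      have "y n x \<le> K * ((\<bar>u x\<bar> + \<bar>v n x\<bar>)\<^sup>2 + (\<bar>u x\<bar> + \<bar>v n x\<bar>) powr (p + 1))"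
        unfolding y_def K_def by (rule young_rest_bound[OF p \<eta> a0 _ _ ab]) (use C in auto)
      also have "\<dots> = K * pgauge (\<bar>u x\<bar> + \<bar>v n x\<bar>)" by (simp add: pgauge_def)
      also have "\<dots> \<le> K * (2 powr (p + 1) * (pgauge \<bar>u x\<bar> + pgauge \<bar>v n x\<bar>))" by (intro mult_left_mono pgauge_add K)
      also have "\<dots> \<le> W x" unfolding W_def using elim K by (intro mult_left_mono add_mono) auto
      finally show "y n x \<le> W x" .
    qed
  qed
  have ylim: "AE x in lebesgue. (\<lambda>n. y n x) \<longlonglongrightarrow> 0"
    using S(3)
  proof eventually_elim
    case (elim x)
    have "(\<lambda>n. a n x) \<longlonglongrightarrow> 0"
    proof -
      \<comment> \<open>The difference quotient is extended by 0 at h = 0, because v n x may vanish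
        for some n.\<close>
      define g where "g h = (if h = 0 then 0 else \<bar>(F x (u x + h) - F x (u x)) / h - f x (u x)\<bar>)" for h
      have "((\<lambda>h. (F x (u x + h) - F x (u x)) / h - f x (u x)) \<longlongrightarrow> 0) (at 0)"
        using DERIV_F[of x "u x"] unfolding DERIV_def by (rule LIM_zero)
      then have "((\<lambda>h. \<bar>(F x (u x + h) - F x (u x)) / h - f x (u x)\<bar>) \<longlongrightarrow> 0) (at 0)" by (rule tendsto_rabs_zero)
      then have "(g \<longlongrightarrow> 0) (at 0)" by (rule Lim_transform_eventually) (auto simp: g_def eventually_at intro!: exI[of _ 1])
      then have "isCont g 0" by (simp add: isCont_def g_def)
      then have "(\<lambda>n. g (v n x)) \<longlonglongrightarrow> g 0" using elim by (intro isCont_tendsto_compose[of 0 g]) auto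
      moreover have "g (v n x) = a n x" for n
        unfolding g_def a_def by (auto simp: diff_divide_distrib simp flip: abs_divide)
      ultimately show ?thesis by (simp add: g_def)
    qed
    then show ?case unfolding y_def by (intro young_rest_tendsto \<eta> a0)
  qed
  have ynW: "AE x in lebesgue. norm (y n x) \<le> W x" for n using yW by eventually_elim (simp add: y0)
  have "(\<lambda>n. LINT x|lebesgue. y n x) \<longlonglongrightarrow> (LINT x|(lebesgue :: R3 measure). (0::real))"
  proof (rule integral_dominated_convergence)
    show "integrable lebesgue W" by (rule Wi)
    show "AE x in lebesgue. (\<lambda>n. y n x) \<longlonglongrightarrow> 0" by (rule ylim)
    show "AE x in lebesgue. norm (y n x) \<le> W x" for n by (rule ynW)
  qed measurable
  then have "\<forall>\<^sub>F n in sequentially. (LINT x|lebesgue. y n x) < e / 2" using e by (intro order_tendstoD(2)) auto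
  then obtain n where n: "(LINT x|lebesgue. y n x) < e / 2" by (auto simp: eventually_sequentially)
  have yi: "integrable lebesgue (y n)"
    by (rule Bochner_Integration.integrable_bound[OF Wi]) (measurable, use ynW[of n] in \<open>auto elim!: eventually_mono\<close>)
  define z where "z x = (1 / nrm (v n)) * v n x" for x
  have z: "z \<in> H" "nrm z = 1" using pos[of n] unfolding z_def[abs_def] by (simp_all only: space_H_scale[OF v(1)] nrm_scale) simp
  have [measurable]: "z \<in> borel_measurable lebesgue" by (rule space_HD(1)[OF z(1)])
  have pt: "\<bar>F x (u x + v n x) - F x (u x) - f x (u x) * v n x\<bar> \<le> nrm (v n) * (\<eta> * pgauge (z x) + y n x)" for x
  proof -
    have "\<bar>F x (u x + v n x) - F x (u x) - f x (u x) * v n x\<bar> = nrm (v n) * (a n x * \<bar>z x\<bar>)"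
      using pos[of n] by (cases "v n x = 0") (auto simp: a_def z_def abs_mult)
    also have "a n x * \<bar>z x\<bar> \<le> \<eta> * (\<bar>z x\<bar>\<^sup>2 + \<bar>z x\<bar> powr (p + 1)) + y n x"
      unfolding y_def using p by (intro young_rest_ineq a0 \<eta>) auto
    finally show ?thesis using pos[of n] by (simp add: mult_left_mono pgauge_def)
  qed
  have i1: "integrable lebesgue (\<lambda>x. F x (u x + v n x) - F x (u x) - f x (u x) * v n x)"
    using F_integrable[OF uv] F_integrable[OF u] f_integrable[OF u v(1)] by simp
  have i2: "integrable lebesgue (\<lambda>x. nrm (v n) * (\<eta> * pgauge (z x) + y n x))"
    using pgauge_integrable[OF z(1)] yi by (intro integrable_mult_right Bochner_Integration.integrable_add)
  have "Fi (\<lambda>x. u x + v n x) - Fi u - fi u (v n) = (LINT x|lebesgue. F x (u x + v n x) - F x (u x) - f x (u x) * v n x)"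
    using F_integrable[OF uv] F_integrable[OF u] f_integrable[OF u v(1)] by (simp add: Fi_def fi_def)
  then have "\<bar>Fi (\<lambda>x. u x + v n x) - Fi u - fi u (v n)\<bar> \<le> (LINT x|lebesgue. \<bar>F x (u x + v n x) - F x (u x) - f x (u x) * v n x\<bar>)"
    using integral_abs_bound by simp
  also have "\<dots> \<le> (LINT x|lebesgue. nrm (v n) * (\<eta> * pgauge (z x) + y n x))"
    by (rule integral_mono) (use i1 i2 pt in auto)
  also have "\<dots> = nrm (v n) * (LINT x|lebesgue. \<eta> * pgauge (z x) + y n x)" by (rule integral_mult_right_zero)
  also have "(LINT x|lebesgue. \<eta> * pgauge (z x) + y n x) = (LINT x|lebesgue. \<eta> * pgauge (z x)) + (LINT x|lebesgue. y n x)"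
    by (rule Bochner_Integration.integral_add[OF integrable_mult_right[OF pgauge_integrable[OF z(1)]] yi])
  also have "(LINT x|lebesgue. \<eta> * pgauge (z x)) = \<eta> * (LINT x|lebesgue. pgauge (z x))" by (rule integral_mult_right_zero)
  also have "nrm (v n) * (\<eta> * (LINT x|lebesgue. pgauge (z x)) + (LINT x|lebesgue. y n x)) \<le> nrm (v n) * e"
  proof (rule mult_left_mono)
    have "(LINT x|lebesgue. pgauge (z x)) \<le> C0" using C0(2)[OF z(1)] z(2) by simp
    then have "\<eta> * (LINT x|lebesgue. pgauge (z x)) \<le> \<eta> * C0" using \<eta> by simp
    also have "\<dots> = e / 4" using C0(1) by (simp add: \<eta>_def)
    finally show "\<eta> * (LINT x|lebesgue. pgauge (z x)) + (LINT x|lebesgue. y n x) \<le> e" using n e by linarith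
  qed simp
  finally show False using v(3)[of n] by (simp add: mult.commute)
qed


lemma fi_bound:
  assumes u: "u \<in> H"
  obtains K where "K \<ge> 0" "\<And>v. v \<in> H \<Longrightarrow> \<bar>fi u v\<bar> \<le> K * nrm v"
proof -
  obtain C0 where C0: "C0 > 0" "\<And>u. u \<in> H \<Longrightarrow> nrm u \<le> 1 \<Longrightarrow> (LINT x|lebesgue. pgauge (u x)) \<le> C0 * nrm u"
    by (rule pgauge_unit, rule that)
  obtain C where C: "C > 0" "\<And>x a b. \<bar>f x a * b\<bar> \<le> C * (pgauge a + pgauge b)" by (rule f_pgauge, rule that)
  define K where "K = C * ((LINT x|lebesgue. pgauge (u x)) + C0)"
  have K: "K \<ge> 0" using C C0 by (simp add: K_def)
  have unit: "\<bar>fi u v\<bar> \<le> K" if v: "v \<in> H" "nrm v = 1" for v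
  proof -
    have "\<bar>fi u v\<bar> \<le> (LINT x|lebesgue. \<bar>f x (u x) * v x\<bar>)" unfolding fi_def by (rule integral_abs_bound)
    also have "\<dots> \<le> (LINT x|lebesgue. C * (pgauge (u x) + pgauge (v x)))"
      by (rule integral_mono) (use f_integrable[OF u v(1)] pgauge_integrable[OF u] pgauge_integrable[OF v(1)] C in auto)
    also have "\<dots> = C * ((LINT x|lebesgue. pgauge (u x)) + (LINT x|lebesgue. pgauge (v x)))"
      using pgauge_integrable[OF u] pgauge_integrable[OF v(1)] by simp
    also have "\<dots> \<le> K" unfolding K_def using C0(2)[OF v(1)] v(2) C(1) by simp
    finally show ?thesis .
  qed
  have "\<bar>fi u v\<bar> \<le> K * nrm v" if v: "v \<in> H" for v
  proof (cases "nrm v = 0")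
    case True
    then have ae: "AE x in lebesgue. v x = 0" using nrm_zero_AE[OF v] by blast
    have "fi u v = 0" unfolding fi_def by (rule integral_eq_zero_AE) (use ae in eventually_elim, simp)
    then show ?thesis using True by simp
  next
    case False
    then have N: "nrm v > 0" using nrm_nonneg[of v] by linarith
    have "\<bar>fi u (\<lambda>x. (1 / nrm v) * v x)\<bar> \<le> K"
      by (rule unit[OF space_H_scale[OF v]]) (simp only: nrm_scale, use N in simp)
    moreover have "fi u (\<lambda>x. (1 / nrm v) * v x) = (1 / nrm v) * fi u v"
    proof -
      have eq: "f x (u x) * (c * v x) = c * (f x (u x) * v x)" for c x by simp
      show ?thesis unfolding fi_def eq by (rule integral_mult_right_zero)
    qed
    ultimately have "\<bar>(1 / nrm v) * fi u v\<bar> \<le> K" by (simp only:)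
    then show ?thesis using N by (simp add: abs_mult field_simps)
  qed
  then show thesis using K that by blast
qed

text \<open>By \<open>inter_expand\<close> the increment consists of the square of the difference of
  potentials and twice the change of \<open>inter u\<close>. Only twice the doubled mixed term is
  linear in v, whence the factor 4.\<close>

lemma inter_remainder:
  assumes u: "u \<in> H" and v: "v \<in> H"
  shows "\<bar>inter (\<lambda>x. u x + v x) (\<lambda>x. u x + v x) - inter u u - 4 * (LINT x|lebesgue. phi t u x * (u x * v x))\<bar>
    \<le> (KT * nrm v * (2 * nrm u + nrm v))\<^sup>2 + 2 * (KT\<^sup>2 * (nrm u)\<^sup>2 * nrm v * nrm v)"
proof -
  let ?w = "\<lambda>x. u x + v x"
  let ?d = "\<lambda>x. phi t ?w x - phi t u x"
  have w: "?w \<in> H" by (rule space_H_add[OF u v])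
  have "inter u ?w - inter u u = (LINT x|lebesgue. phi t u x * (?w x)\<^sup>2 - phi t u x * (u x)\<^sup>2)"
    using phi_integrable_sq[OF u w] phi_integrable_sq[OF u u] by (simp add: inter_def)
  also have "\<dots> = (LINT x|lebesgue. 2 * (phi t u x * (u x * v x)) + phi t u x * (v x * v x))"
    by (rule Bochner_Integration.integral_cong) (auto simp: power2_eq_square algebra_simps)
  also have "\<dots> = 2 * (LINT x|lebesgue. phi t u x * (u x * v x)) + (LINT x|lebesgue. phi t u x * (v x * v x))"
    using phi_integrable[OF u u v] phi_integrable[OF u v v] by simp
  finally have "inter ?w ?w - inter u u - 4 * (LINT x|lebesgue. phi t u x * (u x * v x))
     = gagliardo_form t ?d ?d + 2 * (LINT x|lebesgue. phi t u x * (v x * v x))"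
    using inter_expand[OF u w] by simp
  moreover have "gagliardo_form t ?d ?d \<le> (KT * nrm v * (2 * nrm u + nrm v))\<^sup>2"
    unfolding gagliardo_norm_sq[symmetric] by (intro power_mono phi_diff_norm u v) simp
  moreover have "0 \<le> gagliardo_form t ?d ?d" by simp
  moreover have "\<bar>LINT x|lebesgue. phi t u x * (v x * v x)\<bar> \<le> KT\<^sup>2 * (nrm u)\<^sup>2 * nrm v * nrm v"
    by (rule phi_trilinear_le[OF u v v])
  ultimately show ?thesis by linarith
qed

proposition energy_has_derivative:
  assumes u: "u \<in> H"
  shows "has_derivative_H s V E (DE u) u"
  unfolding has_derivative_H_def
proof (intro conjI ballI allI impI)
  fix v w a b assume v: "v \<in> H" and w: "w \<in> H"
  have "(LINT x|lebesgue. phi t u x * (u x * (a * v x + b * w x))) = (LINT x|lebesgue. a * (phi t u x * (u x * v x)) + b * (phi t u x * (u x * w x)))"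
    by (rule Bochner_Integration.integral_cong) (auto simp: algebra_simps)
  then have 1: "(LINT x|lebesgue. phi t u x * (u x * (a * v x + b * w x))) = a * (LINT x|lebesgue. phi t u x * (u x * v x)) + b * (LINT x|lebesgue. phi t u x * (u x * w x))"
    using phi_integrable[OF u u v] phi_integrable[OF u u w] by simp
  have "fi u (\<lambda>x. a * v x + b * w x) = (LINT x|lebesgue. a * (f x (u x) * v x) + b * (f x (u x) * w x))"
    unfolding fi_def by (rule Bochner_Integration.integral_cong) (auto simp: algebra_simps)
  then have 2: "fi u (\<lambda>x. a * v x + b * w x) = a * fi u v + b * fi u w"
    using f_integrable[OF u v] f_integrable[OF u w] by (simp add: fi_def)
  have 3: "ip u (\<lambda>x. a * v x + b * w x) = a * ip u v + b * ip u w"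
    using ip_lin[OF v w u] by (simp add: ip_commute)
  show "DE u (\<lambda>x. a * v x + b * w x) = a * DE u v + b * DE u w"
    unfolding DE_def 1 2 3 by (simp add: algebra_simps)
next
  obtain K where K: "K \<ge> 0" "\<And>v. v \<in> H \<Longrightarrow> \<bar>fi u v\<bar> \<le> K * nrm v" by (rule fi_bound[OF u], rule that)
  show "\<exists>K. \<forall>v\<in>H. \<bar>DE u v\<bar> \<le> K * nrm v"
  proof (intro exI ballI)
    fix v assume v: "v \<in> H"
    have "\<bar>DE u v\<bar> \<le> \<bar>ip u v\<bar> + lam * \<bar>LINT x|lebesgue. phi t u x * (u x * v x)\<bar> + \<bar>fi u v\<bar>"
      unfolding DE_def using abs_triangle_ineq[of "ip u v" "lam * (LINT x|lebesgue. phi t u x * (u x * v x))"] lam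
        abs_triangle_ineq4[of "ip u v + lam * (LINT x|lebesgue. phi t u x * (u x * v x))" "fi u v"]
      by (simp add: abs_mult)
    also have "\<dots> \<le> nrm u * nrm v + lam * (KT\<^sup>2 * (nrm u)\<^sup>2 * nrm u * nrm v) + K * nrm v"
      using lam by (intro add_mono mult_left_mono ip_CS phi_trilinear_le K u v) auto
    also have "\<dots> = (nrm u + lam * (KT\<^sup>2 * (nrm u)\<^sup>2 * nrm u) + K) * nrm v" by (simp add: algebra_simps)
    finally show "\<bar>DE u v\<bar> \<le> (nrm u + lam * (KT\<^sup>2 * (nrm u)\<^sup>2 * nrm u) + K) * nrm v" .
  qed
next
  fix e :: real assume e: "e > 0"
  obtain \<delta>1 where \<delta>1: "\<delta>1 > 0" "\<And>v. v \<in> H \<Longrightarrow> nrm v < \<delta>1 \<Longrightarrow> \<bar>Fi (\<lambda>x. u x + v x) - Fi u - fi u v\<bar> \<le> e / 2 * nrm v"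
    using Fi_frechet[OF u, of "e/2"] e by auto
  define U where "U = nrm u"
  \<comment> \<open>The quadratic remainder is at most B n^2 for n \<le> 1, and n \<le> e / (2 B)
    turns this into e / 2 times n.\<close>
  define B where "B = 1/2 + lam/4 * ((KT * (2 * U + 1))\<^sup>2 + 2 * (KT\<^sup>2 * U\<^sup>2))"
  have B: "B > 0" unfolding B_def using lam by (intro add_pos_nonneg mult_nonneg_nonneg add_nonneg_nonneg) auto
  define \<delta> where "\<delta> = min \<delta>1 (min 1 (e / (2 * B)))"
  have \<delta>: "\<delta> > 0" using \<delta>1 e B by (simp add: \<delta>_def)
  show "\<exists>\<delta>>0. \<forall>v\<in>H. nrm v < \<delta> \<longrightarrow> \<bar>E (\<lambda>x. u x + v x) - E u - DE u v\<bar> \<le> e * nrm v"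
  proof (intro exI[of _ \<delta>] conjI ballI impI \<delta>)
    fix v assume v: "v \<in> H" and small: "nrm v < \<delta>"
    define n where "n = nrm v"
    have n: "0 \<le> n" "n \<le> 1" "n \<le> e / (2 * B)" "n < \<delta>1" using small by (auto simp: n_def \<delta>_def)
    let ?w = "\<lambda>x. u x + v x"
    define R1 where "R1 = inter ?w ?w - inter u u - 4 * (LINT x|lebesgue. phi t u x * (u x * v x))"
    define R2 where "R2 = Fi ?w - Fi u - fi u v"
    have eq: "E ?w - E u - DE u v = 1/2 * n\<^sup>2 + lam/4 * R1 - R2"
      unfolding energy_eq DE_def R1_def R2_def n_def nrm_sq
      using ip_lin2[OF u v, of 1 1] by (simp add: algebra_simps)
    have "\<bar>R1\<bar> \<le> (KT * n * (2 * U + n))\<^sup>2 + 2 * (KT\<^sup>2 * U\<^sup>2 * n * n)"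
      unfolding R1_def n_def U_def by (rule inter_remainder[OF u v])
    also have "\<dots> = ((KT * (2 * U + n))\<^sup>2 + 2 * (KT\<^sup>2 * U\<^sup>2)) * n\<^sup>2"
      by (simp add: power2_eq_square algebra_simps)
    also have "\<dots> \<le> ((KT * (2 * U + 1))\<^sup>2 + 2 * (KT\<^sup>2 * U\<^sup>2)) * n\<^sup>2"
      using n KT_pos by (intro mult_right_mono add_right_mono power_mono mult_left_mono) (auto simp: U_def)
    finally have "lam/4 * \<bar>R1\<bar> \<le> lam/4 * (((KT * (2 * U + 1))\<^sup>2 + 2 * (KT\<^sup>2 * U\<^sup>2)) * n\<^sup>2)"
      using lam by (intro mult_left_mono) auto
    then have "1/2 * n\<^sup>2 + lam/4 * \<bar>R1\<bar> \<le> B * n\<^sup>2" unfolding B_def by (simp add: algebra_simps)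
    also have "\<dots> \<le> (B * (e / (2 * B))) * n"
      using n B by (simp only: power2_eq_square mult.assoc[symmetric]) (intro mult_right_mono mult_left_mono, auto)
    also have "\<dots> = e / 2 * n" using B by simp
    finally have "1/2 * n\<^sup>2 + lam/4 * \<bar>R1\<bar> \<le> e / 2 * n" .
    moreover have "\<bar>R2\<bar> \<le> e / 2 * n" unfolding R2_def n_def by (rule \<delta>1(2)[OF v]) (use n in \<open>simp add: n_def\<close>)
    moreover have "\<bar>lam/4 * R1\<bar> = lam/4 * \<bar>R1\<bar>" using lam by (simp add: abs_mult)
    moreover have "0 \<le> n\<^sup>2" by simp
    ultimately have "\<bar>1/2 * n\<^sup>2 + lam/4 * R1 - R2\<bar> \<le> e * n" by linarith
    then show "\<bar>E ?w - E u - DE u v\<bar> \<le> e * nrm v" unfolding eq by (simp add: n_def)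
  qed
qed

text \<open>The Nehari condition speaks of some derivative; uniqueness identifies it with
  \<open>DE u\<close>. Scaling v into the region where both remainders are small bounds the
  difference by an arbitrarily small multiple of its argument.\<close>

lemma has_derivative_H_unique:
  assumes L: "has_derivative_H s V J L u" and L': "has_derivative_H s V J L' u" and v: "v \<in> H"
  shows "L v = L' v"
proof (rule ccontr)
  assume ne: "L v \<noteq> L' v"
  \<comment> \<open>Makes 2 e nrm v at most half of |L v - L' v|; the 1 allows nrm v = 0.\<close>
  define e where "e = \<bar>L v - L' v\<bar> / (4 * (nrm v + 1))"
  have e: "e > 0" using ne by (simp add: e_def add_nonneg_pos)
  obtain \<delta>1 where 1: "\<delta>1 > 0" "\<And>w. w \<in> H \<Longrightarrow> nrm w < \<delta>1 \<Longrightarrow> \<bar>J (\<lambda>x. u x + w x) - J u - L w\<bar> \<le> e * nrm w"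
    using L e unfolding has_derivative_H_def by meson
  obtain \<delta>2 where 2: "\<delta>2 > 0" "\<And>w. w \<in> H \<Longrightarrow> nrm w < \<delta>2 \<Longrightarrow> \<bar>J (\<lambda>x. u x + w x) - J u - L' w\<bar> \<le> e * nrm w"
    using L' e unfolding has_derivative_H_def by meson
  define c where "c = min \<delta>1 \<delta>2 / (2 * (nrm v + 1))"
  have n1: "nrm v + 1 > 0" by (simp add: add_nonneg_pos)
  have c: "c > 0" using 1 2 n1 by (simp add: c_def)
  define w where "w x = c * v x" for x
  have w: "w \<in> H" unfolding w_def[abs_def] by (rule space_H_scale[OF v])
  have nw: "nrm w = c * nrm v" unfolding w_def[abs_def] nrm_scale using c by simp
  have "c * nrm v < c * (nrm v + 1) * 2" using c n1 by simp
  also have "c * (nrm v + 1) * 2 = min \<delta>1 \<delta>2"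
  proof -
    have "m / (2 * N) * N * 2 = m" if "N > 0" for m N :: real using that by simp
    from this[OF n1] show ?thesis unfolding c_def .
  qed
  finally have small: "nrm w < \<delta>1" "nrm w < \<delta>2" by (simp_all add: nw)
  have "L (\<lambda>x. c * v x + 0 * v x) = c * L v + 0 * L v" "L' (\<lambda>x. c * v x + 0 * v x) = c * L' v + 0 * L' v"
    using L L' v unfolding has_derivative_H_def by blast+
  then have lw: "L w = c * L v" "L' w = c * L' v" by (simp_all add: w_def[abs_def])
  have "\<bar>L w - L' w\<bar> \<le> 2 * e * nrm w" using 1(2)[OF w small(1)] 2(2)[OF w small(2)] by linarith
  then have "c * \<bar>L v - L' v\<bar> \<le> c * (2 * e * nrm v)"
    unfolding lw nw using c by (simp add: abs_mult mult_ac flip: right_diff_distrib)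
  then have "\<bar>L v - L' v\<bar> \<le> 2 * e * nrm v" using c by simp
  also have "\<dots> \<le> 2 * e * (nrm v + 1)" using e by simp
  also have "\<dots> = \<bar>L v - L' v\<bar> / 2"
  proof -
    have "2 * (d / (4 * N)) * N = d / 2" if "N > 0" for d N :: real using that by simp
    from this[OF n1] show ?thesis unfolding e_def .
  qed
  finally show False using ne by simp
qed

lemma nehari_iff:
  "u \<in> nehari s t V f lam \<longleftrightarrow> u \<in> H \<and> nrm u > 0 \<and> Ne u = 0"
proof -
  have pos: "nrm u > 0 \<longleftrightarrow> nrm u \<noteq> 0" using nrm_nonneg[of u] by linarith
  have "(\<exists>L. has_derivative_H s V E L u \<and> L u = 0) \<longleftrightarrow> Ne u = 0" if u: "u \<in> H"
  proof
    assume "\<exists>L. has_derivative_H s V E L u \<and> L u = 0"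
    then obtain L where L: "has_derivative_H s V E L u" "L u = 0" by blast
    from has_derivative_H_unique[OF L(1) energy_has_derivative[OF u] u] show "Ne u = 0" using L(2) by (simp add: DE_self)
  next
    assume "Ne u = 0"
    then show "\<exists>L. has_derivative_H s V E L u \<and> L u = 0" using energy_has_derivative[OF u] DE_self by metis
  qed
  then show ?thesis unfolding nehari_def pos using nrm_zero_AE by auto
qed


section \<open>The Nehari set\<close>

lemma fi_scale: "fi (\<lambda>x. \<tau> * u x) (\<lambda>x. \<tau> * u x) = \<tau> * (LINT x|lebesgue. f x (\<tau> * u x) * u x)"
proof -
  have eq: "f x (\<tau> * u x) * (\<tau> * u x) = \<tau> * (f x (\<tau> * u x) * u x)" for x by simp
  show ?thesis unfolding fi_def eq by (rule integral_mult_right_zero)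
qed

lemma Ne_scale: "u \<in> H \<Longrightarrow> Ne (\<lambda>x. \<tau> * u x) = \<tau>\<^sup>2 * ip u u + lam * (\<tau> ^ 4 * inter u u) - fi (\<lambda>x. \<tau> * u x) (\<lambda>x. \<tau> * u x)"
  by (simp add: Ne_def ip_scale2 inter_scale)

lemma E_scale: "u \<in> H \<Longrightarrow> E (\<lambda>x. \<tau> * u x) = 1/2 * (\<tau>\<^sup>2 * ip u u) + lam/4 * (\<tau> ^ 4 * inter u u) - Fi (\<lambda>x. \<tau> * u x)"
  by (simp add: energy_eq ip_scale2 inter_scale)

definition AR :: "(R3 \<Rightarrow> real) \<Rightarrow> real" where
  "AR u = (LINT x|lebesgue. f x (u x) * u x / 4 - F x (u x))"

lemma AR_integrable: "u \<in> H \<Longrightarrow> integrable lebesgue (\<lambda>x. f x (u x) * u x / 4 - F x (u x))"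
  using f_integrable[of u u] F_integrable[of u] by simp

lemma AR_eq: "u \<in> H \<Longrightarrow> AR u = fi u u / 4 - Fi u"
  using f_integrable[of u u] F_integrable[of u] by (simp add: AR_def fi_def Fi_def)

lemma AR_integral_nonneg: "0 \<le> AR u"
  unfolding AR_def by (intro Bochner_Integration.integral_nonneg AR_nonneg)

text \<open>A quarter of \<open>Ne\<close> cancels the Poisson term. On the Nehari set both
  remaining terms are nonnegative, so bounded energy bounds the norm.\<close>

lemma E_AR: "u \<in> H \<Longrightarrow> E u = ip u u / 4 + AR u + Ne u / 4"
  by (simp add: AR_eq energy_eq Ne_def field_simps)

lemma Fi_ray:
  assumes u: "u \<in> H" and \<tau>: "0 \<le> \<tau>"
  shows "0 \<le> (1 - \<tau> ^ 4) / 4 * fi u u + Fi (\<lambda>x. \<tau> * u x) - Fi u"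
proof -
  have "0 \<le> (LINT x|lebesgue. (1 - \<tau> ^ 4) / 4 * (f x (u x) * u x) + F x (\<tau> * u x) - F x (u x))"
    by (intro Bochner_Integration.integral_nonneg F_ray[OF \<tau>])
  also have "\<dots> = (1 - \<tau> ^ 4) / 4 * fi u u + Fi (\<lambda>x. \<tau> * u x) - Fi u"
    using f_integrable[OF u u] F_integrable[OF u] F_integrable[OF space_H_scale[OF u]]
    by (simp add: fi_def Fi_def del: times_divide_eq_left)
  finally show ?thesis .
qed

text \<open>Combine \<open>Fi_ray\<close> with the identity 1/2 - \<tau>^2 / 2 - (1 - \<tau>^4) / 4
  = (1 - \<tau>^2)^2 / 4. When \<open>Ne u = 0\<close> the energy on the ray is at most its value at
  u.\<close>

lemma E_ray:
  assumes u: "u \<in> H" and \<tau>: "0 \<le> \<tau>"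
  shows "E (\<lambda>x. \<tau> * u x) + (1 - \<tau>\<^sup>2)\<^sup>2 / 4 * ip u u + (1 - \<tau> ^ 4) / 4 * Ne u \<le> E u"
proof -
  have eq: "(1 - \<tau>\<^sup>2)\<^sup>2 = 1 - 2 * \<tau>\<^sup>2 + \<tau> ^ 4" by (simp add: power2_diff flip: power_mult)
  show ?thesis using Fi_ray[OF u \<tau>] unfolding E_scale[OF u] energy_eq Ne_def eq
    by (simp add: field_simps)
qed

lemma AR_scale_le:
  assumes u: "u \<in> H" and \<tau>: "0 \<le> \<tau>" "\<tau> \<le> 1"
  shows "AR (\<lambda>x. \<tau> * u x) \<le> AR u"
  unfolding AR_def by (rule integral_mono[OF AR_integrable[OF space_H_scale[OF u]] AR_integrable[OF u] AR_ray_le[OF \<tau>]])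

lemma Ne_pos_small:
  obtains \<rho> where "\<rho> > 0" "\<And>u. u \<in> H \<Longrightarrow> 0 < nrm u \<Longrightarrow> nrm u < \<rho> \<Longrightarrow> Ne u > 0"
proof -
  obtain C1 where C1: "C1 > 0" "\<And>u. u \<in> H \<Longrightarrow> (LINT x|lebesgue. (u x)\<^sup>2) \<le> C1 * (nrm u)\<^sup>2" by (rule H_L2_bound, rule that)
  obtain C2 where C2: "C2 > 0" "\<And>u. u \<in> H \<Longrightarrow> integrable lebesgue (\<lambda>x. \<bar>u x\<bar> powr (p + 1))"
    "\<And>u. u \<in> H \<Longrightarrow> (LINT x|lebesgue. \<bar>u x\<bar> powr (p + 1)) \<le> C2 * nrm u powr (p + 1)"
  proof (rule H_embedding[of "p + 1"])
    show "2 \<le> p + 1" "p + 1 \<le> sobolev_exponent s" using p p_subcritical by simp_all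
  qed (rule that)
  \<comment> \<open>This coefficient of the quadratic growth term absorbs half of the squared norm;
    \<rho> below makes the superquadratic part less than the other half.\<close>
  have e: "1 / (2 * C1) > 0" using C1 by simp
  obtain C where C: "C > 0" "\<And>x \<tau>. \<bar>f x \<tau> * \<tau>\<bar> \<le> 1 / (2 * C1) * \<tau>\<^sup>2 + C * \<bar>\<tau>\<bar> powr (p + 1)"
    by (rule F_growth[OF e], rule that)
  define \<rho> where "\<rho> = (1 / (2 * C * C2)) powr (1 / (p - 1))"
  have \<rho>: "\<rho> > 0" using C C2 by (simp add: \<rho>_def)
  have "Ne u > 0" if u: "u \<in> H" "0 < nrm u" "nrm u < \<rho>" for u
  proof -
    have "fi u u \<le> (LINT x|lebesgue. 1 / (2 * C1) * (u x)\<^sup>2 + C * \<bar>u x\<bar> powr (p + 1))"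
      unfolding fi_def
    proof (rule integral_mono[OF f_integrable[OF u(1) u(1)]])
      show "integrable lebesgue (\<lambda>x. 1 / (2 * C1) * (u x)\<^sup>2 + C * \<bar>u x\<bar> powr (p + 1))"
        using space_HD(4)[OF u(1)] C2(2)[OF u(1)] by (intro Bochner_Integration.integrable_add integrable_mult_right)
      show "f x (u x) * u x \<le> 1 / (2 * C1) * (u x)\<^sup>2 + C * \<bar>u x\<bar> powr (p + 1)" for x
        by (rule order_trans[OF abs_ge_self C(2)])
    qed
    also have "\<dots> = 1 / (2 * C1) * (LINT x|lebesgue. (u x)\<^sup>2) + C * (LINT x|lebesgue. \<bar>u x\<bar> powr (p + 1))"
      using space_HD(4)[OF u(1)] C2(2)[OF u(1)] by (simp del: times_divide_eq_left)
    also have "\<dots> \<le> 1 / (2 * C1) * (C1 * (nrm u)\<^sup>2) + C * (C2 * nrm u powr (p + 1))"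
      using C C1 C2 u by (intro add_mono mult_left_mono) auto
    also have "nrm u powr (p + 1) = nrm u powr (p - 1) * (nrm u)\<^sup>2"
    proof -
      have "nrm u powr (p + 1) = nrm u powr ((p - 1) + 2)" by (simp add: add.commute)
      also have "\<dots> = nrm u powr (p - 1) * nrm u powr 2" by (rule powr_add)
      finally show ?thesis using u(2) by simp
    qed
    also have "1 / (2 * C1) * (C1 * (nrm u)\<^sup>2) + C * (C2 * (nrm u powr (p - 1) * (nrm u)\<^sup>2)) = (1/2 + C * C2 * nrm u powr (p - 1)) * (nrm u)\<^sup>2"
      using C1(1) by (simp add: algebra_simps)
    also have "\<dots> < (1/2 + 1/2) * (nrm u)\<^sup>2"
    proof (rule mult_strict_right_mono)
      have "nrm u powr (p - 1) < \<rho> powr (p - 1)" using u p by (intro powr_less_mono2) auto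
      also have "\<dots> = 1 / (2 * C * C2)" using C C2 p by (simp add: \<rho>_def powr_powr)
      finally have "C * C2 * nrm u powr (p - 1) < C * C2 * (1 / (2 * C * C2))" using C C2 by (intro mult_strict_left_mono) auto
      also have "\<dots> = 1/2" using C C2 by simp
      finally show "1/2 + C * C2 * nrm u powr (p - 1) < 1/2 + 1/2" by simp
    qed (use u in simp)
    finally have "fi u u < ip u u" by (simp add: nrm_sq)
    moreover have "0 \<le> lam * inter u u" using lam inter_nonneg[OF u(1)] by simp
    ultimately show ?thesis unfolding Ne_def by linarith
  qed
  then show thesis using that[OF \<rho>] by blast
qed

lemma fi_ray_continuous:
  assumes u: "u \<in> H"
  shows "continuous_on {0..T} (\<lambda>\<tau>. LINT x|lebesgue. f x (\<tau> * u x) * u x)"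
proof (rule continuous_on_sequentiallyI)
  fix a :: "nat \<Rightarrow> real" and \<tau> assume a: "\<forall>n. a n \<in> {0..T}" "\<tau> \<in> {0..T}" "a \<longlonglongrightarrow> \<tau>"
  note [measurable] = space_HD(1)[OF u]
  obtain C where C: "C > 0" "\<And>x a b. \<bar>f x a * b\<bar> \<le> C * (pgauge a + pgauge b)" by (rule f_pgauge, rule that)
  define K where "K = T\<^sup>2 + \<bar>T\<bar> powr (p + 1)"
  have K: "0 \<le> K" by (simp add: K_def)
  have le: "pgauge (\<sigma> * r) \<le> K * pgauge r" if "\<sigma> \<in> {0..T}" for \<sigma> r
  proof -
    have "\<sigma>\<^sup>2 \<le> T\<^sup>2" "\<bar>\<sigma>\<bar> powr (p + 1) \<le> \<bar>T\<bar> powr (p + 1)" using that p by (auto intro!: power_mono powr_mono2)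
    then have "\<sigma>\<^sup>2 * r\<^sup>2 \<le> T\<^sup>2 * r\<^sup>2" "\<bar>\<sigma>\<bar> powr (p + 1) * \<bar>r\<bar> powr (p + 1) \<le> \<bar>T\<bar> powr (p + 1) * \<bar>r\<bar> powr (p + 1)"
      by (simp_all add: mult_right_mono)
    moreover have "0 \<le> T\<^sup>2 * \<bar>r\<bar> powr (p + 1)" "0 \<le> \<bar>T\<bar> powr (p + 1) * r\<^sup>2" by simp_all
    ultimately show ?thesis
      unfolding pgauge_def K_def distrib_left distrib_right abs_mult powr_mult power_mult_distrib by linarith
  qed
  show "(\<lambda>n. LINT x|lebesgue. f x (a n * u x) * u x) \<longlonglongrightarrow> (LINT x|lebesgue. f x (\<tau> * u x) * u x)"
  proof (rule integral_dominated_convergence)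
    show "integrable lebesgue (\<lambda>x. C * (K * pgauge (u x) + pgauge (u x)))"
      using pgauge_integrable[OF u] by simp
    show "AE x in lebesgue. (\<lambda>n. f x (a n * u x) * u x) \<longlonglongrightarrow> f x (\<tau> * u x) * u x"
    proof (intro AE_I2 tendsto_intros)
      fix x
      show "(\<lambda>n. f x (a n * u x)) \<longlonglongrightarrow> f x (\<tau> * u x)"
        using f_cont[of x] a(3) by (intro isCont_tendsto_compose[of _ "f x"] tendsto_intros) (auto simp: continuous_on_eq_continuous_at)
    qed
    show "AE x in lebesgue. norm (f x (a n * u x) * u x) \<le> C * (K * pgauge (u x) + pgauge (u x))" for n
    proof (rule AE_I2)
      fix x
      have "\<bar>f x (a n * u x) * u x\<bar> \<le> C * (pgauge (a n * u x) + pgauge (u x))" by (rule C)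
      also have "\<dots> \<le> C * (K * pgauge (u x) + pgauge (u x))"
        using C(1) a(1) by (intro mult_left_mono add_right_mono le) auto
      finally show "norm (f x (a n * u x) * u x) \<le> C * (K * pgauge (u x) + pgauge (u x))" by simp
    qed
  qed measurable
qed

lemma Ne_ray_continuous:
  assumes u: "u \<in> H"
  shows "continuous_on {0..T} (\<lambda>\<tau>. Ne (\<lambda>x. \<tau> * u x))"
  unfolding Ne_scale[OF u] fi_scale by (intro continuous_intros fi_ray_continuous[OF u])

text \<open>\<open>Ne\<close> is positive near the origin of the ray and nonpositive at \<tau>1, so
  it vanishes in between. The bound \<tau> \<le> \<tau>1 is recorded because later arguments depend
  on factors at most 1 or at most 2.\<close>

lemma nehari_scaling:
  assumes u: "u \<in> H" "nrm u > 0" and \<tau>1: "\<tau>1 > 0" and neg: "Ne (\<lambda>x. \<tau>1 * u x) \<le> 0"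
  obtains \<tau> where "0 < \<tau>" "\<tau> \<le> \<tau>1" "(\<lambda>x. \<tau> * u x) \<in> nehari s t V f lam"
proof -
  obtain \<rho> where \<rho>: "\<rho> > 0" "\<And>u. u \<in> H \<Longrightarrow> 0 < nrm u \<Longrightarrow> nrm u < \<rho> \<Longrightarrow> Ne u > 0" by (rule Ne_pos_small, rule that)
  define \<tau>0 where "\<tau>0 = min \<tau>1 (\<rho> / (2 * nrm u))"
  have \<tau>0: "0 < \<tau>0" "\<tau>0 \<le> \<tau>1" using \<rho> u \<tau>1 by (simp_all add: \<tau>0_def)
  have "\<tau>0 * nrm u \<le> \<rho> / (2 * nrm u) * nrm u" using u by (intro mult_right_mono) (auto simp: \<tau>0_def)
  also have "\<dots> < \<rho>" using u \<rho> by simp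
  finally have "Ne (\<lambda>x. \<tau>0 * u x) > 0"
    using \<tau>0 u by (intro \<rho>(2) space_H_scale) (simp_all add: nrm_scale)
  moreover have "continuous_on {\<tau>0..\<tau>1} (\<lambda>\<tau>. Ne (\<lambda>x. \<tau> * u x))"
    by (rule continuous_on_subset[OF Ne_ray_continuous[OF u(1)]]) (use \<tau>0 in auto)
  ultimately obtain \<tau> where \<tau>: "\<tau>0 \<le> \<tau>" "\<tau> \<le> \<tau>1" "Ne (\<lambda>x. \<tau> * u x) = 0"
    using IVT2'[of "\<lambda>\<tau>. Ne (\<lambda>x. \<tau> * u x)" \<tau>1 0 \<tau>0] neg \<tau>0 by auto
  show thesis
  proof (rule that[of \<tau>])
    show "(\<lambda>x. \<tau> * u x) \<in> nehari s t V f lam"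
      unfolding nehari_iff using \<tau> \<tau>0 u by (simp add: space_H_scale nrm_scale)
  qed (use \<tau> \<tau>0 in auto)
qed

text \<open>If \<open>Ne\<close> stayed nonnegative, the integrals of F(n u) / n^4 would be bounded,
  while (f3) makes the integrand blow up wherever u is nonzero. Fatou then forces u = 0.\<close>

lemma Ne_eventually_neg:
  assumes u: "u \<in> H" "nrm u > 0"
  obtains \<tau> where "\<tau> \<ge> 1" "Ne (\<lambda>x. \<tau> * u x) < 0"
proof (rule ccontr)
  assume "\<not> thesis"
  then have neg: "0 \<le> Ne (\<lambda>x. \<tau> * u x)" if "\<tau> \<ge> 1" for \<tau> using that \<open>\<And>\<tau>. 1 \<le> \<tau> \<Longrightarrow> Ne (\<lambda>x. \<tau> * u x) < 0 \<Longrightarrow> thesis\<close> not_le by blast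
  note [measurable] = space_HD(1)[OF u(1)]
  define B where "B = ip u u + lam * inter u u"
  \<comment> \<open>Subtracting F(u) makes the integrand nonnegative by \<open>F_ray_ge\<close>, as
    Fatou requires.\<close>
  define g where "g n x = F x (real (Suc n) * u x) / real (Suc n) ^ 4 - F x (u x)" for n x
  have sH: "(\<lambda>x. real (Suc n) * u x) \<in> H" for n by (rule space_H_scale[OF u(1)])
  note [measurable] = space_HD(1)[OF sH]
  have [measurable]: "g n \<in> borel_measurable lebesgue" for n unfolding g_def[abs_def] by measurable
  have g0: "0 \<le> g n x" for n x
    using F_ray_ge[of "real (Suc n)" x "u x"] by (simp add: g_def field_simps)
  have gi: "integrable lebesgue (g n)" for n
    unfolding g_def[abs_def] using F_integrable[OF sH, of n] F_integrable[OF u(1)] by simp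
  have gB: "integral\<^sup>L lebesgue (g n) \<le> B / 4 - Fi u" for n
  proof -
    define \<tau> where "\<tau> = real (Suc n)"
    have \<tau>: "\<tau> \<ge> 1" by (simp add: \<tau>_def)
    have "\<tau>\<^sup>2 \<le> \<tau> ^ 4" using \<tau> by (intro power_increasing) auto
    then have "\<tau>\<^sup>2 * ip u u \<le> \<tau> ^ 4 * ip u u" by (intro mult_right_mono) auto
    then have "fi (\<lambda>x. \<tau> * u x) (\<lambda>x. \<tau> * u x) \<le> \<tau> ^ 4 * B"
      using neg[OF \<tau>] unfolding Ne_scale[OF u(1)] B_def by (simp add: algebra_simps)
    moreover have "0 \<le> fi (\<lambda>x. \<tau> * u x) (\<lambda>x. \<tau> * u x) / 4 - Fi (\<lambda>x. \<tau> * u x)"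
      using AR_integral_nonneg[of "\<lambda>x. \<tau> * u x"] AR_eq[OF space_H_scale[OF u(1)]] by simp
    ultimately have "Fi (\<lambda>x. \<tau> * u x) \<le> \<tau> ^ 4 * B / 4" by simp
    then have "Fi (\<lambda>x. \<tau> * u x) / \<tau> ^ 4 \<le> B / 4" using \<tau> by (simp add: field_simps)
    moreover have "integral\<^sup>L lebesgue (g n) = Fi (\<lambda>x. \<tau> * u x) / \<tau> ^ 4 - Fi u"
      unfolding g_def[abs_def] Fi_def \<tau>_def using F_integrable[OF sH, of n] F_integrable[OF u(1)] by simp
    ultimately show ?thesis by simp
  qed
  have inf: "AE x in lebesgue. u x \<noteq> 0 \<longrightarrow> filterlim (\<lambda>n. g n x) at_top sequentially"
    using superquartic
  proof eventually_elim
    case (elim x)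
    show ?case
    proof
      assume ux: "u x \<noteq> 0"
      have "filterlim (\<lambda>n. real (Suc n) * u x) at_infinity sequentially"
      proof (rule filterlim_norm_at_top_imp_at_infinity)
        have "filterlim (\<lambda>n. real (Suc n)) at_top sequentially"
          by (rule filterlim_compose[OF filterlim_real_sequentially filterlim_Suc])
        then have "filterlim (\<lambda>n. \<bar>u x\<bar> * real (Suc n)) at_top sequentially"
          by (rule filterlim_tendsto_pos_mult_at_top[OF tendsto_const, rotated]) (use ux in simp)
        then show "filterlim (\<lambda>n. norm (real (Suc n) * u x)) at_top sequentially"
          by (simp add: abs_mult mult.commute)
      qed
      from filterlim_compose[OF elim this]
      have "filterlim (\<lambda>n. F x (real (Suc n) * u x) / (real (Suc n) * u x) ^ 4) at_top sequentially" .
      then have "filterlim (\<lambda>n. u x ^ 4 * (F x (real (Suc n) * u x) / (real (Suc n) * u x) ^ 4)) at_top sequentially"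
        by (rule filterlim_tendsto_pos_mult_at_top[OF tendsto_const, rotated]) (use ux in simp)
      moreover have "u x ^ 4 * (F x (real (Suc n) * u x) / (real (Suc n) * u x) ^ 4) = F x (real (Suc n) * u x) / real (Suc n) ^ 4" for n
        using ux by (simp add: power_mult_distrib del: of_nat_Suc)
      ultimately have "filterlim (\<lambda>n. F x (real (Suc n) * u x) / real (Suc n) ^ 4) at_top sequentially" by simp
      then have "filterlim (\<lambda>n. - F x (u x) + F x (real (Suc n) * u x) / real (Suc n) ^ 4) at_top sequentially"
        by (rule filterlim_tendsto_add_at_top[OF tendsto_const])
      then show "filterlim (\<lambda>n. g n x) at_top sequentially" by (simp add: g_def)
    qed
  qed
  have "(\<integral>\<^sup>+x. liminf (\<lambda>n. ennreal (g n x)) \<partial>lebesgue) \<le> liminf (\<lambda>n. \<integral>\<^sup>+x. ennreal (g n x) \<partial>lebesgue)"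
    by (rule nn_integral_liminf) measurable
  also have "\<dots> \<le> ennreal (B / 4 - Fi u)"
    by (rule Liminf_le) (simp, intro always_eventually allI, simp add: nn_integral_eq_integral gi g0 gB ennreal_leI)
  also have "\<dots> < \<infinity>" by simp
  finally have "AE x in lebesgue. liminf (\<lambda>n. ennreal (g n x)) \<noteq> \<infinity>"
    by (intro nn_integral_PInf_AE) auto
  then have "AE x in lebesgue. u x = 0"
    using inf
  proof eventually_elim
    case (elim x)
    show ?case
    proof (rule ccontr)
      assume "u x \<noteq> 0"
      then have "filterlim (\<lambda>n. g n x) at_top sequentially" using elim by blast
      then have "(\<lambda>n. ennreal (g n x)) \<longlonglongrightarrow> \<infinity>"
        by (simp add: ennreal_tendsto_top_eq_at_top)
      then have "liminf (\<lambda>n. ennreal (g n x)) = \<infinity>" by (simp add: lim_imp_Liminf)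
      then show False using elim by blast
    qed
  qed
  then show False using nrm_zero_AE[OF u(1)] u(2) by simp
qed

lemma nehari_projection:
  assumes u: "u \<in> H" "nrm u > 0"
  obtains \<tau> where "0 < \<tau>" "(\<lambda>x. \<tau> * u x) \<in> nehari s t V f lam"
proof -
  obtain \<tau>1 where \<tau>1: "\<tau>1 \<ge> 1" "Ne (\<lambda>x. \<tau>1 * u x) < 0" by (rule Ne_eventually_neg[OF u], rule that)
  obtain \<tau> where "0 < \<tau>" "(\<lambda>x. \<tau> * u x) \<in> nehari s t V f lam"
    by (rule nehari_scaling[OF u, of \<tau>1]) (use \<tau>1 in \<open>auto intro: that\<close>)
  then show thesis by (rule that)
qed


section \<open>The Nehari level and its attainment\<close>

abbreviation "NN \<equiv> nehari s t V f lam"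
abbreviation "c0 \<equiv> nehari_level s t V f lam"

lemma nehariD: "u \<in> NN \<Longrightarrow> u \<in> H" "u \<in> NN \<Longrightarrow> nrm u > 0" "u \<in> NN \<Longrightarrow> Ne u = 0"
  by (simp_all add: nehari_iff)

lemma E_nehari: "u \<in> NN \<Longrightarrow> E u = ip u u / 4 + AR u"
  using E_AR[of u] nehariD[of u] by simp

lemma E_nehari_ge: "u \<in> NN \<Longrightarrow> (nrm u)\<^sup>2 / 4 \<le> E u"
  using E_nehari[of u] AR_integral_nonneg[of u] by (simp add: nrm_sq)

lemma nehari_lower:
  obtains \<rho> where "\<rho> > 0" "\<And>u. u \<in> NN \<Longrightarrow> \<rho> \<le> nrm u"
proof -
  obtain \<rho> where \<rho>: "\<rho> > 0" "\<And>u. u \<in> H \<Longrightarrow> 0 < nrm u \<Longrightarrow> nrm u < \<rho> \<Longrightarrow> Ne u > 0" by (rule Ne_pos_small, rule that)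
  have "\<rho> \<le> nrm u" if "u \<in> NN" for u using \<rho>(2)[of u] nehariD[OF that] by force
  then show thesis using that \<rho>(1) by blast
qed

lemma nehari_bdd_below: "bdd_below (E ` NN)"
proof (rule bdd_belowI2[of _ 0])
  fix u assume "u \<in> NN"
  then have "(nrm u)\<^sup>2 / 4 \<le> E u" by (rule E_nehari_ge)
  moreover have "0 \<le> (nrm u)\<^sup>2 / 4" by simp
  ultimately show "0 \<le> E u" by linarith
qed

lemma nehari_level_le: "u \<in> NN \<Longrightarrow> c0 \<le> E u"
  unfolding nehari_level_def by (rule cINF_lower[OF nehari_bdd_below])

lemma nehari_level_pos:
  assumes "NN \<noteq> {}" shows "c0 > 0"
proof -
  obtain \<rho> where \<rho>: "\<rho> > 0" "\<And>u. u \<in> NN \<Longrightarrow> \<rho> \<le> nrm u" by (rule nehari_lower, rule that)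
  have "\<rho>\<^sup>2 / 4 \<le> c0" unfolding nehari_level_def
  proof (rule cINF_greatest[OF assms])
    fix u assume u: "u \<in> NN"
    have "\<rho>\<^sup>2 \<le> (nrm u)\<^sup>2" using \<rho> u by (intro power_mono) auto
    then show "\<rho>\<^sup>2 / 4 \<le> E u" using E_nehari_ge[OF u] by linarith
  qed
  moreover have "\<rho>\<^sup>2 / 4 > 0" using \<rho> by simp
  ultimately show ?thesis by linarith
qed

text \<open>A function with \<open>Ne u \<le> 0\<close> reaches the Nehari set by a factor at most
  one, under which both \<open>ip u u / 4\<close> and \<open>AR u\<close> decrease. So the sum
  bounds the energy of the projection although u itself lies off the set.\<close>

lemma nehari_project_down:
  assumes u: "u \<in> H" "nrm u > 0" and neg: "Ne u \<le> 0"
  obtains \<tau> where "0 < \<tau>" "\<tau> \<le> 1" "(\<lambda>x. \<tau> * u x) \<in> NN" "E (\<lambda>x. \<tau> * u x) \<le> ip u u / 4 + AR u"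
proof -
  have n1: "Ne (\<lambda>x. 1 * u x) \<le> 0" using neg by simp
  obtain \<tau> where \<tau>: "0 < \<tau>" "\<tau> \<le> 1" "(\<lambda>x. \<tau> * u x) \<in> NN"
    by (rule nehari_scaling[OF u zero_less_one n1], rule that)
  have "\<tau>\<^sup>2 * ip u u \<le> 1 * ip u u" using \<tau> by (intro mult_right_mono) (auto simp: power_le_one)
  moreover have "AR (\<lambda>x. \<tau> * u x) \<le> AR u" using \<tau> by (intro AR_scale_le u) auto
  ultimately have "E (\<lambda>x. \<tau> * u x) \<le> ip u u / 4 + AR u"
    unfolding E_nehari[OF \<tau>(3)] ip_scale2 by linarith
  then show thesis using \<tau> that by blast
qed

text \<open>The geometric rate provides an integrable majorant, and the quasi-triangle inequality of
  the gauge transfers it from u n - v to u n.\<close>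

lemma superposition_limits:
  assumes u: "\<And>n. u n \<in> H" and v: "v \<in> H"
    and ae: "AE x in lebesgue. (\<lambda>n. u n x) \<longlonglongrightarrow> v x"
    and L: "\<And>n. (LINT x|lebesgue. pgauge (u n x - v x)) \<le> (1/2)^n"
  shows "(\<lambda>n. fi (u n) (u n)) \<longlonglongrightarrow> fi v v" "(\<lambda>n. Fi (u n)) \<longlonglongrightarrow> Fi v"
proof -
  note [measurable] = space_HD(1)[OF u] space_HD(1)[OF v]
  define w where "w n x = u n x - v x" for n x
  have wH: "w n \<in> H" for n unfolding w_def[abs_def] by (rule space_H_diff[OF u v])
  have sg: "summable (\<lambda>n. (1/2::real)^n)" by (rule summable_geometric) simp
  have "norm (LINT x|lebesgue. pgauge (w n x)) \<le> (1/2)^n" for n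
    using L[of n] by (simp add: w_def)
  then have sm: "summable (\<lambda>n. LINT x|lebesgue. pgauge (w n x))"
    by (intro summable_comparison_test'[OF sg, where N = 0])
  obtain S where S: "integrable lebesgue S" "\<And>x. 0 \<le> S x"
    "AE x in lebesgue. (\<forall>n. pgauge (w n x) \<le> S x) \<and> (\<lambda>n. w n x) \<longlonglongrightarrow> 0"
    by (rule pgauge_dominated[of w, OF wH sm], rule that)
  obtain C where C: "C > 0" "\<And>x a b. \<bar>f x a * b\<bar> \<le> C * (pgauge a + pgauge b)" "\<And>x a. \<bar>F x a\<bar> \<le> C * pgauge a"
    by (rule f_pgauge, rule that)
  define W where "W x = 2 * C * (2 powr (p + 1) * (S x + pgauge (v x)))" for x
  have Wi: "integrable lebesgue W" unfolding W_def[abs_def]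
    using S(1) pgauge_integrable[OF v] by simp
  have g: "AE x in lebesgue. \<forall>n. pgauge (u n x) \<le> 2 powr (p + 1) * (S x + pgauge (v x))"
    using S(3)
  proof eventually_elim
    case (elim x)
    show ?case
    proof
      fix n
      have "pgauge (w n x + v x) \<le> 2 powr (p + 1) * (pgauge (w n x) + pgauge (v x))" by (rule pgauge_add)
      also have "\<dots> \<le> 2 powr (p + 1) * (S x + pgauge (v x))" using elim by (intro mult_left_mono add_right_mono) auto
      finally show "pgauge (u n x) \<le> 2 powr (p + 1) * (S x + pgauge (v x))" by (simp add: w_def)
    qed
  qed
  have b1: "AE x in lebesgue. norm (f x (u n x) * u n x) \<le> W x" for n
    using g
  proof eventually_elim
    case (elim x)
    have "\<bar>f x (u n x) * u n x\<bar> \<le> 2 * C * pgauge (u n x)" using C(2)[of x "u n x" "u n x"] by simp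
    also have "\<dots> \<le> W x" unfolding W_def using elim C(1) by (intro mult_left_mono) auto
    finally show ?case by simp
  qed
  have b2: "AE x in lebesgue. norm (F x (u n x)) \<le> W x" for n
    using g
  proof eventually_elim
    case (elim x)
    have "\<bar>F x (u n x)\<bar> \<le> C * pgauge (u n x)" by (rule C)
    also have "\<dots> \<le> 2 * C * pgauge (u n x)" using C(1) by (intro mult_right_mono) auto
    also have "\<dots> \<le> W x" unfolding W_def using elim C(1) by (intro mult_left_mono) auto
    finally show ?case by simp
  qed
  show "(\<lambda>n. fi (u n) (u n)) \<longlonglongrightarrow> fi v v" unfolding fi_def
  proof (rule integral_dominated_convergence[OF _ _ Wi _ b1])
    show "AE x in lebesgue. (\<lambda>n. f x (u n x) * u n x) \<longlonglongrightarrow> f x (v x) * v x"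
      using ae
    proof eventually_elim
      case (elim x)
      then show ?case using f_cont[of x]
        by (intro tendsto_intros isCont_tendsto_compose[of _ "f x"]) (auto simp: continuous_on_eq_continuous_at)
    qed
  qed measurable
  show "(\<lambda>n. Fi (u n)) \<longlonglongrightarrow> Fi v" unfolding Fi_def
  proof (rule integral_dominated_convergence[OF _ _ Wi _ b2])
    show "AE x in lebesgue. (\<lambda>n. F x (u n x)) \<longlonglongrightarrow> F x (v x)"
      using ae
    proof eventually_elim
      case (elim x)
      then show ?case using F_cont[of x]
        by (intro isCont_tendsto_compose[of _ "F x"]) (auto simp: continuous_on_eq_continuous_at)
    qed
  qed measurable
qed

text \<open>Dropping the square in \<open>inter_expand\<close> leaves inter(u n, u n) \<ge> 2
  inter(v, u n) - inter(v, v), and Fatou with the fixed weight \<open>phi t v\<close> handles the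
  right side.\<close>

lemma inter_lsc:
  assumes u: "\<And>n. u n \<in> H" and v: "v \<in> H"
    and ae: "AE x in lebesgue. (\<lambda>n. u n x) \<longlonglongrightarrow> v x" and a: "a < inter v v"
  shows "\<forall>\<^sub>F n in sequentially. a < inter (u n) (u n)"
proof -
  note [measurable] = space_HD(1)[OF u] space_HD(1)[OF v] critical_spaceD(2)[OF phi_critical[OF v]]
  \<comment> \<open>The potential is nonnegative only almost everywhere, while the Fatou lemma used
    here asks for it at every point.\<close>
  define \<phi> where "\<phi> x = max 0 (phi t v x)" for x
  have [measurable]: "\<phi> \<in> borel_measurable lebesgue" unfolding \<phi>_def[abs_def] by measurable
  have \<phi>: "AE x in lebesgue. phi t v x = \<phi> x"
    using phi_nonneg[OF v] by eventually_elim (simp add: \<phi>_def)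
  have eq: "inter v w = (LINT x|lebesgue. \<phi> x * (w x)\<^sup>2)" if w: "w \<in> H" for w
  proof -
    note [measurable] = space_HD(1)[OF w]
    show ?thesis unfolding inter_def by (rule integral_cong_AE) (measurable, use \<phi> in eventually_elim, simp)
  qed
  have int: "integrable lebesgue (\<lambda>x. \<phi> x * (w x)\<^sup>2)" if w: "w \<in> H" for w
  proof -
    note [measurable] = space_HD(1)[OF w]
    show ?thesis using phi_integrable_sq[OF v w]
      by (rule Bochner_Integration.integrable_cong_AE_imp) (measurable, use \<phi> in eventually_elim, simp)
  qed
  define e where "e = inter v v - a"
  have e: "e > 0" using a by (simp add: e_def)
  have "\<forall>\<^sub>F n in sequentially. inter v v - e / 2 < (LINT x|lebesgue. \<phi> x * (u n x)\<^sup>2)"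
  proof (rule integral_Fatou_eventually_gt)
    show "AE x in lebesgue. (\<lambda>n. \<phi> x * (u n x)\<^sup>2) \<longlonglongrightarrow> \<phi> x * (v x)\<^sup>2"
      using ae by eventually_elim (intro tendsto_intros)
    show "inter v v - e / 2 < (LINT x|lebesgue. \<phi> x * (v x)\<^sup>2)" using e eq[OF v] by simp
  qed (use int[OF u] int[OF v] in \<open>auto simp: \<phi>_def\<close>)
  then show ?thesis
  proof eventually_elim
    case (elim n)
    have "inter v (u n) > inter v v - e / 2" using elim eq[OF u] by simp
    moreover have "inter (u n) (u n) - inter v v = gagliardo_form t (\<lambda>x. phi t (u n) x - phi t v x) (\<lambda>x. phi t (u n) x - phi t v x)
      + 2 * (inter v (u n) - inter v v)" by (rule inter_expand[OF v u])
    moreover have "0 \<le> gagliardo_form t (\<lambda>x. phi t (u n) x - phi t v x) (\<lambda>x. phi t (u n) x - phi t v x)" by simp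
    ultimately show ?case using e_def unfolding right_diff_distrib by linarith
  qed
qed

lemma fi_zero_AE:
  assumes u: "u \<in> H" "nrm u = 0" shows "fi u u = 0"
proof -
  have "AE x in lebesgue. u x = 0" using nrm_zero_AE[OF u(1)] u(2) by simp
  then show ?thesis unfolding fi_def by (intro integral_eq_zero_AE) (auto elim!: eventually_mono)
qed

proposition nehari_level_attained:
  assumes ne: "NN \<noteq> {}"
  obtains w where "w \<in> NN" "E w = c0"
proof -
  have "\<exists>u. u \<in> NN \<and> E u < c0 + 1 / real (Suc n)" for n
    using cInf_lessD[of "E ` NN" "c0 + 1 / real (Suc n)"] ne by (auto simp: nehari_level_def)
  then obtain u where u: "\<And>n. u n \<in> NN" "\<And>n. E (u n) < c0 + 1 / real (Suc n)" by metis
  have uH: "u n \<in> H" for n by (rule nehariD(1)[OF u(1)])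
  define M where "M = sqrt (4 * (c0 + 1))"
  have M: "nrm (u n) \<le> M" for n
  proof -
    have "1 / real (Suc n) \<le> 1" by simp
    then have "E (u n) < c0 + 1" by (intro less_le_trans[OF u(2)] add_left_mono)
    then have "(nrm (u n))\<^sup>2 \<le> 4 * (c0 + 1)" using E_nehari_ge[OF u(1), of n] unfolding distrib_left by linarith
    then show ?thesis unfolding M_def by (rule real_le_rsqrt)
  qed
  obtain r v where r: "strict_mono r" "v \<in> H" "AE x in lebesgue. (\<lambda>k. u (r k) x) \<longlonglongrightarrow> v x"
    "\<And>q. 2 \<le> q \<Longrightarrow> q < sobolev_exponent s \<Longrightarrow> (\<lambda>k. LINT x|lebesgue. \<bar>u (r k) x - v x\<bar> powr q) \<longlonglongrightarrow> 0"
    by (rule H_compact_embedding[of u, OF uH M], rule that)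
  define w where "w k x = u (r k) x - v x" for k x
  have wH: "w k \<in> H" for k unfolding w_def[abs_def] by (rule space_H_diff[OF uH r(2)])
  have "(\<lambda>k. (LINT x|lebesgue. \<bar>w k x\<bar> powr 2) + (LINT x|lebesgue. \<bar>w k x\<bar> powr (p + 1))) \<longlonglongrightarrow> 0 + 0"
    unfolding w_def using p p_subcritical sobolev_exponent_gt_2[OF s] by (intro tendsto_add r(4)) auto
  moreover have "(LINT x|lebesgue. \<bar>w k x\<bar> powr 2) + (LINT x|lebesgue. \<bar>w k x\<bar> powr (p + 1)) = (LINT x|lebesgue. pgauge (w k x))" for k
  proof -
    have i: "integrable lebesgue (\<lambda>x. (w k x)\<^sup>2)" by (rule space_HD(4)[OF wH])
    have "integrable lebesgue (\<lambda>x. pgauge (w k x) - (w k x)\<^sup>2)"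
      using pgauge_integrable[OF wH] i by (rule Bochner_Integration.integrable_diff)
    then have "integrable lebesgue (\<lambda>x. \<bar>w k x\<bar> powr (p + 1))" by (simp add: pgauge_def)
    then show ?thesis using i by (simp add: pgauge_def)
  qed
  ultimately have "(\<lambda>k. LINT x|lebesgue. pgauge (w k x)) \<longlonglongrightarrow> 0" by simp
  then have ev: "\<forall>\<^sub>F k in sequentially. (LINT x|lebesgue. pgauge (w k x)) < (1/2)^n" for n :: nat
    by (rule order_tendstoD(2)) simp
  \<comment> \<open>A second extraction fixes the geometric rate from which the majorant is
    built.\<close>
  obtain r' where r': "strict_mono r'" "\<And>n. (LINT x|lebesgue. pgauge (w (r' n) x)) < (1/2)^n"
    by (rule subsequence_choice[of "\<lambda>n k. (LINT x|lebesgue. pgauge (w k x)) < (1/2)^n", OF ev], rule that)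
  define z where "z n = u (r (r' n))" for n
  have zN: "z n \<in> NN" for n by (simp add: z_def u)
  have zH: "z n \<in> H" for n by (simp add: z_def uH)
  have zae: "AE x in lebesgue. (\<lambda>n. z n x) \<longlonglongrightarrow> v x"
    using r(3) unfolding z_def by eventually_elim (rule LIMSEQ_subseq_LIMSEQ[OF _ r'(1), unfolded o_def])
  have zg: "(LINT x|lebesgue. pgauge (z n x - v x)) \<le> (1/2)^n" for n
    using r'(2)[of n] by (simp add: z_def w_def)
  note lim = superposition_limits[OF zH r(2) zae zg]
  obtain \<rho> where \<rho>: "\<rho> > 0" "\<And>u. u \<in> NN \<Longrightarrow> \<rho> \<le> nrm u" by (rule nehari_lower, rule that)
  have Nez: "ip (z n) (z n) + lam * inter (z n) (z n) = fi (z n) (z n)" for n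
    using nehariD(3)[OF zN, of n] by (simp add: Ne_def)
  \<comment> \<open>On the Nehari set \<open>fi\<close> is at least \<rho>^2 and it converges, so
    the limit cannot vanish.\<close>
  have vpos: "nrm v > 0"
  proof (rule ccontr)
    assume "\<not> nrm v > 0"
    then have "nrm v = 0" using nrm_nonneg[of v] by linarith
    then have "fi v v = 0" by (rule fi_zero_AE[OF r(2)])
    moreover have "\<rho>\<^sup>2 \<le> fi v v"
    proof (rule LIMSEQ_le_const[OF lim(1)], intro exI allI impI)
      fix n
      have "\<rho>\<^sup>2 \<le> (nrm (z n))\<^sup>2" using \<rho> zN by (intro power_mono) auto
      moreover have "0 \<le> lam * inter (z n) (z n)" using lam inter_nonneg[OF zH] by simp
      ultimately show "\<rho>\<^sup>2 \<le> fi (z n) (z n)" using Nez[of n] by (simp add: nrm_sq)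
    qed
    ultimately show False using \<rho>(1) by simp
  qed
  \<comment> \<open>If the claim failed infinitely often, Fatou along that subsequence would bound
    ip v v by ip v v - e.\<close>
  have ip_lsc: "\<forall>\<^sub>F n in sequentially. ip v v - e < ip (z n) (z n)" if e: "e > 0" for e
  proof (rule ccontr)
    assume "\<not> ?thesis"
    then have "infinite {n. ip (z n) (z n) \<le> ip v v - e}"
      by (auto simp: eventually_sequentially infinite_nat_iff_unbounded_le not_less)
    then obtain k :: "nat \<Rightarrow> nat" where k: "strict_mono k" "\<And>n. k n \<in> {n. ip (z n) (z n) \<le> ip v v - e}"
      using infinite_enumerate by blast
    have "AE x in lebesgue. (\<lambda>n. z (k n) x) \<longlonglongrightarrow> v x"
      using zae by eventually_elim (rule LIMSEQ_subseq_LIMSEQ[OF _ k(1), unfolded o_def])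
    from H_Fatou(2)[OF zH space_HD(1)[OF r(2)] this, of "ip v v - e"] k(2) e show False by simp
  qed
  \<comment> \<open>The norm and the Poisson term may drop in the limit while \<open>fi\<close>
    converges, so only an inequality survives; projecting down repairs this.\<close>
  have Nev: "Ne v \<le> 0"
  proof (rule field_le_epsilon)
    fix e :: real assume e: "e > 0"
    \<comment> \<open>One d is lost in the norm term, one in \<open>fi\<close>, and lam d in the
      Poisson term.\<close>
    define d where "d = e / (3 + lam)"
    have d: "d > 0" using e lam by (simp add: d_def)
    have "\<forall>\<^sub>F n in sequentially. fi (z n) (z n) < fi v v + d" by (rule order_tendstoD(2)[OF lim(1)]) (use d in simp)
    moreover have "\<forall>\<^sub>F n in sequentially. inter v v - d < inter (z n) (z n)"
      by (rule inter_lsc[OF zH r(2) zae]) (use d in simp)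
    ultimately have "\<forall>\<^sub>F n in sequentially. Ne v \<le> 0 + e"
      using ip_lsc[OF d]
    proof eventually_elim
      case (elim n)
      have "lam * (inter v v - d) \<le> lam * inter (z n) (z n)" using elim lam by (intro mult_left_mono) auto
      then have "Ne v \<le> (2 + lam) * d" using elim Nez[of n] unfolding Ne_def by (simp add: algebra_simps)
      also have "\<dots> \<le> (3 + lam) * d" using d by simp
      also have "\<dots> = e" using lam by (simp add: d_def)
      finally show ?case by simp
    qed
    then show "Ne v \<le> 0 + e" by simp
  qed
  have le: "ip v v / 4 + AR v \<le> c0"
  proof (rule field_le_epsilon)
    fix e :: real assume e: "e > 0"
    then have e3: "e / 3 > 0" by simp
    have "(\<lambda>n. AR (z n)) \<longlonglongrightarrow> AR v" unfolding AR_eq[OF zH] AR_eq[OF r(2)] by (intro tendsto_intros lim) simp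
    then have 1: "\<forall>\<^sub>F n in sequentially. AR v - e / 3 < AR (z n)" by (rule order_tendstoD(1)) (use e in simp)
    have "(\<lambda>n. c0 + 1 / real (Suc n)) \<longlonglongrightarrow> c0 + 0" by (intro tendsto_intros LIMSEQ_Suc lim_1_over_n)
    then have "\<forall>\<^sub>F n in sequentially. c0 + 1 / real (Suc n) < c0 + e / 3" by (rule order_tendstoD(2)) (use e in simp)
    then have "\<forall>\<^sub>F n in sequentially. ip v v / 4 + AR v \<le> c0 + e"
      using 1 ip_lsc[OF e3]
    proof eventually_elim
      case (elim n)
      have "n \<le> r (r' n)" using seq_suble[OF r(1), of "r' n"] seq_suble[OF r'(1), of n] by linarith
      then have "1 / real (Suc (r (r' n))) \<le> 1 / real (Suc n)" by (intro divide_left_mono) auto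
      then have "E (z n) < c0 + 1 / real (Suc n)" using u(2)[of "r (r' n)"] by (simp add: z_def)
      then show ?case using elim E_nehari[OF zN, of n] e by linarith
    qed
    then show "ip v v / 4 + AR v \<le> c0 + e" by simp
  qed
  obtain \<tau> where \<tau>: "(\<lambda>x. \<tau> * v x) \<in> NN" "E (\<lambda>x. \<tau> * v x) \<le> ip v v / 4 + AR v"
    by (rule nehari_project_down[OF r(2) vpos Nev], rule that)
  show thesis
  proof (rule that[OF \<tau>(1)])
    show "E (\<lambda>x. \<tau> * v x) = c0" using \<tau>(2) le nehari_level_le[OF \<tau>(1)] by linarith
  qed
qed

end

section \<open>Sign parts\<close>

text \<open>Both max(., 0) and min(., 0) are nondecreasing, so their increments never have opposite
  signs.\<close>

lemma gagliardo_kernel_parts_nonneg: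
  "0 \<le> gagliardo_kernel \<alpha> (\<lambda>x. max (u x) 0) (\<lambda>x. min (u x) 0) z"
proof -
  have "0 \<le> (max a 0 - max b 0) * (min a 0 - min b (0::real))" for a b
    by (cases "a \<le> 0"; cases "b \<le> 0") (simp_all add: mult_nonneg_nonpos mult_nonpos_nonneg)
  then show ?thesis by (simp add: gagliardo_kernel_eq)
qed

lemma gagliardo_form_parts_nonneg: "0 \<le> gagliardo_form \<alpha> (\<lambda>x. max (u x) 0) (\<lambda>x. min (u x) 0)"
  unfolding gagliardo_form_def by (intro Bochner_Integration.integral_nonneg gagliardo_kernel_parts_nonneg)

text \<open>A vanishing form makes the kernel vanish almost everywhere. The slice through a single
  point with u > 0 then already excludes a non-null set where u < 0.\<close>

lemma gagliardo_form_parts_pos: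
  assumes p: "(\<lambda>x. max (u x) 0) \<in> gagliardo_space \<alpha>" and m: "(\<lambda>x. min (u x) 0) \<in> gagliardo_space \<alpha>"
    and np: "\<not> (AE x in lebesgue. max (u x) 0 = 0)" and nm: "\<not> (AE x in lebesgue. min (u x) 0 = 0)"
  shows "0 < gagliardo_form \<alpha> (\<lambda>x. max (u x) 0) (\<lambda>x. min (u x) 0)"
proof (rule ccontr)
  assume "\<not> ?thesis"
  then have z: "integral\<^sup>L LL (gagliardo_kernel \<alpha> (\<lambda>x. max (u x) 0) (\<lambda>x. min (u x) 0)) = 0"
    using gagliardo_form_parts_nonneg[of \<alpha> u] unfolding gagliardo_form_def by simp
  then have "AE z in LL. gagliardo_kernel \<alpha> (\<lambda>x. max (u x) 0) (\<lambda>x. min (u x) 0) z = 0"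
    using integral_nonneg_eq_0_iff_AE[OF integrable_gagliardo_kernel[OF p m]] gagliardo_kernel_parts_nonneg by simp
  then have ae: "AE x in lebesgue. AE y in lebesgue. gagliardo_kernel \<alpha> (\<lambda>x. max (u x) 0) (\<lambda>x. min (u x) 0) (x, y) = 0"
    by (rule LL.AE_pair)
  have "AE x in lebesgue. max (u x) 0 = 0"
    using ae
  proof eventually_elim
    case (elim x)
    show ?case
    proof (rule ccontr)
      assume "max (u x) 0 \<noteq> 0"
      then have ux: "u x > 0" by (simp add: max_def split: if_splits)
      have "AE y in lebesgue. min (u y) 0 = 0"
        using elim
      proof eventually_elim
        case (elim y)
        show ?case
        proof (rule ccontr)
          assume "min (u y) 0 \<noteq> 0"
          then have uy: "u y < 0" by (simp add: min_def split: if_splits)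
          then have "x \<noteq> y" using ux by auto
          then show False using elim ux uy by (simp add: gagliardo_kernel_eq)
        qed
      qed
      then show False using nm by blast
    qed
  qed
  then show False using np by blast
qed

section \<open>Decomposition of the energy into sign parts\<close>

context sp_problem
begin

abbreviation pos_part :: "(R3 \<Rightarrow> real) \<Rightarrow> R3 \<Rightarrow> real" where "pos_part u \<equiv> \<lambda>x. max (u x) 0"
abbreviation neg_part :: "(R3 \<Rightarrow> real) \<Rightarrow> R3 \<Rightarrow> real" where "neg_part u \<equiv> \<lambda>x. min (u x) 0"

lemma parts_in_H:
  assumes u: "u \<in> H" shows "pos_part u \<in> H" "neg_part u \<in> H"
proof -
  note [measurable] = space_HD(1)[OF u]
  have m: "pos_part u \<in> borel_measurable lebesgue" "neg_part u \<in> borel_measurable lebesgue" by measurable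
  show "pos_part u \<in> H" by (rule space_H_contraction[OF m(1) u]) (auto simp: max_def)
  show "neg_part u \<in> H" by (rule space_H_contraction[OF m(2) u]) (auto simp: min_def)
qed

definition cross :: "(R3 \<Rightarrow> real) \<Rightarrow> real" where
  "cross u = gagliardo_form s (pos_part u) (neg_part u)"

lemma cross_pos:
  assumes u: "u \<in> H" and "nrm (pos_part u) > 0" "nrm (neg_part u) > 0"
  shows "0 < cross u"
  unfolding cross_def
  by (rule gagliardo_form_parts_pos[OF space_HD(2)[OF parts_in_H(1)[OF u]] space_HD(2)[OF parts_in_H(2)[OF u]]])
    (use assms nrm_zero_AE[OF parts_in_H(1)[OF u]] nrm_zero_AE[OF parts_in_H(2)[OF u]] in auto)

lemma ip_parts: "ip (pos_part u) (neg_part u) = cross u"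
proof -
  have "V x * (max (u x) 0 * min (u x) 0) = 0" for x by (simp add: max_def min_def)
  note eq = this
  show ?thesis unfolding ip_def cross_def eq by simp
qed

lemma parts_sum: "(\<lambda>x. 1 * max (u x) 0 + 1 * min (u x) 0) = (u :: R3 \<Rightarrow> real)"
  by (rule ext) (simp add: max_def min_def)

text \<open>Local terms split exactly because the parts have disjoint supports; only the two
  nonlocal terms leave cross contributions, and both are nonnegative.\<close>

lemma parts_decomposition:
  assumes u: "u \<in> H"
  shows "ip u u = ip (pos_part u) (pos_part u) + 2 * cross u + ip (neg_part u) (neg_part u)"
    and "inter u u = inter (pos_part u) (pos_part u) + 2 * inter (pos_part u) (neg_part u) + inter (neg_part u) (neg_part u)"
    and "Fi u = Fi (pos_part u) + Fi (neg_part u)"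
    and "AR u = AR (pos_part u) + AR (neg_part u)"
    and "DE u (pos_part u) = Ne (pos_part u) + cross u + lam * inter (pos_part u) (neg_part u)"
    and "DE u (neg_part u) = Ne (neg_part u) + cross u + lam * inter (pos_part u) (neg_part u)"
proof -
  note P = parts_in_H(1)[OF u] and M = parts_in_H(2)[OF u]
  show "ip u u = ip (pos_part u) (pos_part u) + 2 * cross u + ip (neg_part u) (neg_part u)"
    using ip_lin2[OF P M, of 1 1] unfolding parts_sum ip_parts by simp
  have split: "inter w u = inter w (pos_part u) + inter w (neg_part u)" if w: "w \<in> H" for w
  proof -
    have "phi t w x * (u x)\<^sup>2 = phi t w x * (max (u x) 0)\<^sup>2 + phi t w x * (min (u x) 0)\<^sup>2" for x
      by (simp add: max_def min_def)
    then show ?thesis using phi_integrable_sq[OF w P] phi_integrable_sq[OF w M] by (simp add: inter_def)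
  qed
  have up: "inter u (pos_part u) = inter (pos_part u) (pos_part u) + inter (pos_part u) (neg_part u)"
    using split[OF P] inter_commute[OF u P] by simp
  have um: "inter u (neg_part u) = inter (pos_part u) (neg_part u) + inter (neg_part u) (neg_part u)"
    using split[OF M] inter_commute[OF u M] inter_commute[OF P M] by simp
  show "inter u u = inter (pos_part u) (pos_part u) + 2 * inter (pos_part u) (neg_part u) + inter (neg_part u) (neg_part u)"
    using split[OF u] up um by simp
  have F: "F x (u x) = F x (max (u x) 0) + F x (min (u x) 0)" for x by (simp add: max_def min_def)
  then show "Fi u = Fi (pos_part u) + Fi (neg_part u)"
    using F_integrable[OF P] F_integrable[OF M] by (simp add: Fi_def)
  have A: "f x (u x) * u x / 4 - F x (u x) = (f x (max (u x) 0) * max (u x) 0 / 4 - F x (max (u x) 0))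
     + (f x (min (u x) 0) * min (u x) 0 / 4 - F x (min (u x) 0))" for x by (simp add: max_def min_def)
  show "AR u = AR (pos_part u) + AR (neg_part u)"
    unfolding AR_def A using AR_integrable[OF P] AR_integrable[OF M] by (rule Bochner_Integration.integral_add)
  have ip1: "ip u (pos_part u) = ip (pos_part u) (pos_part u) + cross u"
    using ip_lin[OF P M P, of 1 1] unfolding parts_sum ip_commute[of "neg_part u"] ip_parts by simp
  have ip2: "ip u (neg_part u) = cross u + ip (neg_part u) (neg_part u)"
    using ip_lin[OF P M M, of 1 1] unfolding parts_sum ip_parts by simp
  have i1: "(LINT x|lebesgue. phi t u x * (u x * max (u x) 0)) = inter u (pos_part u)"
    unfolding inter_def by (rule Bochner_Integration.integral_cong) (auto simp: max_def power2_eq_square)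
  have i2: "(LINT x|lebesgue. phi t u x * (u x * min (u x) 0)) = inter u (neg_part u)"
    unfolding inter_def by (rule Bochner_Integration.integral_cong) (auto simp: min_def power2_eq_square)
  have f1: "fi u (pos_part u) = fi (pos_part u) (pos_part u)"
    unfolding fi_def by (rule Bochner_Integration.integral_cong) (auto simp: max_def)
  have f2: "fi u (neg_part u) = fi (neg_part u) (neg_part u)"
    unfolding fi_def by (rule Bochner_Integration.integral_cong) (auto simp: min_def)
  show "DE u (pos_part u) = Ne (pos_part u) + cross u + lam * inter (pos_part u) (neg_part u)"
    unfolding DE_def Ne_def ip1 i1 up f1 by (simp add: algebra_simps)
  show "DE u (neg_part u) = Ne (neg_part u) + cross u + lam * inter (pos_part u) (neg_part u)"
    unfolding DE_def Ne_def ip2 i2 um f2 by (simp add: algebra_simps)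
qed

text \<open>Testing criticality with each part expresses \<open>fi\<close> of the part through its
  norm, its Poisson term and the cross terms. Subtracting the energies of the two projections then
  leaves nonnegative terms and a strictly positive multiple of the cross term.\<close>

proposition energy_doubling:
  assumes u: "u \<in> H" and pos: "nrm (pos_part u) > 0" "nrm (neg_part u) > 0"
    and crit: "DE u (pos_part u) = 0" "DE u (neg_part u) = 0"
  shows "2 * c0 < E u"
proof -
  note P = parts_in_H(1)[OF u] and M = parts_in_H(2)[OF u]
  note D = parts_decomposition[OF u]
  obtain \<alpha> where \<alpha>: "0 < \<alpha>" "(\<lambda>x. \<alpha> * pos_part u x) \<in> NN" by (rule nehari_projection[OF P pos(1)], rule that)
  obtain \<beta> where \<beta>: "0 < \<beta>" "(\<lambda>x. \<beta> * neg_part u x) \<in> NN" by (rule nehari_projection[OF M pos(2)], rule that)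
  \<comment> \<open>Only even powers of the factors occur, so the identity below is quadratic in a
    and b.\<close>
  define a b where "a = \<alpha>\<^sup>2" and "b = \<beta>\<^sup>2"
  have a4: "\<alpha> ^ 4 = a\<^sup>2" "\<beta> ^ 4 = b\<^sup>2" by (simp_all add: a_def b_def flip: power_mult)
  define Ap Am X Dp Dm Dx where "Ap = ip (pos_part u) (pos_part u)" and "Am = ip (neg_part u) (neg_part u)"
    and "X = cross u" and "Dp = inter (pos_part u) (pos_part u)" and "Dm = inter (neg_part u) (neg_part u)"
    and "Dx = inter (pos_part u) (neg_part u)"
  define fp fm Fp Fm Fap Fbm where "fp = fi (pos_part u) (pos_part u)" and "fm = fi (neg_part u) (neg_part u)"
    and "Fp = Fi (pos_part u)" and "Fm = Fi (neg_part u)"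
    and "Fap = Fi (\<lambda>x. \<alpha> * pos_part u x)" and "Fbm = Fi (\<lambda>x. \<beta> * neg_part u x)"
  have S1: "0 \<le> (1 - a\<^sup>2) / 4 * fp + Fap - Fp"
    using Fi_ray[OF P, of \<alpha>] \<alpha>(1) unfolding a4 fp_def Fap_def Fp_def by simp
  have S2: "0 \<le> (1 - b\<^sup>2) / 4 * fm + Fbm - Fm"
    using Fi_ray[OF M, of \<beta>] \<beta>(1) unfolding a4 fm_def Fbm_def Fm_def by simp
  have fpe: "fp = Ap + X + lam * (Dp + Dx)" using crit(1) D(5)
    unfolding Ne_def fp_def Ap_def X_def Dp_def Dx_def by (simp add: algebra_simps)
  have fme: "fm = Am + X + lam * (Dm + Dx)" using crit(2) D(6)
    unfolding Ne_def fm_def Am_def X_def Dm_def Dx_def by (simp add: algebra_simps)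
  have Eu: "E u = 1/2 * (Ap + 2 * X + Am) + lam/4 * (Dp + 2 * Dx + Dm) - (Fp + Fm)"
    unfolding energy_eq D(1-3) Ap_def Am_def X_def Dp_def Dm_def Dx_def Fp_def Fm_def by simp
  have Ea: "E (\<lambda>x. \<alpha> * pos_part u x) = 1/2 * (a * Ap) + lam/4 * (a\<^sup>2 * Dp) - Fap"
    unfolding E_scale[OF P] a4 by (simp add: Ap_def Dp_def Fap_def a_def)
  have Eb: "E (\<lambda>x. \<beta> * neg_part u x) = 1/2 * (b * Am) + lam/4 * (b\<^sup>2 * Dm) - Fbm"
    unfolding E_scale[OF M] a4 by (simp add: Am_def Dm_def Fbm_def b_def)
  have "E u - E (\<lambda>x. \<alpha> * pos_part u x) - E (\<lambda>x. \<beta> * neg_part u x) =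
     (1 - a)\<^sup>2 / 4 * Ap + (1 - b)\<^sup>2 / 4 * Am + X * (1/2 + (a\<^sup>2 + b\<^sup>2) / 4) + lam * Dx * (a\<^sup>2 + b\<^sup>2) / 4
     + ((1 - a\<^sup>2) / 4 * fp + Fap - Fp) + ((1 - b\<^sup>2) / 4 * fm + Fbm - Fm)"
    unfolding Eu Ea Eb fpe fme by (simp add: field_simps power2_eq_square)
  moreover have "0 \<le> (1 - a)\<^sup>2 / 4 * Ap" "0 \<le> (1 - b)\<^sup>2 / 4 * Am" by (simp_all add: Ap_def Am_def)
  moreover have "0 < X * (1/2 + (a\<^sup>2 + b\<^sup>2) / 4)"
    using cross_pos[OF u pos] unfolding X_def by (intro mult_pos_pos add_pos_nonneg) auto
  moreover have "0 \<le> lam * Dx * (a\<^sup>2 + b\<^sup>2) / 4"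
    using lam inter_nonneg[OF P] by (simp add: Dx_def)
  ultimately have "E (\<lambda>x. \<alpha> * pos_part u x) + E (\<lambda>x. \<beta> * neg_part u x) < E u" using S1 S2 by linarith
  then show ?thesis using nehari_level_le[OF \<alpha>(2)] nehari_level_le[OF \<beta>(2)] by linarith
qed

text \<open>If one sign part pairs nonpositively with \<open>E'\<close>, projecting that part alone onto the Nehari set
  costs strictly less energy.\<close>

lemma minimizer_constant_sign:
  assumes w: "w \<in> NN" "E w = c0"
  shows "nrm (pos_part w) = 0 \<or> nrm (neg_part w) = 0"
proof (rule ccontr)
  assume "\<not> ?thesis"
  then have pos: "nrm (pos_part w) > 0" "nrm (neg_part w) > 0"
    using nrm_nonneg[of "pos_part w"] nrm_nonneg[of "neg_part w"] by linarith+
  have wH: "w \<in> H" by (rule nehariD(1)[OF w(1)])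
  note P = parts_in_H(1)[OF wH] and M = parts_in_H(2)[OF wH]
  note D = parts_decomposition[OF wH]
  have X: "cross w > 0" by (rule cross_pos[OF wH pos])
  have Dx: "0 \<le> lam * inter (pos_part w) (neg_part w)" using lam inter_nonneg[OF P] by simp
  have "DE w (\<lambda>x. 1 * pos_part w x + 1 * neg_part w x) = 1 * DE w (pos_part w) + 1 * DE w (neg_part w)"
    by (rule bspec[OF bspec[OF conjunct1[OF energy_has_derivative[OF wH, unfolded has_derivative_H_def]] P] M, THEN spec, THEN spec])
  then have sum0: "DE w (pos_part w) + DE w (neg_part w) = 0"
    unfolding parts_sum DE_self using nehariD(3)[OF w(1)] by simp
  have A: "ip (pos_part w) (pos_part w) > 0" "ip (neg_part w) (neg_part w) > 0"
    using pos unfolding nrm_sq[symmetric] by simp_all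
  have c: "c0 = ip w w / 4 + AR w" using E_nehari[OF w(1)] w(2) by simp
  have False if v: "v \<in> H" "nrm v > 0" "Ne v \<le> 0" and lt: "ip v v / 4 + AR v < c0" for v
  proof -
    obtain \<tau> where \<tau>: "(\<lambda>x. \<tau> * v x) \<in> NN" "E (\<lambda>x. \<tau> * v x) \<le> ip v v / 4 + AR v"
      by (rule nehari_project_down[OF v], rule that)
    show False using nehari_level_le[OF \<tau>(1)] \<tau>(2) lt by linarith
  qed
  \<comment> \<open>The two pairings sum to 0 and each exceeds \<open>Ne\<close> of its part by
    positive cross terms, so not both values of \<open>Ne\<close> can be positive.\<close>
  moreover have "Ne (pos_part w) \<le> 0 \<or> Ne (neg_part w) \<le> 0" using sum0 D(5,6) X Dx by linarith
  moreover have "ip (pos_part w) (pos_part w) / 4 + AR (pos_part w) < c0"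
    unfolding c D(1) D(4) add_divide_distrib using A X AR_integral_nonneg[of "neg_part w"] by linarith
  moreover have "ip (neg_part w) (neg_part w) / 4 + AR (neg_part w) < c0"
    unfolding c D(1) D(4) add_divide_distrib using A X AR_integral_nonneg[of "pos_part w"] by linarith
  ultimately show False using P M pos by blast
qed

text \<open>A part of norm zero contributes to none of the terms, cross terms included, so the other
  part inherits both constraint and energy. This turns an almost everywhere sign into a pointwise
  one, as the positivity argument requires.\<close>

lemma null_part:
  assumes w: "w \<in> NN" "E w = c0"
  shows "nrm (neg_part w) = 0 \<Longrightarrow> pos_part w \<in> NN \<and> E (pos_part w) = c0"
    and "nrm (pos_part w) = 0 \<Longrightarrow> neg_part w \<in> NN \<and> E (neg_part w) = c0"
proof -
  have wH: "w \<in> H" by (rule nehariD(1)[OF w(1)])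
  note P = parts_in_H(1)[OF wH] and M = parts_in_H(2)[OF wH]
  note D = parts_decomposition[OF wH]
  have Z: "inter u z = 0" "fi z z = 0" "Fi z = 0" "ip z z = 0" if z: "z \<in> H" "nrm z = 0" for u z
  proof -
    have ae: "AE x in lebesgue. z x = 0" using nrm_zero_AE z by blast
    show "inter u z = 0" unfolding inter_def by (rule integral_eq_zero_AE) (use ae in eventually_elim, simp)
    show "Fi z = 0" unfolding Fi_def by (rule integral_eq_zero_AE) (use ae in eventually_elim, simp)
    show "fi z z = 0" by (rule fi_zero_AE[OF z])
    show "ip z z = 0" using z(2) by (simp flip: nrm_sq)
  qed
  have AR0: "AR z = 0" if z: "z \<in> H" "nrm z = 0" for z using AR_eq[OF z(1)] Z[OF z] by simp
  have fsum: "fi w w = fi (pos_part w) (pos_part w) + fi (neg_part w) (neg_part w)"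
    using D(3,4) AR_eq[OF wH] AR_eq[OF P] AR_eq[OF M] by linarith
  have Xle: "\<bar>cross w\<bar> \<le> nrm (pos_part w) * nrm (neg_part w)" unfolding ip_parts[symmetric] by (rule ip_CS[OF P M])
  have Ew: "1/2 * ip w w + lam/4 * inter w w - Fi w = c0" using w(2) by (simp add: energy_eq)
  have Nw: "ip w w + lam * inter w w - fi w w = 0" using nehariD(3)[OF w(1)] by (simp add: Ne_def)
  have wpos: "ip w w > 0" using nehariD(2)[OF w(1)] unfolding nrm_sq[symmetric] by simp
  show "pos_part w \<in> NN \<and> E (pos_part w) = c0" if z: "nrm (neg_part w) = 0"
  proof -
    have "cross w = 0" using Xle z by simp
    then have e: "ip w w = ip (pos_part w) (pos_part w)" "inter w w = inter (pos_part w) (pos_part w)"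
      "fi w w = fi (pos_part w) (pos_part w)" "Fi w = Fi (pos_part w)"
      using D(1-3) fsum Z[OF M z] by simp_all
    have "(nrm (pos_part w))\<^sup>2 > 0" using wpos e(1) by (simp add: nrm_sq)
    then show ?thesis using P Ew Nw nrm_nonneg[of "pos_part w"] unfolding e nehari_iff energy_eq Ne_def
      by (auto simp: less_le)
  qed
  show "neg_part w \<in> NN \<and> E (neg_part w) = c0" if z: "nrm (pos_part w) = 0"
  proof -
    have "cross w = 0" using Xle z by simp
    moreover have "inter (pos_part w) (neg_part w) = 0" using inter_commute[OF P M] Z(1)[OF P z] by simp
    ultimately have e: "ip w w = ip (neg_part w) (neg_part w)" "inter w w = inter (neg_part w) (neg_part w)"
      "fi w w = fi (neg_part w) (neg_part w)" "Fi w = Fi (neg_part w)"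
      using D(1-3) fsum Z[OF P z] by simp_all
    have "(nrm (neg_part w))\<^sup>2 > 0" using wpos e(1) by (simp add: nrm_sq)
    then show ?thesis using M Ew Nw nrm_nonneg[of "neg_part w"] unfolding e nehari_iff energy_eq Ne_def
      by (auto simp: less_le)
  qed
qed

end

section \<open>Strict positivity\<close>

text \<open>If the pairs cross, that is a < p and q < b, the left side differs from the right by
  exactly (a - q)^2. The product that is kept is the gain of the nonlocal form when a is raised to
  p.\<close>

lemma max_kernel_ineq:
  fixes a b p q :: real
  shows "(max a p - max b q)\<^sup>2 + 2 * (max (p - a) 0 * max (b - q) 0) \<le> (a - b)\<^sup>2 + (p - q)\<^sup>2"
proof -
  have key: "(a - q)\<^sup>2 \<le> (a - b)\<^sup>2 + (p - q)\<^sup>2" if "p \<le> a" "b \<le> q" for a b p q :: real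
  proof -
    have "(a - b)\<^sup>2 + (p - q)\<^sup>2 = (a - q)\<^sup>2 + (p - b)\<^sup>2 + 2 * ((a - p) * (q - b))"
      by (simp add: power2_eq_square algebra_simps)
    moreover have "0 \<le> (a - p) * (q - b)" using that by (intro mult_nonneg_nonneg) auto
    ultimately show ?thesis using zero_le_power2[of "p - b"] by linarith
  qed
  consider "p \<le> a" "q \<le> b" | "p \<le> a" "b < q" | "a < p" "q \<le> b" | "a < p" "b < q" by linarith
  then show ?thesis
  proof cases
    case 3
    have "(a - b)\<^sup>2 + (p - q)\<^sup>2 = (p - b)\<^sup>2 + 2 * ((p - a) * (b - q)) + (a - q)\<^sup>2"
      by (simp add: power2_eq_square algebra_simps)
    then show ?thesis using 3 zero_le_power2[of "a - q"] by (simp add: max_def)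
  qed (use key in \<open>auto simp: max_def\<close>)
qed

section \<open>Cone functions and comparison with a raised minimizer\<close>

context sp_problem
begin

definition bump :: "real \<Rightarrow> R3 \<Rightarrow> real" where
  "bump R x = max 0 (R - norm x)"

lemma bump_props:
  shows "\<bar>bump R x - bump R y\<bar> \<le> 1 * norm (x - y)" "0 \<le> bump R x" "bump R x \<le> \<bar>R\<bar>" "R \<le> norm x \<Longrightarrow> bump R x = 0"
    "norm x < R \<Longrightarrow> 0 < bump R x"
proof -
  have "\<bar>norm x - norm y\<bar> \<le> norm (x - y)" by (rule norm_triangle_ineq3)
  then show "\<bar>bump R x - bump R y\<bar> \<le> 1 * norm (x - y)" by (auto simp: bump_def max_def)
  show "bump R x \<le> \<bar>R\<bar>" unfolding bump_def using norm_ge_zero[of x] by linarith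
qed (auto simp: bump_def)

text \<open>A cone is Lipschitz with compact support, on which the continuous V is bounded; being
  positive exactly inside a ball is all that the comparison asks of it.\<close>

lemma bump_in_H: "bump R \<in> H"
proof (rule space_HI)
  have "continuous_on UNIV (\<lambda>x. max 0 (R - norm (x :: R3)))" by (intro continuous_intros)
  then have c: "continuous_on UNIV (bump R)" by (simp add: bump_def[abs_def])
  then have [measurable]: "bump R \<in> borel_measurable lebesgue"
    by (simp add: borel_measurable_continuous_onI measurable_completion)
  show "bump R \<in> gagliardo_space s"
  proof (rule lipschitz_gagliardo_space[OF s])
    show "\<bar>bump R x - bump R y\<bar> \<le> 1 * norm (x - y)" for x y by (rule bump_props)
    show "\<bar>bump R x\<bar> \<le> \<bar>R\<bar>" for x using bump_props(2,3)[of R x] by simp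
    show "bump R x = 0" if "R \<le> norm x" for x using that by (rule bump_props)
  qed
  have "compact (V ` cball 0 \<bar>R\<bar>)"
    using V_cont by (intro compact_continuous_image continuous_on_subset[OF V_cont]) auto
  then have "bounded (V ` cball 0 \<bar>R\<bar>)" by (rule compact_imp_bounded)
  then obtain B where "\<forall>y\<in>V ` cball 0 \<bar>R\<bar>. norm y \<le> B" unfolding bounded_iff ..
  then have B: "\<And>x. norm x \<le> \<bar>R\<bar> \<Longrightarrow> \<bar>V x\<bar> \<le> B" by simp
  show "integrable lebesgue (\<lambda>x. V x * (bump R x)\<^sup>2)"
  proof (rule integrable_bounded_support[where B = "B * \<bar>R\<bar>\<^sup>2" and R = R])
    show "(\<lambda>x. V x * (bump R x)\<^sup>2) \<in> borel_measurable lebesgue" by measurable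
    show "V x * (bump R x)\<^sup>2 = 0" if "R \<le> norm x" for x using bump_props(4)[OF that] by simp
    show "\<bar>V x * (bump R x)\<^sup>2\<bar> \<le> B * \<bar>R\<bar>\<^sup>2" for x
    proof (cases "norm x < R")
      case True
      then have "\<bar>V x\<bar> \<le> B" by (intro B) simp
      moreover have "(bump R x)\<^sup>2 \<le> \<bar>R\<bar>\<^sup>2" using bump_props(2,3)[of R x] by (intro power_mono)
      ultimately show ?thesis unfolding abs_mult by (intro mult_mono) auto
    next
      case False
      have "0 \<le> B" using B[of 0] by simp
      then show ?thesis using False bump_props(4)[of R x] by simp
    qed
  qed
qed

text \<open>Strong maximum principle by comparison of energies: raising a nonnegative minimizer \<open>m\<close> to
  \<open>max m (\<epsilon> \<psi>)\<close> changes every term by \<open>O(\<epsilon>\<^sup>2)\<close>, except that the Gagliardo form gains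
  \<open>- 2 \<epsilon> \<kappa>\<close> with \<open>\<kappa> > 0\<close> whenever \<open>m\<close> vanishes on a set of positive measure.\<close>

proposition minimizer_positive:
  fixes \<sigma> :: real
  assumes \<sigma>: "\<sigma> = 1 \<or> \<sigma> = -1" and m: "m \<in> H" "\<And>x. 0 \<le> m x"
    and w: "(\<lambda>x. \<sigma> * m x) \<in> NN" "E (\<lambda>x. \<sigma> * m x) = c0"
  shows "AE x in lebesgue. 0 < m x"
proof (rule ccontr)
  assume notpos: "\<not> ?thesis"
  \<comment> \<open>The sign allows a nonpositive minimizer without any symmetry of f; outside the
    argument of f only even powers of \<sigma> or its modulus occur.\<close>
  have \<sigma>2: "\<sigma>\<^sup>2 = 1" "\<sigma> ^ 4 = 1" "\<bar>\<sigma>\<bar> = 1" using \<sigma> by auto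
  note [measurable] = space_HD(1)[OF m(1)]
  have mpos: "nrm m > 0" using nehariD(2)[OF w(1)] by (simp add: nrm_scale \<sigma>2)
  \<comment> \<open>Localizes the zero set: some ball already contains a non-null part of
    it.\<close>
  obtain R where R: "\<not> (AE x in lebesgue. norm x < R \<longrightarrow> 0 < m x)"
  proof (rule ccontr)
    assume "\<not> thesis"
    then have "\<forall>n::nat. AE x in lebesgue. norm x < real n \<longrightarrow> 0 < m x" using that by blast
    then have "AE x in lebesgue. \<forall>n::nat. norm x < real n \<longrightarrow> 0 < m x" unfolding AE_all_countable .
    then have "AE x in lebesgue. 0 < m x" by eventually_elim (metis reals_Archimedean2)
    then show False using notpos by blast
  qed
  define \<psi> where "\<psi> = bump R"
  have \<psi>H: "\<psi> \<in> H" unfolding \<psi>_def by (rule bump_in_H)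
  note [measurable] = space_HD(1)[OF \<psi>H]
  have \<psi>: "0 \<le> \<psi> x" "\<psi> x \<le> \<bar>R\<bar>" "norm x < R \<Longrightarrow> 0 < \<psi> x" for x
    unfolding \<psi>_def using bump_props by blast+
  \<comment> \<open>Since m is not a null function, it exceeds \<epsilon>0 \<psi> on a non-null set
    for a small fixed \<epsilon>0; these points and the zeros of m interact.\<close>
  obtain N :: nat where N: "\<not> (AE x in lebesgue. m x \<le> \<psi> x / real (Suc N))"
  proof (rule ccontr)
    assume "\<not> thesis"
    then have "\<forall>n::nat. AE x in lebesgue. m x \<le> \<psi> x / real (Suc n)" using that by blast
    then have "AE x in lebesgue. \<forall>n::nat. m x \<le> \<psi> x / real (Suc n)" unfolding AE_all_countable .
    then have "AE x in lebesgue. m x = 0"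
    proof eventually_elim
      case (elim x)
      have "(\<lambda>n. \<psi> x * (1 / real (Suc n))) \<longlonglongrightarrow> \<psi> x * 0" by (intro tendsto_intros LIMSEQ_Suc lim_1_over_n)
      then have "m x \<le> \<psi> x * 0" by (rule LIMSEQ_le_const) (use elim in simp)
      then show ?case using m(2)[of x] by simp
    qed
    then show False using nrm_zero_AE[OF m(1)] mpos by simp
  qed
  define \<epsilon>0 where "\<epsilon>0 = 1 / real (Suc N)"
  have \<epsilon>0: "0 < \<epsilon>0" "\<epsilon>0 \<le> 1" by (simp_all add: \<epsilon>0_def)
  define ind where "ind x = (if m x = 0 then 1 else 0 :: real)" for x
  \<comment> \<open>The crossing product with one factor \<epsilon> divided out. Using \<epsilon>0
    in place of \<epsilon> in the second factor makes it independent of \<epsilon>, and the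
    indicator keeps only the zeros of m.\<close>
  define cr where "cr z = ind (fst z) * \<psi> (fst z) * max (m (snd z) - \<epsilon>0 * \<psi> (snd z)) 0 / norm (fst z - snd z) powr (3 + 2 * s)" for z
  have [measurable]: "ind \<in> borel_measurable lebesgue" unfolding ind_def[abs_def] by measurable
  have [measurable]: "cr \<in> borel_measurable LL" unfolding cr_def[abs_def] by measurable
  have cr0: "0 \<le> cr z" for z unfolding cr_def by (intro divide_nonneg_nonneg mult_nonneg_nonneg \<psi>) (auto simp: ind_def)
  define me where "me \<epsilon> x = max (m x) (\<epsilon> * \<psi> x)" for \<epsilon> x
  have kern: "gagliardo_kernel s (me \<epsilon>) (me \<epsilon>) z + 2 * \<epsilon> * cr z \<le> gagliardo_kernel s m m z + \<epsilon>\<^sup>2 * gagliardo_kernel s \<psi> \<psi> z"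
    if \<epsilon>: "0 < \<epsilon>" "\<epsilon> \<le> \<epsilon>0" for \<epsilon> z
  proof -
    define x y where "x = fst z" and "y = snd z"
    define d where "d = norm (x - y) powr (3 + 2 * s)"
    have d: "0 \<le> d" by (simp add: d_def)
    have "ind x * (\<epsilon> * \<psi> x) \<le> max (\<epsilon> * \<psi> x - m x) 0" using \<epsilon> \<psi>(1)[of x] by (simp add: ind_def)
    moreover have "max (m y - \<epsilon>0 * \<psi> y) 0 \<le> max (m y - \<epsilon> * \<psi> y) 0"
    proof -
      have "\<epsilon> * \<psi> y \<le> \<epsilon>0 * \<psi> y" using \<epsilon> \<psi>(1) by (intro mult_right_mono)
      then show ?thesis by (simp add: max_def)
    qed
    ultimately have "ind x * (\<epsilon> * \<psi> x) * max (m y - \<epsilon>0 * \<psi> y) 0 \<le> max (\<epsilon> * \<psi> x - m x) 0 * max (m y - \<epsilon> * \<psi> y) 0"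
      by (intro mult_mono) auto
    then have "(me \<epsilon> x - me \<epsilon> y)\<^sup>2 + 2 * (ind x * (\<epsilon> * \<psi> x) * max (m y - \<epsilon>0 * \<psi> y) 0) \<le> (m x - m y)\<^sup>2 + (\<epsilon> * \<psi> x - \<epsilon> * \<psi> y)\<^sup>2"
      using max_kernel_ineq[of "m x" "\<epsilon> * \<psi> x" "m y" "\<epsilon> * \<psi> y"] unfolding me_def by linarith
    then have "((me \<epsilon> x - me \<epsilon> y)\<^sup>2 + 2 * (ind x * (\<epsilon> * \<psi> x) * max (m y - \<epsilon>0 * \<psi> y) 0)) / d \<le> ((m x - m y)\<^sup>2 + (\<epsilon> * \<psi> x - \<epsilon> * \<psi> y)\<^sup>2) / d"
      using d by (rule divide_right_mono)
    moreover have "(\<epsilon> * \<psi> x - \<epsilon> * \<psi> y)\<^sup>2 = \<epsilon>\<^sup>2 * (\<psi> x - \<psi> y)\<^sup>2"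
      by (simp add: power_mult_distrib flip: right_diff_distrib)
    ultimately show ?thesis
      unfolding gagliardo_kernel_diag cr_def x_def[symmetric] y_def[symmetric] d_def[symmetric]
      by (simp add: add_divide_distrib mult_ac)
  qed
  have mi: "integrable LL (gagliardo_kernel s m m)" "integrable LL (gagliardo_kernel s \<psi> \<psi>)"
    using gagliardo_spaceD(2) space_HD(2) m(1) \<psi>H by blast+
  have cri: "integrable LL cr"
  proof (rule Bochner_Integration.integrable_bound)
    show "integrable LL (\<lambda>z. 1 / (2 * \<epsilon>0) * (gagliardo_kernel s m m z + \<epsilon>0\<^sup>2 * gagliardo_kernel s \<psi> \<psi> z))" using mi by simp
    have "cr z \<le> 1 / (2 * \<epsilon>0) * (gagliardo_kernel s m m z + \<epsilon>0\<^sup>2 * gagliardo_kernel s \<psi> \<psi> z)" for z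
    proof -
      have "2 * \<epsilon>0 * cr z \<le> gagliardo_kernel s m m z + \<epsilon>0\<^sup>2 * gagliardo_kernel s \<psi> \<psi> z"
        using kern[OF \<epsilon>0(1) order_refl, of z] gagliardo_kernel_nonneg[of s "me \<epsilon>0" z] by linarith
      then show ?thesis using \<epsilon>0 by (simp add: field_simps)
    qed
    then show "AE z in LL. norm (cr z) \<le> norm (1 / (2 * \<epsilon>0) * (gagliardo_kernel s m m z + \<epsilon>0\<^sup>2 * gagliardo_kernel s \<psi> \<psi> z))"
      unfolding real_norm_def abs_of_nonneg[OF cr0] by (intro AE_I2 order_trans[OF _ abs_ge_self])
  qed measurable
  define \<kappa> where "\<kappa> = integral\<^sup>L LL cr"
  \<comment> \<open>If the integral vanished, the slice through almost every zero of m in the ball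
    would give m \<le> \<epsilon>0 \<psi> almost everywhere, contrary to the choice of N.\<close>
  have \<kappa>: "\<kappa> > 0"
  proof (rule ccontr)
    assume "\<not> \<kappa> > 0"
    moreover have "\<kappa> \<ge> 0" unfolding \<kappa>_def by (rule Bochner_Integration.integral_nonneg) (rule cr0)
    ultimately have "integral\<^sup>L LL cr = 0" by (simp add: \<kappa>_def)
    then have "AE z in LL. cr z = 0" using integral_nonneg_eq_0_iff_AE[OF cri] cr0 by simp
    then have "AE x in lebesgue. AE y in lebesgue. cr (x, y) = 0" by (rule LL.AE_pair)
    then have "AE x in lebesgue. norm x < R \<longrightarrow> 0 < m x"
    proof eventually_elim
      case (elim x)
      show ?case
      proof (intro impI, rule ccontr)
        assume x: "norm x < R" "\<not> 0 < m x"
        then have mx: "m x = 0" using m(2)[of x] by simp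
        have "AE y in lebesgue. m y \<le> \<psi> y / real (Suc N)"
          using elim
        proof eventually_elim
          case (elim y)
          show ?case
          proof (rule ccontr)
            assume "\<not> m y \<le> \<psi> y / real (Suc N)"
            then have y: "0 < m y - \<epsilon>0 * \<psi> y" by (simp add: \<epsilon>0_def)
            moreover have "0 \<le> \<epsilon>0 * \<psi> y" using \<epsilon>0 \<psi>(1)[of y] by simp
            ultimately have "x \<noteq> y" using mx by auto
            then have "0 < cr (x, y)" unfolding cr_def using mx y \<psi>(3)[OF x(1)] by (simp add: ind_def)
            then show False using elim by simp
          qed
        qed
        then show False using N by blast
      qed
    qed
    then show False using R by blast
  qed
  have meH: "me \<epsilon> \<in> H" if \<epsilon>: "0 < \<epsilon>" "\<epsilon> \<le> \<epsilon>0" for \<epsilon>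
  proof (rule space_H_dominated[OF _ m(1) space_H_scale[OF \<psi>H, of \<epsilon>]])
    show "me \<epsilon> \<in> borel_measurable lebesgue" unfolding me_def[abs_def] by measurable
    show "(me \<epsilon> x - me \<epsilon> y)\<^sup>2 \<le> (m x - m y)\<^sup>2 + (\<epsilon> * \<psi> x - \<epsilon> * \<psi> y)\<^sup>2" for x y
    proof -
      have "0 \<le> max (\<epsilon> * \<psi> x - m x) 0 * max (m y - \<epsilon> * \<psi> y) 0" by (intro mult_nonneg_nonneg) auto
      then show ?thesis
        using max_kernel_ineq[of "m x" "\<epsilon> * \<psi> x" "m y" "\<epsilon> * \<psi> y"] unfolding me_def by linarith
    qed
    show "(me \<epsilon> x)\<^sup>2 \<le> (m x)\<^sup>2 + (\<epsilon> * \<psi> x)\<^sup>2" for x by (simp add: me_def max_def)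
  qed
  have ip_me: "ip (me \<epsilon>) (me \<epsilon>) \<le> ip m m + \<epsilon>\<^sup>2 * ip \<psi> \<psi> - 2 * \<epsilon> * \<kappa>" if \<epsilon>: "0 < \<epsilon>" "\<epsilon> \<le> \<epsilon>0" for \<epsilon>
  proof -
    note H = meH[OF \<epsilon>]
    have ki: "integrable LL (gagliardo_kernel s (me \<epsilon>) (me \<epsilon>))" by (rule gagliardo_spaceD(2)[OF space_HD(2)[OF H]])
    have "(\<integral>z. gagliardo_kernel s (me \<epsilon>) (me \<epsilon>) z + 2 * \<epsilon> * cr z \<partial>LL) \<le> (\<integral>z. gagliardo_kernel s m m z + \<epsilon>\<^sup>2 * gagliardo_kernel s \<psi> \<psi> z \<partial>LL)"
      by (rule integral_mono) (use ki cri mi kern[OF \<epsilon>] in auto)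
    then have 1: "gagliardo_form s (me \<epsilon>) (me \<epsilon>) + 2 * \<epsilon> * \<kappa> \<le> gagliardo_form s m m + \<epsilon>\<^sup>2 * gagliardo_form s \<psi> \<psi>"
      using ki cri mi by (simp add: gagliardo_form_def \<kappa>_def)
    have "(LINT x|lebesgue. V x * (me \<epsilon> x)\<^sup>2) \<le> (LINT x|lebesgue. V x * (m x)\<^sup>2 + \<epsilon>\<^sup>2 * (V x * (\<psi> x)\<^sup>2))"
    proof (rule integral_mono)
      fix x
      have "V x * (me \<epsilon> x)\<^sup>2 \<le> V x * ((m x)\<^sup>2 + (\<epsilon> * \<psi> x)\<^sup>2)" by (intro mult_left_mono V_nonneg) (simp add: me_def max_def)
      then show "V x * (me \<epsilon> x)\<^sup>2 \<le> V x * (m x)\<^sup>2 + \<epsilon>\<^sup>2 * (V x * (\<psi> x)\<^sup>2)" by (simp add: power_mult_distrib algebra_simps)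
    qed (use space_HD(5) H m(1) \<psi>H in auto)
    then have 2: "(LINT x|lebesgue. V x * (me \<epsilon> x)\<^sup>2) \<le> (LINT x|lebesgue. V x * (m x)\<^sup>2) + \<epsilon>\<^sup>2 * (LINT x|lebesgue. V x * (\<psi> x)\<^sup>2)"
      using space_HD(5)[OF m(1)] space_HD(5)[OF \<psi>H] by simp
    show ?thesis using 1 2 unfolding ip_def power2_eq_square[symmetric] by (simp add: algebra_simps)
  qed
  define C1 where "C1 = ip \<psi> \<psi>"
  have C1: "0 \<le> C1" by (simp add: C1_def)
  define B where "B = ip m m + C1"
  have B0: "0 \<le> B" using C1 by (simp add: B_def)
  have nB: "(nrm (me \<epsilon>))\<^sup>2 \<le> B" if \<epsilon>: "0 < \<epsilon>" "\<epsilon> \<le> \<epsilon>0" for \<epsilon>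
  proof -
    have "\<epsilon>\<^sup>2 * C1 \<le> 1 * C1" using \<epsilon> \<epsilon>0 C1 by (intro mult_right_mono power_le_one) auto
    moreover have "0 \<le> \<epsilon> * \<kappa>" using \<epsilon> \<kappa> by simp
    ultimately show ?thesis using ip_me[OF \<epsilon>] unfolding nrm_sq B_def C1_def by linarith
  qed
  define C2 where "C2 = 2 * (KT\<^sup>2 * B * (nrm \<psi>)\<^sup>2)"
  have C2: "0 \<le> C2" using B0 by (simp add: C2_def)
  \<comment> \<open>The square of the maximum is at most m^2 + (\<epsilon> \<psi>)^2. One argument
    is replaced at a time, with symmetry in between, so that each step has a fixed nonnegative
    potential.\<close>
  have inter_me: "inter (me \<epsilon>) (me \<epsilon>) \<le> inter m m + \<epsilon>\<^sup>2 * C2" if \<epsilon>: "0 < \<epsilon>" "\<epsilon> \<le> \<epsilon>0" for \<epsilon>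
  proof -
    note H = meH[OF \<epsilon>]
    have step: "inter v (me \<epsilon>) - inter v m \<le> \<epsilon>\<^sup>2 * (KT\<^sup>2 * B * (nrm \<psi>)\<^sup>2)" if v: "v \<in> H" "(nrm v)\<^sup>2 \<le> B" for v
    proof -
      have "inter v (me \<epsilon>) \<le> (LINT x|lebesgue. phi t v x * (m x)\<^sup>2 + \<epsilon>\<^sup>2 * (phi t v x * (\<psi> x * \<psi> x)))"
        unfolding inter_def
      proof (rule integral_mono_AE)
        show "integrable lebesgue (\<lambda>x. phi t v x * (me \<epsilon> x)\<^sup>2)" by (rule phi_integrable_sq[OF v(1) H])
        show "integrable lebesgue (\<lambda>x. phi t v x * (m x)\<^sup>2 + \<epsilon>\<^sup>2 * (phi t v x * (\<psi> x * \<psi> x)))"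
          using phi_integrable_sq[OF v(1) m(1)] phi_integrable[OF v(1) \<psi>H \<psi>H] by simp
        show "AE x in lebesgue. phi t v x * (me \<epsilon> x)\<^sup>2 \<le> phi t v x * (m x)\<^sup>2 + \<epsilon>\<^sup>2 * (phi t v x * (\<psi> x * \<psi> x))"
          using phi_nonneg[OF v(1)]
        proof eventually_elim
          case (elim x)
          have "phi t v x * (me \<epsilon> x)\<^sup>2 \<le> phi t v x * ((m x)\<^sup>2 + (\<epsilon> * \<psi> x)\<^sup>2)" using elim by (intro mult_left_mono) (simp_all add: me_def max_def)
          then show ?case by (simp add: power2_eq_square algebra_simps)
        qed
      qed
      also have "\<dots> = inter v m + \<epsilon>\<^sup>2 * (LINT x|lebesgue. phi t v x * (\<psi> x * \<psi> x))"
        using phi_integrable_sq[OF v(1) m(1)] phi_integrable[OF v(1) \<psi>H \<psi>H] by (simp add: inter_def)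
      also have "\<dots> \<le> inter v m + \<epsilon>\<^sup>2 * (KT\<^sup>2 * B * (nrm \<psi>)\<^sup>2)"
      proof (intro add_left_mono mult_left_mono)
        have "(LINT x|lebesgue. phi t v x * (\<psi> x * \<psi> x)) \<le> KT\<^sup>2 * (nrm v)\<^sup>2 * nrm \<psi> * nrm \<psi>"
          using phi_trilinear_le[OF v(1) \<psi>H \<psi>H] by linarith
        also have "\<dots> = KT\<^sup>2 * (nrm v)\<^sup>2 * (nrm \<psi>)\<^sup>2" by (simp add: power2_eq_square)
        also have "\<dots> \<le> KT\<^sup>2 * B * (nrm \<psi>)\<^sup>2" using v(2) by (intro mult_right_mono mult_left_mono) auto
        finally show "(LINT x|lebesgue. phi t v x * (\<psi> x * \<psi> x)) \<le> KT\<^sup>2 * B * (nrm \<psi>)\<^sup>2" .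
      qed simp
      finally show ?thesis by simp
    qed
    have mB: "(nrm m)\<^sup>2 \<le> B" using C1 by (simp add: B_def nrm_sq)
    show ?thesis
      using step[OF H nB[OF \<epsilon>]] step[OF m(1) mB] inter_commute[OF H m(1)] unfolding C2_def by (simp add: algebra_simps)
  qed
  obtain C' where C': "C' > 0" "\<And>x \<tau>. \<bar>f x \<tau> * \<tau>\<bar> \<le> 1 * \<tau>\<^sup>2 + C' * \<bar>\<tau>\<bar> powr (p + 1)"
    "\<And>x \<tau>. \<bar>F x \<tau>\<bar> \<le> 1 * \<tau>\<^sup>2 + C' * \<bar>\<tau>\<bar> powr (p + 1)" by (rule F_growth[of 1, OF zero_less_one], rule that)
  define C where "C = 1 + C' * (2 * \<bar>R\<bar>) powr (p - 1)"
  have C: "0 \<le> C" using C' by (simp add: C_def)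
  have small: "\<bar>f x r * r\<bar> \<le> C * r\<^sup>2" "\<bar>F x r\<bar> \<le> C * r\<^sup>2" if r: "\<bar>r\<bar> \<le> 2 * \<bar>R\<bar>" for x r
  proof -
    have "\<bar>r\<bar> powr (p + 1) = \<bar>r\<bar> powr ((p - 1) + 2)" by (simp add: add.commute)
    also have "\<dots> = \<bar>r\<bar> powr (p - 1) * \<bar>r\<bar> powr 2" by (rule powr_add)
    also have "\<dots> \<le> (2 * \<bar>R\<bar>) powr (p - 1) * r\<^sup>2" using r p by (intro mult_mono powr_mono2) auto
    finally have "C' * \<bar>r\<bar> powr (p + 1) \<le> C' * ((2 * \<bar>R\<bar>) powr (p - 1) * r\<^sup>2)" using C'(1) by (intro mult_left_mono) auto
    then have "1 * r\<^sup>2 + C' * \<bar>r\<bar> powr (p + 1) \<le> C * r\<^sup>2" by (simp add: C_def algebra_simps)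
    then show "\<bar>f x r * r\<bar> \<le> C * r\<^sup>2" "\<bar>F x r\<bar> \<le> C * r\<^sup>2" using C'(2,3)[of x r] by linarith+
  qed
  define S where "S = (LINT x|lebesgue. (\<psi> x)\<^sup>2)"
  have S: "0 \<le> S" by (simp add: S_def)
  define C3 where "C3 = 2 * C * S"
  have C3: "0 \<le> C3" using C S by (simp add: C3_def)
  \<comment> \<open>The integrands differ only where m < \<epsilon> \<psi>. There both arguments are
    at most 2 |R| in modulus, so each value is of second order in \<epsilon>; restricting \<tau> to
    at most 2 keeps the constant uniform.\<close>
  have pert: "(LINT x|lebesgue. G x (\<tau> * \<sigma> * m x)) - \<tau>\<^sup>2 * \<epsilon>\<^sup>2 * C3 \<le> (LINT x|lebesgue. G x (\<tau> * \<sigma> * me \<epsilon> x))"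
    if \<epsilon>: "0 < \<epsilon>" "\<epsilon> \<le> \<epsilon>0" and \<tau>: "0 \<le> \<tau>" "\<tau> \<le> 2"
      and G: "\<And>x r. \<bar>r\<bar> \<le> 2 * \<bar>R\<bar> \<Longrightarrow> \<bar>G x r\<bar> \<le> C * r\<^sup>2"
      and Gi: "\<And>u. u \<in> H \<Longrightarrow> integrable lebesgue (\<lambda>x. G x (u x))" for \<epsilon> \<tau> and G :: "R3 \<Rightarrow> real \<Rightarrow> real"
  proof -
    have i: "integrable lebesgue (\<lambda>x. G x (\<tau> * \<sigma> * m x))" "integrable lebesgue (\<lambda>x. G x (\<tau> * \<sigma> * me \<epsilon> x))"
      by (intro Gi space_H_scale m meH \<epsilon>)+
    have pw: "G x (\<tau> * \<sigma> * m x) - \<tau>\<^sup>2 * \<epsilon>\<^sup>2 * (2 * C) * (\<psi> x)\<^sup>2 \<le> G x (\<tau> * \<sigma> * me \<epsilon> x)" for x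
    proof (cases "\<epsilon> * \<psi> x \<le> m x")
      case True
      then have "me \<epsilon> x = m x" by (simp add: me_def)
      moreover have "0 \<le> \<tau>\<^sup>2 * \<epsilon>\<^sup>2 * (2 * C) * (\<psi> x)\<^sup>2" using C by simp
      ultimately show ?thesis by simp
    next
      case False
      have bd: "\<bar>G x (\<tau> * \<sigma> * y)\<bar> \<le> \<tau>\<^sup>2 * \<epsilon>\<^sup>2 * C * (\<psi> x)\<^sup>2" if y: "0 \<le> y" "y \<le> \<epsilon> * \<psi> x" for y
      proof -
        have "\<epsilon> * \<psi> x \<le> 1 * \<bar>R\<bar>" using \<epsilon> \<epsilon>0 \<psi>(1,2) by (intro mult_mono) auto
        then have "\<tau> * y \<le> 2 * \<bar>R\<bar>" using \<tau> y by (intro mult_mono) auto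
        then have "\<bar>\<tau> * \<sigma> * y\<bar> \<le> 2 * \<bar>R\<bar>" using \<tau> y by (simp add: abs_mult \<sigma>2)
        then have "\<bar>G x (\<tau> * \<sigma> * y)\<bar> \<le> C * (\<tau> * \<sigma> * y)\<^sup>2" by (rule G)
        also have "\<dots> = C * \<tau>\<^sup>2 * y\<^sup>2" by (simp add: power_mult_distrib \<sigma>2)
        also have "\<dots> \<le> C * \<tau>\<^sup>2 * (\<epsilon> * \<psi> x)\<^sup>2" using C y by (intro mult_left_mono power_mono) auto
        finally show ?thesis by (simp add: power_mult_distrib mult_ac)
      qed
      have "\<bar>G x (\<tau> * \<sigma> * m x)\<bar> \<le> \<tau>\<^sup>2 * \<epsilon>\<^sup>2 * C * (\<psi> x)\<^sup>2" using bd[of "m x"] m(2) False by simp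
      moreover have "\<bar>G x (\<tau> * \<sigma> * me \<epsilon> x)\<bar> \<le> \<tau>\<^sup>2 * \<epsilon>\<^sup>2 * C * (\<psi> x)\<^sup>2"
        using bd[of "me \<epsilon> x"] False \<epsilon> \<psi>(1)[of x] by (simp add: me_def)
      moreover have "\<tau>\<^sup>2 * \<epsilon>\<^sup>2 * (2 * C) * (\<psi> x)\<^sup>2 = 2 * (\<tau>\<^sup>2 * \<epsilon>\<^sup>2 * C * (\<psi> x)\<^sup>2)" by simp
      ultimately show ?thesis by linarith
    qed
    have "(LINT x|lebesgue. G x (\<tau> * \<sigma> * m x) - \<tau>\<^sup>2 * \<epsilon>\<^sup>2 * (2 * C) * (\<psi> x)\<^sup>2) \<le> (LINT x|lebesgue. G x (\<tau> * \<sigma> * me \<epsilon> x))"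
      by (rule integral_mono) (use i space_HD(4)[OF \<psi>H] pw in auto)
    moreover have "(LINT x|lebesgue. G x (\<tau> * \<sigma> * m x) - \<tau>\<^sup>2 * \<epsilon>\<^sup>2 * (2 * C) * (\<psi> x)\<^sup>2) = (LINT x|lebesgue. G x (\<tau> * \<sigma> * m x)) - \<tau>\<^sup>2 * \<epsilon>\<^sup>2 * (2 * C) * S"
      using i space_HD(4)[OF \<psi>H] by (simp add: S_def)
    ultimately show ?thesis by (simp add: C3_def mult_ac)
  qed
  define A D where "A = ip m m" and "D = inter m m"
  have A: "A > 0" using mpos unfolding A_def nrm_sq[symmetric] by simp
  have ipw: "ip (\<lambda>x. \<sigma> * u x) (\<lambda>x. \<sigma> * u x) = ip u u" for u by (simp add: ip_scale2 \<sigma>2)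
  have inw: "u \<in> H \<Longrightarrow> inter (\<lambda>x. \<sigma> * u x) (\<lambda>x. \<sigma> * u x) = inter u u" for u by (simp add: inter_scale \<sigma>2)
  have wH: "(\<lambda>x. \<sigma> * m x) \<in> H" by (rule space_H_scale[OF m(1)])
  define L where "L = 4 * C1 + 16 * (lam * C2) + 4 * C3"
  have L: "0 \<le> L" using C1 C2 C3 lam by (simp add: L_def)
  define L' where "L' = C1 / 2 + lam * C2 + C3"
  have L': "0 \<le> L'" using C1 C2 C3 lam by (simp add: L'_def)
  \<comment> \<open>The bound through L makes \<open>Ne\<close> nonpositive at twice u; the bound
    through L' makes the gain \<epsilon> \<kappa> exceed all errors of order \<epsilon>^2.\<close>
  define \<epsilon> where "\<epsilon> = min \<epsilon>0 (min (A / (L + 1)) (\<kappa> / (2 * (L' + 1))))"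
  have \<epsilon>: "0 < \<epsilon>" "\<epsilon> \<le> \<epsilon>0" using \<epsilon>0 A L \<kappa> L' by (simp_all add: \<epsilon>_def)
  have \<epsilon>L: "\<epsilon>\<^sup>2 * L \<le> A"
  proof -
    have "\<epsilon>\<^sup>2 \<le> \<epsilon> * 1" unfolding power2_eq_square using \<epsilon> \<epsilon>0 by (intro mult_left_mono) auto
    then have "\<epsilon>\<^sup>2 * L \<le> A / (L + 1) * L" using L by (intro mult_right_mono) (auto simp: \<epsilon>_def)
    also have "\<dots> \<le> A" using L A by (simp add: field_simps)
    finally show ?thesis .
  qed
  have \<epsilon>L': "\<epsilon> * L' < \<kappa>"
  proof -
    have "\<epsilon> * L' \<le> \<kappa> / (2 * (L' + 1)) * L'" using L' by (intro mult_right_mono) (auto simp: \<epsilon>_def)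
    also have "\<dots> < \<kappa>"
    proof -
      have "0 < L' * \<kappa> + \<kappa> * 2" using L' \<kappa> by (intro add_nonneg_pos mult_nonneg_nonneg) auto
      then show ?thesis using L' by (simp add: field_simps)
    qed
    finally show ?thesis .
  qed
  note H = meH[OF \<epsilon>]
  define u where "u x = \<sigma> * me \<epsilon> x" for x
  have uH: "u \<in> H" unfolding u_def[abs_def] by (rule space_H_scale[OF H])
  have upos: "nrm u > 0"
  proof (rule ccontr)
    assume "\<not> nrm u > 0"
    then have "nrm u = 0" using nrm_nonneg[of u] by linarith
    then have "AE x in lebesgue. u x = 0" using nrm_zero_AE[OF uH] by blast
    then have "AE x in lebesgue. m x = 0"
    proof eventually_elim
      case (elim x)
      then have "me \<epsilon> x = 0" using \<sigma> by (auto simp: u_def)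
      then show ?case using m(2)[of x] by (simp add: me_def max_def split: if_splits)
    qed
    then show False using nrm_zero_AE[OF m(1)] mpos by simp
  qed
  have ipu: "ip u u \<le> A + \<epsilon>\<^sup>2 * C1 - 2 * \<epsilon> * \<kappa>" unfolding u_def[abs_def] ipw A_def C1_def by (rule ip_me[OF \<epsilon>])
  have inu: "inter u u \<le> D + \<epsilon>\<^sup>2 * C2" unfolding u_def[abs_def] inw[OF H] D_def by (rule inter_me[OF \<epsilon>])
  have ff: "integrable lebesgue (\<lambda>x. f x (v x) * v x)" if "v \<in> H" for v by (rule f_integrable[OF that that])
  \<comment> \<open>Doubling multiplies the norm term by 4 but \<open>fi\<close> by at least 16, and
    16 fi = 16 (A + lam D). The surplus 12 A absorbs the errors, so the projection factor is at most
    2.\<close>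
  have neg: "Ne (\<lambda>x. 2 * u x) \<le> 0"
  proof -
    have "(LINT x|lebesgue. f x (2 * \<sigma> * m x) * (2 * \<sigma> * m x)) - 2\<^sup>2 * \<epsilon>\<^sup>2 * C3 \<le> (LINT x|lebesgue. f x (2 * \<sigma> * me \<epsilon> x) * (2 * \<sigma> * me \<epsilon> x))"
      by (rule pert[OF \<epsilon>, of 2 "\<lambda>x r. f x r * r"]) (use small(1) ff in auto)
    then have f1: "(LINT x|lebesgue. f x (2 * (\<sigma> * m x)) * (2 * (\<sigma> * m x))) - 4 * \<epsilon>\<^sup>2 * C3 \<le> fi (\<lambda>x. 2 * u x) (\<lambda>x. 2 * u x)"
      by (simp add: fi_def u_def mult.assoc)
    have "(LINT x|lebesgue. 16 * (f x (\<sigma> * m x) * (\<sigma> * m x))) \<le> (LINT x|lebesgue. f x (2 * (\<sigma> * m x)) * (2 * (\<sigma> * m x)))"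
    proof (rule integral_mono)
      show "integrable lebesgue (\<lambda>x. 16 * (f x (\<sigma> * m x) * (\<sigma> * m x)))" using ff[OF wH] by simp
      show "integrable lebesgue (\<lambda>x. f x (2 * (\<sigma> * m x)) * (2 * (\<sigma> * m x)))" by (rule ff[OF space_H_scale[OF wH]])
      show "16 * (f x (\<sigma> * m x) * (\<sigma> * m x)) \<le> f x (2 * (\<sigma> * m x)) * (2 * (\<sigma> * m x))" for x
      proof -
        have "16 * (f x r * r) \<le> f x (2 * r) * (2 * r)" for r using f_ray_ge[of 2 x r] by (simp add: mult_ac)
        then show ?thesis .
      qed
    qed
    then have f2: "16 * fi (\<lambda>x. \<sigma> * m x) (\<lambda>x. \<sigma> * m x) \<le> (LINT x|lebesgue. f x (2 * (\<sigma> * m x)) * (2 * (\<sigma> * m x)))"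
      by (simp add: fi_def)
    have f3: "fi (\<lambda>x. \<sigma> * m x) (\<lambda>x. \<sigma> * m x) = A + lam * D"
      using nehariD(3)[OF w(1)] unfolding Ne_def ipw inw[OF m(1)] A_def D_def by simp
    have "lam * inter u u \<le> lam * (D + \<epsilon>\<^sup>2 * C2)" using inu lam by (intro mult_left_mono) auto
    then have "Ne (\<lambda>x. 2 * u x) \<le> 4 * (A + \<epsilon>\<^sup>2 * C1 - 2 * \<epsilon> * \<kappa>) + 16 * (lam * (D + \<epsilon>\<^sup>2 * C2)) - (16 * (A + lam * D) - 4 * \<epsilon>\<^sup>2 * C3)"
      using ipu f1 f2 f3 unfolding Ne_scale[OF uH] by simp
    also have "\<dots> = \<epsilon>\<^sup>2 * L - 12 * A - 8 * \<epsilon> * \<kappa>" by (simp add: L_def algebra_simps)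
    also have "\<dots> \<le> 0"
    proof -
      have "0 \<le> 8 * \<epsilon> * \<kappa>" using \<epsilon> \<kappa> by simp
      then show ?thesis using \<epsilon>L A by linarith
    qed
    finally show ?thesis .
  qed
  obtain \<tau> where \<tau>: "0 < \<tau>" "\<tau> \<le> 2" "(\<lambda>x. \<tau> * u x) \<in> NN"
    by (rule nehari_scaling[OF uH upos zero_less_numeral neg], rule that)
  have Fp: "Fi (\<lambda>x. \<tau> * (\<sigma> * m x)) - \<tau>\<^sup>2 * \<epsilon>\<^sup>2 * C3 \<le> Fi (\<lambda>x. \<tau> * u x)"
    using pert[OF \<epsilon>, of \<tau> F] \<tau> small(2) F_integrable unfolding Fi_def u_def by (simp add: mult.assoc)
  have Ew: "E (\<lambda>x. \<tau> * (\<sigma> * m x)) \<le> c0"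
  proof -
    have "E (\<lambda>x. \<tau> * (\<sigma> * m x)) + (1 - \<tau>\<^sup>2)\<^sup>2 / 4 * ip (\<lambda>x. \<sigma> * m x) (\<lambda>x. \<sigma> * m x) + (1 - \<tau> ^ 4) / 4 * Ne (\<lambda>x. \<sigma> * m x) \<le> E (\<lambda>x. \<sigma> * m x)"
      using \<tau> by (intro E_ray[OF wH]) simp
    moreover have "0 \<le> (1 - \<tau>\<^sup>2)\<^sup>2 / 4 * ip (\<lambda>x. \<sigma> * m x) (\<lambda>x. \<sigma> * m x)" by simp
    moreover have "(1 - \<tau> ^ 4) / 4 * Ne (\<lambda>x. \<sigma> * m x) = 0" using nehariD(3)[OF w(1)] by simp
    ultimately show ?thesis using w(2) by linarith
  qed
  have Ew': "E (\<lambda>x. \<tau> * (\<sigma> * m x)) = 1/2 * (\<tau>\<^sup>2 * A) + lam/4 * (\<tau> ^ 4 * D) - Fi (\<lambda>x. \<tau> * (\<sigma> * m x))"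
    unfolding E_scale[OF wH] ipw inw[OF m(1)] A_def D_def ..
  \<comment> \<open>With \<tau> \<le> 2 all error terms carry the common factor \<tau>^2, which
    cancels from the comparison however small \<tau> may be.\<close>
  have t4: "\<tau> ^ 4 \<le> 4 * \<tau>\<^sup>2"
  proof -
    have "\<tau> ^ 4 = \<tau>\<^sup>2 * \<tau>\<^sup>2" by (simp flip: power_add)
    also have "\<dots> \<le> 2\<^sup>2 * \<tau>\<^sup>2" using \<tau> by (intro mult_right_mono power_mono) auto
    finally show ?thesis by simp
  qed
  have "1/2 * (\<tau>\<^sup>2 * ip u u) \<le> 1/2 * (\<tau>\<^sup>2 * (A + \<epsilon>\<^sup>2 * C1 - 2 * \<epsilon> * \<kappa>))" using ipu by (intro mult_left_mono) auto
  moreover have "lam/4 * (\<tau> ^ 4 * inter u u) \<le> lam/4 * (\<tau> ^ 4 * (D + \<epsilon>\<^sup>2 * C2))"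
    using inu lam by (intro mult_left_mono) auto
  moreover have "lam/4 * (\<tau> ^ 4 * (\<epsilon>\<^sup>2 * C2)) \<le> lam/4 * (4 * \<tau>\<^sup>2 * (\<epsilon>\<^sup>2 * C2))"
    using t4 lam C2 by (intro mult_left_mono mult_right_mono) auto
  ultimately have "E (\<lambda>x. \<tau> * u x) \<le> E (\<lambda>x. \<tau> * (\<sigma> * m x)) + (1/2 * (\<tau>\<^sup>2 * (\<epsilon>\<^sup>2 * C1 - 2 * \<epsilon> * \<kappa>)) + lam * (\<tau>\<^sup>2 * (\<epsilon>\<^sup>2 * C2)) + \<tau>\<^sup>2 * \<epsilon>\<^sup>2 * C3)"
    using Fp unfolding E_scale[OF uH] Ew' by (simp add: algebra_simps)
  also have "1/2 * (\<tau>\<^sup>2 * (\<epsilon>\<^sup>2 * C1 - 2 * \<epsilon> * \<kappa>)) + lam * (\<tau>\<^sup>2 * (\<epsilon>\<^sup>2 * C2)) + \<tau>\<^sup>2 * \<epsilon>\<^sup>2 * C3 = \<tau>\<^sup>2 * \<epsilon> * (\<epsilon> * L' - \<kappa>)"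
    by (simp add: L'_def power2_eq_square algebra_simps)
  also have "\<tau>\<^sup>2 * \<epsilon> * (\<epsilon> * L' - \<kappa>) < 0" using \<tau> \<epsilon> \<epsilon>L' by (intro mult_pos_neg mult_pos_pos) auto
  finally have "E (\<lambda>x. \<tau> * u x) < c0" using Ew by simp
  then show False using nehari_level_le[OF \<tau>(3)] by linarith
qed

section \<open>Conclusions for the regularized problem\<close>

proposition ground_state_and_doubling:
  assumes u: "u \<in> sign_changing_solutions s t V f lam"
  shows "c0 > 0 \<and> (\<exists>w\<in>NN. E w = c0) \<and> E u > 2 * c0
    \<and> (\<exists>w\<in>NN. E w = c0 \<and> ((AE x in lebesgue. w x > 0) \<or> (AE x in lebesgue. w x < 0)))"
proof -
  from u have uH: "u \<in> H" and sc: "sign_changing u" and d: "has_derivative_H s V E (\<lambda>_. 0) u"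
    by (auto simp: sign_changing_solutions_def)
  have npos: "nrm (pos_part u) > 0" "nrm (neg_part u) > 0"
    using sc nrm_zero_AE[OF parts_in_H(1)[OF uH]] nrm_zero_AE[OF parts_in_H(2)[OF uH]]
      nrm_nonneg[of "pos_part u"] nrm_nonneg[of "neg_part u"] unfolding sign_changing_def by linarith+
  have "DE u v = 0" if "v \<in> H" for v
    using has_derivative_H_unique[OF energy_has_derivative[OF uH] d that] by simp
  then have doubled: "2 * c0 < E u" using parts_in_H[OF uH] by (intro energy_doubling[OF uH npos]) auto
  obtain \<tau> where "(\<lambda>x. \<tau> * pos_part u x) \<in> NN" by (rule nehari_projection[OF parts_in_H(1)[OF uH] npos(1)], rule that)
  then have ne: "NN \<noteq> {}" by blast
  obtain w where w: "w \<in> NN" "E w = c0" by (rule nehari_level_attained[OF ne], rule that)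
  have wH: "w \<in> H" by (rule nehariD(1)[OF w(1)])
  have "\<exists>w\<in>NN. E w = c0 \<and> ((AE x in lebesgue. w x > 0) \<or> (AE x in lebesgue. w x < 0))"
    using minimizer_constant_sign[OF w]
  proof
    assume "nrm (neg_part w) = 0"
    from null_part(1)[OF w this] have p: "pos_part w \<in> NN" "E (pos_part w) = c0" by auto
    have "AE x in lebesgue. 0 < pos_part w x"
      by (rule minimizer_positive[of 1]) (use p parts_in_H(1)[OF wH] in auto)
    then show ?thesis using p by blast
  next
    assume "nrm (pos_part w) = 0"
    from null_part(2)[OF w this] have p: "neg_part w \<in> NN" "E (neg_part w) = c0" by auto
    have "AE x in lebesgue. 0 < - neg_part w x"
    proof (rule minimizer_positive[of "-1"])
      show "(\<lambda>x. - neg_part w x) \<in> H" using space_H_scale[OF parts_in_H(2)[OF wH], of "-1"] by simp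
    qed (use p in auto)
    then have "AE x in lebesgue. neg_part w x < 0" by eventually_elim simp
    then show ?thesis using p by blast
  qed
  then show ?thesis using nehari_level_pos[OF ne] w doubled by blast
qed

end

text \<open>Completeness of Lebesgue measure transfers measurability between functions equal almost
  everywhere. If neither is measurable, both integrals are the default value 0, so no measurability
  is required; this lets energies agree at every argument.\<close>

lemma integral_lebesgue_cong_AE:
  fixes a b :: "R3 \<Rightarrow> real"
  assumes ae: "AE x in lebesgue. a x = b x"
  shows "integral\<^sup>L lebesgue a = integral\<^sup>L lebesgue b"
proof (cases "a \<in> borel_measurable lebesgue")
  case True
  then have "b \<in> borel_measurable lebesgue" using ae by (rule borel_measurable_AE)
  then show ?thesis using True ae by (intro integral_cong_AE)
next
  case False
  have "b \<notin> borel_measurable lebesgue"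
  proof
    assume "b \<in> borel_measurable lebesgue"
    moreover have "AE x in lebesgue. b x = a x" using ae by eventually_elim simp
    ultimately show False using False borel_measurable_AE by blast
  qed
  then show ?thesis using False borel_measurable_integrable by (metis not_integrable_integral_eq)
qed

text \<open>On the null set of bad x the nonlinearity is replaced by 0, which is continuous, weakly
  monotone and satisfies the growth bound. The estimate with small linear coefficient joins the
  uniform o(|\<tau>|) near 0 with the power bound away from it.\<close>

lemma quartic_nonlinearity_modification:
  fixes f :: "R3 \<Rightarrow> real \<Rightarrow> real" and p C :: real
  assumes f1: "caratheodory f" "uniform_limit UNIV (\<lambda>\<tau> x. f x \<tau> / \<bar>\<tau>\<bar>) (\<lambda>x. 0) (at 0)"
    and p: "1 < p" and C: "C > 0" and f2: "\<And>x \<tau>. \<bar>f x \<tau>\<bar> \<le> C * (1 + \<bar>\<tau>\<bar> powr p)"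
    and f3: "AE x in lebesgue. filterlim (\<lambda>\<tau>. primitive f x \<tau> / \<tau> ^ 4) at_top at_infinity"
    and f4: "AE x in lebesgue. mono_on (UNIV - {0}) (\<lambda>\<tau>. f x \<tau> / \<bar>\<tau>\<bar> ^ 3)"
  obtains g where "quartic_nonlinearity g p" "AE x in lebesgue. g x = f x"
proof -
  define G where "G = {x. continuous_on UNIV (f x) \<and> mono_on (UNIV - {0}) (\<lambda>\<tau>. f x \<tau> / \<bar>\<tau>\<bar> ^ 3)}"
  define g where "g x = (if x \<in> G then f x else (\<lambda>\<tau>. 0))" for x
  have aeG: "AE x in lebesgue. x \<in> G"
    using f1(1) f4 unfolding caratheodory_def G_def by auto
  have near: "\<exists>d>0. \<forall>\<tau>. \<tau> \<noteq> 0 \<longrightarrow> \<bar>\<tau>\<bar> < d \<longrightarrow> (\<forall>x. \<bar>f x \<tau>\<bar> \<le> e * \<bar>\<tau>\<bar>)" if e: "e > 0" for e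
  proof -
    have "\<forall>\<^sub>F \<tau> in at 0. \<forall>x. dist (f x \<tau> / \<bar>\<tau>\<bar>) 0 < e"
      using f1(2) e unfolding uniform_limit_iff by simp
    then obtain d where d: "d > 0" "\<And>\<tau>. \<tau> \<noteq> 0 \<Longrightarrow> \<bar>\<tau>\<bar> < d \<Longrightarrow> \<forall>x. \<bar>f x \<tau>\<bar> / \<bar>\<tau>\<bar> < e"
      unfolding eventually_at by (auto simp: dist_norm)
    have "\<bar>f x \<tau>\<bar> \<le> e * \<bar>\<tau>\<bar>" if "\<tau> \<noteq> 0" "\<bar>\<tau>\<bar> < d" for x \<tau>
      using d(2)[OF that] that(1) by (simp add: divide_less_eq less_imp_le)
    then show ?thesis using d(1) by blast
  qed
  \<comment> \<open>The limit in (f1) is over \<tau> \<noteq> 0 and says nothing about the value at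
    0; that value follows from continuity.\<close>
  have zero: "f x 0 = 0" if x: "x \<in> G" for x
  proof -
    have "(f x \<longlongrightarrow> f x 0) (at 0)" using x unfolding G_def by (simp add: continuous_on_eq_continuous_at isCont_def)
    moreover have "(f x \<longlongrightarrow> 0) (at 0)"
    proof (rule Lim_null_comparison)
      obtain d where "d > 0" "\<And>\<tau>. \<tau> \<noteq> 0 \<Longrightarrow> \<bar>\<tau>\<bar> < d \<Longrightarrow> \<bar>f x \<tau>\<bar> \<le> 1 * \<bar>\<tau>\<bar>" using near[of 1] by auto
      then show "\<forall>\<^sub>F \<tau> in at 0. norm (f x \<tau>) \<le> \<bar>\<tau>\<bar>" unfolding eventually_at by (auto simp: dist_norm intro!: exI[of _ d])
      show "((\<lambda>\<tau>. \<bar>\<tau>\<bar>) \<longlongrightarrow> 0) (at (0::real))" by (rule tendsto_rabs_zero[OF tendsto_ident_at])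
    qed
    ultimately show ?thesis using tendsto_unique[OF at_neq_bot] by blast
  qed
  have aeg: "AE x in lebesgue. g x = f x" using aeG by eventually_elim (simp add: g_def)
  have "quartic_nonlinearity g p"
  proof
    show "(\<lambda>x. g x \<tau>) \<in> borel_measurable lebesgue" for \<tau>
    proof (rule borel_measurable_AE)
      show "(\<lambda>x. f x \<tau>) \<in> borel_measurable lebesgue" using f1(1) by (simp add: caratheodory_def)
      show "AE x in lebesgue. f x \<tau> = g x \<tau>" using aeg by eventually_elim simp
    qed
    show "continuous_on UNIV (g x)" for x by (simp add: g_def G_def)
    show "g x 0 = 0" for x using zero by (simp add: g_def)
    show "1 < p" by (rule p)
    show "mono_on (UNIV - {0}) (\<lambda>\<tau>. g x \<tau> / \<bar>\<tau>\<bar> ^ 3)" for x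
      by (simp add: g_def G_def) (simp add: mono_on_def)
    show "AE x in lebesgue. filterlim (\<lambda>\<tau>. primitive g x \<tau> / \<tau> ^ 4) at_top at_infinity"
      using f3 aeg by eventually_elim (simp add: primitive_def)
    fix \<epsilon> :: real assume \<epsilon>: "\<epsilon> > 0"
    obtain d where d: "d > 0" "\<And>\<tau> x. \<tau> \<noteq> 0 \<Longrightarrow> \<bar>\<tau>\<bar> < d \<Longrightarrow> \<bar>f x \<tau>\<bar> \<le> \<epsilon> * \<bar>\<tau>\<bar>" using near[OF \<epsilon>] by auto
    \<comment> \<open>For |\<tau>| \<ge> d the constant 1 in (f2) is at most d^(-p)
      |\<tau>|^p.\<close>
    define K where "K = C * (d powr (- p) + 1)"
    have K: "K > 0" using C by (simp add: K_def add_nonneg_pos)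
    have "\<bar>g x \<tau>\<bar> \<le> \<epsilon> * \<bar>\<tau>\<bar> + K * \<bar>\<tau>\<bar> powr p" for x \<tau>
    proof (cases "x \<in> G \<and> \<tau> \<noteq> 0")
      case False
      then have "g x \<tau> = 0" using zero by (auto simp: g_def)
      then show ?thesis using \<epsilon> K by simp
    next
      case True
      then have gf: "g x \<tau> = f x \<tau>" by (simp add: g_def)
      show ?thesis
      proof (cases "\<bar>\<tau>\<bar> < d")
        case near: True
        have "\<bar>f x \<tau>\<bar> \<le> \<epsilon> * \<bar>\<tau>\<bar>" using d(2)[of \<tau> x] near True by blast
        moreover have "0 \<le> K * \<bar>\<tau>\<bar> powr p" using K by simp
        ultimately show ?thesis unfolding gf by linarith
      next
        case False
        then have "d powr p \<le> \<bar>\<tau>\<bar> powr p" using d(1) p by (intro powr_mono2) auto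
        then have "d powr (- p) * d powr p \<le> d powr (- p) * \<bar>\<tau>\<bar> powr p" by (rule mult_left_mono) simp
        then have "1 \<le> d powr (- p) * \<bar>\<tau>\<bar> powr p" using d(1) by (simp flip: powr_add)
        then have "C * (1 + \<bar>\<tau>\<bar> powr p) \<le> C * (d powr (- p) * \<bar>\<tau>\<bar> powr p + \<bar>\<tau>\<bar> powr p)"
          using C by (intro mult_left_mono) auto
        also have "\<dots> = K * \<bar>\<tau>\<bar> powr p" by (simp add: K_def distrib_right)
        finally have "\<bar>f x \<tau>\<bar> \<le> K * \<bar>\<tau>\<bar> powr p" using f2[of x \<tau>] by linarith
        moreover have "0 \<le> \<epsilon> * \<bar>\<tau>\<bar>" using \<epsilon> by simp
        ultimately show ?thesis unfolding gf by linarith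
      qed
    qed
    then show "\<exists>C>0. \<forall>x \<tau>. \<bar>g x \<tau>\<bar> \<le> \<epsilon> * \<bar>\<tau>\<bar> + C * \<bar>\<tau>\<bar> powr p" using K by blast
  qed
  then show thesis using aeg by (rule that)
qed

lemma energy_cong_AE:
  assumes "AE x in lebesgue. g x = f x"
  shows "energy s t V g lam = energy s t V f lam"
proof
  fix u
  have "(LINT x|lebesgue. primitive g x (u x)) = (LINT x|lebesgue. primitive f x (u x))"
    by (rule integral_lebesgue_cong_AE) (use assms in eventually_elim, simp add: primitive_def)
  then show "energy s t V g lam u = energy s t V f lam u" by (simp add: energy_def)
qed

theorem theorem1p2:
  fixes s t lam :: real
    and V :: "real^3 \<Rightarrow> real"
    and f :: "real^3 \<Rightarrow> real \<Rightarrow> real"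
    and u :: "real^3 \<Rightarrow> real"
  assumes "0 < s" "s < 1" "0 < t" "t < 1" "4 * s + 2 * t > 3"
    and V1: "continuous_on UNIV V" "\<exists>V0>0. \<forall>x. V0 \<le> V x"
    and V2: "\<exists>h>0. \<forall>c>0.
      ((\<lambda>y. measure lebesgue {x \<in> ball y h. V x \<le> c}) \<longlongrightarrow> 0) at_infinity"
    and f1: "caratheodory f"
      "uniform_limit UNIV (\<lambda>\<tau> x. f x \<tau> / \<bar>\<tau>\<bar>) (\<lambda>x. 0) (at 0)"
    and f2: "\<exists>p C. 1 < p \<and> p < 6 / (3 - 2 * s) - 1 \<and> C > 0 \<and>
      (\<forall>x \<tau>. \<bar>f x \<tau>\<bar> \<le> C * (1 + \<bar>\<tau>\<bar> powr p))"
    and f3: "AE x in lebesgue. filterlim (\<lambda>\<tau>. primitive f x \<tau> / \<tau> ^ 4) at_top at_infinity"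
    and f4: "AE x in lebesgue. mono_on (UNIV - {0}) (\<lambda>\<tau>. f x \<tau> / \<bar>\<tau>\<bar> ^ 3)"
    and "lam > 0"
    and "least_energy_sign_changing_solution s t V f lam u"
    and "card (nodal_domains u) = 2"
  shows "nehari_level s t V f lam > 0
    \<and> (\<exists>w \<in> nehari s t V f lam. energy s t V f lam w = nehari_level s t V f lam)
    \<and> energy s t V f lam u > 2 * nehari_level s t V f lam
    \<and> (\<exists>w \<in> nehari s t V f lam. energy s t V f lam w = nehari_level s t V f lam
         \<and> ((AE x in lebesgue. w x > 0) \<or> (AE x in lebesgue. w x < 0)))"
proof -
  obtain p C where pC: "1 < p" "p < 6 / (3 - 2 * s) - 1" and C: "C > 0"
    and fC: "\<And>x \<tau>. \<bar>f x \<tau>\<bar> \<le> C * (1 + \<bar>\<tau>\<bar> powr p)" using f2 by blast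
  obtain g where g: "quartic_nonlinearity g p" "AE x in lebesgue. g x = f x"
    by (rule quartic_nonlinearity_modification[OF f1 pC(1) C fC f3 f4], rule that)
  interpret quartic_nonlinearity g p by (rule g(1))
  interpret sp_problem s V t g p lam
    by unfold_locales (use assms(1-5) V1 V2 pC(2) \<open>lam > 0\<close> in \<open>auto simp: sobolev_exponent_def\<close>)
  \<comment> \<open>The energies agree as functions, at all arguments, so the Nehari sets, levels
    and solution sets built from them coincide.\<close>
  have E: "energy s t V g lam = energy s t V f lam" by (rule energy_cong_AE[OF g(2)])
  have N: "nehari s t V g lam = nehari s t V f lam" "nehari_level s t V g lam = nehari_level s t V f lam"
    "sign_changing_solutions s t V g lam = sign_changing_solutions s t V f lam"
    unfolding nehari_level_def nehari_def sign_changing_solutions_def E by simp_all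
  have "u \<in> sign_changing_solutions s t V g lam"
    using \<open>least_energy_sign_changing_solution s t V f lam u\<close> unfolding least_energy_sign_changing_solution_def N by blast
  from ground_state_and_doubling[OF this] show ?thesis unfolding N E .
qed

end
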